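(* Let $G$ be a second countable locally compact Hausdorff groupoid with a left Haar system. If $\phi=(\xi,\eta)\in B(G)$ is a coefficient of a $G$-Hilbert bundle $(\{\mathfrak H_u\},L)$, with $\xi,\eta\in\Delta_b$, then $T_\phi$ is completely bounded on $C^*(G)$ and $$\|T_\phi\|_{cb}\le\|\xi\|\,\|\eta\|.$$
   Context: Hilbert spaces are separable and inner products are conjugate linear in the first variable. $G$ has unit space $G^0$ and range and source maps $r,s$. A $G$-Hilbert bundle is a continuous Hilbert bundle $\mathfrak H=\{\mathfrak H_u\}_{u\in G^0}$ over $G^0$ (a continuous field of Hilbert spaces in Dixmier's sense) together with, for each $x\in G$, a linear isometry $L_x$ of $\mathfrak H_{s(x)}$ onto $\mathfrak H_{r(x)}$ such that $x\mapsto L_x$ is a groupoid homomorphism and, for all $\xi,\eta\in\Delta_b$, the function $(\xi,\eta):x\mapsto (L_x\xi(s(x)),\eta(r(x)))$ (a coefficient) is continuous on $G$. Here $\Delta_b$ is the space of bounded continuous sections of $\mathfrak H$, with norm $\|\xi\|=\sup_u\|\xi(u)\|$. $B(G)$ is the set of all coefficients $(\xi,\eta)$ over all $G$-Hilbert bundles. $C^*(G)$ is the full groupoid $C^*$-algebra of $G$ (the enveloping $C^*$-completion of the convolution algebra $C_c(G)$), and $\pi:C_c(G)\to C^*(G)$ is the canonical embedding. For $\phi\in B(G)$, $T_\phi:\pi(C_c(G))\to\pi(C_c(G))$ is $T_\phi\pi(f)=\pi(\phi f)$ (pointwise product); the assertion is that it extends to a completely bounded map on $C^*(G)$ (also denoted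 $T_\phi$) with the stated bound. *)

theory Defs
  imports "HOL-Analysis.Analysis"
begin

section \<open>Complex Hilbert spaces\<close>

text \<open>
  The distribution only has real inner product spaces, so the complex structure is added on top
  of \<^class>\<open>real_inner\<close>: the real inner product is the real part of the complex one, whence
  \<open>norm x ^ 2 = cinner x x\<close>. The complex inner product is conjugate linear in its first argument.
\<close>

class chilbert_space = real_inner + complete_space +
  fixes scaleC :: "complex \<Rightarrow> 'a \<Rightarrow> 'a" (infixr "*\<^sub>C" 75)
    and cinner :: "'a \<Rightarrow> 'a \<Rightarrow> complex"
  assumes scaleC_add_right: "c *\<^sub>C (x + y) = c *\<^sub>C x + c *\<^sub>C y"
    and scaleC_add_left: "(c + d) *\<^sub>C x = c *\<^sub>C x + d *\<^sub>C x"
    and scaleC_scaleC: "c *\<^sub>C d *\<^sub>C x = (c * d) *\<^sub>C x"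
    and scaleC_of_real: "complex_of_real t *\<^sub>C x = t *\<^sub>R x"
    and cinner_commute: "cinner x y = cnj (cinner y x)"
    and cinner_add_right: "cinner x (y + z) = cinner x y + cinner x z"
    and cinner_scaleC_right: "cinner x (c *\<^sub>C y) = c * cinner x y"
    and Re_cinner: "Re (cinner x y) = inner x y"

definition csubspace :: "'h::chilbert_space set \<Rightarrow> bool" where
  "csubspace S \<longleftrightarrow> 0 \<in> S \<and> (\<forall>x\<in>S. \<forall>y\<in>S. x + y \<in> S) \<and> (\<forall>c. \<forall>x\<in>S. c *\<^sub>C x \<in> S)"

definition bounded_clinear :: "('h::chilbert_space \<Rightarrow> 'k::chilbert_space) \<Rightarrow> bool" where
  "bounded_clinear A \<longleftrightarrow> bounded_linear A \<and> (\<forall>c x. A (c *\<^sub>C x) = c *\<^sub>C A x)"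

subsection \<open>The space of square summable sequences\<close>

typedef ell2 = "{x :: nat \<Rightarrow> complex. summable (\<lambda>n. (cmod (x n))\<^sup>2)}"
  by (rule exI[of _ "\<lambda>_. 0"]) simp

setup_lifting type_definition_ell2

lemma ell2_summable: "summable (\<lambda>n. (cmod (Rep_ell2 x n))\<^sup>2)"
  using Rep_ell2[of x] by simp

lemma square_add_le: "(cmod (a + b))\<^sup>2 \<le> 2 * (cmod a)\<^sup>2 + 2 * (cmod b)\<^sup>2"
proof -
  have "(cmod (a + b))\<^sup>2 \<le> (cmod a + cmod b)\<^sup>2"
    by (rule power_mono[OF norm_triangle_ineq]) simp
  also have "\<dots> \<le> 2 * (cmod a)\<^sup>2 + 2 * (cmod b)\<^sup>2"
    using sum_squares_bound[of "cmod a" "cmod b"] by (simp add: power2_sum)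
  finally show ?thesis .
qed

lemma square_summable_add:
  assumes "summable (\<lambda>n. (cmod (x n))\<^sup>2)" "summable (\<lambda>n. (cmod (y n))\<^sup>2)"
  shows "summable (\<lambda>n. (cmod (x n + y n))\<^sup>2)"
proof (rule summable_comparison_test'[where N = 0])
  show "summable (\<lambda>n. 2 * (cmod (x n))\<^sup>2 + 2 * (cmod (y n))\<^sup>2)"
    by (intro summable_add summable_mult assms)
qed (simp add: square_add_le)

lemma square_summable_scale:
  assumes "summable (\<lambda>n. (cmod (x n))\<^sup>2)"
  shows "summable (\<lambda>n. (cmod (c * x n))\<^sup>2)"
  using summable_mult[OF assms, of "(cmod c)\<^sup>2"] by (simp add: norm_mult power_mult_distrib)

lemma ell2_summable_cinner: "summable (\<lambda>n. cnj (Rep_ell2 x n) * Rep_ell2 y n)"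
proof (rule summable_comparison_test'[where N = 0])
  show "summable (\<lambda>n. (cmod (Rep_ell2 x n))\<^sup>2 + (cmod (Rep_ell2 y n))\<^sup>2)"
    by (intro summable_add ell2_summable)
next
  fix n :: nat
  have "0 \<le> (cmod (Rep_ell2 x n))\<^sup>2" "0 \<le> (cmod (Rep_ell2 y n))\<^sup>2" by auto
  moreover have "2 * cmod (Rep_ell2 x n) * cmod (Rep_ell2 y n)
      \<le> (cmod (Rep_ell2 x n))\<^sup>2 + (cmod (Rep_ell2 y n))\<^sup>2"
    by (rule sum_squares_bound)
  moreover have "0 \<le> cmod (Rep_ell2 x n) * cmod (Rep_ell2 y n)" by simp
  ultimately show "norm (cnj (Rep_ell2 x n) * Rep_ell2 y n)
      \<le> (cmod (Rep_ell2 x n))\<^sup>2 + (cmod (Rep_ell2 y n))\<^sup>2"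
    unfolding norm_mult complex_mod_cnj by linarith
qed

instantiation ell2 :: real_vector
begin

lift_definition zero_ell2 :: ell2 is "\<lambda>_. 0" by simp
lift_definition plus_ell2 :: "ell2 \<Rightarrow> ell2 \<Rightarrow> ell2" is "\<lambda>x y n. x n + y n"
  by (rule square_summable_add)
lift_definition uminus_ell2 :: "ell2 \<Rightarrow> ell2" is "\<lambda>x n. - x n" by simp
lift_definition minus_ell2 :: "ell2 \<Rightarrow> ell2 \<Rightarrow> ell2" is "\<lambda>x y n. x n - y n"
  subgoal for x y using square_summable_add[of x "\<lambda>n. - y n"] by simp
  done
lift_definition scaleR_ell2 :: "real \<Rightarrow> ell2 \<Rightarrow> ell2" is "\<lambda>t x n. complex_of_real t * x n"
  by (rule square_summable_scale)

instance
  by standard (transfer; simp add: algebra_simps fun_eq_iff)+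

end

instantiation ell2 :: real_inner
begin

definition norm_ell2 :: "ell2 \<Rightarrow> real" where
  "norm_ell2 x = sqrt (\<Sum>n. (cmod (Rep_ell2 x n))\<^sup>2)"
definition sgn_ell2 :: "ell2 \<Rightarrow> ell2" where "sgn_ell2 x = x /\<^sub>R norm x"
definition dist_ell2 :: "ell2 \<Rightarrow> ell2 \<Rightarrow> real" where "dist_ell2 x y = norm (x - y)"
definition uniformity_ell2 :: "(ell2 \<times> ell2) filter" where
  "uniformity_ell2 = (INF e\<in>{0<..}. principal {(x, y). dist x y < e})"
definition open_ell2 :: "ell2 set \<Rightarrow> bool" where
  "open_ell2 U \<longleftrightarrow> (\<forall>x\<in>U. eventually (\<lambda>(x', y). x' = x \<longrightarrow> y \<in> U) uniformity)"
definition inner_ell2 :: "ell2 \<Rightarrow> ell2 \<Rightarrow> real" where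
  "inner_ell2 x y = Re (\<Sum>n. cnj (Rep_ell2 x n) * Rep_ell2 y n)"

lemma ell2_inner_sums: "inner x y = (\<Sum>n. Re (cnj (Rep_ell2 x n) * Rep_ell2 y n))"
  for x y :: ell2
  unfolding inner_ell2_def by (rule Re_suminf[OF ell2_summable_cinner])

lemma ell2_inner_self: "inner x x = (\<Sum>n. (cmod (Rep_ell2 x n))\<^sup>2)" for x :: ell2
  unfolding ell2_inner_sums cmod_power2 by (simp add: power2_eq_square)

instance
proof
  fix x y z :: ell2 and t :: real
  have sm: "summable (\<lambda>n. Re (cnj (Rep_ell2 u n) * Rep_ell2 v n))" for u v
    by (rule summable_Re[OF ell2_summable_cinner])
  show "dist x y = norm (x - y)" by (rule dist_ell2_def)
  show "sgn x = x /\<^sub>R norm x" by (rule sgn_ell2_def)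
  show "uniformity = (INF e\<in>{0<..}. principal {(x::ell2, y). dist x y < e})"
    by (rule uniformity_ell2_def)
  show "open U \<longleftrightarrow> (\<forall>x\<in>U. \<forall>\<^sub>F (x', y) in uniformity. x' = x \<longrightarrow> y \<in> U)" for U :: "ell2 set"
    by (rule open_ell2_def)
  show "inner x y = inner y x"
    unfolding ell2_inner_sums by (simp add: mult.commute)
  show "inner (x + y) z = inner x z + inner y z"
    unfolding ell2_inner_sums suminf_add[OF sm sm]
    by (simp add: plus_ell2.rep_eq algebra_simps)
  show "inner (t *\<^sub>R x) y = t * inner x y"
    unfolding ell2_inner_sums suminf_mult[OF sm, symmetric]
    by (simp add: scaleR_ell2.rep_eq algebra_simps)
  show "0 \<le> inner x x"
    unfolding ell2_inner_self by (intro suminf_nonneg ell2_summable) simp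
  show "inner x x = 0 \<longleftrightarrow> x = 0"
  proof -
    have "inner x x = 0 \<longleftrightarrow> (\<forall>n. (cmod (Rep_ell2 x n))\<^sup>2 = 0)"
      unfolding ell2_inner_self by (rule suminf_eq_zero_iff[OF ell2_summable]) simp
    also have "\<dots> \<longleftrightarrow> x = 0"
      by (auto simp: zero_ell2.rep_eq fun_eq_iff Rep_ell2_inject[symmetric])
    finally show ?thesis .
  qed
  show "norm x = sqrt (inner x x)"
    unfolding norm_ell2_def ell2_inner_self ..
qed

end

lemma ell2_norm_square: "(norm x)\<^sup>2 = (\<Sum>n. (cmod (Rep_ell2 x n))\<^sup>2)" for x :: ell2
  by (simp add: power2_norm_eq_inner ell2_inner_self)

lemma ell2_partial_le: "(\<Sum>n<N. (cmod (Rep_ell2 x n))\<^sup>2) \<le> (norm x)\<^sup>2" for x :: ell2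
  unfolding ell2_norm_square by (rule sum_le_suminf[OF ell2_summable]) auto

lemma ell2_component_le: "cmod (Rep_ell2 x n) \<le> norm x" for x :: ell2
proof -
  have "(cmod (Rep_ell2 x n))\<^sup>2 \<le> (\<Sum>i<Suc n. (cmod (Rep_ell2 x i))\<^sup>2)"
    by (simp add: sum_nonneg)
  also have "\<dots> \<le> (norm x)\<^sup>2" by (rule ell2_partial_le)
  finally show ?thesis by (rule power2_le_imp_le) simp
qed

instance ell2 :: complete_space
proof
  fix X :: "nat \<Rightarrow> ell2"
  assume X: "Cauchy X"
  have "Cauchy (\<lambda>n. Rep_ell2 (X n) i)" for i
  proof (rule metric_CauchyI)
    fix e :: real assume "e > 0"
    then obtain M where M: "\<And>m n. m \<ge> M \<Longrightarrow> n \<ge> M \<Longrightarrow> dist (X m) (X n) < e"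
      using metric_CauchyD[OF X \<open>e > 0\<close>] by blast
    show "\<exists>M. \<forall>m\<ge>M. \<forall>n\<ge>M. dist (Rep_ell2 (X m) i) (Rep_ell2 (X n) i) < e"
    proof (intro exI allI impI)
      fix m n assume "m \<ge> M" "n \<ge> M"
      have "dist (Rep_ell2 (X m) i) (Rep_ell2 (X n) i) = cmod (Rep_ell2 (X m - X n) i)"
        by (simp add: dist_norm minus_ell2.rep_eq)
      also have "\<dots> \<le> dist (X m) (X n)" by (simp add: dist_norm ell2_component_le)
      also have "\<dots> < e" by (rule M) fact+
      finally show "dist (Rep_ell2 (X m) i) (Rep_ell2 (X n) i) < e" .
    qed
  qed
  then have conv: "convergent (\<lambda>n. Rep_ell2 (X n) i)" for i
    by (rule Cauchy_convergent)
  define l where "l i = lim (\<lambda>n. Rep_ell2 (X n) i)" for i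
  have l: "(\<lambda>n. Rep_ell2 (X n) i) \<longlonglongrightarrow> l i" for i
    unfolding l_def using conv[of i] by (simp add: convergent_LIMSEQ_iff)
  have key: "\<exists>M. \<forall>m\<ge>M. \<forall>N. (\<Sum>i<N. (cmod (Rep_ell2 (X m) i - l i))\<^sup>2) \<le> e\<^sup>2"
    if e: "e > 0" for e :: real
  proof -
    obtain M where M: "\<And>m n. m \<ge> M \<Longrightarrow> n \<ge> M \<Longrightarrow> dist (X m) (X n) < e"
      using metric_CauchyD[OF X e] by blast
    show ?thesis
    proof (intro exI allI impI)
      fix m N assume m: "m \<ge> M"
      have "(\<lambda>n. \<Sum>i<N. (cmod (Rep_ell2 (X m) i - Rep_ell2 (X n) i))\<^sup>2)
          \<longlonglongrightarrow> (\<Sum>i<N. (cmod (Rep_ell2 (X m) i - l i))\<^sup>2)"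
        by (intro tendsto_intros l)
      moreover have "\<forall>\<^sub>F n in sequentially.
          (\<Sum>i<N. (cmod (Rep_ell2 (X m) i - Rep_ell2 (X n) i))\<^sup>2) \<le> e\<^sup>2"
        using eventually_ge_at_top[of M]
      proof eventually_elim
        case (elim n)
        have "(\<Sum>i<N. (cmod (Rep_ell2 (X m) i - Rep_ell2 (X n) i))\<^sup>2) \<le> (norm (X m - X n))\<^sup>2"
          using ell2_partial_le[of "X m - X n" N] by (simp add: minus_ell2.rep_eq)
        also have "\<dots> \<le> e\<^sup>2"
          using M[OF m elim] by (intro power_mono) (auto simp: dist_norm)
        finally show ?case .
      qed
      ultimately show "(\<Sum>i<N. (cmod (Rep_ell2 (X m) i - l i))\<^sup>2) \<le> e\<^sup>2"
        by (rule tendsto_upperbound) simp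
    qed
  qed
  have diff: "summable (\<lambda>i. (cmod (Rep_ell2 (X m) i - l i))\<^sup>2)"
    if "\<And>N. (\<Sum>i<N. (cmod (Rep_ell2 (X m) i - l i))\<^sup>2) \<le> e\<^sup>2" for m and e :: real
    by (rule summableI_nonneg_bounded[OF _ that]) simp
  obtain M1 where M1: "\<And>N. (\<Sum>i<N. (cmod (Rep_ell2 (X M1) i - l i))\<^sup>2) \<le> 1\<^sup>2"
    using key[OF zero_less_one] by blast
  have "summable (\<lambda>i. (cmod (l i - Rep_ell2 (X M1) i))\<^sup>2)"
    using diff[OF M1] by (subst norm_minus_commute)
  from square_summable_add[OF this ell2_summable[of "X M1"]]
  have "summable (\<lambda>i. (cmod (l i))\<^sup>2)" by simp
  then have Rl: "Rep_ell2 (Abs_ell2 l) = l" by (simp add: Abs_ell2_inverse)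
  have "X \<longlonglongrightarrow> Abs_ell2 l"
  proof (rule metric_LIMSEQ_I)
    fix e :: real assume "e > 0"
    then have "e / 2 > 0" by simp
    from key[OF this] obtain M where
      M: "\<And>m N. m \<ge> M \<Longrightarrow> (\<Sum>i<N. (cmod (Rep_ell2 (X m) i - l i))\<^sup>2) \<le> (e / 2)\<^sup>2" by blast
    have "dist (X m) (Abs_ell2 l) < e" if "m \<ge> M" for m
    proof -
      have "(norm (X m - Abs_ell2 l))\<^sup>2 \<le> (e / 2)\<^sup>2"
        unfolding ell2_norm_square minus_ell2.rep_eq Rl
        by (rule suminf_le_const[OF diff[OF M[OF that]] M[OF that]])
      then have "norm (X m - Abs_ell2 l) \<le> e / 2"
        by (rule power2_le_imp_le) (use \<open>e > 0\<close> in simp)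
      then show ?thesis using \<open>e > 0\<close> by (simp add: dist_norm)
    qed
    then show "\<exists>M. \<forall>m\<ge>M. dist (X m) (Abs_ell2 l) < e" by blast
  qed
  then show "convergent X" by (rule convergentI)
qed

instantiation ell2 :: chilbert_space
begin

lift_definition scaleC_ell2 :: "complex \<Rightarrow> ell2 \<Rightarrow> ell2" is "\<lambda>c x n. c * x n"
  by (rule square_summable_scale)
definition cinner_ell2 :: "ell2 \<Rightarrow> ell2 \<Rightarrow> complex" where
  "cinner_ell2 x y = (\<Sum>n. cnj (Rep_ell2 x n) * Rep_ell2 y n)"

instance
proof
  fix x y z :: ell2 and c d :: complex and t :: real
  note sm = ell2_summable_cinner
  show "c *\<^sub>C (x + y) = c *\<^sub>C x + c *\<^sub>C y" by transfer (simp add: algebra_simps)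
  show "(c + d) *\<^sub>C x = c *\<^sub>C x + d *\<^sub>C x" by transfer (simp add: algebra_simps)
  show "c *\<^sub>C d *\<^sub>C x = (c * d) *\<^sub>C x" by transfer (simp add: algebra_simps)
  show "complex_of_real t *\<^sub>C x = t *\<^sub>R x" by transfer simp
  have "cnj (\<Sum>n. cnj (Rep_ell2 y n) * Rep_ell2 x n) = (\<Sum>n. cnj (cnj (Rep_ell2 y n) * Rep_ell2 x n))"
    by (rule bounded_linear.suminf[OF bounded_linear_cnj sm])
  then show "cinner x y = cnj (cinner y x)"
    unfolding cinner_ell2_def by (simp add: mult.commute)
  show "cinner x (y + z) = cinner x y + cinner x z"
    unfolding cinner_ell2_def suminf_add[OF sm sm]
    by (simp add: plus_ell2.rep_eq algebra_simps)
  show "cinner x (c *\<^sub>C y) = c * cinner x y"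
    unfolding cinner_ell2_def suminf_mult[OF sm, symmetric]
    by (simp add: scaleC_ell2.rep_eq algebra_simps)
  show "Re (cinner x y) = inner x y"
    unfolding cinner_ell2_def inner_ell2_def ..
qed

end

section \<open>Locally compact groupoids with Haar system\<close>

text \<open>
  A groupoid is carried by a whole type; the product of \<open>x\<close> and \<open>y\<close> is only meaningful if
  \<open>gsrc G x = grng G y\<close>. The units are elements of the groupoid.
\<close>

record 'g groupoid =
  gmult :: "'g \<Rightarrow> 'g \<Rightarrow> 'g"
  ginv :: "'g \<Rightarrow> 'g"
  gsrc :: "'g \<Rightarrow> 'g"
  grng :: "'g \<Rightarrow> 'g"

definition groupoid :: "'g groupoid \<Rightarrow> bool" where
  "groupoid G \<longleftrightarrow>
     (\<forall>x. gsrc G (gsrc G x) = gsrc G x \<and> grng G (gsrc G x) = gsrc G x \<and>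
          gsrc G (grng G x) = grng G x \<and> grng G (grng G x) = grng G x) \<and>
     (\<forall>x y. gsrc G x = grng G y \<longrightarrow>
          gsrc G (gmult G x y) = gsrc G y \<and> grng G (gmult G x y) = grng G x) \<and>
     (\<forall>x y z. gsrc G x = grng G y \<longrightarrow> gsrc G y = grng G z \<longrightarrow>
          gmult G (gmult G x y) z = gmult G x (gmult G y z)) \<and>
     (\<forall>x. gmult G (grng G x) x = x \<and> gmult G x (gsrc G x) = x) \<and>
     (\<forall>x. gsrc G (ginv G x) = grng G x \<and> grng G (ginv G x) = gsrc G x \<and>
          gmult G (ginv G x) x = gsrc G x \<and> gmult G x (ginv G x) = grng G x)"

definition units :: "'g groupoid \<Rightarrow> 'g set" where
  "units G = range (gsrc G)"

definition rfibre :: "'g groupoid \<Rightarrow> 'g \<Rightarrow> 'g set" where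
  "rfibre G u = {x. grng G x = u}"

text \<open>Continuity of range and source follows from that of product and inversion.\<close>

definition lch_groupoid :: "'g::t2_space groupoid \<Rightarrow> bool" where
  "lch_groupoid G \<longleftrightarrow> groupoid G \<and>
     locally_compact_space (euclidean :: 'g topology) \<and>
     continuous_on {(x, y). gsrc G x = grng G y} (\<lambda>(x, y). gmult G x y) \<and>
     continuous_on UNIV (ginv G)"

definition Cc :: "('g::topological_space \<Rightarrow> complex) set" where
  "Cc = {f. continuous_on UNIV f \<and> compact (closure {x. f x \<noteq> 0})}"

text \<open>
  The measure on the range fibre over \<open>u\<close> is regarded as a Borel measure on the whole groupoid
  concentrated on that fibre. On a second countable locally compact Hausdorff space a Borel measure
  that is finite on compact sets is automatically regular. The two support conditions say that the
  support is exactly the fibre. Integrals of products are restricted to the fibre, where these are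
  defined.
\<close>

definition left_haar_system :: "'g::t2_space groupoid \<Rightarrow> ('g \<Rightarrow> 'g measure) \<Rightarrow> bool" where
  "left_haar_system G lam \<longleftrightarrow>
     (\<forall>u\<in>units G.
        sets (lam u) = sets borel \<and>
        (\<forall>K. compact K \<longrightarrow> emeasure (lam u) K < \<infinity>) \<and>
        emeasure (lam u) (- rfibre G u) = 0 \<and>
        (\<forall>U. open U \<longrightarrow> U \<inter> rfibre G u \<noteq> {} \<longrightarrow> emeasure (lam u) U > 0)) \<and>
     (\<forall>f\<in>Cc. continuous_on (units G) (\<lambda>u. LINT y|lam u. f y)) \<and>
     (\<forall>f\<in>Cc. \<forall>x.
        (LINT y:rfibre G (gsrc G x)|lam (gsrc G x). f (gmult G x y)) =
        (LINT y|lam (grng G x). f y))"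

definition conv ::
    "'g groupoid \<Rightarrow> ('g \<Rightarrow> 'g measure) \<Rightarrow> ('g \<Rightarrow> complex) \<Rightarrow> ('g \<Rightarrow> complex) \<Rightarrow> 'g \<Rightarrow> complex" where
  "conv G lam f g x =
     (LINT y:rfibre G (grng G x)|lam (grng G x). f y * g (gmult G (ginv G y) x))"

definition star :: "'g groupoid \<Rightarrow> ('g \<Rightarrow> complex) \<Rightarrow> 'g \<Rightarrow> complex" where
  "star G f x = cnj (f (ginv G x))"

definition I_norm :: "'g groupoid \<Rightarrow> ('g \<Rightarrow> 'g measure) \<Rightarrow> ('g \<Rightarrow> complex) \<Rightarrow> real" where
  "I_norm G lam f = max
     (SUP u\<in>units G. LINT y|lam u. cmod (f y))
     (SUP u\<in>units G. LINT y|lam u. cmod (f (ginv G y)))"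

section \<open>The full groupoid C*-algebra\<close>

text \<open>
  The representations of the convolution algebra are its I-norm bounded *-representations on
  separable Hilbert spaces. Realising the Hilbert space as a closed subspace of \<^typ>\<open>ell2\<close> and
  extending the operators by zero on the orthogonal complement, these are the following
  (possibly degenerate) representations on \<^typ>\<open>ell2\<close>.
\<close>

type_synonym 'g rep = "('g \<Rightarrow> complex) \<Rightarrow> ell2 \<Rightarrow> ell2"

definition reps :: "'g::t2_space groupoid \<Rightarrow> ('g \<Rightarrow> 'g measure) \<Rightarrow> 'g rep set" where
  "reps G lam = {\<sigma>.
     (\<forall>f\<in>Cc. bounded_clinear (\<sigma> f)) \<and>
     (\<forall>f\<in>Cc. \<forall>g\<in>Cc. \<sigma> (\<lambda>x. f x + g x) = (\<lambda>v. \<sigma> f v + \<sigma> g v)) \<and>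
     (\<forall>c. \<forall>f\<in>Cc. \<sigma> (\<lambda>x. c * f x) = (\<lambda>v. c *\<^sub>C \<sigma> f v)) \<and>
     (\<forall>f\<in>Cc. \<forall>g\<in>Cc. \<sigma> (conv G lam f g) = \<sigma> f \<circ> \<sigma> g) \<and>
     (\<forall>f\<in>Cc. \<forall>v w. cinner (\<sigma> (star G f) v) w = cinner v (\<sigma> f w)) \<and>
     (\<forall>f\<in>Cc. onorm (\<sigma> f) \<le> I_norm G lam f)}"

text \<open>
  The C*-algebra is the norm closure of the image of the universal representation, the direct sum
  of all representations. An operator of this block diagonal form is given by the family of its
  blocks, with the operations acting blockwise and the supremum of the norms of the blocks as its
  norm; so the norm of the image of \<open>f\<close> is the supremum of \<open>onorm (\<sigma> f)\<close> over all
  representations. Outside of \<^const>\<open>reps\<close> the families are set to zero.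
\<close>

type_synonym 'g blocks = "'g rep \<Rightarrow> ell2 \<Rightarrow> ell2"

definition cstar_emb ::
    "'g::t2_space groupoid \<Rightarrow> ('g \<Rightarrow> 'g measure) \<Rightarrow> ('g \<Rightarrow> complex) \<Rightarrow> 'g blocks" where
  "cstar_emb G lam f = (\<lambda>\<sigma>. if \<sigma> \<in> reps G lam then \<sigma> f else (\<lambda>_. 0))"

definition cstar_alg :: "'g::t2_space groupoid \<Rightarrow> ('g \<Rightarrow> 'g measure) \<Rightarrow> 'g blocks set" where
  "cstar_alg G lam = {a.
     (\<forall>\<sigma>. \<sigma> \<notin> reps G lam \<longrightarrow> a \<sigma> = (\<lambda>_. 0)) \<and>
     (\<forall>\<sigma>\<in>reps G lam. bounded_clinear (a \<sigma>)) \<and>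
     (\<forall>e>0. \<exists>f\<in>Cc. \<forall>\<sigma>\<in>reps G lam. onorm (\<lambda>v. a \<sigma> v - cstar_emb G lam f \<sigma> v) \<le> e)}"

text \<open>
  The norm of an n by n matrix of operators on \<^typ>\<open>ell2\<close>, acting on the n-fold Hilbert sum
  of \<^typ>\<open>ell2\<close>. Only the entries with indices below \<open>n\<close> matter.
\<close>

definition opmat_norm :: "nat \<Rightarrow> (nat \<Rightarrow> nat \<Rightarrow> ell2 \<Rightarrow> ell2) \<Rightarrow> real" where
  "opmat_norm n A =
     (SUP v \<in> {v. (\<Sum>j<n. (norm (v j))\<^sup>2) \<le> 1}. sqrt (\<Sum>i<n. (norm (\<Sum>j<n. A i j (v j)))\<^sup>2))"

text \<open>
  A matrix of block diagonal operators is, up to a permutation of the summands, a block diagonal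
  operator whose blocks are matrices. Hence its norm is the supremum of the norms of these blocks.
\<close>

definition cstar_matnorm ::
    "'g::t2_space groupoid \<Rightarrow> ('g \<Rightarrow> 'g measure) \<Rightarrow> nat \<Rightarrow> (nat \<Rightarrow> nat \<Rightarrow> 'g blocks) \<Rightarrow> real" where
  "cstar_matnorm G lam n a = (SUP \<sigma>\<in>reps G lam. opmat_norm n (\<lambda>i j. a i j \<sigma>))"

definition cstar_linear ::
    "'g::t2_space groupoid \<Rightarrow> ('g \<Rightarrow> 'g measure) \<Rightarrow> ('g blocks \<Rightarrow> 'g blocks) \<Rightarrow> bool" where
  "cstar_linear G lam T \<longleftrightarrow>
     (\<forall>a\<in>cstar_alg G lam. T a \<in> cstar_alg G lam) \<and>
     (\<forall>a\<in>cstar_alg G lam. \<forall>b\<in>cstar_alg G lam.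
        T (\<lambda>\<sigma> v. a \<sigma> v + b \<sigma> v) = (\<lambda>\<sigma> v. T a \<sigma> v + T b \<sigma> v)) \<and>
     (\<forall>c. \<forall>a\<in>cstar_alg G lam. T (\<lambda>\<sigma> v. c *\<^sub>C a \<sigma> v) = (\<lambda>\<sigma> v. c *\<^sub>C T a \<sigma> v))"

definition amp_norm ::
    "'g::t2_space groupoid \<Rightarrow> ('g \<Rightarrow> 'g measure) \<Rightarrow> nat \<Rightarrow> ('g blocks \<Rightarrow> 'g blocks) \<Rightarrow> ereal" where
  "amp_norm G lam n T =
     (SUP a \<in> {a. (\<forall>i<n. \<forall>j<n. a i j \<in> cstar_alg G lam) \<and> cstar_matnorm G lam n a \<le> 1}.
        ereal (cstar_matnorm G lam n (\<lambda>i j. T (a i j))))"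

definition cb_norm ::
    "'g::t2_space groupoid \<Rightarrow> ('g \<Rightarrow> 'g measure) \<Rightarrow> ('g blocks \<Rightarrow> 'g blocks) \<Rightarrow> ereal" where
  "cb_norm G lam T = (SUP n. amp_norm G lam n T)"

definition completely_bounded ::
    "'g::t2_space groupoid \<Rightarrow> ('g \<Rightarrow> 'g measure) \<Rightarrow> ('g blocks \<Rightarrow> 'g blocks) \<Rightarrow> bool" where
  "completely_bounded G lam T \<longleftrightarrow> cstar_linear G lam T \<and> cb_norm G lam T < \<infinity>"

section \<open>Groupoid Hilbert bundles\<close>

text \<open>
  The fibres are closed subspaces of an arbitrary Hilbert space. This is no restriction, since any
  family of Hilbert spaces embeds in its Hilbert sum; the ambient space carries no information about
  the topology of the bundle, which is given by the space \<open>\<Gamma>\<close> of continuous sections alone. As in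
  Dixmier's definition, \<open>\<Gamma>\<close> is a linear space of sections with dense values in each fibre,
  with continuous norm functions, and closed under local uniform approximation. Sections are
  functions on the whole groupoid, of which only the values at units matter.
\<close>

definition separable_set :: "'a::topological_space set \<Rightarrow> bool" where
  "separable_set S \<longleftrightarrow> (\<exists>D. countable D \<and> D \<subseteq> S \<and> S \<subseteq> closure D)"

definition hilbert_bundle ::
    "'g::topological_space set \<Rightarrow> ('g \<Rightarrow> 'h::chilbert_space set) \<Rightarrow> ('g \<Rightarrow> 'h) set \<Rightarrow> bool" where
  "hilbert_bundle B H \<Gamma> \<longleftrightarrow>
     (\<forall>u\<in>B. csubspace (H u) \<and> closed (H u) \<and> separable_set (H u)) \<and>
     \<Gamma> \<subseteq> Pi B H \<and>
     (\<lambda>_. 0) \<in> \<Gamma> \<and>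
     (\<forall>\<xi>\<in>\<Gamma>. \<forall>\<eta>\<in>\<Gamma>. (\<lambda>u. \<xi> u + \<eta> u) \<in> \<Gamma>) \<and>
     (\<forall>c. \<forall>\<xi>\<in>\<Gamma>. (\<lambda>u. c *\<^sub>C \<xi> u) \<in> \<Gamma>) \<and>
     (\<forall>u\<in>B. H u \<subseteq> closure ((\<lambda>\<xi>. \<xi> u) ` \<Gamma>)) \<and>
     (\<forall>\<xi>\<in>\<Gamma>. continuous_on B (\<lambda>u. norm (\<xi> u))) \<and>
     (\<forall>\<xi>\<in>Pi B H.
        (\<forall>u\<in>B. \<forall>e>0. \<exists>\<zeta>\<in>\<Gamma>. \<exists>U. open U \<and> u \<in> U \<and> (\<forall>w\<in>U \<inter> B. norm (\<xi> w - \<zeta> w) \<le> e))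
        \<longrightarrow> \<xi> \<in> \<Gamma>)"

definition bounded_sections ::
    "'g set \<Rightarrow> ('g \<Rightarrow> 'h::chilbert_space) set \<Rightarrow> ('g \<Rightarrow> 'h) set" where
  "bounded_sections B \<Gamma> = {\<xi>\<in>\<Gamma>. bounded (\<xi> ` B)}"

definition section_norm :: "'g set \<Rightarrow> ('g \<Rightarrow> 'h::chilbert_space) \<Rightarrow> real" where
  "section_norm B \<xi> = (SUP u\<in>B. norm (\<xi> u))"

definition coefficient ::
    "'g groupoid \<Rightarrow> ('g \<Rightarrow> 'h \<Rightarrow> 'h) \<Rightarrow> ('g \<Rightarrow> 'h::chilbert_space) \<Rightarrow> ('g \<Rightarrow> 'h) \<Rightarrow> 'g \<Rightarrow> complex" where
  "coefficient G L \<xi> \<eta> x = cinner (L x (\<xi> (gsrc G x))) (\<eta> (grng G x))"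

definition G_hilbert_bundle ::
    "'g::topological_space groupoid \<Rightarrow> ('g \<Rightarrow> 'h::chilbert_space set) \<Rightarrow> ('g \<Rightarrow> 'h) set
       \<Rightarrow> ('g \<Rightarrow> 'h \<Rightarrow> 'h) \<Rightarrow> bool" where
  "G_hilbert_bundle G H \<Gamma> L \<longleftrightarrow>
     hilbert_bundle (units G) H \<Gamma> \<and>
     (\<forall>x. (\<forall>v\<in>H (gsrc G x). \<forall>w\<in>H (gsrc G x). L x (v + w) = L x v + L x w) \<and>
          (\<forall>c. \<forall>v\<in>H (gsrc G x). L x (c *\<^sub>C v) = c *\<^sub>C L x v) \<and>
          (\<forall>v\<in>H (gsrc G x). norm (L x v) = norm v) \<and>
          L x ` H (gsrc G x) = H (grng G x)) \<and>
     (\<forall>x y. gsrc G x = grng G y \<longrightarrow> (\<forall>v\<in>H (gsrc G y). L (gmult G x y) v = L x (L y v))) \<and>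
     (\<forall>\<xi>\<in>bounded_sections (units G) \<Gamma>. \<forall>\<eta>\<in>bounded_sections (units G) \<Gamma>.
        continuous_on UNIV (coefficient G L \<xi> \<eta>))"

end

theory Submission
  imports Defs
begin

text \<open>
  Let \<open>\<sigma>\<close> be a representation of \<open>Cc\<close> on \<open>K\<close>. It is tensored with the bundle: on the
  interior tensor product of the sections with \<open>K\<close> there is a representation \<open>\<tau>\<close> with
  \<open>\<langle>b \<otimes> v, \<tau>(f)(a \<otimes> w)\<rangle> = \<langle>v, \<sigma>(x \<mapsto> f x \<langle>b(r x), L x a(s x)\<rangle>) w\<rangle>\<close>. So multiplication by the coefficient
  \<open>(\<xi>, \<eta>)\<close> is \<open>\<sigma>(f) \<mapsto> V\<^sub>\<eta>\<^sup>* \<tau>(f) V\<^sub>\<xi>\<close>, where \<open>V\<^sub>a w = a \<otimes> w\<close> has norm at most \<open>\<parallel>a\<parallel>\<close>, and since \<open>\<tau>\<close> is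
  again one of the representations that define the norm of the C*-algebra, matrices over \<open>Cc\<close>
  satisfy the asserted bound.

  The disintegration theorem is not needed. The tensor product is the Kolmogorov decomposition of a
  kernel whose positivity is reduced to that of \<open>\<sigma>(g\<^sup>* * g)\<close>: fields of vectors are approximated by
  finite combinations of sections, and the Gram matrices of these by locally constant ones. The
  bound of \<open>\<tau>\<close> by the I-norm is automatic by a spectral radius argument. Only the part generated
  by \<open>\<xi>\<close> and \<open>\<eta>\<close> is used, which makes the Hilbert space separable, although the space of all
  sections need not be separable.
\<close>

section \<open>Complex inner products\<close>

text \<open>The C*-norm is a supremum over representations on \<open>ell2\<close>, so the tensor
  product must be realised in that very space; its vectors are therefore constructed as sequences
  with prescribed inner products. A representation \<open>\<sigma>\<close> acts through
  \<open>Cc\<close> only and may be degenerate: the function \<open>|a|^2\<close> of a section is a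
  multiplier and has no image under \<open>\<sigma>\<close>, so \<open>a \<otimes> w\<close> makes
  sense only for \<open>w\<close> of the form \<open>\<sigma> g w'\<close>. Hence
  \<open>V\<^sub>a\<close> lives on the span of such vectors, and the norm estimate has to be tested
  there. For a matrix \<open>A\<close> with entries \<open>\<sigma> (\<phi> f)\<close> this is
  enough: if \<open>|<q, A p>| \<le> R |q| |p|\<close> on such vectors, take \<open>y = A v\<close>
  and \<open>p = A' y\<close> with the adjoint \<open>A'\<close>. Both have the required form,
  \<open>|p|^2 = <y, A p> \<le> R |y| |p|\<close> and \<open>|y|^2 = <p, v> \<le> |p| |v|\<close>,
  so \<open>|y| \<le> R |v|\<close>. Matrices cost nothing extra, since \<open>\<tau>\<close>
  depends on \<open>\<sigma>\<close>, \<open>\<xi>\<close> and \<open>\<eta>\<close> but not on the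
  functions and serves all entries at once.\<close>

lemma cinner_add_left: "cinner (x + y) z = cinner x z + cinner y z"
  by (metis cinner_add_right cinner_commute complex_cnj_add)

lemma cinner_scaleC_left: "cinner (c *\<^sub>C x) y = cnj c * cinner x y"
  by (metis cinner_commute cinner_scaleC_right complex_cnj_mult)

lemma scaleC_one [simp]: "1 *\<^sub>C x = x"
  using scaleC_of_real[of 1 x] by simp

lemma scaleC_zero_left [simp]: "0 *\<^sub>C x = 0"
  using scaleC_of_real[of 0 x] by simp

lemma scaleC_minus_one: "(- 1) *\<^sub>C x = - x"
  using scaleC_of_real[of "-1" x] by simp

lemma scaleC_zero_right [simp]: "c *\<^sub>C 0 = 0"
  using scaleC_add_right[of c 0 0] by simp

lemma scaleC_diff_right: "c *\<^sub>C (x - y) = c *\<^sub>C x - c *\<^sub>C y"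
  using scaleC_add_right[of c "x - y" y] by (simp add: algebra_simps)

lemma cinner_zero_left [simp]: "cinner 0 x = 0"
  using cinner_scaleC_left[of 0 0 x] by simp

lemma cinner_zero_right [simp]: "cinner x 0 = 0"
  using cinner_scaleC_right[of x 0 0] by simp

lemma cinner_minus_left: "cinner (- x) y = - cinner x y"
  using cinner_scaleC_left[of "-1" x y] by (simp add: scaleC_minus_one)

lemma cinner_minus_right: "cinner x (- y) = - cinner x y"
  using cinner_scaleC_right[of x "-1" y] by (simp add: scaleC_minus_one)

lemma cinner_diff_left: "cinner (x - y) z = cinner x z - cinner y z"
  using cinner_add_left[of x "- y" z] by (simp add: cinner_minus_left)

lemma cinner_diff_right: "cinner x (y - z) = cinner x y - cinner x z"
  using cinner_add_right[of x y "- z"] by (simp add: cinner_minus_right)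

lemma cinner_sum_left: "cinner (\<Sum>i\<in>A. f i) y = (\<Sum>i\<in>A. cinner (f i) y)"
  by (induction A rule: infinite_finite_induct) (simp_all add: cinner_add_left)

lemma cinner_sum_right: "cinner y (\<Sum>i\<in>A. f i) = (\<Sum>i\<in>A. cinner y (f i))"
  by (induction A rule: infinite_finite_induct) (simp_all add: cinner_add_right)

lemma cinner_self: "cinner x x = complex_of_real ((norm x)\<^sup>2)"
proof -
  have "Im (cinner x x) = 0"
    using arg_cong[OF cinner_commute[of x x], of Im] by simp
  then show ?thesis
    by (simp add: complex_eq_iff Re_cinner power2_norm_eq_inner)
qed

lemma norm_scaleC [simp]: "norm (c *\<^sub>C x) = cmod c * norm x"
proof -
  have "complex_of_real ((norm (c *\<^sub>C x))\<^sup>2) = complex_of_real ((cmod c * norm x)\<^sup>2)"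
    unfolding cinner_self[symmetric] cinner_scaleC_left cinner_scaleC_right
    by (simp add: cinner_self power_mult_distrib complex_norm_square[symmetric] mult.assoc[symmetric] mult.commute)
  then have "(norm (c *\<^sub>C x))\<^sup>2 = (cmod c * norm x)\<^sup>2"
    using of_real_eq_iff by blast
  then show ?thesis by (simp add: power2_eq_iff_nonneg)
qed

text \<open>Multiplying \<open>x\<close> by the phase of the inner product makes the product real
  and nonnegative, and the Cauchy-Schwarz inequality of the underlying real space applies.\<close>

lemma cmod_cinner_le: "cmod (cinner x y) \<le> norm x * norm y"
proof (cases "cinner x y = 0")
  case False
  define u where "u = sgn (cinner x y)"
  have u: "cmod u = 1" using False by (simp add: u_def norm_sgn)
  have "cinner (u *\<^sub>C x) y = complex_of_real (cmod (cinner x y))"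
    unfolding cinner_scaleC_left u_def sgn_eq
    using False by (simp add: complex_norm_square[symmetric] power2_eq_square mult.commute)
  then have "cmod (cinner x y) = inner (u *\<^sub>C x) y"
    by (metis Re_cinner Re_complex_of_real)
  also have "\<dots> \<le> norm (u *\<^sub>C x) * norm y" by (rule norm_cauchy_schwarz)
  finally show ?thesis by (simp add: u)
qed simp

lemma bounded_bilinear_cinner: "bounded_bilinear (cinner :: 'h::chilbert_space \<Rightarrow> 'h \<Rightarrow> complex)"
proof
  show "cinner (r *\<^sub>R a) b = r *\<^sub>R cinner a b" for r and a b :: 'h
    by (simp add: scaleC_of_real[symmetric] cinner_scaleC_left scaleR_conv_of_real)
  show "cinner a (r *\<^sub>R b) = r *\<^sub>R cinner a b" for r and a b :: 'h
    by (simp add: scaleC_of_real[symmetric] cinner_scaleC_right scaleR_conv_of_real)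
  show "\<exists>K. \<forall>a b :: 'h. norm (cinner a b) \<le> norm a * norm b * K"
    by (rule exI[of _ 1]) (simp add: cmod_cinner_le)
qed (simp_all add: cinner_add_left cinner_add_right)

lemmas tendsto_cinner = bounded_bilinear.tendsto[OF bounded_bilinear_cinner]

text \<open>The signs of the two imaginary terms reflect conjugate linearity in the first argument.
  Isometries and sections with continuous norms get their inner products under control in this
  way.\<close>

lemma cinner_polarization:
  "4 * cinner x y = complex_of_real ((norm (x + y))\<^sup>2) - complex_of_real ((norm (x - y))\<^sup>2)
     - \<i> * complex_of_real ((norm (x + \<i> *\<^sub>C y))\<^sup>2) + \<i> * complex_of_real ((norm (x - \<i> *\<^sub>C y))\<^sup>2)"
  unfolding cinner_self[symmetric]
  by (simp add: cinner_add_left cinner_add_right cinner_diff_left cinner_diff_right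
      cinner_scaleC_left cinner_scaleC_right algebra_simps)

lemma bounded_linear_scaleC: "bounded_linear (\<lambda>x. c *\<^sub>C x)"
  by (rule bounded_linear_intro[where K = "cmod c"])
    (simp_all add: scaleC_add_right scaleC_of_real[symmetric] scaleC_scaleC mult.commute)

lemmas tendsto_scaleC = bounded_linear.tendsto[OF bounded_linear_scaleC]

section \<open>Closed complex subspaces and orthogonal projection\<close>

lemma csubspace_closed_under:
  assumes "csubspace S"
  shows "x \<in> S \<Longrightarrow> y \<in> S \<Longrightarrow> x + y \<in> S" "x \<in> S \<Longrightarrow> c *\<^sub>C x \<in> S"
    "x \<in> S \<Longrightarrow> y \<in> S \<Longrightarrow> x - y \<in> S" "0 \<in> S"
proof -
  show a: "x + y \<in> S" if "x \<in> S" "y \<in> S" for x y using assms that by (auto simp: csubspace_def)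
  show s: "c *\<^sub>C x \<in> S" if "x \<in> S" for c x using assms that by (auto simp: csubspace_def)
  show "x - y \<in> S" if "x \<in> S" "y \<in> S"
    using a[OF that(1) s[OF that(2), of "-1"]] by (simp add: scaleC_minus_one)
  show "0 \<in> S" using assms by (auto simp: csubspace_def)
qed

lemma csubspace_closure:
  assumes "csubspace S"
  shows "csubspace (closure S)"
  unfolding csubspace_def
proof (intro conjI ballI allI)
  note S = csubspace_closed_under[OF assms]
  show "0 \<in> closure S" using S(4) closure_subset by blast
  show "x + y \<in> closure S" if xy: "x \<in> closure S" "y \<in> closure S" for x y
  proof -
    obtain f g where "\<And>n. f n \<in> S" "f \<longlonglongrightarrow> x" "\<And>n. g n \<in> S" "g \<longlonglongrightarrow> y"
      using xy unfolding closure_sequential by blast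
    then have "(\<forall>n. f n + g n \<in> S) \<and> (\<lambda>n. f n + g n) \<longlonglongrightarrow> x + y"
      by (auto intro!: S tendsto_add)
    then show ?thesis unfolding closure_sequential by (intro exI[of _ "\<lambda>n. f n + g n"])
  qed
  show "c *\<^sub>C x \<in> closure S" if x: "x \<in> closure S" for c x
  proof -
    obtain f where "\<And>n. f n \<in> S" "f \<longlonglongrightarrow> x"
      using x unfolding closure_sequential by blast
    then have "(\<forall>n. c *\<^sub>C f n \<in> S) \<and> (\<lambda>n. c *\<^sub>C f n) \<longlonglongrightarrow> c *\<^sub>C x"
      by (auto intro!: S tendsto_scaleC)
    then show ?thesis unfolding closure_sequential by (intro exI[of _ "\<lambda>n. c *\<^sub>C f n"])
  qed
qed

lemma parallelogram: "(norm (x + y))\<^sup>2 + (norm (x - y))\<^sup>2 = 2 * (norm x)\<^sup>2 + 2 * (norm (y::'a::real_inner))\<^sup>2"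
  by (simp add: power2_norm_eq_inner inner_add_left inner_add_right inner_diff_left inner_diff_right)

text \<open>A minimising sequence for the distance to \<open>M\<close> is Cauchy by the
  parallelogram law, and its limit cannot be improved by moving along any \<open>q\<close> in
  \<open>M\<close>, which forces orthogonality.\<close>

lemma closed_csubspace_projection:
  fixes v :: "'h::chilbert_space"
  assumes M: "csubspace M" "closed M"
  obtains p where "p \<in> M" "\<And>m. m \<in> M \<Longrightarrow> cinner m (v - p) = 0"
proof -
  note S = csubspace_closed_under[OF M(1)]
  define d where "d = infdist v M"
  have ne: "M \<noteq> {}" using S(4) by blast
  have le: "d \<le> norm (v - m)" if "m \<in> M" for m
    using infdist_le[OF that, of v] by (simp add: d_def dist_norm)
  have d0: "0 \<le> d" by (simp add: d_def infdist_nonneg)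
  have "\<exists>m\<in>M. norm (v - m) < d + e" if "e > 0" for e
  proof (rule ccontr)
    assume "\<not> ?thesis"
    then have "d + e \<le> infdist v M"
      unfolding infdist_notempty[OF ne] by (intro cINF_greatest[OF ne]) (auto simp: dist_norm not_less)
    then show False using that by (simp add: d_def)
  qed
  then have "\<forall>n. \<exists>m\<in>M. norm (v - m) < d + 1 / (Suc n)"
    by (metis of_nat_0_less_iff zero_less_Suc zero_less_divide_1_iff)
  then obtain m where m: "\<And>n. m n \<in> M" "\<And>n. norm (v - m n) < d + 1 / (Suc n)" by metis
  have lim: "(\<lambda>n. 4 * ((d + 1 / (Suc n))\<^sup>2 - d\<^sup>2)) \<longlonglongrightarrow> 4 * ((d + 0)\<^sup>2 - d\<^sup>2)"
    by (intro tendsto_intros LIMSEQ_inverse_real_of_nat[unfolded inverse_eq_divide])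
  have close: "(norm (m a - m b))\<^sup>2 \<le> 4 * ((d + 1 / (Suc n))\<^sup>2 - d\<^sup>2)" if "a \<ge> n" "b \<ge> n" for a b n
  proof -
    have bd: "(norm (v - m k))\<^sup>2 \<le> (d + 1 / (Suc n))\<^sup>2" if "k \<ge> n" for k
    proof (rule power_mono)
      have "1 / real (Suc k) \<le> 1 / real (Suc n)" using that by (intro divide_left_mono) auto
      then show "norm (v - m k) \<le> d + 1 / (Suc n)" using m(2)[of k] by linarith
    qed simp
    \<comment> \<open>The midpoint of two members is again a member, hence at distance at least
      \<open>d\<close>; the parallelogram law turns this into a bound on their difference.\<close>
    have mid: "(1/2) *\<^sub>R (m a + m b) \<in> M"
      using S(1)[OF m(1)[of a] m(1)[of b]] S(2)[of "m a + m b" "complex_of_real (1/2)"] by (simp only: scaleC_of_real)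
    have e: "(v - m a) + (v - m b) = 2 *\<^sub>R (v - (1/2) *\<^sub>R (m a + m b))"
      by (simp add: algebra_simps scaleR_2)
    have "d \<le> norm (v - (1/2) *\<^sub>R (m a + m b))" using le[OF mid] .
    then have "d\<^sup>2 \<le> (norm (v - (1/2) *\<^sub>R (m a + m b)))\<^sup>2" using d0 by (rule power_mono)
    then have "4 * d\<^sup>2 \<le> (norm ((v - m a) + (v - m b)))\<^sup>2"
      unfolding e by (simp add: power_mult_distrib)
    moreover have "norm (m a - m b) = norm ((v - m a) - (v - m b))"
      by (simp add: norm_minus_commute)
    ultimately show ?thesis
      using parallelogram[of "v - m a" "v - m b"] bd[OF that(1)] bd[OF that(2)] by simp
  qed
  have "Cauchy m"
  proof (rule metric_CauchyI)
    fix e :: real assume "e > 0"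
    then have "\<forall>\<^sub>F n in sequentially. 4 * ((d + 1 / (Suc n))\<^sup>2 - d\<^sup>2) < e\<^sup>2"
      using order_tendstoD(2)[OF lim, of "e\<^sup>2"] by simp
    then obtain n where n: "4 * ((d + 1 / (Suc n))\<^sup>2 - d\<^sup>2) < e\<^sup>2"
      by (auto simp: eventually_sequentially)
    have "dist (m a) (m b) < e" if "a \<ge> n" "b \<ge> n" for a b
      using close[OF that] n \<open>e > 0\<close> by (intro power2_less_imp_less[of _ e]) (auto simp: dist_norm)
    then show "\<exists>n. \<forall>a\<ge>n. \<forall>b\<ge>n. dist (m a) (m b) < e" by blast
  qed
  then obtain p where p: "m \<longlonglongrightarrow> p" using Cauchy_convergent convergent_def by blast
  have pM: "p \<in> M" using M(2) m(1) p by (metis closed_sequentially)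
  have "norm (v - p) \<le> d"
  proof (rule LIMSEQ_le)
    show "(\<lambda>n. norm (v - m n)) \<longlonglongrightarrow> norm (v - p)" by (intro tendsto_intros p)
    have "(\<lambda>n. d + 1 / (Suc n)) \<longlonglongrightarrow> d + 0"
      by (intro tendsto_intros LIMSEQ_inverse_real_of_nat[unfolded inverse_eq_divide])
    then show "(\<lambda>n. d + 1 / (Suc n)) \<longlonglongrightarrow> d" by simp
  qed (use m(2) in \<open>auto intro: less_imp_le\<close>)
  have min: "norm (v - p) \<le> norm (v - p - q)" if "q \<in> M" for q
    using le[OF S(1)[OF pM that]] \<open>norm (v - p) \<le> d\<close> by (simp add: algebra_simps)
  have "cinner q (v - p) = 0" if q: "q \<in> M" for q
  proof (cases "q = 0")
    case False
    define w where "w = v - p"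
    \<comment> \<open>The multiple of \<open>q\<close> by \<open>c\<close> is the projection of
      \<open>w\<close> to the line through \<open>q\<close>. Subtracting it lowers the squared norm
      by \<open>|<q, w>|^2 / |q|^2\<close>, which minimality forbids unless this vanishes.\<close>
    define c where "c = cinner q w / complex_of_real ((norm q)\<^sup>2)"
    have "norm w \<le> norm (w - c *\<^sub>C q)" unfolding w_def by (rule min[OF S(2)[OF q]])
    then have "(norm w)\<^sup>2 \<le> (norm (w - c *\<^sub>C q))\<^sup>2" by (rule power_mono) simp
    moreover have "complex_of_real ((norm (w - c *\<^sub>C q))\<^sup>2)
        = complex_of_real ((norm w)\<^sup>2) - complex_of_real ((cmod (cinner q w))\<^sup>2 / (norm q)\<^sup>2)"
      unfolding cinner_self[symmetric] cinner_diff_left cinner_diff_right cinner_scaleC_left cinner_scaleC_right c_def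
      using False by (simp add: cinner_self cinner_commute[of w q] complex_norm_square[unfolded power2_eq_square of_real_mult] field_simps power2_eq_square)
    then have "(norm (w - c *\<^sub>C q))\<^sup>2 = (norm w)\<^sup>2 - (cmod (cinner q w))\<^sup>2 / (norm q)\<^sup>2"
      by (metis of_real_diff of_real_eq_iff)
    ultimately have "(cmod (cinner q w))\<^sup>2 / (norm q)\<^sup>2 \<le> 0" by simp
    then show ?thesis using False by (auto simp: divide_le_0_iff w_def)
  qed simp
  with pM show ?thesis by (rule that)
qed

section \<open>Kolmogorov decomposition in the sequence space\<close>

text \<open>Only the real part of the quadratic form is tested, so Hermitian symmetry is demanded
  separately. Points are listed by a sequence and may repeat, which makes the notion stable under
  composition with arbitrary maps into \<open>I\<close>.\<close>

definition pos_kernel :: "'i set \<Rightarrow> ('i \<Rightarrow> 'i \<Rightarrow> complex) \<Rightarrow> bool" where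
  "pos_kernel I k \<longleftrightarrow> (\<forall>i\<in>I. \<forall>j\<in>I. k j i = cnj (k i j)) \<and>
     (\<forall>(N::nat) x c. (\<forall>m<N. x m \<in> I) \<longrightarrow>
        0 \<le> Re (\<Sum>m<N. \<Sum>n<N. cnj (c m) * c n * k (x m) (x n)))"

lemma pos_kernelD:
  assumes "pos_kernel I k"
  shows "i \<in> I \<Longrightarrow> j \<in> I \<Longrightarrow> k j i = cnj (k i j)"
    "(\<And>m::nat. m < N \<Longrightarrow> x m \<in> I) \<Longrightarrow> 0 \<le> Re (\<Sum>m<N. \<Sum>n<N. cnj (c m) * c n * k (x m) (x n))"
proof -
  show "i \<in> I \<Longrightarrow> j \<in> I \<Longrightarrow> k j i = cnj (k i j)"
    using assms unfolding pos_kernel_def by blast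
  show "0 \<le> Re (\<Sum>m<N. \<Sum>n<N. cnj (c m) * c n * k (x m) (x n))"
    if x: "\<And>m. m < N \<Longrightarrow> x m \<in> I"
    by (rule assms[unfolded pos_kernel_def, THEN conjunct2, rule_format], rule x)
qed

lemma pos_kernel_compose:
  assumes "pos_kernel I k" "\<And>j. j \<in> J \<Longrightarrow> f j \<in> I"
  shows "pos_kernel J (\<lambda>i j. k (f i) (f j))"
  unfolding pos_kernel_def
proof (intro conjI allI impI ballI)
  show "k (f j) (f i) = cnj (k (f i) (f j))" if "i \<in> J" "j \<in> J" for i j
    using pos_kernelD(1)[OF assms(1)] assms(2) that by blast
  show "0 \<le> Re (\<Sum>m<N. \<Sum>n<N. cnj (c m) * c n * k (f (x m)) (f (x n)))"
    if "\<forall>m<N. x m \<in> J" for N :: nat and x c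
    by (rule pos_kernelD(2)[OF assms(1), where x = "\<lambda>m. f (x m)"]) (use assms(2) that in blast)
qed

lemma pos_kernel_subset: "pos_kernel I k \<Longrightarrow> J \<subseteq> I \<Longrightarrow> pos_kernel J k"
  by (drule pos_kernel_compose[where f = "\<lambda>i. i" and J = J]) auto

lemma pos_kernel_cinner: "pos_kernel I (\<lambda>i j. cinner (f i) (f j))"
  unfolding pos_kernel_def
proof (intro conjI allI impI ballI)
  fix N :: nat and x c
  have "(\<Sum>m<N. \<Sum>n<N. cnj (c m) * c n * cinner (f (x m)) (f (x n)))
     = cinner (\<Sum>m<N. c m *\<^sub>C f (x m)) (\<Sum>n<N. c n *\<^sub>C f (x n))"
    by (simp only: cinner_sum_left cinner_scaleC_left)
      (simp add: cinner_sum_right cinner_scaleC_right sum_distrib_left mult.assoc)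
  then show "0 \<le> Re (\<Sum>m<N. \<Sum>n<N. cnj (c m) * c n * cinner (f (x m)) (f (x n)))"
    by (simp add: cinner_self)
qed (rule cinner_commute)

lemma pos_kernel_diag:
  assumes "pos_kernel I k" "i \<in> I"
  shows "k i i = complex_of_real (Re (k i i))" "0 \<le> Re (k i i)"
proof -
  have "Im (k i i) = 0" using arg_cong[OF pos_kernelD(1)[OF assms(1,2,2)], of Im] by simp
  then show "k i i = complex_of_real (Re (k i i))" by (simp add: complex_eq_iff)
  show "0 \<le> Re (k i i)"
    using pos_kernelD(2)[OF assms(1), of "Suc 0" "\<lambda>_. i" "\<lambda>_. 1"] assms(2) by (simp add: lessThan_Suc)
qed

text \<open>On the combination with coefficient \<open>- t * k p j\<close> at \<open>p\<close> and 1
  at \<open>j\<close> the form is affine in \<open>t\<close> with slope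
  \<open>- 2 |k p j|^2\<close>, once the diagonal entry at \<open>p\<close> is zero. It can be
  nonnegative for all \<open>t\<close> only if the slope vanishes.\<close>

lemma pos_kernel_diag_zero:
  assumes k: "pos_kernel I k" and "p \<in> I" "j \<in> I" "Re (k p p) = 0"
  shows "k p j = 0"
proof (rule ccontr)
  assume ne: "k p j \<noteq> 0"
  have "0 \<le> - 2 * t * (cmod (k p j))\<^sup>2 + Re (k j j)" for t :: real
  proof -
    define x where "x m = (if m = (0::nat) then p else j)" for m
    define c where "c m = (if m = (0::nat) then - complex_of_real t * k p j else 1)" for m
    have "0 \<le> Re (\<Sum>m<2. \<Sum>n<2. cnj (c m) * c n * k (x m) (x n))"
      by (rule pos_kernelD(2)[OF k]) (use assms(2,3) in \<open>auto simp: x_def\<close>)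
    also have "(\<Sum>m<2. \<Sum>n<2. cnj (c m) * c n * k (x m) (x n))
        = complex_of_real (- 2 * t) * (k p j * cnj (k p j)) + k j j"
      using pos_kernel_diag(1)[OF k assms(2)] assms(4) pos_kernelD(1)[OF k assms(2,3)]
      by (simp add: numeral_2_eq_2 x_def c_def)
    finally show ?thesis
      by (simp add: complex_norm_square[symmetric] del: of_real_power of_real_mult)
  qed
  \<comment> \<open>At this \<open>t\<close> the form would take the value -1.\<close>
  from this[of "(Re (k j j) + 1) / (2 * (cmod (k p j))\<^sup>2)"] ne show False
    by (simp add: field_simps)
qed

text \<open>The Schur complement with respect to a single pivot, that is, one step of Cholesky
  elimination.\<close>

definition schur :: "'i \<Rightarrow> ('i \<Rightarrow> 'i \<Rightarrow> complex) \<Rightarrow> 'i \<Rightarrow> 'i \<Rightarrow> complex" where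
  "schur p k i j = k i j - k i p * k p j / k p p"

text \<open>If the pivot vanishes, so does its row, and division by zero makes the complement trivial.\<close>

lemma schur_row: 
  assumes "pos_kernel I k" "p \<in> I" "j \<in> I"
  shows "schur p k p j = 0" "schur p k j p = 0"
proof -
  have "k p p \<noteq> 0 \<or> k p j = 0"
    using pos_kernel_diag_zero[OF assms] by (metis zero_complex.simps(1))
  moreover have "k j p = cnj (k p j)" by (rule pos_kernelD(1)[OF assms])
  ultimately show "schur p k p j = 0" "schur p k j p = 0" by (auto simp: schur_def)
qed

text \<open>Completing the square: the form of the complement at \<open>c\<close> is the form of
  \<open>k\<close> at \<open>c\<close> with the minimising coefficient added at the pivot.\<close>

lemma pos_kernel_schur:
  fixes k :: "'i \<Rightarrow> 'i \<Rightarrow> complex"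
  assumes k: "pos_kernel I k" and p: "p \<in> I"
  shows "pos_kernel I (schur p k)"
  unfolding pos_kernel_def
proof (intro conjI allI impI ballI)
  note herm = pos_kernelD(1)[OF k]
  define d where "d = Re (k p p)"
  have d: "k p p = complex_of_real d" "0 \<le> d"
    using pos_kernel_diag[OF k p] by (simp_all add: d_def)
  show "schur p k j i = cnj (schur p k i j)" if "i \<in> I" "j \<in> I" for i j
    using that p d herm[of i j] herm[of p i] herm[of j p] by (simp add: schur_def mult.commute)
  fix N :: nat and x :: "nat \<Rightarrow> 'i" and c :: "nat \<Rightarrow> complex"
  assume x: "\<forall>m<N. x m \<in> I"
  define S where "S = (\<Sum>m<N. \<Sum>n<N. cnj (c m) * c n * k (x m) (x n))"
  define s where "s = (\<Sum>n<N. c n * k p (x n))"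
  have s': "(\<Sum>m<N. cnj (c m) * k (x m) p) = cnj s"
    unfolding s_def cnj_sum by (intro sum.cong) (use x p herm[of p] in auto)
  have "(\<Sum>m<N. \<Sum>n<N. cnj (c m) * c n * schur p k (x m) (x n))
      = S - (\<Sum>m<N. \<Sum>n<N. (cnj (c m) * k (x m) p) * (c n * k p (x n))) / k p p"
    unfolding S_def schur_def
    by (simp add: right_diff_distrib sum_subtractf sum_divide_distrib mult_ac)
  also have "(\<Sum>m<N. \<Sum>n<N. (cnj (c m) * k (x m) p) * (c n * k p (x n))) = cnj s * s"
    by (simp only: sum_product[symmetric] s' s_def)
  finally have eq: "(\<Sum>m<N. \<Sum>n<N. cnj (c m) * c n * schur p k (x m) (x n)) = S - cnj s * s / k p p" .
  define y where "y m = (if m < N then x m else p)" for m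
  \<comment> \<open>The coefficient at index \<open>N\<close>, where \<open>y\<close> is the pivot,
    is the minimiser. For \<open>d = 0\<close> it is zero by division by zero, and so is the
    subtracted term.\<close>
  define b where "b m = (if m < N then c m else - s / d)" for m
  have "0 \<le> Re (\<Sum>m<Suc N. \<Sum>n<Suc N. cnj (b m) * b n * k (y m) (y n))"
    by (rule pos_kernelD(2)[OF k]) (use x p in \<open>auto simp: y_def\<close>)
  also have "(\<Sum>m<Suc N. \<Sum>n<Suc N. cnj (b m) * b n * k (y m) (y n))
      = S + (\<Sum>m<N. cnj (c m) * k (x m) p) * (- s / d) + cnj (- s / d) * (\<Sum>n<N. c n * k p (x n))
        + cnj (- s / d) * (- s / d) * d"
    by (simp add: y_def b_def S_def sum.distrib sum_distrib_left sum_distrib_right d algebra_simps sum_negf sum_subtractf sum_divide_distrib)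
  also have "\<dots> = S - cnj s * s / k p p"
    unfolding s' s_def[symmetric] d by (simp add: field_simps)
  finally show "0 \<le> Re (\<Sum>m<N. \<Sum>n<N. cnj (c m) * c n * schur p k (x m) (x n))"
    unfolding eq .
qed

text \<open>Infinite Cholesky factorisation. \<open>K m\<close> is what remains after the indices
  below \<open>m\<close> have been eliminated, and the pivot row at \<open>m\<close>, divided by the
  root of the pivot, supplies coordinate \<open>m\<close> of all vectors. A row of the remainder is
  zero once its index is eliminated, so every vector has finite support and lies in
  \<open>ell2\<close>.\<close>

lemma kolmogorov_nat:
  fixes k :: "nat \<Rightarrow> nat \<Rightarrow> complex"
  assumes "pos_kernel UNIV k"
  obtains \<Phi> :: "nat \<Rightarrow> ell2" where "\<And>i j. cinner (\<Phi> i) (\<Phi> j) = k i j"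
proof -
  define K where "K = rec_nat k schur"
  have K: "K 0 = k" "K (Suc m) = schur m (K m)" for m by (simp_all add: K_def)
  have pos: "pos_kernel UNIV (K m)" for m
    by (induction m) (simp_all add: K assms pos_kernel_schur)
  have zero: "K m i j = 0 \<and> K m j i = 0" if "i < m" for m i j
    using that
  proof (induction m arbitrary: j)
    case (Suc m)
    then show ?case
      using schur_row[OF pos[of m]]
      by (cases "i = m") (auto simp: K schur_def[of m "K m" i] schur_def[of m "K m" _ i])
  qed simp
  define d where "d m = sqrt (Re (K m m m))" for m
  define F where "F j m = K m m j / complex_of_real (d m)" for j m
  have F0: "F j m = 0" if "j < m" for j m using zero[OF that] by (simp add: F_def)
  \<comment> \<open>A zero pivot is covered by division by zero: the new coordinate and the
    subtracted product both vanish.\<close>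
  have step: "K m i j = cnj (F i m) * F j m + K (Suc m) i j" for m i j
  proof -
    have "K m m m = complex_of_real (d m * d m)"
      using pos_kernel_diag[OF pos[of m], of m] by (simp add: d_def)
    moreover have "K m i m = cnj (K m m i)" by (rule pos_kernelD(1)[OF pos]) auto
    ultimately show ?thesis by (simp add: K schur_def F_def)
  qed
  have tele: "k i j = (\<Sum>m<M. cnj (F i m) * F j m) + K M i j" for M i j
  proof (induction M)
    case (Suc M)
    then show ?case using step[of M i j] by simp
  qed (simp add: K)
  have "summable (\<lambda>m. (cmod (F j m))\<^sup>2)" for j
    by (rule summable_finite[of "{..j}"]) (auto simp: F0)
  then have Rep: "Rep_ell2 (Abs_ell2 (F j)) = F j" for j by (simp add: Abs_ell2_inverse)
  have "cinner (Abs_ell2 (F i)) (Abs_ell2 (F j)) = k i j" for i j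
  proof -
    have "cinner (Abs_ell2 (F i)) (Abs_ell2 (F j)) = (\<Sum>m<Suc i. cnj (F i m) * F j m)"
      unfolding cinner_ell2_def Rep by (rule suminf_finite) (auto simp: F0)
    \<comment> \<open>Row \<open>i\<close> of \<open>K (Suc i)\<close> is zero, so the telescoping
      sum is exact after \<open>Suc i\<close> terms.\<close>
    also have "\<dots> = k i j" using tele[of i j "Suc i"] zero[of i "Suc i" j] by simp
    finally show ?thesis .
  qed
  then show ?thesis by (rule that)
qed

text \<open>The squared distance between the vectors of \<open>i\<close> and \<open>j\<close> in any
  decomposition of \<open>k\<close>; it allows density to be expressed before the vectors
  exist.\<close>

definition kdist :: "('i \<Rightarrow> 'i \<Rightarrow> complex) \<Rightarrow> 'i \<Rightarrow> 'i \<Rightarrow> real" where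
  "kdist k i j = Re (k i i - k i j - k j i + k j j)"

text \<open>Vectors for countably many dense indices come from the factorisation, the others as
  limits. The obstacle is to control these limits without a decomposition over all of
  \<open>I\<close>. For each pair \<open>i\<close>, \<open>j\<close> the countable family of
  \<open>i\<close>, \<open>j\<close> and the dense sequence is decomposed afresh into
  \<open>\<Theta>\<close>. Inner products among the dense vectors are the same for
  \<open>\<Theta>\<close> and \<open>\<Phi>\<close>, so convergence and limits of inner products
  carry over.\<close>

theorem kolmogorov_separable:
  fixes k :: "'i \<Rightarrow> 'i \<Rightarrow> complex"
  assumes k: "pos_kernel I k" and D: "countable D" "D \<subseteq> I"
    and dense: "\<And>i e. i \<in> I \<Longrightarrow> 0 < e \<Longrightarrow> \<exists>d\<in>D. kdist k i d < e"
  obtains \<Psi> :: "'i \<Rightarrow> ell2" where "\<forall>i\<in>I. \<forall>j\<in>I. cinner (\<Psi> i) (\<Psi> j) = k i j"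
proof (cases "I = {}")
  case False
  then have "D \<noteq> {}" using dense[OF _ zero_less_one] by blast
  define d where "d = from_nat_into D"
  have d: "d n \<in> I" for n
    using from_nat_into[OF \<open>D \<noteq> {}\<close>] D(2) by (auto simp: d_def)
  have dD: "\<exists>n. d n = x" if "x \<in> D" for x
    using that D(1) by (metis d_def from_nat_into_surj)
  have "pos_kernel UNIV (\<lambda>m n. k (d m) (d n))"
    by (rule pos_kernel_compose[OF k, of UNIV d]) (rule d)
  from kolmogorov_nat[OF this] obtain \<Phi> :: "nat \<Rightarrow> ell2"
    where \<Phi>: "\<And>m n. cinner (\<Phi> m) (\<Phi> n) = k (d m) (d n)" by metis
  \<comment> \<open>The bound is a square because \<open>kdist\<close> is a squared
    distance.\<close>
  have "\<exists>s. \<forall>l. kdist k i (d (s l)) < (1 / Suc l)\<^sup>2" if i: "i \<in> I" for i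
  proof (rule choice, rule allI)
    fix l :: nat
    have "0 < (1 / real (Suc l))\<^sup>2" by simp
    from dense[OF i this] dD show "\<exists>n. kdist k i (d n) < (1 / Suc l)\<^sup>2" by metis
  qed
  then have "\<forall>i. \<exists>s. i \<in> I \<longrightarrow> (\<forall>l. kdist k i (d (s l)) < (1 / Suc l)\<^sup>2)" by blast
  from choice[OF this] obtain s
    where s: "\<And>i l. i \<in> I \<Longrightarrow> kdist k i (d (s i l)) < (1 / Suc l)\<^sup>2" by blast
  have ext: "\<exists>\<Theta> :: nat \<Rightarrow> ell2. \<exists>a b. cinner a b = k i j \<and> (\<lambda>l. \<Theta> (s i l)) \<longlonglongrightarrow> a
       \<and> (\<lambda>l. \<Theta> (s j l)) \<longlonglongrightarrow> b \<and> (\<forall>m n. cinner (\<Theta> m) (\<Theta> n) = k (d m) (d n))"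
    if "i \<in> I" "j \<in> I" for i j
  proof -
    \<comment> \<open>The two extra indices occupy the places 0 and 1, so the dense sequence is
      shifted by 2.\<close>
    define e where "e n = (if n = 0 then i else if n = 1 then j else d (n - 2))" for n :: nat
    have e: "e n \<in> I" for n by (simp add: e_def that d)
    have "pos_kernel UNIV (\<lambda>m n. k (e m) (e n))"
      by (rule pos_kernel_compose[OF k, of UNIV e]) (rule e)
    from kolmogorov_nat[OF this] obtain \<Theta> :: "nat \<Rightarrow> ell2"
      where \<Theta>: "\<And>m n. cinner (\<Theta> m) (\<Theta> n) = k (e m) (e n)" by metis
    have kd: "kdist k (e m) (e n) = (norm (\<Theta> m - \<Theta> n))\<^sup>2" for m n
    proof -
      have "complex_of_real ((norm (\<Theta> m - \<Theta> n))\<^sup>2) = k (e m) (e m) - k (e m) (e n) - k (e n) (e m) + k (e n) (e n)"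
        unfolding cinner_self[symmetric] by (simp add: cinner_diff_left cinner_diff_right \<Theta>)
      from arg_cong[OF this, of Re] show ?thesis by (simp add: kdist_def)
    qed
    have lim: "(\<lambda>l. \<Theta> (s (e a) l + 2)) \<longlonglongrightarrow> \<Theta> a" if "a < 2" for a
    proof (rule LIM_zero_cancel, rule tendsto_norm_zero_cancel, rule tendsto_sandwich[where f = "\<lambda>_. 0"])
      show "\<forall>\<^sub>F l in sequentially. norm (\<Theta> (s (e a) l + 2) - \<Theta> a) \<le> 1 / Suc l"
      proof (intro always_eventually allI)
        fix l
        have "(norm (\<Theta> a - \<Theta> (s (e a) l + 2)))\<^sup>2 < (1 / Suc l)\<^sup>2"
          using s[OF e[of a], of l] kd[of a "s (e a) l + 2"] by (simp add: e_def)
        then have "norm (\<Theta> a - \<Theta> (s (e a) l + 2)) < 1 / Suc l"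
          by (rule power2_less_imp_less) simp
        then show "norm (\<Theta> (s (e a) l + 2) - \<Theta> a) \<le> 1 / Suc l"
          by (simp add: norm_minus_commute)
      qed
      show "(\<lambda>l. 1 / real (Suc l)) \<longlonglongrightarrow> 0"
        using LIMSEQ_inverse_real_of_nat by (simp add: inverse_eq_divide)
    qed auto
    have e2: "e (n + 2) = d n" for n by (simp add: e_def)
    have "(\<lambda>l. \<Theta> (s i l + 2)) \<longlonglongrightarrow> \<Theta> 0" "(\<lambda>l. \<Theta> (s j l + 2)) \<longlonglongrightarrow> \<Theta> 1"
      using lim[of 0] lim[of 1] by (simp_all add: e_def)
    moreover have "cinner (\<Theta> 0) (\<Theta> 1) = k i j" using \<Theta>[of 0 1] by (simp add: e_def)
    moreover have "\<forall>m n. cinner (\<Theta> (m + 2)) (\<Theta> (n + 2)) = k (d m) (d n)"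
      unfolding \<Theta> e2 by blast
    ultimately show ?thesis
      by (intro exI[of _ "\<lambda>n. \<Theta> (n + 2)"] exI[of _ "\<Theta> 0"] exI[of _ "\<Theta> 1"] conjI)
  qed
  have conv: "convergent (\<lambda>l. \<Phi> (s i l))" if i: "i \<in> I" for i
  proof -
    obtain \<Theta> :: "nat \<Rightarrow> ell2" and a where \<Theta>: "(\<lambda>l. \<Theta> (s i l)) \<longlonglongrightarrow> a" "\<And>m n. cinner (\<Theta> m) (\<Theta> n) = k (d m) (d n)"
      using ext[OF i i] by blast
    have "norm (\<Theta> m - \<Theta> n) = norm (\<Phi> m - \<Phi> n)" for m n
    proof -
      have "complex_of_real ((norm (\<Theta> m - \<Theta> n))\<^sup>2) = complex_of_real ((norm (\<Phi> m - \<Phi> n))\<^sup>2)"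
        unfolding cinner_self[symmetric] by (simp add: cinner_diff_left cinner_diff_right \<Theta> \<Phi>)
      then show ?thesis unfolding of_real_eq_iff by (simp add: power2_eq_iff_nonneg)
    qed
    moreover have "Cauchy (\<lambda>l. \<Theta> (s i l))" using \<Theta>(1) by (rule LIMSEQ_imp_Cauchy)
    ultimately have "Cauchy (\<lambda>l. \<Phi> (s i l))" by (simp add: Cauchy_def dist_norm)
    then show ?thesis by (rule Cauchy_convergent)
  qed
  define \<Psi> where "\<Psi> i = lim (\<lambda>l. \<Phi> (s i l))" for i
  have \<Psi>: "(\<lambda>l. \<Phi> (s i l)) \<longlonglongrightarrow> \<Psi> i" if "i \<in> I" for i
    unfolding \<Psi>_def using conv[OF that] by (simp add: convergent_LIMSEQ_iff)
  have "cinner (\<Psi> i) (\<Psi> j) = k i j" if ij: "i \<in> I" "j \<in> I" for i j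
  proof -
    obtain \<Theta> :: "nat \<Rightarrow> ell2" and a b where \<Theta>: "cinner a b = k i j" "(\<lambda>l. \<Theta> (s i l)) \<longlonglongrightarrow> a" "(\<lambda>l. \<Theta> (s j l)) \<longlonglongrightarrow> b"
        "\<And>m n. cinner (\<Theta> m) (\<Theta> n) = k (d m) (d n)"
      using ext[OF ij] by blast
    have "(\<lambda>l. cinner (\<Theta> (s i l)) (\<Theta> (s j l))) \<longlonglongrightarrow> k i j"
      using tendsto_cinner[OF \<Theta>(2,3)] \<Theta>(1) by simp
    moreover have "(\<lambda>l. cinner (\<Phi> (s i l)) (\<Phi> (s j l))) \<longlonglongrightarrow> cinner (\<Psi> i) (\<Psi> j)"
      by (intro tendsto_cinner \<Psi> ij)
    ultimately show ?thesis unfolding \<Phi> \<Theta>(4) by (metis LIMSEQ_unique)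
  qed
  then show ?thesis by (intro that[of \<Psi>] ballI)
next
  case True
  then show ?thesis using that[of "\<lambda>_. 0"] by blast
qed

text \<open>Schur's product theorem. The Gram matrix of \<open>b\<close> is first realised in
  \<open>ell2\<close>, where there are coordinates; expanding in them writes the sum as a series of
  squared norms.\<close>

lemma sum_cinner_cinner_nonneg:
  fixes b :: "nat \<Rightarrow> 'h::chilbert_space" and x :: "nat \<Rightarrow> 'k::chilbert_space"
  shows "0 \<le> Re (\<Sum>m<N. \<Sum>n<N. cinner (b n) (b m) * cinner (x m) (x n))"
proof -
  have "pos_kernel UNIV (\<lambda>m n. cinner (b m) (b n))" by (rule pos_kernel_cinner)
  then obtain \<Phi> :: "nat \<Rightarrow> ell2" where \<Phi>: "\<And>m n. cinner (\<Phi> m) (\<Phi> n) = cinner (b m) (b n)"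
    using kolmogorov_nat by blast
  have s: "(\<lambda>l. cnj (Rep_ell2 (\<Phi> n) l) * Rep_ell2 (\<Phi> m) l * cinner (x m) (x n))
       sums (cinner (b n) (b m) * cinner (x m) (x n))" for m n
    unfolding \<Phi>[symmetric] cinner_ell2_def by (intro sums_mult2 summable_sums ell2_summable_cinner)
  have "(\<lambda>l. \<Sum>m<N. \<Sum>n<N. cnj (Rep_ell2 (\<Phi> n) l) * Rep_ell2 (\<Phi> m) l * cinner (x m) (x n))
       sums (\<Sum>m<N. \<Sum>n<N. cinner (b n) (b m) * cinner (x m) (x n))"
    by (intro sums_sum s)
  then have sm: "(\<lambda>l. Re (\<Sum>m<N. \<Sum>n<N. cnj (Rep_ell2 (\<Phi> n) l) * Rep_ell2 (\<Phi> m) l * cinner (x m) (x n)))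
       sums Re (\<Sum>m<N. \<Sum>n<N. cinner (b n) (b m) * cinner (x m) (x n))"
    by (rule sums_Re)
  have "0 \<le> Re (\<Sum>m<N. \<Sum>n<N. cnj (Rep_ell2 (\<Phi> n) l) * Rep_ell2 (\<Phi> m) l * cinner (x m) (x n))" for l
  proof -
    have "(\<Sum>m<N. \<Sum>n<N. cnj (Rep_ell2 (\<Phi> n) l) * Rep_ell2 (\<Phi> m) l * cinner (x m) (x n))
      = cinner (\<Sum>m<N. cnj (Rep_ell2 (\<Phi> m) l) *\<^sub>C x m) (\<Sum>m<N. cnj (Rep_ell2 (\<Phi> m) l) *\<^sub>C x m)"
      by (simp only: cinner_sum_left cinner_scaleC_left)
        (simp add: cinner_sum_right cinner_scaleC_right sum_distrib_left mult_ac)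
    then show ?thesis by (simp add: cinner_self)
  qed
  then show ?thesis by (rule sums_le[OF _ sums_zero sm])
qed

section \<open>Functions on second countable locally compact Hausdorff spaces\<close>

lemma CcI:
  fixes f :: "'g::t2_space \<Rightarrow> complex"
  assumes "continuous_on UNIV f" "compact K" "\<And>x. x \<notin> K \<Longrightarrow> f x = 0"
  shows "f \<in> Cc"
proof -
  have "closure {x. f x \<noteq> 0} \<subseteq> K"
    using assms(3) by (intro closure_minimal compact_imp_closed[OF assms(2)]) auto
  then have "compact (closure {x. f x \<noteq> 0})"
    using assms(2) by (metis closed_closure compact_Int_closed inf.absorb_iff2)
  with assms(1) show ?thesis by (simp add: Cc_def)
qed

lemma CcE:
  assumes "f \<in> Cc"
  obtains K where "continuous_on UNIV f" "compact K" "\<And>x. x \<notin> K \<Longrightarrow> f x = 0"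
  using assms closure_subset[of "{x. f x \<noteq> 0}"] unfolding Cc_def by blast

lemma Cc_continuous: "f \<in> Cc \<Longrightarrow> continuous_on UNIV f"
  by (simp add: Cc_def)

lemma Cc_zero: "(\<lambda>_. 0) \<in> Cc"
  by (simp add: Cc_def)

lemma Cc_add:
  fixes f g :: "'g::t2_space \<Rightarrow> complex"
  assumes "f \<in> Cc" "g \<in> Cc"
  shows "(\<lambda>x. f x + g x) \<in> Cc"
proof -
  obtain K where K: "compact K" "\<And>x. x \<notin> K \<Longrightarrow> f x = 0" using assms(1) by (rule CcE) blast
  obtain K' where K': "compact K'" "\<And>x. x \<notin> K' \<Longrightarrow> g x = 0" using assms(2) by (rule CcE) blast
  show ?thesis
    using K K' by (intro CcI[of _ "K \<union> K'"] continuous_on_add Cc_continuous[OF assms(1)] Cc_continuous[OF assms(2)]) auto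
qed

lemma Cc_mult:
  fixes f m :: "'g::t2_space \<Rightarrow> complex"
  assumes "f \<in> Cc" "continuous_on UNIV m"
  shows "(\<lambda>x. m x * f x) \<in> Cc"
proof -
  obtain K where K: "compact K" "\<And>x. x \<notin> K \<Longrightarrow> f x = 0" using assms(1) by (rule CcE) blast
  then show ?thesis
    by (intro CcI[of _ K] continuous_on_mult assms(2) Cc_continuous[OF assms(1)]) auto
qed

lemma Cc_scale: "f \<in> Cc \<Longrightarrow> (\<lambda>x. c * f x) \<in> Cc" for f :: "'g::t2_space \<Rightarrow> complex"
  by (rule Cc_mult) auto

lemma Cc_diff: "f \<in> Cc \<Longrightarrow> g \<in> Cc \<Longrightarrow> (\<lambda>x. f x - g x) \<in> Cc" for f :: "'g::t2_space \<Rightarrow> complex"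
  using Cc_add[of f "\<lambda>x. (-1) * g x"] Cc_scale[of g "-1"] by simp

lemma Cc_sum:
  fixes f :: "'i \<Rightarrow> 'g::t2_space \<Rightarrow> complex"
  assumes "\<And>i. i \<in> A \<Longrightarrow> f i \<in> Cc"
  shows "(\<lambda>x. \<Sum>i\<in>A. f i x) \<in> Cc"
  using assms by (induction A rule: infinite_finite_induct) (simp_all add: Cc_zero Cc_add)

lemma Cc_norm:
  fixes f :: "'g::t2_space \<Rightarrow> complex"
  assumes "f \<in> Cc"
  shows "(\<lambda>x. complex_of_real (cmod (f x))) \<in> Cc"
proof -
  obtain K where K: "compact K" "\<And>x. x \<notin> K \<Longrightarrow> f x = 0" using assms(1) by (rule CcE) blast
  then show ?thesis
    by (intro CcI[of _ K] continuous_on_of_real continuous_on_norm Cc_continuous[OF assms]) auto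
qed

lemma Cc_bounded:
  assumes "f \<in> Cc"
  obtains B where "0 \<le> B" "\<And>x. cmod (f x) \<le> B"
proof -
  obtain K where K: "compact K" "\<And>x. x \<notin> K \<Longrightarrow> f x = 0" using assms(1) by (rule CcE) blast
  have "compact (f ` K)"
    by (rule compact_continuous_image[OF continuous_on_subset[OF Cc_continuous[OF assms]] K(1)]) simp
  then obtain B where B: "\<And>y. y \<in> f ` K \<Longrightarrow> cmod y \<le> B"
    using compact_imp_bounded[of "f ` K"] unfolding bounded_iff by blast
  have "cmod (f x) \<le> max 0 B" for x
    using B[of "f x"] K(2)[of x] by (cases "x \<in> K") (auto simp: le_max_iff_disj)
  then show ?thesis using that[of "max 0 B"] by simp
qed

section \<open>Normality, extension of functions, and bump functions\<close>

lemma normal_space_euclidean: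
  assumes "locally_compact_space (euclidean :: 'g topology)"
  shows "normal_space (euclidean :: 'g::{second_countable_topology, t2_space} topology)"
proof (rule regular_Lindelof_imp_normal_space)
  have "Hausdorff_space (euclidean :: 'g topology)"
    unfolding Hausdorff_space_def using hausdorff by (auto simp: disjnt_def)
  then show "regular_space (euclidean :: 'g topology)"
    using assms locally_compact_Hausdorff_imp_regular_space by blast
  obtain B :: "'g set set" where B: "countable B" "topological_basis B"
    using ex_countable_basis by blast
  have "second_countable (euclidean :: 'g topology)"
    unfolding second_countable_def
    using B by (intro exI[of _ B]) (auto simp: topological_basis_def open_openin[symmetric] elim!: topological_basisE[OF B(2)])
  then show "Lindelof_space (euclidean :: 'g topology)"
    by (rule second_countable_imp_Lindelof_space)
qed

lemma compact_open_superset: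
  fixes K :: "'g::t2_space set"
  assumes "locally_compact_space (euclidean :: 'g topology)" "compact K"
  obtains W where "open W" "K \<subseteq> W" "compact (closure W)"
proof -
  have "\<exists>U C. open U \<and> compact C \<and> x \<in> U \<and> U \<subseteq> C" for x :: 'g
    using assms(1) unfolding locally_compact_space_def by simp
  then obtain U C where UC: "\<And>x. open (U x)" "\<And>x. compact (C x)" "\<And>x. x \<in> U x" "\<And>x::'g. U x \<subseteq> C x"
    by metis
  obtain T where T: "T \<subseteq> K" "finite T" "K \<subseteq> (\<Union>t\<in>T. U t)"
    using compactE_image[OF assms(2), of K U] UC(1,3) by blast
  have C: "compact (\<Union>t\<in>T. C t)" using T(2) UC(2) by (intro compact_UN) auto
  have "closure (\<Union>t\<in>T. U t) \<subseteq> (\<Union>t\<in>T. C t)"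
    using UC(4) by (intro closure_minimal compact_imp_closed[OF C]) blast
  then have "compact (closure (\<Union>t\<in>T. U t))"
    using C by (metis closed_closure compact_Int_closed inf.absorb_iff2)
  with T UC(1) show ?thesis by (intro that[of "\<Union>t\<in>T. U t"]) auto
qed

text \<open>The function is set to zero on the complement of a relatively compact neighbourhood
  \<open>W\<close> of \<open>K\<close> before the extension theorem is applied, so the extension
  vanishes off \<open>closure W\<close>. Real and imaginary parts are extended separately.\<close>

lemma Tietze_Cc:
  fixes f :: "'g::{second_countable_topology, t2_space} \<Rightarrow> complex"
  assumes lc: "locally_compact_space (euclidean :: 'g topology)"
    and S: "closed S" "continuous_on S f" and K: "compact K" "\<And>x. x \<in> S \<Longrightarrow> x \<notin> K \<Longrightarrow> f x = 0"
  obtains g where "g \<in> Cc" "\<And>x. x \<in> S \<Longrightarrow> g x = f x"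
proof -
  obtain W where W: "open W" "K \<subseteq> W" "compact (closure W)"
    using compact_open_superset[OF lc K(1)] .
  define h where "h x = (if x \<in> S then f x else 0)" for x
  have "continuous_on (S \<union> - W) h"
    unfolding h_def using S W K(2) by (intro continuous_on_cases continuous_on_const) auto
  then have cont: "continuous_on (S \<union> - W) (\<lambda>x. Re (h x))" "continuous_on (S \<union> - W) (\<lambda>x. Im (h x))"
    by (auto intro!: continuous_intros)
  have cl: "closedin euclidean (S \<union> - W)" using S(1) W(1) by auto
  have ext: "\<exists>g. continuous_on UNIV g \<and> (\<forall>x\<in>S \<union> - W. g x = k x)"
    if "continuous_on (S \<union> - W) k" for k :: "'g \<Rightarrow> real"
    by (rule Tietze_extension_realinterval[OF normal_space_euclidean[OF lc] cl, of UNIV k])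
      (use that in auto)
  obtain a b where ab: "continuous_on UNIV a" "continuous_on UNIV b"
      "\<And>x. x \<in> S \<union> - W \<Longrightarrow> a x = Re (h x)" "\<And>x. x \<in> S \<union> - W \<Longrightarrow> b x = Im (h x)"
    using ext[OF cont(1)] ext[OF cont(2)] by metis
  define g where "g x = Complex (a x) (b x)" for x
  have gh: "g x = h x" if "x \<in> S \<union> - W" for x using ab(3,4)[OF that] by (simp add: g_def)
  show ?thesis
  proof
    have "continuous_on UNIV (\<lambda>x. complex_of_real (a x) + \<i> * complex_of_real (b x))"
      by (intro continuous_intros ab(1,2))
    then have "continuous_on UNIV g" by (simp add: g_def Complex_eq)
    moreover have "g x = 0" if "x \<notin> closure W" for x
    proof -
      have "x \<notin> W" using that closure_subset by blast
      then show ?thesis using gh[of x] K(2)[of x] W(2) by (auto simp: h_def)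
    qed
    ultimately show "g \<in> Cc" using W(3) by (intro CcI)
    show "g x = f x" if "x \<in> S" for x using gh[of x] that by (simp add: h_def)
  qed
qed

lemma Cc_bump:
  fixes K :: "'g::{second_countable_topology, t2_space} set"
  assumes lc: "locally_compact_space (euclidean :: 'g topology)" and K: "compact K" "open U" "K \<subseteq> U"
  obtains q :: "'g \<Rightarrow> real" where "continuous_on UNIV q" "\<And>x. 0 \<le> q x" "\<And>x. q x \<le> 1"
    "\<And>x. x \<in> K \<Longrightarrow> q x = 1" "\<And>x. x \<notin> U \<Longrightarrow> q x = 0" "(\<lambda>x. complex_of_real (q x)) \<in> Cc"
proof -
  obtain W where W: "open W" "K \<subseteq> W" "compact (closure W)"
    using compact_open_superset[OF lc K(1)] .
  have "closedin euclidean (- (U \<inter> W))" "closedin euclidean K" "disjnt (- (U \<inter> W)) K"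
    using K W compact_imp_closed[OF K(1)] by (auto simp: disjnt_def)
  from Urysohn_lemma[OF normal_space_euclidean[OF lc] this, of 0 1]
  obtain q :: "'g \<Rightarrow> real" where q: "continuous_map euclidean (top_of_set {0..1}) q"
     "q ` (- (U \<inter> W)) \<subseteq> {0}" "q ` K \<subseteq> {1}" by auto
  have c: "continuous_on UNIV q" "\<And>x. q x \<in> {0..1}"
    using q(1) by (auto simp: continuous_map_in_subtopology)
  have z: "q x = 0" if "x \<notin> U \<inter> W" for x using q(2) that by blast
  have "(\<lambda>x. complex_of_real (q x)) \<in> Cc"
    using c(1) z closure_subset[of W] by (intro CcI[OF _ W(3)]) (auto intro!: continuous_intros)
  then show ?thesis using c q(3) z by (intro that[of q]) auto
qed

section \<open>Countable families of bumps and partitions of unity\<close>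

definition bump_family :: "('g::topological_space \<Rightarrow> real) set \<Rightarrow> bool" where
  "bump_family Q \<longleftrightarrow> (\<forall>q\<in>Q. continuous_on UNIV q \<and> (\<forall>x. 0 \<le> q x)) \<and>
     (\<forall>x U. open U \<longrightarrow> x \<in> U \<longrightarrow> (\<exists>q\<in>Q. q x = 1 \<and> (\<forall>y. y \<notin> U \<longrightarrow> q y = 0)))"

text \<open>One function is chosen for every pair of basis sets \<open>A\<close> and
  \<open>C\<close> that admits a function equal to 1 on \<open>A\<close> and 0 off \<open>C\<close>.
  Drawing partitions of unity from a countable family is what later makes a dense set of functions
  countable.\<close>

lemma countable_bump_family:
  assumes lc: "locally_compact_space (euclidean :: 'g topology)"
  obtains Q :: "('g::{second_countable_topology, t2_space} \<Rightarrow> real) set" where "countable Q" "bump_family Q"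
proof -
  obtain B :: "'g set set" where B: "countable B" "topological_basis B"
    using ex_countable_basis by blast
  define P where "P A C q \<longleftrightarrow> continuous_on UNIV q \<and> (\<forall>x. 0 \<le> q x) \<and> (\<forall>x\<in>A. q x = 1) \<and>
    (\<forall>x. x \<notin> C \<longrightarrow> q x = 0)" for A C :: "'g set" and q :: "'g \<Rightarrow> real"
  define Q where "Q = (\<lambda>(A, C). SOME q. P A C q) ` {(A, C) \<in> B \<times> B. \<exists>q. P A C q}"
  have "countable {(A, C) \<in> B \<times> B. \<exists>q. P A C q}"
    by (rule countable_subset[OF _ countable_SIGMA[OF B(1) B(1)]]) auto
  then have "countable Q" unfolding Q_def by (rule countable_image)
  have QP: "\<exists>A C. P A C q" if q: "q \<in> Q" for q
  proof -
    obtain A C where "q = (SOME q. P A C q)" "\<exists>q. P A C q" using q unfolding Q_def by auto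
    then have "P A C q" using someI_ex[of "P A C"] by simp
    then show ?thesis by blast
  qed
  have "\<exists>q\<in>Q. q x = 1 \<and> (\<forall>y. y \<notin> U \<longrightarrow> q y = 0)" if U: "open U" "x \<in> U" for x U
  proof -
    obtain C where C: "C \<in> B" "x \<in> C" "C \<subseteq> U" using topological_basisE[OF B(2) U] .
    have "open C" using topological_basis_open[OF B(2) C(1)] .
    have "compact {x}" "{x} \<subseteq> C" using C(2) by auto
    from Cc_bump[OF lc this(1) \<open>open C\<close> this(2)]
    obtain f :: "'g \<Rightarrow> real" where f: "continuous_on UNIV f" "\<And>x. 0 \<le> f x" "\<And>x. f x \<le> 1"
      "\<And>y. y \<in> {x} \<Longrightarrow> f y = 1" "\<And>x. x \<notin> C \<Longrightarrow> f x = 0" "(\<lambda>x. complex_of_real (f x)) \<in> Cc" by blast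
    have "open {y. f y > 1/2}" using f(1) by (intro open_Collect_less continuous_intros)
    then obtain A where A: "A \<in> B" "x \<in> A" "A \<subseteq> {y. f y > 1/2}"
      using topological_basisE[OF B(2), of "{y. f y > 1/2}" x] f(4) by auto
    \<comment> \<open>The bump \<open>f\<close> is known to equal 1 only at \<open>x\<close>;
      doubling and truncating makes it 1 on the whole of \<open>A\<close>, where \<open>f\<close>
      exceeds one half.\<close>
    have "P A C (\<lambda>y. min 1 (2 * f y))"
      unfolding P_def
    proof (intro conjI ballI allI impI)
      show "continuous_on UNIV (\<lambda>y. min 1 (2 * f y))" by (intro continuous_intros f(1))
      show "min 1 (2 * f y) = 1" if "y \<in> A" for y using A(3) that by force
    qed (use f in auto)
    then have ex: "\<exists>q. P A C q" by blast
    define q where "q = (SOME q. P A C q)"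
    have "P A C q" unfolding q_def by (rule someI_ex[OF ex])
    moreover have "q \<in> Q" unfolding Q_def q_def using A(1) C(1) ex by (intro image_eqI[of _ _ "(A, C)"]) auto
    ultimately show ?thesis using A(2) C(3) unfolding P_def by blast
  qed
  then have "bump_family Q" unfolding bump_family_def using QP by (auto simp: P_def)
  with \<open>countable Q\<close> show ?thesis by (rule that)
qed

text \<open>The sum of the chosen bumps exceeds one half on \<open>K\<close>, so taking the maximum
  with one half keeps the denominator away from zero everywhere and changes nothing on
  \<open>K\<close>. The formula for \<open>p\<close> belongs to the conclusion because it shows
  \<open>p\<close> to be determined by finitely many members of \<open>Q\<close>.\<close>

lemma partition_of_unity_bumps:
  fixes K :: "'g::topological_space set"
  assumes Q: "bump_family Q" and K: "compact K" and N: "\<And>x. x \<in> K \<Longrightarrow> open (N x)" "\<And>x. x \<in> K \<Longrightarrow> x \<in> N x"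
  obtains T q p where "finite T" "T \<subseteq> K" "\<forall>t\<in>T. q t \<in> Q"
    "\<forall>t z. p t z = q t z / max (1/2) (\<Sum>s\<in>T. q s z)"
    "\<forall>t\<in>T. continuous_on UNIV (p t)" "\<forall>t\<in>T. \<forall>z. 0 \<le> p t z"
    "\<forall>t\<in>T. \<forall>z. z \<notin> N t \<longrightarrow> p t z = 0"
    "\<forall>z. (\<Sum>t\<in>T. p t z) \<le> 1" "\<forall>z\<in>K. (\<Sum>t\<in>T. p t z) = 1"
proof -
  have "\<forall>x\<in>K. \<exists>q. q \<in> Q \<and> q x = 1 \<and> (\<forall>y. y \<notin> N x \<longrightarrow> q y = 0)"
    using Q N unfolding bump_family_def by blast
  from bchoice[OF this] obtain q
    where q: "\<And>x. x \<in> K \<Longrightarrow> q x \<in> Q" "\<And>x. x \<in> K \<Longrightarrow> q x x = 1"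
      "\<And>x y. x \<in> K \<Longrightarrow> y \<notin> N x \<Longrightarrow> q x y = 0" by blast
  have cont: "continuous_on UNIV (q x)" and nonneg: "0 \<le> q x z" if "x \<in> K" for x z
    using Q q(1)[OF that] unfolding bump_family_def by blast+
  have "open {y. q x y > 1/2}" if "x \<in> K" for x
    using cont[OF that] by (intro open_Collect_less continuous_intros)
  then obtain T where T: "T \<subseteq> K" "finite T" "K \<subseteq> (\<Union>t\<in>T. {y. q t y > 1/2})"
    by (rule compactE_image[OF K, of K "\<lambda>x. {y. q x y > 1/2}"]) (use q(2) in force)+
  define m where "m z = max (1/2) (\<Sum>s\<in>T. q s z)" for z
  define p where "p = (\<lambda>t z. q t z / m z)"
  have m: "0 < m z" "(\<Sum>s\<in>T. q s z) \<le> m z" for z by (auto simp: m_def)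
  have sum: "(\<Sum>t\<in>T. p t z) = (\<Sum>t\<in>T. q t z) / m z" for z
    by (simp add: p_def sum_divide_distrib)
  have pc: "continuous_on UNIV (p t)" if t: "t \<in> T" for t
  proof -
    have "continuous_on UNIV m"
      unfolding m_def using cont T(1) by (intro continuous_intros) auto
    moreover have "\<forall>z\<in>UNIV. m z \<noteq> 0" using m(1) by (metis less_irrefl)
    moreover have "continuous_on UNIV (q t)" using cont T(1) t by blast
    ultimately show ?thesis unfolding p_def by (intro continuous_on_divide)
  qed
  have p1: "(\<Sum>t\<in>T. p t z) = 1" if z: "z \<in> K" for z
  proof -
    obtain t where t: "t \<in> T" "q t z > 1/2" using T(3) z by blast
    have "q t z \<le> (\<Sum>s\<in>T. q s z)"
      using t(1) T nonneg by (intro member_le_sum) auto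
    then have "m z = (\<Sum>s\<in>T. q s z)" using t(2) by (simp add: m_def)
    then show ?thesis unfolding sum using m(1)[of z] by simp
  qed
  show ?thesis
  proof (rule that[of T q p])
    show "\<forall>t z. p t z = q t z / max (1/2) (\<Sum>s\<in>T. q s z)" by (simp add: p_def m_def)
    show "\<forall>t\<in>T. \<forall>z. 0 \<le> p t z"
      using nonneg m(1) T(1) by (auto simp: p_def intro!: divide_nonneg_pos)
    show "\<forall>t\<in>T. \<forall>z. z \<notin> N t \<longrightarrow> p t z = 0"
      using q(3) T(1) by (auto simp: p_def)
    show "\<forall>z. (\<Sum>t\<in>T. p t z) \<le> 1"
      unfolding sum using m by simp
    show "\<forall>t\<in>T. q t \<in> Q" using q(1) T(1) by blast
  qed (use T pc p1 in blast)+
qed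

text \<open>The alternative \<open>a = 0\<close> serves points off the compact set, where the
  weights of a partition of unity may add up to less than one.\<close>

lemma norm_convex_approx:
  fixes a :: "'a::real_normed_vector"
  assumes "finite T" "\<And>t. t \<in> T \<Longrightarrow> 0 \<le> p t" "(\<Sum>t\<in>T. p t) \<le> 1" "a = 0 \<or> (\<Sum>t\<in>T. p t) = 1"
    "\<And>t. t \<in> T \<Longrightarrow> p t \<noteq> 0 \<Longrightarrow> norm (a - b t) \<le> e" "0 \<le> e"
  shows "norm (a - (\<Sum>t\<in>T. p t *\<^sub>R b t)) \<le> e"
proof -
  have "a = (\<Sum>t\<in>T. p t) *\<^sub>R a" using assms(4) by auto
  then have "norm (a - (\<Sum>t\<in>T. p t *\<^sub>R b t)) = norm (\<Sum>t\<in>T. p t *\<^sub>R (a - b t))"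
    by (simp add: scaleR_sum_left scaleR_diff_right sum_subtractf)
  also have "\<dots> \<le> (\<Sum>t\<in>T. p t * e)"
  proof (rule order_trans[OF norm_sum], rule sum_mono)
    fix t assume "t \<in> T"
    then show "norm (p t *\<^sub>R (a - b t)) \<le> p t * e"
      using assms(2,5)[of t] by (cases "p t = 0") (auto intro: mult_left_mono)
  qed
  also have "\<dots> = (\<Sum>t\<in>T. p t) * e" by (simp add: sum_distrib_right)
  also have "\<dots> \<le> 1 * e" by (intro mult_right_mono assms)
  finally show ?thesis by simp
qed

text \<open>The approximants combine partition functions with coefficients from a countable dense
  set. A partition is determined by finitely many bumps of a countable family, so finite lists of
  pairs describe all of them. One compact set works for every \<open>e\<close>, because uniform
  closeness controls the I-norm only on a common support.\<close>

lemma Cc_separable: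
  assumes lc: "locally_compact_space (euclidean :: 'g topology)"
  obtains D :: "('g::{second_countable_topology, t2_space} \<Rightarrow> complex) set" where "countable D" "D \<subseteq> Cc"
    "\<forall>f\<in>Cc. \<exists>K. compact K \<and> (\<forall>e>0. \<exists>d\<in>D. (\<forall>x. cmod (f x - d x) \<le> e) \<and> (\<forall>x. x \<notin> K \<longrightarrow> f x = d x))"
proof -
  obtain Q :: "('g \<Rightarrow> real) set" where Q: "countable Q" "bump_family Q"
    using countable_bump_family[OF lc] .
  obtain C :: "complex set" where C: "countable C" "\<And>U. open U \<Longrightarrow> U \<noteq> {} \<Longrightarrow> \<exists>c\<in>C. c \<in> U"
    using countable_dense_exists by blast
  define F where "F l z = (\<Sum>(c, q)\<leftarrow>l. complex_of_real (q z / max (1/2) (\<Sum>(c, q)\<leftarrow>l. q z)) * c)"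
    for l :: "(complex \<times> ('g \<Rightarrow> real)) list" and z
  define D where "D = F ` lists (C \<times> Q) \<inter> Cc"
  have "countable (F ` lists (C \<times> Q))"
    by (intro countable_image countable_lists countable_SIGMA C(1) Q(1))
  then have "countable D" unfolding D_def by (metis countable_Int1)
  moreover have "\<exists>K. compact K \<and> (\<forall>e>0. \<exists>d\<in>D. (\<forall>x. cmod (f x - d x) \<le> e) \<and> (\<forall>x. x \<notin> K \<longrightarrow> f x = d x))"
    if f: "f \<in> Cc" for f
  proof -
    obtain K where K: "continuous_on UNIV f" "compact K" "\<And>x. x \<notin> K \<Longrightarrow> f x = 0" using f by (rule CcE) blast
    obtain W where W: "open W" "K \<subseteq> W" "compact (closure W)"
      using compact_open_superset[OF lc K(2)] .
    have "\<exists>d\<in>D. (\<forall>x. cmod (f x - d x) \<le> e) \<and> (\<forall>x. x \<notin> closure W \<longrightarrow> f x = d x)" if e: "e > 0" for e :: real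
    proof -
      define N where "N x = {z \<in> W. cmod (f z - f x) < e / 2}" for x
      have "open (N x)" for x
      proof -
        have "open {z. cmod (f z - f x) < e / 2}"
          using K(1) by (intro open_Collect_less continuous_intros)
        moreover have "N x = W \<inter> {z. cmod (f z - f x) < e / 2}" by (auto simp: N_def)
        ultimately show ?thesis using W(1) by auto
      qed
      moreover have "x \<in> N x" if "x \<in> K" for x using that W(2) e by (auto simp: N_def)
      ultimately obtain T q p where T: "finite T" "T \<subseteq> K" "\<forall>t\<in>T. q t \<in> Q"
        and p: "\<forall>t z. p t z = q t z / max (1/2) (\<Sum>s\<in>T. q s z)"
          "\<forall>t\<in>T. continuous_on UNIV (p t)" "\<forall>t\<in>T. \<forall>z. 0 \<le> p t z"
          "\<forall>t\<in>T. \<forall>z. z \<notin> N t \<longrightarrow> p t z = 0"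
          "\<forall>z. (\<Sum>t\<in>T. p t z) \<le> 1" "\<forall>z\<in>K. (\<Sum>t\<in>T. p t z) = 1"
        by (rule partition_of_unity_bumps[OF Q(2) K(2)])
      have "\<exists>c\<in>C. cmod (f t - c) < e / 2" for t
        using C(2)[of "ball (f t) (e / 2)"] e by (auto simp: dist_norm)
      then obtain c where c: "\<And>t. c t \<in> C" "\<And>t. cmod (f t - c t) < e / 2" by metis
      \<comment> \<open>Without repetitions the sums over the list agree with the sums over
        \<open>T\<close>.\<close>
      obtain l where l: "set l = T" "distinct l" using finite_distinct_list[OF T(1)] by blast
      define d where "d z = (\<Sum>t\<in>T. p t z *\<^sub>R c t)" for z
      have "F (map (\<lambda>t. (c t, q t)) l) = d"
        unfolding F_def d_def
        by (rule ext) (simp add: o_def p(1) sum_list_distinct_conv_sum_set[OF l(2)] l(1) scaleR_conv_of_real)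
      moreover have "map (\<lambda>t. (c t, q t)) l \<in> lists (C \<times> Q)" using c(1) T(3) l(1) by auto
      moreover have d0: "d x = 0" if "x \<notin> closure W" for x
        unfolding d_def
      proof (rule sum.neutral, intro ballI)
        fix t assume "t \<in> T"
        moreover have "x \<notin> N t" using that closure_subset[of W] by (auto simp: N_def)
        ultimately show "p t x *\<^sub>R c t = 0" using p(4) by simp
      qed
      moreover have "d \<in> Cc"
        using p(2) d0 by (intro CcI[OF _ W(3)]) (auto simp: d_def intro!: continuous_intros)
      ultimately have "d \<in> D" unfolding D_def by blast
      moreover have "cmod (f x - d x) \<le> e" for x
        unfolding d_def
      proof (rule norm_convex_approx[OF T(1)])
        show "f x = 0 \<or> (\<Sum>t\<in>T. p t x) = 1" using K(3) p(6) by blast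
        fix t assume t: "t \<in> T" "p t x \<noteq> 0"
        then have "cmod (f x - f t) < e / 2" using p(4) by (auto simp: N_def)
        with c(2)[of t] show "cmod (f x - c t) \<le> e"
          using norm_triangle_ineq[of "f x - f t" "f t - c t"] by simp
      qed (use e p(3,5) in auto)
      moreover have "f x = d x" if "x \<notin> closure W" for x
        using K(3)[of x] d0[OF that] W(2) closure_subset[of W] that by auto
      ultimately show ?thesis by blast
    qed
    then show ?thesis using W(3) by blast
  qed
  ultimately show ?thesis by (intro that[of D]) (auto simp: D_def)
qed

lemma ell2_separable:
  obtains D :: "ell2 set" where "countable D" "\<forall>v. \<forall>e>0. \<exists>d\<in>D. norm (v - d) < e"
proof -
  obtain C :: "complex set" where C: "countable C" "\<And>U. open U \<Longrightarrow> U \<noteq> {} \<Longrightarrow> \<exists>c\<in>C. c \<in> U"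
    using countable_dense_exists by blast
  define F where "F l n = (if n < length l then l ! n else 0)" for l :: "complex list" and n
  have smF: "summable (\<lambda>n. (cmod (F l n))\<^sup>2)" for l
    by (rule summable_finite[of "{..<length l}"]) (auto simp: F_def)
  then have RF: "Rep_ell2 (Abs_ell2 (F l)) = F l" for l by (simp add: Abs_ell2_inverse)
  define D where "D = (\<lambda>l. Abs_ell2 (F l)) ` lists C"
  have "countable D" unfolding D_def by (intro countable_image countable_lists C(1))
  moreover have "\<exists>d\<in>D. norm (v - d) < e" if e: "0 < e" for v e
  proof -
    define x where "x n = Rep_ell2 v n" for n
    have smx: "summable (\<lambda>n. (cmod (x n))\<^sup>2)" unfolding x_def by (rule ell2_summable)
    obtain N where N: "\<And>n. n \<ge> N \<Longrightarrow> norm (\<Sum>i. (cmod (x (i + n)))\<^sup>2) < e\<^sup>2 / 2"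
      using suminf_exist_split[OF _ smx, of "e\<^sup>2 / 2"] e by auto
    \<comment> \<open>The \<open>N\<close> leading coordinates contribute at most
      \<open>N * r^2\<close>, hence at most half of \<open>e^2\<close>, and the tail the rest;
      adding one to \<open>N\<close> keeps \<open>r\<close> positive for
      \<open>N = 0\<close>.\<close>
    define r where "r = sqrt (e\<^sup>2 / (2 * (real N + 1)))"
    have r: "0 < r" "r\<^sup>2 = e\<^sup>2 / (2 * (real N + 1))" using e by (auto simp: r_def)
    have "\<exists>c\<in>C. cmod (x n - c) < r" for n
      using C(2)[of "ball (x n) r"] r(1) by (auto simp: dist_norm)
    then obtain c where c: "\<And>n. c n \<in> C" "\<And>n. cmod (x n - c n) < r" by metis
    define l where "l = map c [0..<N]"
    define y where "y n = (cmod (x n - F l n))\<^sup>2" for n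
    have y1: "y n \<le> r\<^sup>2" if "n < N" for n
      unfolding y_def using c(2)[of n] that by (intro power_mono) (auto simp: F_def l_def)
    have y2: "y (n + N) = (cmod (x (n + N)))\<^sup>2" for n
      by (simp add: y_def F_def l_def)
    have smy: "summable y"
      unfolding y_def using square_summable_add[OF smx, of "\<lambda>n. - F l n"] smF by simp
    have "(norm (v - Abs_ell2 (F l)))\<^sup>2 = (\<Sum>n. y n)"
      unfolding ell2_norm_square minus_ell2.rep_eq RF y_def x_def ..
    also have "\<dots> = (\<Sum>n. y (n + N)) + (\<Sum>n<N. y n)"
      by (rule suminf_split_initial_segment[OF smy])
    also have "(\<Sum>n. y (n + N)) < e\<^sup>2 / 2"
      using N[of N] unfolding y2 by (simp add: abs_less_iff)
    also have "(\<Sum>n<N. y n) \<le> (\<Sum>n<N. r\<^sup>2)" by (intro sum_mono y1) auto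
    also have "\<dots> \<le> e\<^sup>2 / 2"
      unfolding r(2) by (simp add: field_simps)
    finally have "(norm (v - Abs_ell2 (F l)))\<^sup>2 < e\<^sup>2" by simp
    then have "norm (v - Abs_ell2 (F l)) < e" by (rule power2_less_imp_less) (use e in simp)
    moreover have "Abs_ell2 (F l) \<in> D" unfolding D_def l_def using c(1) by (intro imageI) auto
    ultimately show ?thesis by blast
  qed
  ultimately show ?thesis by (intro that[of D]) blast+
qed

section \<open>Integration on the range fibres\<close>

locale haar_groupoid =
  fixes G :: "'g::{second_countable_topology, t2_space} groupoid"
    and lam :: "'g \<Rightarrow> 'g measure"
  assumes lch: "lch_groupoid G" and haar: "left_haar_system G lam"
begin

section \<open>Groupoid identities and continuity of the structure maps\<close>

abbreviation src :: "'g \<Rightarrow> 'g" where "src \<equiv> gsrc G"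
abbreviation rng :: "'g \<Rightarrow> 'g" where "rng \<equiv> grng G"
abbreviation mul :: "'g \<Rightarrow> 'g \<Rightarrow> 'g" (infixl \<open>\<cdot>\<close> 70) where "mul \<equiv> gmult G"
abbreviation iv :: "'g \<Rightarrow> 'g" where "iv \<equiv> ginv G"

lemma lc: "locally_compact_space (euclidean :: 'g topology)"
  using lch by (simp add: lch_groupoid_def)

lemma gpd: "groupoid G"
  using lch by (simp add: lch_groupoid_def)

lemma src_rng [simp]:
  "src (src x) = src x" "rng (src x) = src x" "src (rng x) = rng x" "rng (rng x) = rng x"
  "src (iv x) = rng x" "rng (iv x) = src x"
  using gpd unfolding groupoid_def by blast+

lemma mul_src_rng [simp]: "src x = rng y \<Longrightarrow> src (x \<cdot> y) = src y" "src x = rng y \<Longrightarrow> rng (x \<cdot> y) = rng x"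
  using gpd unfolding groupoid_def by blast+

lemma mul_assoc: "src x = rng y \<Longrightarrow> src y = rng z \<Longrightarrow> (x \<cdot> y) \<cdot> z = x \<cdot> (y \<cdot> z)"
  using gpd unfolding groupoid_def by blast

lemma mul_units [simp]: "rng x \<cdot> x = x" "x \<cdot> src x = x" "iv x \<cdot> x = src x" "x \<cdot> iv x = rng x"
  using gpd unfolding groupoid_def by blast+

lemma iv_mul_cancel [simp]:
  assumes "src x = rng y"
  shows "iv x \<cdot> (x \<cdot> y) = y"
  using mul_assoc[of "iv x" x y] assms mul_units(1)[of y] by simp

lemma mul_iv_cancel [simp]:
  assumes "rng x = rng y"
  shows "x \<cdot> (iv x \<cdot> y) = y"
  using mul_assoc[of x "iv x" y] assms mul_units(1)[of y] by simp

lemma iv_iv [simp]: "iv (iv x) = x"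
  using iv_mul_cancel[of "iv x" x] mul_units(2)[of "iv (iv x)"] by simp

lemma iv_mul:
  assumes "src x = rng y"
  shows "iv (x \<cdot> y) = iv y \<cdot> iv x"
proof -
  have "(x \<cdot> y) \<cdot> (iv y \<cdot> iv x) = rng x"
    using assms mul_assoc[of x y "iv y \<cdot> iv x"] by simp
  moreover have "iv (x \<cdot> y) \<cdot> ((x \<cdot> y) \<cdot> (iv y \<cdot> iv x)) = iv y \<cdot> iv x"
    by (rule iv_mul_cancel) (simp add: assms)
  ultimately show ?thesis
    using assms mul_units(2)[of "iv (x \<cdot> y)"] by simp
qed

lemma src_units [simp]: "src x \<in> units G" and rng_units [simp]: "rng x \<in> units G"
  unfolding units_def by (metis rangeI src_rng(3))+

lemma units_src: "u \<in> units G \<Longrightarrow> src u = u" and units_rng: "u \<in> units G \<Longrightarrow> rng u = u"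
  unfolding units_def by auto

lemma continuous_on_iv [continuous_intros]:
  "continuous_on S f \<Longrightarrow> continuous_on S (\<lambda>x. iv (f x))"
  using lch unfolding lch_groupoid_def by (metis continuous_on_compose2 subset_UNIV)

lemma continuous_on_mul:
  assumes "continuous_on S f" "continuous_on S g" "\<And>x. x \<in> S \<Longrightarrow> src (f x) = rng (g x)"
  shows "continuous_on S (\<lambda>x. f x \<cdot> g x)"
proof -
  have "continuous_on {(x, y). src x = rng y} (\<lambda>(x, y). x \<cdot> y)"
    using lch by (simp add: lch_groupoid_def)
  from continuous_on_compose2[OF this continuous_on_Pair[OF assms(1,2)]] assms(3)
  show ?thesis by auto
qed

lemma continuous_on_src [continuous_intros]:
  assumes "continuous_on S f"
  shows "continuous_on S (\<lambda>x. src (f x))"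
  using continuous_on_mul[OF continuous_on_iv[OF assms] assms] by simp

lemma continuous_on_rng [continuous_intros]:
  assumes "continuous_on S f"
  shows "continuous_on S (\<lambda>x. rng (f x))"
  using continuous_on_mul[OF assms continuous_on_iv[OF assms]] by simp

lemma continuous_on_units_comp:
  assumes "continuous_on (units G) h"
  shows "continuous_on UNIV (\<lambda>x. h (rng x))" "continuous_on UNIV (\<lambda>x. h (src x))"
  by (rule continuous_on_compose2[OF assms continuous_on_rng[OF continuous_on_id]]; force)
     (rule continuous_on_compose2[OF assms continuous_on_src[OF continuous_on_id]]; force)

lemma closed_rfibre: "closed (rfibre G u)"
  unfolding rfibre_def by (intro closed_Collect_eq continuous_intros)

lemma closed_composable: "closed {(x, y). rng x = rng y}"
  using closed_Collect_eq[of "\<lambda>p::'g\<times>'g. rng (fst p)" "\<lambda>p. rng (snd p)"]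
  by (simp add: case_prod_unfold continuous_on_rng continuous_on_fst continuous_on_snd)

section \<open>Integration over one fibre\<close>

definition fint :: "'g \<Rightarrow> ('g \<Rightarrow> complex) \<Rightarrow> complex" where
  "fint u k = (LINT y:rfibre G u|lam u. k y)"

text \<open>Integrands such as \<open>y \<mapsto> g (iv y \<cdot> x)\<close> are meaningful only for
  \<open>y\<close> in one fibre, so continuity and compact support are demanded there.\<close>

definition fibre_Cc :: "'g \<Rightarrow> ('g \<Rightarrow> complex) \<Rightarrow> bool" where
  "fibre_Cc u k \<longleftrightarrow> continuous_on (rfibre G u) k \<and>
     (\<exists>K. compact K \<and> (\<forall>y. rng y = u \<longrightarrow> y \<notin> K \<longrightarrow> k y = 0))"

lemma fibre_CcI:
  "continuous_on (rfibre G u) k \<Longrightarrow> compact K \<Longrightarrow> (\<And>y. rng y = u \<Longrightarrow> y \<notin> K \<Longrightarrow> k y = 0) \<Longrightarrow> fibre_Cc u k"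
  unfolding fibre_Cc_def by blast

lemma fibre_Cc_of_Cc: "k \<in> Cc \<Longrightarrow> fibre_Cc u k"
  by (erule CcE, rule fibre_CcI) (auto intro: continuous_on_subset)

lemma fibre_Cc_mult:
  assumes "fibre_Cc u k" "continuous_on (rfibre G u) h"
  shows "fibre_Cc u (\<lambda>y. h y * k y)"
  using assms unfolding fibre_Cc_def by (auto intro: continuous_on_mult)

lemma fibre_Cc_diff:
  assumes "fibre_Cc u k" "fibre_Cc u h"
  shows "fibre_Cc u (\<lambda>y. k y - h y)"
proof -
  obtain K K' where "compact K" "compact K'" "\<forall>y. rng y = u \<longrightarrow> y \<notin> K \<longrightarrow> k y = 0"
      "\<forall>y. rng y = u \<longrightarrow> y \<notin> K' \<longrightarrow> h y = 0"
    using assms unfolding fibre_Cc_def by blast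
  then show ?thesis
    using assms unfolding fibre_Cc_def
    by (intro conjI continuous_on_diff exI[of _ "K \<union> K'"]) auto
qed

lemma fibre_Cc_cong:
  assumes "fibre_Cc u k" "\<And>y. rng y = u \<Longrightarrow> h y = k y"
  shows "fibre_Cc u h"
proof -
  have "continuous_on (rfibre G u) h \<longleftrightarrow> continuous_on (rfibre G u) k"
    using assms(2) by (intro continuous_on_cong) (auto simp: rfibre_def)
  then show ?thesis using assms unfolding fibre_Cc_def by auto
qed

text \<open>The fibre is closed, so Tietze's theorem applies. This carries integrability and left
  invariance, which the Haar system provides for \<open>Cc\<close>, over to integrands living on one
  fibre.\<close>

lemma fibre_Cc_extend:
  assumes "fibre_Cc u k"
  obtains g where "g \<in> Cc" "\<forall>y. rng y = u \<longrightarrow> g y = k y"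
proof -
  obtain K where K: "continuous_on (rfibre G u) k" "compact K" "\<forall>y. rng y = u \<longrightarrow> y \<notin> K \<longrightarrow> k y = 0"
    using assms unfolding fibre_Cc_def by blast
  obtain g where "g \<in> Cc" "\<And>y. y \<in> rfibre G u \<Longrightarrow> g y = k y"
    by (rule Tietze_Cc[OF lc closed_rfibre K(1,2)]) (use K(3) in \<open>auto simp: rfibre_def\<close>)
  then show ?thesis by (intro that) (auto simp: rfibre_def)
qed

lemmas haar_measures = haar[unfolded left_haar_system_def, THEN conjunct1, THEN bspec]
lemmas haar_continuous = haar[unfolded left_haar_system_def, THEN conjunct2, THEN conjunct1, THEN bspec]
lemmas haar_invariant = haar[unfolded left_haar_system_def, THEN conjunct2, THEN conjunct2, THEN bspec, THEN spec]

lemma sets_lam: "u \<in> units G \<Longrightarrow> sets (lam u) = sets borel"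
  by (rule haar_measures[THEN conjunct1])

lemma space_lam: "u \<in> units G \<Longrightarrow> space (lam u) = UNIV"
  using sets_eq_imp_space_eq[OF sets_lam] by simp

lemma borel_measurable_lam: "u \<in> units G \<Longrightarrow> borel_measurable (lam u) = borel_measurable borel"
  by (intro measurable_cong_sets sets_lam refl)

lemma emeasure_lam_compact: "u \<in> units G \<Longrightarrow> compact K \<Longrightarrow> emeasure (lam u) K < \<infinity>"
  by (rule haar_measures[THEN conjunct2, THEN conjunct1, rule_format])

lemma AE_rfibre:
  assumes "u \<in> units G"
  shows "AE y in lam u. rng y = u"
proof (rule AE_I')
  show "- rfibre G u \<in> null_sets (lam u)"
    using haar_measures[OF assms, THEN conjunct2, THEN conjunct2, THEN conjunct1]
      closed_rfibre[of u] sets_lam[OF assms]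
    by (simp add: null_sets_def borel_open open_Compl)
qed (auto simp: rfibre_def)

lemma integrable_Cc:
  assumes "f \<in> Cc" "u \<in> units G"
  shows "integrable (lam u) f"
proof -
  obtain K where K: "continuous_on UNIV f" "compact K" "\<And>x. x \<notin> K \<Longrightarrow> f x = 0" using assms(1) by (rule CcE) blast
  obtain B where B: "\<And>x. cmod (f x) \<le> B" using assms(1) by (rule Cc_bounded) blast
  show ?thesis
  proof (rule integrableI_bounded_set)
    show "K \<in> sets (lam u)" using K(2) sets_lam[OF assms(2)] by (simp add: borel_compact)
    show "f \<in> borel_measurable (lam u)"
      unfolding borel_measurable_lam[OF assms(2)] by (rule borel_measurable_continuous_onI[OF K(1)])
    show "emeasure (lam u) K < \<infinity>" by (rule emeasure_lam_compact[OF assms(2) K(2)])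
  qed (use B K(3) in auto)
qed

lemma fint_cong: "(\<And>y. rng y = u \<Longrightarrow> f y = g y) \<Longrightarrow> fint u f = fint u g"
  unfolding fint_def set_lebesgue_integral_def
  by (intro Bochner_Integration.integral_cong) (auto simp: rfibre_def indicator_def)

lemma fint_Cc:
  assumes "f \<in> Cc" "u \<in> units G"
  shows "fint u f = (LINT y|lam u. f y)"
  unfolding fint_def set_lebesgue_integral_def
proof (rule integral_cong_AE)
  have f: "f \<in> borel_measurable (lam u)" using integrable_Cc[OF assms] by (rule borel_measurable_integrable)
  show "f \<in> borel_measurable (lam u)" by fact
  have "rfibre G u \<in> sets (lam u)" using closed_rfibre sets_lam[OF assms(2)] by auto
  then show "(\<lambda>x. indicat_real (rfibre G u) x *\<^sub>R f x) \<in> borel_measurable (lam u)"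
    using f by measurable
  show "AE x in lam u. indicat_real (rfibre G u) x *\<^sub>R f x = f x"
    using AE_rfibre[OF assms(2)] by eventually_elim (simp add: rfibre_def)
qed

lemma set_integrable_fibre:
  assumes "fibre_Cc u k" "u \<in> units G"
  shows "set_integrable (lam u) (rfibre G u) k"
proof -
  obtain g where g: "g \<in> Cc" "\<forall>y. rng y = u \<longrightarrow> g y = k y" using assms(1) by (rule fibre_Cc_extend)
  have "rfibre G u \<in> sets (lam u)" using closed_rfibre sets_lam[OF assms(2)] by auto
  then have "set_integrable (lam u) (rfibre G u) g"
    unfolding set_integrable_def using integrable_Cc[OF g(1) assms(2)] by (rule integrable_mult_indicator)
  moreover have "(\<lambda>x. indicat_real (rfibre G u) x *\<^sub>R g x) = (\<lambda>x. indicat_real (rfibre G u) x *\<^sub>R k x)"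
    using g(2) by (auto simp: fun_eq_iff indicator_def rfibre_def)
  ultimately show ?thesis unfolding set_integrable_def by simp
qed

lemma fint_add:
  "fibre_Cc u k \<Longrightarrow> fibre_Cc u h \<Longrightarrow> u \<in> units G \<Longrightarrow> fint u (\<lambda>y. k y + h y) = fint u k + fint u h"
  unfolding fint_def by (intro set_integral_add set_integrable_fibre)

lemma fint_diff:
  "fibre_Cc u k \<Longrightarrow> fibre_Cc u h \<Longrightarrow> u \<in> units G \<Longrightarrow> fint u (\<lambda>y. k y - h y) = fint u k - fint u h"
  unfolding fint_def by (intro set_integral_diff set_integrable_fibre)

lemma fint_mult: "fint u (\<lambda>y. c * k y) = c * fint u k"
  unfolding fint_def by (rule set_integral_mult_right)

lemma fint_cnj: "fint u (\<lambda>y. cnj (k y)) = cnj (fint u k)"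
  using Bochner_Integration.integral_cnj[of "lam u" "\<lambda>y. indicat_real (rfibre G u) y *\<^sub>R k y"]
  unfolding fint_def set_lebesgue_integral_def by simp

lemma cmod_fint_le:
  assumes "fibre_Cc u k" "fibre_Cc u (\<lambda>y. complex_of_real (b y))" "u \<in> units G"
    and "\<And>y. rng y = u \<Longrightarrow> cmod (k y) \<le> b y"
  shows "cmod (fint u k) \<le> Re (fint u (\<lambda>y. complex_of_real (b y)))"
proof -
  note int = set_integrable_fibre[OF assms(1,3), unfolded set_integrable_def]
    set_integrable_fibre[OF assms(2,3), unfolded set_integrable_def]
  have "cmod (fint u k) \<le> (LINT y|lam u. norm (indicat_real (rfibre G u) y *\<^sub>R k y))"
    unfolding fint_def set_lebesgue_integral_def by (rule integral_norm_bound)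
  also have "\<dots> \<le> (LINT y|lam u. Re (indicat_real (rfibre G u) y *\<^sub>R complex_of_real (b y)))"
    using int assms(4) by (intro integral_mono integrable_norm integrable_Re) (auto simp: indicator_def rfibre_def)
  also have "\<dots> = Re (fint u (\<lambda>y. complex_of_real (b y)))"
    unfolding fint_def set_lebesgue_integral_def by (rule integral_Re[OF int(2)])
  finally show ?thesis .
qed

lemma fint_left_mult:
  assumes "fibre_Cc (rng x) k"
  shows "fint (src x) (\<lambda>y. k (x \<cdot> y)) = fint (rng x) k"
proof -
  obtain g where g: "g \<in> Cc" "\<forall>y. rng y = rng x \<longrightarrow> g y = k y" using assms by (rule fibre_Cc_extend)
  have "fint (src x) (\<lambda>y. k (x \<cdot> y)) = fint (src x) (\<lambda>y. g (x \<cdot> y))"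
    using g(2) by (intro fint_cong) simp
  also have "\<dots> = (LINT y|lam (rng x). g y)"
    unfolding fint_def by (rule haar_invariant[OF g(1)])
  also have "\<dots> = fint (rng x) g" by (rule fint_Cc[symmetric, OF g(1)]) simp
  also have "\<dots> = fint (rng x) k" using g(2) by (intro fint_cong) simp
  finally show ?thesis .
qed

lemma continuous_fint_Cc:
  assumes "f \<in> Cc"
  shows "continuous_on (units G) (\<lambda>u. fint u f)" "continuous_on UNIV (\<lambda>x. fint (rng x) f)"
proof -
  have "continuous_on (units G) (\<lambda>u. LINT y|lam u. f y)"
    by (rule haar_continuous[OF assms])
  then show 1: "continuous_on (units G) (\<lambda>u. fint u f)"
    using fint_Cc[OF assms] by (simp cong: continuous_on_cong)
  show "continuous_on UNIV (\<lambda>x. fint (rng x) f)"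
    by (rule continuous_on_units_comp(1)[OF 1])
qed

text \<open>The integrand at \<open>x\<^sub>0\<close> is extended to a function in \<open>Cc\<close>, for which
  continuity is part of the Haar system; nearby integrands are uniformly close to it on a compact
  set by the tube lemma.\<close>

lemma continuous_fint:
  assumes F: "continuous_on {(x, y). rng x = rng y} (\<lambda>(x, y). F x y)"
    and K: "compact K" "\<And>x y. rng x = rng y \<Longrightarrow> y \<notin> K \<Longrightarrow> F x y = 0"
  shows "continuous_on UNIV (\<lambda>x. fint (rng x) (F x))"
proof -
  have fib: "fibre_Cc (rng x) (F x)" for x
  proof (rule fibre_CcI[OF _ K(1)])
    show "continuous_on (rfibre G (rng x)) (F x)"
    proof -
      have "continuous_on (rfibre G (rng x)) (\<lambda>y. case (x, y) of (x, y) \<Rightarrow> F x y)"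
        by (rule continuous_on_compose2[OF F continuous_on_Pair[OF continuous_on_const continuous_on_id]])
          (auto simp: rfibre_def)
      then show ?thesis by simp
    qed
  qed (use K(2) in auto)
  have "((\<lambda>x. fint (rng x) (F x)) \<longlongrightarrow> fint (rng x0) (F x0)) (at x0)" for x0
  proof -
    obtain k where k: "k \<in> Cc" "\<forall>y. rng y = rng x0 \<longrightarrow> k y = F x0 y"
      using fib by (rule fibre_Cc_extend)
    obtain Kk where Kk: "compact Kk" "\<And>y. y \<notin> Kk \<Longrightarrow> k y = 0" using k(1) by (rule CcE) blast
    \<comment> \<open>Being 1 on both supports, \<open>\<kappa>\<close> dominates the difference of
      the integrands up to a factor \<open>\<epsilon>\<close>. Its integral \<open>c\<close> is
      continuous, hence below \<open>c x0 + 1\<close> near \<open>x0\<close>, which explains the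
      choice of \<open>\<epsilon>\<close>.\<close>
    obtain \<kappa> :: "'g \<Rightarrow> real" where \<kappa>: "\<And>x. 0 \<le> \<kappa> x" "\<And>x. x \<in> K \<union> Kk \<Longrightarrow> \<kappa> x = 1"
        "(\<lambda>x. complex_of_real (\<kappa> x)) \<in> Cc"
      using Cc_bump[OF lc compact_Un[OF K(1) Kk(1)] open_UNIV] by (metis subset_UNIV)
    define c where "c x = Re (fint (rng x) (\<lambda>y. complex_of_real (\<kappa> y)))" for x
    have "isCont c x0"
      using continuous_fint_Cc(2)[OF \<kappa>(3)] unfolding c_def
      by (intro isCont_Re) (simp add: continuous_on_eq_continuous_at)
    then have clim: "(c \<longlongrightarrow> c x0) (at x0)" by (simp add: isCont_def)
    have c0: "0 \<le> c x0"
      using cmod_fint_le[OF fibre_Cc_of_Cc[OF Cc_zero] fibre_Cc_of_Cc[OF \<kappa>(3)], of "rng x0"] \<kappa>(1)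
      unfolding c_def by (auto intro: order_trans[OF norm_ge_zero])
    have "((\<lambda>x. fint (rng x) (F x) - fint (rng x) k) \<longlongrightarrow> 0) (at x0)"
    proof (rule tendstoI)
      fix e :: real assume e: "e > 0"
      define \<epsilon> where "\<epsilon> = e / (c x0 + 1)"
      have \<epsilon>: "0 < \<epsilon>" using e c0 by (simp add: \<epsilon>_def)
      define E where "E = {p \<in> {(x, y). rng x = rng y}. \<epsilon> \<le> cmod (F (fst p) (snd p) - k (snd p))}"
      have "continuous_on {(x, y). rng x = rng y} (\<lambda>p. F (fst p) (snd p))"
        using F by (simp add: case_prod_unfold)
      moreover have "continuous_on {(x, y). rng x = rng y} (\<lambda>p. k (snd p))"
        by (rule continuous_on_compose2[OF Cc_continuous[OF k(1)]]) (auto intro: continuous_intros)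
      ultimately have "closed E"
        unfolding E_def
        by (intro continuous_on_closed_Collect_le closed_composable continuous_intros)
      have "open (- E)" "{x0} \<times> (K \<union> Kk) \<subseteq> - E"
        using \<open>closed E\<close> k(2) \<epsilon> by (auto simp: E_def)
      from Elementary_Topology.tube_lemma[OF compact_Un[OF K(1) Kk(1)] this]
      obtain V where V: "x0 \<in> V" "open V" "V \<times> (K \<union> Kk) \<subseteq> - E" by blast
      have "\<forall>\<^sub>F x in at x0. x \<in> V" by (rule eventually_at_in_open'[OF V(2,1)])
      moreover have "\<forall>\<^sub>F x in at x0. c x < c x0 + 1"
        using clim by (rule order_tendstoD) simp
      ultimately show "\<forall>\<^sub>F x in at x0. dist (fint (rng x) (F x) - fint (rng x) k) 0 < e"
      proof eventually_elim
        case (elim x)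
        have fk: "fibre_Cc (rng x) k" by (rule fibre_Cc_of_Cc[OF k(1)])
        have "cmod (fint (rng x) (\<lambda>y. F x y - k y)) \<le> Re (fint (rng x) (\<lambda>y. complex_of_real (\<epsilon> * \<kappa> y)))"
        proof (rule cmod_fint_le[OF fibre_Cc_diff[OF fib fk]])
          show "fibre_Cc (rng x) (\<lambda>y. complex_of_real (\<epsilon> * \<kappa> y))"
            using fibre_Cc_of_Cc[OF Cc_scale[OF \<kappa>(3), of "complex_of_real \<epsilon>"]] by simp
          fix y assume y: "rng y = rng x"
          show "cmod (F x y - k y) \<le> \<epsilon> * \<kappa> y"
          proof (cases "y \<in> K \<union> Kk")
            case True
            then have "(x, y) \<in> - E" using elim V(3) by blast
            then show ?thesis using y \<kappa>(2)[OF True] by (auto simp: E_def)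
          next
            case False
            then show ?thesis using K(2)[of x y] Kk(2)[of y] y \<epsilon> \<kappa>(1)[of y] by simp
          qed
        qed simp
        also have "\<dots> = \<epsilon> * c x" unfolding c_def by (simp add: fint_mult)
        also have "\<dots> < \<epsilon> * (c x0 + 1)" using elim \<epsilon> by simp
        also have "\<dots> = e" using c0 by (simp add: \<epsilon>_def)
        finally show ?case using fint_diff[OF fib fk] by simp
      qed
    qed
    moreover have "((\<lambda>x. fint (rng x) k) \<longlongrightarrow> fint (rng x0) k) (at x0)"
      using continuous_fint_Cc(2)[OF k(1)] by (simp add: continuous_on_eq_continuous_at isCont_def)
    ultimately have "((\<lambda>x. (fint (rng x) (F x) - fint (rng x) k) + fint (rng x) k) \<longlongrightarrow> 0 + fint (rng x0) k) (at x0)"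
      by (rule tendsto_add)
    moreover have "fint (rng x0) k = fint (rng x0) (F x0)" using k(2) by (intro fint_cong) simp
    ultimately show ?thesis by simp
  qed
  then show ?thesis by (simp add: continuous_on_eq_continuous_at isCont_def)
qed

section \<open>Sigma-finiteness and the exchange of integrals\<close>

lemma sigma_finite_lam:
  assumes u: "u \<in> units G"
  shows "sigma_finite_measure (lam u)"
proof
  obtain B :: "'g set set" where B: "countable B" "topological_basis B"
    using ex_countable_basis by blast
  define A where "A = closure ` {U \<in> B. compact (closure U)}"
  have "\<Union>A = UNIV"
  proof (intro set_eqI iffI UNIV_I)
    fix x :: 'g
    have "compact {x}" by simp
    obtain W where W: "open W" "{x} \<subseteq> W" "compact (closure W)"
      using compact_open_superset[OF lc \<open>compact {x}\<close>] .
    obtain U where U: "U \<in> B" "x \<in> U" "U \<subseteq> W"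
      by (rule topological_basisE[OF B(2) W(1), of x]) (use W(2) in auto)
    have "closure W \<inter> closure U = closure U" using closure_mono[OF U(3)] by blast
    then have "compact (closure U)"
      using compact_Int_closed[OF W(3) closed_closure[of U]] by simp
    then show "x \<in> \<Union>A" using U closure_subset[of U] by (auto simp: A_def)
  qed
  moreover have "countable A" unfolding A_def using B(1) by (intro countable_image) auto
  moreover have "A \<subseteq> sets (lam u)" unfolding sets_lam[OF u] by (auto simp: A_def)
  moreover have "emeasure (lam u) a \<noteq> \<infinity>" if a: "a \<in> A" for a
  proof -
    have "compact a" using a by (auto simp: A_def)
    from emeasure_lam_compact[OF u this] show ?thesis by simp
  qed
  ultimately show "\<exists>A. countable A \<and> A \<subseteq> sets (lam u) \<and> \<Union> A = space (lam u) \<and> (\<forall>a\<in>A. emeasure (lam u) a \<noteq> \<infinity>)"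
    unfolding space_lam[OF u] by blast
qed

text \<open>Set to zero off the product of the fibres, the integrand is bounded and vanishes off
  \<open>K \<times> K\<close>, a set of finite measure. Second countability identifies the product
  of the Borel algebras with the Borel algebra of the product, which gives measurability.\<close>

lemma fint_Fubini:
  assumes u: "u \<in> units G"
    and P: "continuous_on (rfibre G u \<times> rfibre G u) (\<lambda>(y, z). P y z)"
    and K: "compact K" "\<And>y z. rng y = u \<Longrightarrow> rng z = u \<Longrightarrow> y \<notin> K \<or> z \<notin> K \<Longrightarrow> P y z = 0"
  shows "fint u (\<lambda>y. fint u (\<lambda>z. P y z)) = fint u (\<lambda>z. fint u (\<lambda>y. P y z))"
proof -
  interpret sigma_finite_measure "lam u" by (rule sigma_finite_lam[OF u])
  interpret pair_sigma_finite "lam u" "lam u" ..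
  define E where "E = rfibre G u"
  define Q where "Q p = indicat_real (E \<times> E) p *\<^sub>R (\<lambda>(y, z). P y z) p" for p
  have E: "closed (E \<times> E)" unfolding E_def by (intro closed_Times closed_rfibre)
  have sets2: "sets (lam u \<Otimes>\<^sub>M lam u) = sets borel"
    unfolding borel_prod[symmetric] by (intro sets_pair_measure_cong sets_lam u)
  have KK: "compact (K \<times> K)" by (intro compact_Times K(1))
  have "bounded ((\<lambda>(y, z). P y z) ` (K \<times> K \<inter> E \<times> E))"
  proof (intro compact_imp_bounded compact_continuous_image)
    show "continuous_on (K \<times> K \<inter> E \<times> E) (\<lambda>(y, z). P y z)"
      by (rule continuous_on_subset[OF P]) (simp add: E_def)
    show "compact (K \<times> K \<inter> E \<times> E)" by (rule compact_Int_closed[OF KK E])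
  qed
  then obtain C where "\<forall>q\<in>(\<lambda>(y, z). P y z) ` (K \<times> K \<inter> E \<times> E). cmod q \<le> C"
    unfolding bounded_iff by blast
  then have C: "cmod (case p of (y, z) \<Rightarrow> P y z) \<le> C" if "p \<in> K \<times> K \<inter> E \<times> E" for p
    using that by (simp only: ball_simps)
  have "integrable (lam u \<Otimes>\<^sub>M lam u) Q"
  proof (rule integrableI_bounded_set)
    show "K \<times> K \<in> sets (lam u \<Otimes>\<^sub>M lam u)" unfolding sets2 by (rule borel_compact[OF KK])
    have "Q \<in> borel_measurable borel"
      unfolding Q_def using E P by (intro borel_measurable_continuous_on_indicator) (auto simp: E_def)
    then show "Q \<in> borel_measurable (lam u \<Otimes>\<^sub>M lam u)"
      using measurable_cong_sets[OF sets2 refl] by blast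
    have "K \<in> sets (lam u)" using sets_lam[OF u] borel_compact[OF K(1)] by simp
    then have "emeasure (lam u \<Otimes>\<^sub>M lam u) (K \<times> K) = emeasure (lam u) K * emeasure (lam u) K"
      by (intro sigma_finite_measure.emeasure_pair_measure_Times[OF sigma_finite_lam[OF u]])
    then show "emeasure (lam u \<Otimes>\<^sub>M lam u) (K \<times> K) < \<infinity>"
      using emeasure_lam_compact[OF u K(1)] by (simp add: ennreal_mult_less_top)
    show "AE x\<in>K \<times> K in lam u \<Otimes>\<^sub>M lam u. norm (Q x) \<le> max 0 C"
      using C by (auto simp: Q_def indicator_def le_max_iff_disj)
    show "AE x in lam u \<Otimes>\<^sub>M lam u. x \<notin> K \<times> K \<longrightarrow> Q x = 0"
    proof (rule AE_I2, rule impI)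
      fix p assume "p \<notin> K \<times> K"
      then show "Q p = 0"
        using K(2)[of "fst p" "snd p"] by (cases p) (auto simp: Q_def indicator_def E_def rfibre_def)
    qed
  qed
  then have "(LINT z|lam u. LINT y|lam u. Q (y, z)) = (LINT y|lam u. LINT z|lam u. Q (y, z))"
    using Fubini_integral[of "\<lambda>y z. Q (y, z)"] by (simp add: case_prod_unfold)
  moreover have "(LINT z|lam u. Q (y, z)) = indicat_real E y *\<^sub>R fint u (\<lambda>z. P y z)" for y
    unfolding fint_def set_lebesgue_integral_def E_def[symmetric] integral_scaleR_right[symmetric]
    by (intro Bochner_Integration.integral_cong) (auto simp: Q_def indicator_def)
  moreover have "(LINT y|lam u. Q (y, z)) = indicat_real E z *\<^sub>R fint u (\<lambda>y. P y z)" for z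
    unfolding fint_def set_lebesgue_integral_def E_def[symmetric] integral_scaleR_right[symmetric]
    by (intro Bochner_Integration.integral_cong) (auto simp: Q_def indicator_def)
  ultimately show ?thesis
    unfolding fint_def[of u "\<lambda>y. fint u (\<lambda>z. P y z)"] fint_def[of u "\<lambda>z. fint u (\<lambda>y. P y z)"]
      set_lebesgue_integral_def E_def[symmetric] by simp
qed

section \<open>The convolution algebra\<close>

abbreviation cv :: "('g \<Rightarrow> complex) \<Rightarrow> ('g \<Rightarrow> complex) \<Rightarrow> 'g \<Rightarrow> complex" where "cv \<equiv> conv G lam"
abbreviation st :: "('g \<Rightarrow> complex) \<Rightarrow> 'g \<Rightarrow> complex" where "st \<equiv> star G"
abbreviation nrm :: "('g \<Rightarrow> complex) \<Rightarrow> real" where "nrm \<equiv> I_norm G lam"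

lemma cv_fint: "cv f g x = fint (rng x) (\<lambda>y. f y * g (iv y \<cdot> x))"
  by (simp add: conv_def fint_def)

lemma fint_zero [simp]: "fint u (\<lambda>_. 0) = 0"
  by (simp add: fint_def)

lemma compact_mul:
  assumes "compact A" "compact B"
  shows "compact ((\<lambda>(a, b). a \<cdot> b) ` {(a, b). a \<in> A \<and> b \<in> B \<and> src a = rng b})"
proof (rule compact_continuous_image)
  show "continuous_on {(a, b). a \<in> A \<and> b \<in> B \<and> src a = rng b} (\<lambda>(a, b). a \<cdot> b)"
    using lch unfolding lch_groupoid_def by (auto elim: continuous_on_subset)
  have "closed {p::'g \<times> 'g. src (fst p) = rng (snd p)}"
    by (intro closed_Collect_eq continuous_on_src continuous_on_rng continuous_on_fst continuous_on_snd continuous_on_id)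
  then have "compact (A \<times> B \<inter> {p. src (fst p) = rng (snd p)})"
    by (rule compact_Int_closed[OF compact_Times[OF assms]])
  then show "compact {(a, b). a \<in> A \<and> b \<in> B \<and> src a = rng b}"
    by (rule back_subst[of compact]) auto
qed

text \<open>If the product is nonzero then \<open>y \<in> A\<close> and
  \<open>iv y \<cdot> x \<in> B\<close>, hence \<open>x\<close> lies in the compact product of
  \<open>A\<close> and \<open>B\<close>. Confining both variables at once yields compact support of
  convolutions as well as the hypothesis of \<open>fint_Fubini\<close>.\<close>

lemma cv_support:
  assumes "compact A" "\<And>y. y \<notin> A \<Longrightarrow> f y = (0::complex)" "compact B" "\<And>y. y \<notin> B \<Longrightarrow> g y = (0::complex)"
  obtains K where "compact K" "\<forall>x y. rng x = rng y \<longrightarrow> x \<notin> K \<or> y \<notin> K \<longrightarrow> f y * g (iv y \<cdot> x) = 0"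
proof -
  define M where "M = (\<lambda>(a, b). a \<cdot> b) ` {(a, b). a \<in> A \<and> b \<in> B \<and> src a = rng b}"
  have "f y * g (iv y \<cdot> x) = 0" if "rng x = rng y" "x \<notin> A \<union> M \<or> y \<notin> A \<union> M" for x y
  proof (rule ccontr)
    assume "f y * g (iv y \<cdot> x) \<noteq> 0"
    then have "y \<in> A" "iv y \<cdot> x \<in> B" using assms(2)[of y] assms(4)[of "iv y \<cdot> x"] by auto
    then have "(y, iv y \<cdot> x) \<in> {(a, b). a \<in> A \<and> b \<in> B \<and> src a = rng b}"
      using that(1) by simp
    then have "(\<lambda>(a, b). a \<cdot> b) (y, iv y \<cdot> x) \<in> M" unfolding M_def by (rule imageI)
    then have "x \<in> M" using that(1) by simp
    then show False using that(2) \<open>y \<in> A\<close> by blast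
  qed
  then show ?thesis
    using compact_Un[OF assms(1) compact_mul[OF assms(1,3)]] by (intro that[of "A \<union> M"]) (auto simp: M_def)
qed

lemma continuous_on_cv_integrand:
  assumes "f \<in> Cc" "g \<in> Cc" "continuous_on S a" "continuous_on S b" "\<And>p. p \<in> S \<Longrightarrow> rng (a p) = rng (b p)"
  shows "continuous_on S (\<lambda>p. f (b p) * g (iv (b p) \<cdot> a p))"
proof -
  have "continuous_on S (\<lambda>p. iv (b p) \<cdot> a p)"
    using assms(5) by (intro continuous_on_mul continuous_on_iv assms) simp
  then show ?thesis
    by (intro continuous_on_mult continuous_on_compose2[OF Cc_continuous[OF assms(1)] assms(4)]
        continuous_on_compose2[OF Cc_continuous[OF assms(2)]]) auto
qed

lemma fibre_Cc_cv:
  assumes "f \<in> Cc" "g \<in> Cc" "u = rng x"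
  shows "fibre_Cc u (\<lambda>y. f y * g (iv y \<cdot> x))"
proof -
  obtain A where A: "compact A" "\<And>y. y \<notin> A \<Longrightarrow> f y = 0" using assms(1) by (rule CcE) blast
  show ?thesis
  proof (rule fibre_CcI[OF _ A(1)])
    show "continuous_on (rfibre G u) (\<lambda>y. f y * g (iv y \<cdot> x))"
      using assms(3) by (intro continuous_on_cv_integrand[OF assms(1,2)]) (auto simp: rfibre_def)
  qed (simp add: A(2))
qed

lemma fibre_Cc_translate:
  assumes g: "g \<in> Cc" and z: "rng z = u"
  shows "fibre_Cc u (\<lambda>y. g (iv z \<cdot> y))"
proof -
  obtain B where B: "compact B" "\<And>y. y \<notin> B \<Longrightarrow> g y = 0" using g by (rule CcE) blast
  show ?thesis
  proof (rule fibre_CcI)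
    have "continuous_on (rfibre G u) (\<lambda>y. iv z \<cdot> y)"
      using z by (intro continuous_on_mul continuous_on_const continuous_on_id) (simp add: rfibre_def)
    then show "continuous_on (rfibre G u) (\<lambda>y. g (iv z \<cdot> y))"
      by (rule continuous_on_compose2[OF Cc_continuous[OF g]]) simp
    show "compact ((\<lambda>(a, b). a \<cdot> b) ` {(a, b). a \<in> {z} \<and> b \<in> B \<and> src a = rng b})"
      by (rule compact_mul) (auto simp: B(1))
    fix y assume y: "rng y = u" "y \<notin> (\<lambda>(a, b). a \<cdot> b) ` {(a, b). a \<in> {z} \<and> b \<in> B \<and> src a = rng b}"
    have "iv z \<cdot> y \<notin> B"
    proof
      assume "iv z \<cdot> y \<in> B"
      then have "(z, iv z \<cdot> y) \<in> {(a, b). a \<in> {z} \<and> b \<in> B \<and> src a = rng b}"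
        using y(1) z by simp
      then have "(\<lambda>(a, b). a \<cdot> b) (z, iv z \<cdot> y) \<in> (\<lambda>(a, b). a \<cdot> b) ` {(a, b). a \<in> {z} \<and> b \<in> B \<and> src a = rng b}"
        by (rule imageI)
      then show False using y z by simp
    qed
    then show "g (iv z \<cdot> y) = 0" by (rule B(2))
  qed
qed

lemma cv_Cc:
  assumes "f \<in> Cc" "g \<in> Cc"
  shows "cv f g \<in> Cc"
proof -
  obtain A where A: "compact A" "\<And>y. y \<notin> A \<Longrightarrow> f y = 0" using assms(1) by (rule CcE) blast
  obtain B where B: "compact B" "\<And>y. y \<notin> B \<Longrightarrow> g y = 0" using assms(2) by (rule CcE) blast
  obtain K where K: "compact K" "\<forall>x y. rng x = rng y \<longrightarrow> x \<notin> K \<or> y \<notin> K \<longrightarrow> f y * g (iv y \<cdot> x) = 0"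
    by (rule cv_support[OF A B])
  show ?thesis
  proof (rule CcI[OF _ K(1)])
    have "continuous_on {(x, y). rng x = rng y} (\<lambda>p. f (snd p) * g (iv (snd p) \<cdot> fst p))"
      by (rule continuous_on_cv_integrand[OF assms]) (auto intro: continuous_intros)
    then have "continuous_on UNIV (\<lambda>x. fint (rng x) (\<lambda>y. f y * g (iv y \<cdot> x)))"
      using K by (intro continuous_fint[of "\<lambda>x y. f y * g (iv y \<cdot> x)" K]) (auto simp: case_prod_unfold)
    then show "continuous_on UNIV (cv f g)" by (simp add: cv_fint[abs_def])
    show "cv f g x = 0" if "x \<notin> K" for x
    proof -
      have "cv f g x = fint (rng x) (\<lambda>y. 0)"
        unfolding cv_fint by (rule fint_cong) (use K(2) that in auto)
      then show ?thesis by simp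
    qed
  qed
qed

lemma Cc_iv:
  assumes "f \<in> Cc"
  shows "(\<lambda>x. f (iv x)) \<in> Cc"
proof -
  obtain A where A: "compact A" "\<And>y. y \<notin> A \<Longrightarrow> f y = 0" using assms(1) by (rule CcE) blast
  have "compact (iv ` A)"
    by (intro compact_continuous_image continuous_on_iv continuous_on_id A(1))
  then show ?thesis
  proof (rule CcI[rotated])
    show "continuous_on UNIV (\<lambda>x. f (iv x))"
      by (rule continuous_on_compose2[OF Cc_continuous[OF assms] continuous_on_iv[OF continuous_on_id]]) simp
    show "f (iv x) = 0" if "x \<notin> iv ` A" for x
    proof (rule A(2), rule notI)
      assume "iv x \<in> A"
      then have "iv (iv x) \<in> iv ` A" by (rule imageI)
      then show False using that by simp
    qed
  qed
qed

lemma st_Cc: "f \<in> Cc \<Longrightarrow> st f \<in> Cc"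
proof -
  assume f: "f \<in> Cc"
  obtain A where A: "continuous_on UNIV (\<lambda>x. f (iv x))" "compact A" "\<And>x. x \<notin> A \<Longrightarrow> f (iv x) = 0"
    using Cc_iv[OF f] by (rule CcE) blast
  show "st f \<in> Cc"
    unfolding star_def[abs_def] using A by (intro CcI[OF _ A(2)] continuous_on_cnj) auto
qed

lemma st_st [simp]: "st (st f) = f"
  by (rule ext) (simp add: star_def)

text \<open>Left invariance with \<open>x \<cdot> y\<close> substituted for \<open>y\<close>, which
  moves the integral from the fibre over \<open>rng x\<close> to the one over
  \<open>rng (iv x)\<close>.\<close>

lemma st_cv:
  assumes "f \<in> Cc" "g \<in> Cc"
  shows "st (cv f g) = cv (st g) (st f)"
proof
  fix x
  have "fibre_Cc (rng x) (\<lambda>y. st g y * st f (iv y \<cdot> x))"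
    by (rule fibre_Cc_cv[OF st_Cc[OF assms(2)] st_Cc[OF assms(1)] refl])
  from fint_left_mult[OF this]
  have "cv (st g) (st f) x = fint (src x) (\<lambda>y. st g (x \<cdot> y) * st f (iv (x \<cdot> y) \<cdot> x))"
    by (simp add: cv_fint)
  also have "\<dots> = fint (src x) (\<lambda>y. cnj (f y * g (iv y \<cdot> iv x)))"
  proof (rule fint_cong)
    fix y assume y: "rng y = src x"
    then have "iv (x \<cdot> y) \<cdot> x = iv y" using mul_assoc[of "iv y" "iv x" x] mul_units(2)[of "iv y"] by (simp add: iv_mul)
    then show "st g (x \<cdot> y) * st f (iv (x \<cdot> y) \<cdot> x) = cnj (f y * g (iv y \<cdot> iv x))"
      using y by (simp add: star_def iv_mul)
  qed
  also have "\<dots> = st (cv f g) x" by (simp only: star_def cv_fint fint_cnj src_rng)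
  finally show "st (cv f g) x = cv (st g) (st f) x" ..
qed

text \<open>The integrals are exchanged first: for fixed \<open>z\<close> the integral over
  \<open>y\<close> can then be translated by \<open>z\<close>, which turns it into the convolution
  of \<open>g\<close> and \<open>h\<close>.\<close>

lemma cv_assoc:
  assumes f: "f \<in> Cc" and g: "g \<in> Cc" and h: "h \<in> Cc"
  shows "cv (cv f g) h = cv f (cv g h)"
proof
  fix x
  define u where "u = rng x"
  have u: "u \<in> units G" by (simp add: u_def)
  obtain A where A: "compact A" "\<And>y. y \<notin> A \<Longrightarrow> f y = 0" using f by (rule CcE) blast
  obtain B where B: "compact B" "\<And>y. y \<notin> B \<Longrightarrow> g y = 0" using g by (rule CcE) blast
  obtain K where K: "compact K" "\<forall>x y. rng x = rng y \<longrightarrow> x \<notin> K \<or> y \<notin> K \<longrightarrow> f y * g (iv y \<cdot> x) = 0"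
    by (rule cv_support[OF A B])
  define P where "P y z = f z * g (iv z \<cdot> y) * h (iv y \<cdot> x)" for y z
  have Pcont: "continuous_on (rfibre G u \<times> rfibre G u) (\<lambda>(y, z). P y z)"
  proof -
    have "continuous_on (rfibre G u \<times> rfibre G u) (\<lambda>p. f (snd p) * g (iv (snd p) \<cdot> fst p))"
      by (rule continuous_on_cv_integrand[OF f g]) (auto simp: rfibre_def intro: continuous_intros)
    moreover have "continuous_on (rfibre G u \<times> rfibre G u) (\<lambda>p. iv (fst p) \<cdot> x)"
      by (intro continuous_on_mul continuous_on_iv continuous_on_fst continuous_on_id continuous_on_const)
        (auto simp: rfibre_def u_def)
    then have "continuous_on (rfibre G u \<times> rfibre G u) (\<lambda>p. h (iv (fst p) \<cdot> x))"
      by (rule continuous_on_compose2[OF Cc_continuous[OF h]]) simp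
    ultimately show ?thesis unfolding P_def case_prod_unfold by (rule continuous_on_mult)
  qed
  have "cv (cv f g) h x = fint u (\<lambda>y. fint u (\<lambda>z. P y z))"
    unfolding cv_fint[of "cv f g"] u_def[symmetric]
  proof (rule fint_cong)
    fix y assume y: "rng y = u"
    have "cv f g y * h (iv y \<cdot> x) = h (iv y \<cdot> x) * fint u (\<lambda>z. f z * g (iv z \<cdot> y))"
      by (simp add: cv_fint y)
    also have "\<dots> = fint u (\<lambda>z. P y z)"
      unfolding fint_mult[symmetric] by (simp add: P_def mult_ac)
    finally show "cv f g y * h (iv y \<cdot> x) = fint u (\<lambda>z. P y z)" .
  qed
  also have "\<dots> = fint u (\<lambda>z. fint u (\<lambda>y. P y z))"
    by (rule fint_Fubini[OF u Pcont K(1)]) (use K(2) in \<open>auto simp: P_def\<close>)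
  also have "\<dots> = fint u (\<lambda>z. f z * cv g h (iv z \<cdot> x))"
  proof (rule fint_cong)
    fix z assume z: "rng z = u"
    define k where "k y = g (iv z \<cdot> y) * h (iv y \<cdot> x)" for y
    have "continuous_on (rfibre G u) (\<lambda>y. iv y \<cdot> x)"
      by (intro continuous_on_mul continuous_on_iv continuous_on_id continuous_on_const) (simp add: rfibre_def u_def)
    then have "continuous_on (rfibre G u) (\<lambda>y. h (iv y \<cdot> x))"
      by (rule continuous_on_compose2[OF Cc_continuous[OF h]]) simp
    from fibre_Cc_mult[OF fibre_Cc_translate[OF g z] this]
    have "fibre_Cc u k" by (simp add: k_def[abs_def] mult.commute)
    then have "fint u k = fint (src z) (\<lambda>w. k (z \<cdot> w))" using fint_left_mult[of z k] z by simp
    also have "\<dots> = cv g h (iv z \<cdot> x)"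
    proof -
      have "rng (iv z \<cdot> x) = src z" using z by (simp add: u_def)
      moreover have "fint (src z) (\<lambda>w. k (z \<cdot> w)) = fint (src z) (\<lambda>w. g w * h (iv w \<cdot> (iv z \<cdot> x)))"
      proof (rule fint_cong)
        fix w assume w: "rng w = src z"
        have "(iv w \<cdot> iv z) \<cdot> x = iv w \<cdot> (iv z \<cdot> x)" using w z by (intro mul_assoc) (auto simp: u_def)
        then show "k (z \<cdot> w) = g w * h (iv w \<cdot> (iv z \<cdot> x))" using w by (simp add: k_def iv_mul)
      qed
      ultimately show ?thesis by (simp add: cv_fint)
    qed
    finally have "fint u k = cv g h (iv z \<cdot> x)" .
    moreover have "fint u (\<lambda>y. P y z) = fint u (\<lambda>y. f z * k y)"
      by (simp add: P_def k_def mult_ac)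
    ultimately show "fint u (\<lambda>y. P y z) = f z * cv g h (iv z \<cdot> x)"
      by (simp add: fint_mult)
  qed
  also have "\<dots> = cv f (cv g h) x" by (simp add: cv_fint[of f] u_def)
  finally show "cv (cv f g) h x = cv f (cv g h) x" .
qed

lemma cv_add_left:
  assumes "f \<in> Cc" "g \<in> Cc" "h \<in> Cc"
  shows "cv (\<lambda>x. f x + g x) h = (\<lambda>x. cv f h x + cv g h x)"
  by (rule ext) (simp add: cv_fint fint_add[symmetric] fibre_Cc_cv assms distrib_right)

lemma cv_diff_left:
  assumes "f \<in> Cc" "g \<in> Cc" "h \<in> Cc"
  shows "cv (\<lambda>x. f x - g x) h = (\<lambda>x. cv f h x - cv g h x)"
  by (rule ext) (simp add: cv_fint fint_diff[symmetric] fibre_Cc_cv assms left_diff_distrib)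

lemma cv_diff_right:
  assumes "f \<in> Cc" "g \<in> Cc" "h \<in> Cc"
  shows "cv h (\<lambda>x. f x - g x) = (\<lambda>x. cv h f x - cv h g x)"
  by (rule ext) (simp add: cv_fint fint_diff[symmetric] fibre_Cc_cv assms right_diff_distrib)

lemma cv_scale_left: "cv (\<lambda>x. c * f x) h = (\<lambda>x. c * cv f h x)"
  by (rule ext) (simp add: cv_fint fint_mult[symmetric] mult_ac)

subsection \<open>The I-norm\<close>

definition fibre_norm :: "('g \<Rightarrow> complex) \<Rightarrow> 'g \<Rightarrow> real" where
  "fibre_norm f u = (LINT y|lam u. cmod (f y))"

lemma nrm_eq: "nrm f = max (SUP u\<in>units G. fibre_norm f u) (SUP u\<in>units G. fibre_norm (\<lambda>x. f (iv x)) u)"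
  by (simp add: I_norm_def fibre_norm_def)

lemma fibre_norm_fint:
  assumes "f \<in> Cc" "u \<in> units G"
  shows "fibre_norm f u = Re (fint u (\<lambda>y. complex_of_real (cmod (f y))))"
proof -
  have "fint u (\<lambda>y. complex_of_real (cmod (f y))) = (LINT y|lam u. complex_of_real (cmod (f y)))"
    by (rule fint_Cc[OF Cc_norm[OF assms(1)] assms(2)])
  also have "\<dots> = complex_of_real (fibre_norm f u)"
    unfolding fibre_norm_def by (rule integral_complex_of_real)
  finally show ?thesis by simp
qed

lemma fibre_norm_nonneg: "0 \<le> fibre_norm f u"
  unfolding fibre_norm_def by (rule Bochner_Integration.integral_nonneg) simp

lemma fibre_norm_le:
  assumes "f \<in> Cc" "g \<in> Cc" "u \<in> units G" "0 \<le> C" "\<And>x. cmod (f x) \<le> C * cmod (g x)"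
  shows "fibre_norm f u \<le> C * fibre_norm g u"
proof -
  have "fibre_norm f u \<le> (LINT y|lam u. C * cmod (g y))"
    unfolding fibre_norm_def
    using integrable_Cc[OF assms(1,3)] integrable_Cc[OF assms(2,3)] assms(5)
    by (intro integral_mono integrable_norm integrable_mult_right) auto
  then show ?thesis by (simp add: fibre_norm_def)
qed

lemma fibre_norm_triangle:
  assumes "f \<in> Cc" "g \<in> Cc" "u \<in> units G"
  shows "fibre_norm (\<lambda>x. f x + g x) u \<le> fibre_norm f u + fibre_norm g u"
proof -
  have "fibre_norm (\<lambda>x. f x + g x) u \<le> (LINT y|lam u. cmod (f y) + cmod (g y))"
    unfolding fibre_norm_def
    using integrable_Cc[OF assms(1,3)] integrable_Cc[OF assms(2,3)]
    by (intro integral_mono integrable_norm Bochner_Integration.integrable_add norm_triangle_ineq)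
  also have "\<dots> = fibre_norm f u + fibre_norm g u"
    unfolding fibre_norm_def
    using integrable_Cc[OF assms(1,3)] integrable_Cc[OF assms(2,3)]
    by (intro Bochner_Integration.integral_add integrable_norm)
  finally show ?thesis .
qed

text \<open>A supremum of reals is meaningful only for a bounded set. Composed with the range map,
  the fibre norm is continuous and therefore bounded on the support; over units outside the image of
  the support it is zero.\<close>

lemma bdd_above_fibre_norm:
  assumes "f \<in> Cc"
  shows "bdd_above (fibre_norm f ` units G)"
proof -
  obtain K where K: "compact K" "\<And>x. x \<notin> K \<Longrightarrow> f x = 0" using assms(1) by (rule CcE) blast
  define h where "h x = Re (fint (rng x) (\<lambda>y. complex_of_real (cmod (f y))))" for x
  have "continuous_on UNIV h"
    unfolding h_def by (intro continuous_on_Re continuous_fint_Cc(2) Cc_norm assms)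
  then have "compact (h ` K)"
    by (intro compact_continuous_image K(1)) (auto intro: continuous_on_subset)
  then obtain B where B: "\<forall>y\<in>h ` K. norm y \<le> B"
    using compact_imp_bounded[of "h ` K"] unfolding bounded_iff by blast
  have "fibre_norm f u \<le> max 0 B" if u: "u \<in> units G" for u
  proof (cases "\<exists>x\<in>K. rng x = u")
    case True
    then obtain x where "x \<in> K" "rng x = u" by blast
    then have "h x = fibre_norm f u" unfolding h_def using fibre_norm_fint[OF assms u] by simp
    moreover have "norm (h x) \<le> B" using B \<open>x \<in> K\<close> by blast
    ultimately show ?thesis by simp
  next
    case False
    then have "fint u (\<lambda>y. complex_of_real (cmod (f y))) = fint u (\<lambda>y. 0)"
      using K(2) by (intro fint_cong) auto
    then show ?thesis using fibre_norm_fint[OF assms u] by simp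
  qed
  then show ?thesis by (intro bdd_aboveI2)
qed

lemma units_nonempty: "units G \<noteq> {}"
  using src_units by blast

lemma fibre_norm_le_nrm:
  assumes "f \<in> Cc" "u \<in> units G"
  shows "fibre_norm f u \<le> nrm f" "fibre_norm (\<lambda>x. f (iv x)) u \<le> nrm f"
  using cSUP_upper[OF assms(2) bdd_above_fibre_norm[OF assms(1)]]
    cSUP_upper[OF assms(2) bdd_above_fibre_norm[OF Cc_iv[OF assms(1)]]]
  unfolding nrm_eq by simp_all

lemma nrm_leI:
  assumes "\<And>u. u \<in> units G \<Longrightarrow> fibre_norm f u \<le> B" "\<And>u. u \<in> units G \<Longrightarrow> fibre_norm (\<lambda>x. f (iv x)) u \<le> B"
  shows "nrm f \<le> B"
  unfolding nrm_eq using assms by (auto intro!: cSUP_least units_nonempty)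

lemma nrm_nonneg: "f \<in> Cc \<Longrightarrow> 0 \<le> nrm f"
  using order_trans[OF fibre_norm_nonneg fibre_norm_le_nrm(1)[OF _ src_units]] .

lemma nrm_le:
  assumes "f \<in> Cc" "g \<in> Cc" "0 \<le> C" "\<And>x. cmod (f x) \<le> C * cmod (g x)"
  shows "nrm f \<le> C * nrm g"
proof (rule nrm_leI)
  fix u assume u: "u \<in> units G"
  show "fibre_norm f u \<le> C * nrm g"
    by (rule order_trans[OF fibre_norm_le[OF assms(1,2) u assms(3,4)]])
      (intro mult_left_mono fibre_norm_le_nrm assms u)
  show "fibre_norm (\<lambda>x. f (iv x)) u \<le> C * nrm g"
    by (rule order_trans[OF fibre_norm_le[OF Cc_iv[OF assms(1)] Cc_iv[OF assms(2)] u assms(3,4)]])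
      (intro mult_left_mono fibre_norm_le_nrm assms u)
qed

lemma nrm_triangle:
  assumes "f \<in> Cc" "g \<in> Cc"
  shows "nrm (\<lambda>x. f x + g x) \<le> nrm f + nrm g"
proof (rule nrm_leI)
  fix u assume u: "u \<in> units G"
  show "fibre_norm (\<lambda>x. f x + g x) u \<le> nrm f + nrm g"
    by (rule order_trans[OF fibre_norm_triangle[OF assms u]]) (intro add_mono fibre_norm_le_nrm assms u)
  show "fibre_norm (\<lambda>x. f (iv x) + g (iv x)) u \<le> nrm f + nrm g"
    by (rule order_trans[OF fibre_norm_triangle[OF Cc_iv[OF assms(1)] Cc_iv[OF assms(2)] u]])
      (intro add_mono fibre_norm_le_nrm assms u)
qed

lemma nrm_st: "nrm (st f) = nrm f"
  unfolding nrm_eq by (simp add: star_def fibre_norm_def max.commute)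

text \<open>After passing to absolute values and exchanging integrals, the inner integral of
  \<open>|g|\<close> is translated from the fibre over \<open>rng y\<close> to the one over
  \<open>src y\<close>, where it is at most \<open>nrm g\<close> whatever \<open>y\<close>
  is.\<close>

lemma fibre_norm_cv:
  assumes f: "f \<in> Cc" and g: "g \<in> Cc" and u: "u \<in> units G"
  shows "fibre_norm (cv f g) u \<le> nrm f * nrm g"
proof -
  define a where "a x = complex_of_real (cmod (f x))" for x
  define b where "b x = complex_of_real (cmod (g x))" for x
  have ab: "a \<in> Cc" "b \<in> Cc" unfolding a_def b_def by (intro Cc_norm f g)+
  obtain A where A: "compact A" "\<And>y. y \<notin> A \<Longrightarrow> a y = 0" using ab(1) by (rule CcE) blast
  obtain B where B: "compact B" "\<And>y. y \<notin> B \<Longrightarrow> b y = 0" using ab(2) by (rule CcE) blast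
  obtain K where K: "compact K" "\<forall>x y. rng x = rng y \<longrightarrow> x \<notin> K \<or> y \<notin> K \<longrightarrow> a y * b (iv y \<cdot> x) = 0"
    by (rule cv_support[OF A B])
  have le: "cmod (cv f g x) \<le> Re (cv a b x)" for x
  proof -
    have "cmod (cv f g x) \<le> Re (fint (rng x) (\<lambda>y. complex_of_real (cmod (f y) * cmod (g (iv y \<cdot> x)))))"
      unfolding cv_fint using fibre_Cc_cv[OF ab refl, of x]
      by (intro cmod_fint_le fibre_Cc_cv f g) (simp_all add: a_def b_def norm_mult)
    then show ?thesis by (simp add: cv_fint a_def b_def)
  qed
  have "fibre_norm (cv f g) u \<le> (LINT x|lam u. Re (cv a b x))"
    unfolding fibre_norm_def
    using integrable_Cc[OF cv_Cc[OF f g] u] integrable_Cc[OF cv_Cc[OF ab] u] le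
    by (intro integral_mono integrable_norm integrable_Re) auto
  also have "\<dots> = Re (fint u (cv a b))"
    unfolding fint_Cc[OF cv_Cc[OF ab] u] by (rule integral_Re[OF integrable_Cc[OF cv_Cc[OF ab] u]])
  also have "fint u (cv a b) = fint u (\<lambda>x. fint u (\<lambda>y. a y * b (iv y \<cdot> x)))"
    by (rule fint_cong) (simp add: cv_fint)
  also have "\<dots> = fint u (\<lambda>y. fint u (\<lambda>x. a y * b (iv y \<cdot> x)))"
  proof (rule fint_Fubini[OF u _ K(1)])
    show "continuous_on (rfibre G u \<times> rfibre G u) (\<lambda>(x, y). a y * b (iv y \<cdot> x))"
      unfolding case_prod_unfold
      by (rule continuous_on_cv_integrand[OF ab]) (auto simp: rfibre_def intro: continuous_intros)
  qed (use K(2) in auto)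
  also have "\<dots> = fint u (\<lambda>y. fint (src y) b * a y)"
  proof (rule fint_cong)
    fix y assume y: "rng y = u"
    have "fibre_Cc u (\<lambda>x. b (iv y \<cdot> x))" by (rule fibre_Cc_translate[OF ab(2) y])
    then have "fint u (\<lambda>x. b (iv y \<cdot> x)) = fint (src y) (\<lambda>w. b (iv y \<cdot> (y \<cdot> w)))"
      using fint_left_mult[of y "\<lambda>x. b (iv y \<cdot> x)"] y by simp
    also have "\<dots> = fint (src y) b" by (rule fint_cong) simp
    finally show "fint u (\<lambda>x. a y * b (iv y \<cdot> x)) = fint (src y) b * a y"
      by (simp add: fint_mult)
  qed
  also have "Re \<dots> \<le> cmod \<dots>" by (rule complex_Re_le_cmod)
  also have "\<dots> \<le> Re (fint u (\<lambda>y. complex_of_real (nrm g * cmod (f y))))"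
  proof (rule cmod_fint_le[OF _ _ u])
    have "continuous_on UNIV (\<lambda>y. fint (src y) b)"
      by (rule continuous_on_units_comp(2)[OF continuous_fint_Cc(1)[OF ab(2)]])
    then show "fibre_Cc u (\<lambda>y. fint (src y) b * a y)"
      by (intro fibre_Cc_of_Cc Cc_mult ab)
    show "fibre_Cc u (\<lambda>y. complex_of_real (nrm g * cmod (f y)))"
      using fibre_Cc_of_Cc[OF Cc_scale[OF ab(1), of "complex_of_real (nrm g)"]] by (simp add: a_def)
    fix y
    have r: "fint (src y) b = complex_of_real (fibre_norm g (src y))"
      unfolding b_def fibre_norm_def fint_Cc[OF Cc_norm[OF g] src_units]
      by (rule integral_complex_of_real)
    show "cmod (fint (src y) b * a y) \<le> nrm g * cmod (f y)"
      unfolding norm_mult r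
      using fibre_norm_le_nrm(1)[OF g, of "src y"] fibre_norm_nonneg[of g "src y"]
      by (auto simp: a_def intro!: mult_right_mono)
  qed
  also have "\<dots> = nrm g * fibre_norm f u"
    by (simp add: fibre_norm_fint[OF f u] fint_mult)
  also have "\<dots> \<le> nrm g * nrm f"
    by (intro mult_left_mono fibre_norm_le_nrm f u nrm_nonneg g)
  finally show ?thesis by (simp add: mult.commute)
qed

text \<open>The supremum over inverted functions is reduced to the previous bound by the involution,
  which reverses the factors and preserves the norm.\<close>

lemma nrm_cv:
  assumes "f \<in> Cc" "g \<in> Cc"
  shows "nrm (cv f g) \<le> nrm f * nrm g"
proof (rule nrm_leI)
  fix u assume u: "u \<in> units G"
  show "fibre_norm (cv f g) u \<le> nrm f * nrm g" by (rule fibre_norm_cv[OF assms u])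
  have "fibre_norm (\<lambda>x. cv f g (iv x)) u = fibre_norm (st (cv f g)) u"
    by (simp add: fibre_norm_def star_def)
  also have "\<dots> \<le> nrm (st g) * nrm (st f)"
    unfolding st_cv[OF assms] by (intro fibre_norm_cv st_Cc assms u)
  finally show "fibre_norm (\<lambda>x. cv f g (iv x)) u \<le> nrm f * nrm g"
    by (simp add: nrm_st mult.commute)
qed

end

section \<open>Groupoid Hilbert bundles and positivity\<close>

lemma sum_cinner_cinner_nonneg_finite:
  fixes b :: "'i \<Rightarrow> 'h::chilbert_space" and x :: "'i \<Rightarrow> 'k::chilbert_space"
  assumes "finite A"
  shows "0 \<le> Re (\<Sum>m\<in>A. \<Sum>n\<in>A. cinner (b n) (b m) * cinner (x m) (x n))"
proof -
  obtain f where f: "bij_betw f {..<card A} A"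
    using ex_bij_betw_nat_finite[OF assms] by (auto simp: atLeast0LessThan)
  have "(\<Sum>m\<in>A. \<Sum>n\<in>A. cinner (b n) (b m) * cinner (x m) (x n))
      = (\<Sum>m<card A. \<Sum>n<card A. cinner (b (f n)) (b (f m)) * cinner (x (f m)) (x (f n)))"
    by (simp add: sum.reindex_bij_betw[OF f, symmetric])
  then show ?thesis
    using sum_cinner_cinner_nonneg[where N = "card A" and b = "\<lambda>n. b (f n)" and x = "\<lambda>n. x (f n)"] by simp
qed

context haar_groupoid
begin

section \<open>Elementary laws of representations\<close>

lemma
  assumes "\<sigma> \<in> reps G lam"
  shows rep_bounded_clinear: "f \<in> Cc \<Longrightarrow> bounded_clinear (\<sigma> f)"
    and rep_add: "f \<in> Cc \<Longrightarrow> g \<in> Cc \<Longrightarrow> \<sigma> (\<lambda>x. f x + g x) v = \<sigma> f v + \<sigma> g v"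
    and rep_scale: "f \<in> Cc \<Longrightarrow> \<sigma> (\<lambda>x. c * f x) v = c *\<^sub>C \<sigma> f v"
    and rep_cv: "f \<in> Cc \<Longrightarrow> g \<in> Cc \<Longrightarrow> \<sigma> (cv f g) v = \<sigma> f (\<sigma> g v)"
    and rep_st: "f \<in> Cc \<Longrightarrow> cinner (\<sigma> (st f) v) w = cinner v (\<sigma> f w)"
    and rep_onorm: "f \<in> Cc \<Longrightarrow> onorm (\<sigma> f) \<le> nrm f"
  using assms unfolding reps_def by (auto simp: fun_eq_iff)

lemma rep_norm_le:
  assumes "\<sigma> \<in> reps G lam" "f \<in> Cc"
  shows "norm (\<sigma> f v) \<le> nrm f * norm v"
proof -
  have "norm (\<sigma> f v) \<le> onorm (\<sigma> f) * norm v"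
    using rep_bounded_clinear[OF assms] unfolding bounded_clinear_def by (intro onorm) simp
  also have "\<dots> \<le> nrm f * norm v" by (intro mult_right_mono rep_onorm assms) simp
  finally show ?thesis .
qed

lemma
  assumes "\<sigma> \<in> reps G lam" "f \<in> Cc"
  shows rep_vadd: "\<sigma> f (v + w) = \<sigma> f v + \<sigma> f w"
    and rep_vdiff: "\<sigma> f (v - w) = \<sigma> f v - \<sigma> f w"
    and rep_vscale: "\<sigma> f (c *\<^sub>C v) = c *\<^sub>C \<sigma> f v"
    and rep_vsum: "\<sigma> f (\<Sum>i\<in>A. h i) = (\<Sum>i\<in>A. \<sigma> f (h i))"
proof -
  have bl: "bounded_linear (\<sigma> f)" using rep_bounded_clinear[OF assms] by (simp add: bounded_clinear_def)
  show "\<sigma> f (v + w) = \<sigma> f v + \<sigma> f w" "\<sigma> f (v - w) = \<sigma> f v - \<sigma> f w" "\<sigma> f (\<Sum>i\<in>A. h i) = (\<Sum>i\<in>A. \<sigma> f (h i))"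
    using bl by (simp_all add: linear_simps bounded_linear.linear linear_sum)
  show "\<sigma> f (c *\<^sub>C v) = c *\<^sub>C \<sigma> f v"
    using rep_bounded_clinear[OF assms] by (simp add: bounded_clinear_def)
qed

lemma rep_zero: "\<sigma> \<in> reps G lam \<Longrightarrow> \<sigma> (\<lambda>_. 0) v = 0"
  using rep_scale[of \<sigma> "\<lambda>_. 0" 0 v] by (simp add: Cc_zero)

lemma rep_diff:
  assumes "\<sigma> \<in> reps G lam" "f \<in> Cc" "g \<in> Cc"
  shows "\<sigma> (\<lambda>x. f x - g x) v = \<sigma> f v - \<sigma> g v"
  using rep_add[OF assms(1,2) Cc_scale[OF assms(3), of "-1"], of v] rep_scale[OF assms(1,3), of "-1" v]
  by (simp add: scaleC_minus_one)

lemma rep_sum: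
  assumes "\<sigma> \<in> reps G lam" "\<And>i. i \<in> A \<Longrightarrow> f i \<in> Cc"
  shows "\<sigma> (\<lambda>x. \<Sum>i\<in>A. f i x) v = (\<Sum>i\<in>A. \<sigma> (f i) v)"
  using assms(2)
  by (induction A rule: infinite_finite_induct)
    (simp_all add: rep_zero[OF assms(1)] rep_add[OF assms(1)] Cc_sum)

lemma rep_st': "\<sigma> \<in> reps G lam \<Longrightarrow> f \<in> Cc \<Longrightarrow> cinner v (\<sigma> (st f) w) = cinner (\<sigma> f v) w"
  using rep_st[of \<sigma> f w v] cinner_commute by metis

end

locale coefficient_bundle = haar_groupoid G lam
  for G :: "'g::{second_countable_topology, t2_space} groupoid" and lam +
  fixes H :: "'g \<Rightarrow> 'h::chilbert_space set" and \<Gamma> :: "('g \<Rightarrow> 'h) set" and L :: "'g \<Rightarrow> 'h \<Rightarrow> 'h"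
  assumes G_bundle: "G_hilbert_bundle G H \<Gamma> L"
begin

section \<open>The sections and the isometries of the bundle\<close>

abbreviation \<Gamma>b :: "('g \<Rightarrow> 'h) set" where "\<Gamma>b \<equiv> bounded_sections (units G) \<Gamma>"

lemma hilbert: "hilbert_bundle (units G) H \<Gamma>"
  using G_bundle by (simp add: G_hilbert_bundle_def)

lemma
  shows H_csubspace: "u \<in> units G \<Longrightarrow> csubspace (H u)"
    and section_in: "a \<in> \<Gamma> \<Longrightarrow> u \<in> units G \<Longrightarrow> a u \<in> H u"
    and section_zero: "(\<lambda>_. 0) \<in> \<Gamma>"
    and section_add: "a \<in> \<Gamma> \<Longrightarrow> b \<in> \<Gamma> \<Longrightarrow> (\<lambda>u. a u + b u) \<in> \<Gamma>"
    and section_scaleC: "a \<in> \<Gamma> \<Longrightarrow> (\<lambda>u. c *\<^sub>C a u) \<in> \<Gamma>"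
    and sections_dense: "u \<in> units G \<Longrightarrow> H u \<subseteq> closure ((\<lambda>a. a u) ` \<Gamma>)"
    and section_norm_continuous: "a \<in> \<Gamma> \<Longrightarrow> continuous_on (units G) (\<lambda>u. norm (a u))"
  using hilbert[unfolded hilbert_bundle_def, THEN conjunct1] hilbert[unfolded hilbert_bundle_def, THEN conjunct2, THEN conjunct1]
    hilbert[unfolded hilbert_bundle_def, THEN conjunct2, THEN conjunct2, THEN conjunct1] hilbert[unfolded hilbert_bundle_def, THEN conjunct2, THEN conjunct2, THEN conjunct2, THEN conjunct1]
    hilbert[unfolded hilbert_bundle_def, THEN conjunct2, THEN conjunct2, THEN conjunct2, THEN conjunct2, THEN conjunct1] hilbert[unfolded hilbert_bundle_def, THEN conjunct2, THEN conjunct2, THEN conjunct2, THEN conjunct2, THEN conjunct2, THEN conjunct1]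
    hilbert[unfolded hilbert_bundle_def, THEN conjunct2, THEN conjunct2, THEN conjunct2, THEN conjunct2, THEN conjunct2, THEN conjunct2, THEN conjunct1]
  by (simp_all add: subset_iff Pi_iff)

lemma section_local:
  assumes "\<And>u. u \<in> units G \<Longrightarrow> a u \<in> H u"
    and "\<And>u e. u \<in> units G \<Longrightarrow> 0 < e \<Longrightarrow>
      \<exists>\<zeta>\<in>\<Gamma>. \<exists>U. open U \<and> u \<in> U \<and> (\<forall>w\<in>U \<inter> units G. norm (a w - \<zeta> w) \<le> e)"
  shows "a \<in> \<Gamma>"
proof -
  have "a \<in> Pi (units G) H" using assms(1) by blast
  from hilbert[unfolded hilbert_bundle_def, THEN conjunct2, THEN conjunct2, THEN conjunct2, THEN conjunct2, THEN conjunct2, THEN conjunct2, THEN conjunct2, THEN bspec, OF this]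
  show ?thesis using assms(2) by (auto dest: mp)
qed

lemma
  fixes x :: 'g
  shows L_add: "v \<in> H (src x) \<Longrightarrow> w \<in> H (src x) \<Longrightarrow> L x (v + w) = L x v + L x w"
    and L_scaleC: "v \<in> H (src x) \<Longrightarrow> L x (c *\<^sub>C v) = c *\<^sub>C L x v"
    and L_norm: "v \<in> H (src x) \<Longrightarrow> norm (L x v) = norm v"
    and L_image: "L x ` H (src x) = H (rng x)"
    and L_mul: "src x = rng y \<Longrightarrow> v \<in> H (src y) \<Longrightarrow> L (x \<cdot> y) v = L x (L y v)"
    and L_continuous: "a \<in> \<Gamma>b \<Longrightarrow> b \<in> \<Gamma>b \<Longrightarrow> continuous_on UNIV (coefficient G L a b)"
  using G_bundle[unfolded G_hilbert_bundle_def, THEN conjunct2, THEN conjunct1]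
    G_bundle[unfolded G_hilbert_bundle_def, THEN conjunct2, THEN conjunct2, THEN conjunct1]
    G_bundle[unfolded G_hilbert_bundle_def, THEN conjunct2, THEN conjunct2, THEN conjunct2]
  by simp_all

lemma L_in: "v \<in> H (src x) \<Longrightarrow> L x v \<in> H (rng x)"
  using L_image[of x] by blast

lemmas H_closed = csubspace_closed_under[OF H_csubspace]

lemma L_diff:
  assumes "v \<in> H (src x)" "w \<in> H (src x)"
  shows "L x (v - w) = L x v - L x w"
  using L_add[OF assms(1) H_closed(2)[OF src_units assms(2)], of "-1"] L_scaleC[OF assms(2), of "-1"]
  by (simp add: scaleC_minus_one)

lemma L_cinner:
  assumes v: "v \<in> H (src x)" and w: "w \<in> H (src x)"
  shows "cinner (L x v) (L x w) = cinner v w"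
proof -
  note H = H_closed[OF src_units[of x]]
  note i = H(2)[OF w, of \<i>]
  have "norm (L x v + L x w) = norm (v + w)" "norm (L x v - L x w) = norm (v - w)"
    "norm (L x v + \<i> *\<^sub>C L x w) = norm (v + \<i> *\<^sub>C w)" "norm (L x v - \<i> *\<^sub>C L x w) = norm (v - \<i> *\<^sub>C w)"
    unfolding L_scaleC[OF w, symmetric] L_add[OF v w, symmetric] L_diff[OF v w, symmetric]
      L_add[OF v i, symmetric] L_diff[OF v i, symmetric]
    by (intro L_norm H v w i)+
  then have "4 * cinner (L x v) (L x w) = 4 * cinner v w"
    by (simp only: cinner_polarization)
  then show ?thesis by simp
qed

text \<open>A unit composes with itself, so \<open>L u\<close> is idempotent; being linear and
  isometric it is injective, hence the identity.\<close>

lemma L_unit: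
  assumes "u \<in> units G" "v \<in> H u"
  shows "L u v = v"
proof -
  have u: "src u = u" "rng u = u" using assms(1) by (simp_all add: units_src units_rng)
  have v: "v \<in> H (src u)" using assms(2) u by simp
  have Lv: "L u v \<in> H (src u)" using L_in[OF v] u by simp
  have "L u (L u v) = L u v"
    using L_mul[of u u v] u v mul_units(2)[of u] by simp
  then have "L u (L u v - v) = 0" using L_diff[OF Lv v] by simp
  then have "norm (L u v - v) = 0"
    using L_norm[OF H_closed(3)[OF src_units Lv v]] by simp
  then show ?thesis by simp
qed

lemma L_iv:
  assumes "v \<in> H (src x)"
  shows "L (iv x) (L x v) = v"
  using L_mul[of "iv x" x v] L_unit[of "src x" v] assms by simp

lemma bounded_sectionD: "a \<in> \<Gamma>b \<Longrightarrow> a \<in> \<Gamma>"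
  by (simp add: bounded_sections_def)

lemma section_norm_bound:
  assumes "a \<in> \<Gamma>b" "u \<in> units G"
  shows "norm (a u) \<le> section_norm (units G) a"
  unfolding section_norm_def
proof (rule cSUP_upper[OF assms(2)])
  show "bdd_above ((\<lambda>u. norm (a u)) ` units G)"
    using assms(1) unfolding bounded_sections_def bounded_iff by (auto intro: bdd_aboveI2)
qed

lemma section_norm_nonneg:
  assumes "a \<in> \<Gamma>b"
  shows "0 \<le> section_norm (units G) a"
  using section_norm_bound[OF assms src_units] norm_ge_zero order_trans by blast

lemma bounded_section_zero: "(\<lambda>_. 0) \<in> \<Gamma>b"
proof -
  have "bounded ((\<lambda>_. 0 :: 'h) ` units G)" by (rule boundedI[of _ 0]) auto
  then show ?thesis using section_zero by (simp add: bounded_sections_def)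
qed

text \<open>Polarization: for sections only continuity of norms is given, but
  \<open>\<Gamma>\<close> is a complex vector space.\<close>

lemma section_cinner_continuous:
  assumes "a \<in> \<Gamma>" "b \<in> \<Gamma>"
  shows "continuous_on (units G) (\<lambda>u. cinner (a u) (b u))"
proof -
  have n: "continuous_on (units G) (\<lambda>u. (norm (a u + c *\<^sub>C b u))\<^sup>2)" for c
    by (intro continuous_on_power section_norm_continuous section_add section_scaleC assms)
  have m: "a u - \<i> *\<^sub>C b u = a u + (- \<i>) *\<^sub>C b u" "a u - b u = a u + (- 1) *\<^sub>C b u" "a u + b u = a u + 1 *\<^sub>C b u" for u
    using scaleC_scaleC[of "-1" \<i> "b u"] by (simp_all add: scaleC_minus_one)
  have "continuous_on (units G) (\<lambda>u. 1/4 * (4 * cinner (a u) (b u)))"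
    unfolding cinner_polarization m
    by (intro continuous_on_mult continuous_on_const continuous_on_add continuous_on_diff continuous_on_of_real n)
  then show ?thesis by simp
qed

text \<open>Near \<open>u\<close> the product is uniformly close to the constant multiple by
  \<open>m u\<close>, so closure under local uniform approximation applies.\<close>

lemma section_mult:
  assumes m: "continuous_on (units G) m" and a: "a \<in> \<Gamma>"
  shows "(\<lambda>u. m u *\<^sub>R a u) \<in> \<Gamma>"
proof (rule section_local)
  show "m u *\<^sub>R a u \<in> H u" if "u \<in> units G" for u
    using H_closed(2)[OF that section_in[OF a that], of "complex_of_real (m u)"] by (simp add: scaleC_of_real)
  fix u and e :: real assume u: "u \<in> units G" and e: "0 < e"
  have "continuous_on (units G) (\<lambda>w. \<bar>m w - m u\<bar> * norm (a w))"
    by (intro continuous_on_mult continuous_on_rabs continuous_on_diff m continuous_on_const section_norm_continuous a)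
  then obtain U where U: "open U" "U \<inter> units G = (\<lambda>w. \<bar>m w - m u\<bar> * norm (a w)) -` {..<e} \<inter> units G"
    unfolding continuous_on_open_invariant using open_lessThan by blast
  have "u \<in> U" using U(2) u e by auto
  moreover have "norm (m w *\<^sub>R a w - complex_of_real (m u) *\<^sub>C a w) \<le> e" if "w \<in> U \<inter> units G" for w
  proof -
    have "m w *\<^sub>R a w - complex_of_real (m u) *\<^sub>C a w = (m w - m u) *\<^sub>R a w"
      by (simp add: scaleC_of_real scaleR_diff_left)
    then show ?thesis using that U(2) by auto
  qed
  ultimately show "\<exists>\<zeta>\<in>\<Gamma>. \<exists>U. open U \<and> u \<in> U \<and> (\<forall>w\<in>U \<inter> units G. norm (m w *\<^sub>R a w - \<zeta> w) \<le> e)"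
    using U(1) by (intro bexI[OF _ section_scaleC[OF a, of "complex_of_real (m u)"]] exI[of _ U]) auto
qed

text \<open>Coefficients are only assumed to be continuous for bounded sections, so approximating
  sections have to be cut off.\<close>

lemma bounded_sections_dense:
  assumes u: "u \<in> units G" and v: "v \<in> H u" and e: "0 < e"
  obtains b where "b \<in> \<Gamma>b" "norm (v - b u) < e"
proof -
  have "v \<in> closure ((\<lambda>a. a u) ` \<Gamma>)" using sections_dense[OF u] v by blast
  then obtain a where a: "a \<in> \<Gamma>" "dist (a u) v < e"
    using e unfolding closure_approachable by blast
  \<comment> \<open>The factor \<open>m\<close> truncates \<open>a\<close> to norm at most
    \<open>M\<close> and equals 1 at \<open>u\<close>; adding one makes \<open>M\<close> positive
    even if \<open>a u\<close> is zero.\<close>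
  define M where "M = norm (a u) + 1"
  have M: "0 < M" by (simp add: M_def add_nonneg_pos)
  define m where "m w = M / max M (norm (a w))" for w
  have "continuous_on (units G) m"
    unfolding m_def using M
    by (intro continuous_on_divide continuous_on_const continuous_on_max section_norm_continuous a(1))
      (auto simp: max_def)
  then have "(\<lambda>w. m w *\<^sub>R a w) \<in> \<Gamma>" by (rule section_mult[OF _ a(1)])
  moreover have "norm (m w *\<^sub>R a w) \<le> M" for w
    using M by (auto simp: m_def max_def field_simps)
  then have "bounded ((\<lambda>w. m w *\<^sub>R a w) ` units G)"
    by (intro boundedI[of _ M]) auto
  ultimately have "(\<lambda>w. m w *\<^sub>R a w) \<in> \<Gamma>b" by (simp add: bounded_sections_def)
  moreover have "m u = 1" using M by (simp add: m_def M_def max_def)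
  then have "norm (v - m u *\<^sub>R a u) < e" using a(2) by (simp add: dist_norm norm_minus_commute)
  ultimately show ?thesis by (rule that)
qed

text \<open>These are the compactly supported continuous sections of the bundle pulled back along
  the range map. The total space carries no topology here, so continuity is expressed by distances
  to pulled back bounded sections.\<close>

definition field_Cc :: "('g \<Rightarrow> 'h) \<Rightarrow> bool" where
  "field_Cc F \<longleftrightarrow> (\<forall>z. F z \<in> H (rng z)) \<and> (\<exists>K. compact K \<and> (\<forall>z. z \<notin> K \<longrightarrow> F z = 0)) \<and>
     (\<forall>b\<in>\<Gamma>b. continuous_on UNIV (\<lambda>z. norm (F z - b (rng z))))"

text \<open>The weights vanish off a set \<open>W\<close> that is fixed before \<open>e\<close>, so
  that all errors can later be dominated by \<open>e\<close> times one function.\<close>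

definition section_approx :: "'g set \<Rightarrow> nat \<Rightarrow> (nat \<Rightarrow> 'g \<Rightarrow> 'h) \<Rightarrow> real \<Rightarrow> bool" where
  "section_approx W N F e \<longleftrightarrow> (\<exists>(T::'g set) p b. finite T \<and> (\<forall>t\<in>T. continuous_on UNIV (p t) \<and> (\<forall>z. 0 \<le> p t z) \<and> (\<forall>z. z \<notin> W \<longrightarrow> p t z = 0))
       \<and> (\<forall>z. (\<Sum>t\<in>T. p t z) \<le> 1) \<and> (\<forall>t. \<forall>i<N. b t i \<in> \<Gamma>b)
       \<and> (\<forall>i<N. \<forall>z. norm (F i z - (\<Sum>t\<in>T. p t z *\<^sub>R b t i (rng z))) \<le> e))"

text \<open>The fields are first approximated by combinations of pulled back sections, then the Gram
  matrix of these sections is approximated by its values at finitely many units.\<close>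

lemma field_approx:
  fixes F :: "nat \<Rightarrow> 'g \<Rightarrow> 'h"
  assumes F: "\<And>i. i < N \<Longrightarrow> field_Cc (F i)"
  obtains W where "open W" "compact (closure W)" "\<forall>i<N. \<forall>z. z \<notin> W \<longrightarrow> F i z = 0"
    "\<forall>e>0. section_approx W N F e"
proof -
  have "\<exists>K. i < N \<longrightarrow> compact K \<and> (\<forall>z. z \<notin> K \<longrightarrow> F i z = 0)" for i
    using F[of i] by (cases "i < N") (simp_all add: field_Cc_def)
  then have "\<exists>Ki. \<forall>i. i < N \<longrightarrow> compact (Ki i) \<and> (\<forall>z. z \<notin> Ki i \<longrightarrow> F i z = 0)"
    by (intro choice allI)
  then obtain Ki where "\<forall>i. i < N \<longrightarrow> compact (Ki i) \<and> (\<forall>z. z \<notin> Ki i \<longrightarrow> F i z = 0)" ..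
  then have Ki: "compact (Ki i)" "z \<notin> Ki i \<Longrightarrow> F i z = 0" if "i < N" for i z using that by simp_all
  define K where "K = (\<Union>i<N. Ki i)"
  have K: "compact K" unfolding K_def using Ki(1) by (intro compact_UN) auto
  have K0: "F i z = 0" if "i < N" "z \<notin> K" for i z using Ki(2)[OF that(1), of z] that by (auto simp: K_def)
  obtain W where W: "open W" "K \<subseteq> W" "compact (closure W)"
    using compact_open_superset[OF lc K] .
  obtain Q :: "('g \<Rightarrow> real) set" where Q: "bump_family Q" using countable_bump_family[OF lc] by blast
  have "section_approx W N F e" if e: "0 < e" for e :: real
  proof -
    have "\<exists>c. snd p < N \<longrightarrow> c \<in> \<Gamma>b \<and> norm (F (snd p) (fst p) - c (rng (fst p))) < e" for p :: "'g \<times> nat"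
    proof (cases "snd p < N")
      case True
      then have "F (snd p) (fst p) \<in> H (rng (fst p))" using F by (simp add: field_Cc_def)
      then obtain c where "c \<in> \<Gamma>b" "norm (F (snd p) (fst p) - c (rng (fst p))) < e"
        by (rule bounded_sections_dense[OF rng_units _ e])
      then show ?thesis by (intro exI[of _ c]) simp
    qed simp
    then have "\<exists>c. \<forall>p. snd p < N \<longrightarrow> c p \<in> \<Gamma>b \<and> norm (F (snd p) (fst p) - c p (rng (fst p))) < e"
      by (intro choice allI)
    then obtain c where "\<forall>p. snd p < N \<longrightarrow> c p \<in> \<Gamma>b \<and> norm (F (snd p) (fst p) - c p (rng (fst p))) < e" ..
    then have c: "c p \<in> \<Gamma>b \<and> norm (F (snd p) (fst p) - c p (rng (fst p))) < e" if "snd p < N" for p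
      using that by (cases p) simp
    define b where "b t i = c (t, i)" for t i
    have b: "b t i \<in> \<Gamma>b" "norm (F i t - b t i (rng t)) < e" if "i < N" for i t
      using c[of "(t, i)"] that by (simp_all add: b_def)
    define N' where "N' x = W \<inter> (\<Inter>i<N. {z. norm (F i z - b x i (rng z)) < e})" for x
    have "open (N' x)" for x
      unfolding N'_def using F b(1)
      by (intro open_Int W(1) open_INT) (auto simp: field_Cc_def intro!: open_Collect_less continuous_on_const)
    moreover have "x \<in> N' x" if "x \<in> K" for x using that W(2) b(2) by (auto simp: N'_def)
    ultimately obtain T q p where T: "finite T" "T \<subseteq> K" "\<forall>t\<in>T. q t \<in> Q"
      and p: "\<forall>t z. p t z = q t z / max (1/2) (\<Sum>s\<in>T. q s z)"
        "\<forall>t\<in>T. continuous_on UNIV (p t)" "\<forall>t\<in>T. \<forall>z. 0 \<le> p t z"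
        "\<forall>t\<in>T. \<forall>z. z \<notin> N' t \<longrightarrow> p t z = 0"
        "\<forall>z. (\<Sum>t\<in>T. p t z) \<le> 1" "\<forall>z\<in>K. (\<Sum>t\<in>T. p t z) = 1"
      by (rule partition_of_unity_bumps[OF Q K])
    have "norm (F i z - (\<Sum>t\<in>T. p t z *\<^sub>R b t i (rng z))) \<le> e" if i: "i < N" for i z
    proof (rule norm_convex_approx[OF T(1)])
      show "F i z = 0 \<or> (\<Sum>t\<in>T. p t z) = 1" using K0[OF i] p(6) by blast
      show "norm (F i z - b t i (rng z)) \<le> e" if "t \<in> T" "p t z \<noteq> 0" for t
      proof -
        have "z \<in> N' t" using p(4) that by blast
        then show ?thesis using i by (auto simp: N'_def less_imp_le)
      qed
    qed (use p(3,5) e in auto)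
    moreover have "\<forall>t\<in>T. \<forall>z. z \<notin> W \<longrightarrow> p t z = 0" using p(4) by (auto simp: N'_def)
    ultimately show ?thesis unfolding section_approx_def using T(1) p(2,3,5) b(1) by (intro exI[of _ T] exI[of _ p] exI[of _ b]) simp
  qed
  then have "\<forall>e>0. section_approx W N F e" by (intro allI impI)
  moreover have "\<forall>i<N. \<forall>z. z \<notin> W \<longrightarrow> F i z = 0" using K0 W(2) by blast
  ultimately show ?thesis by (intro that[OF W(1,3)])
qed

text \<open>For fixed \<open>s\<close> the coefficients form a Gram matrix of vectors in one Hilbert
  space, and the functions occur as a product of one in \<open>z\<close> and one in
  \<open>z'\<close>; both features serve positivity after convolution. The error is weighted by
  \<open>\<kappa> z * \<kappa> z'\<close>, which integrates to a convolution in
  \<open>Cc\<close>.\<close>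

definition kernel_approx :: "('g \<Rightarrow> real) \<Rightarrow> nat \<Rightarrow> (nat \<Rightarrow> 'g \<Rightarrow> 'h) \<Rightarrow> real \<Rightarrow> bool" where
  "kernel_approx \<kappa> N F e \<longleftrightarrow> (\<exists>(S::'g set) (T::'g set) g \<beta>. finite S \<and> finite T \<and> (\<forall>s\<in>S. \<forall>t\<in>T. g s t \<in> Cc) \<and>
       (\<forall>i<N. \<forall>j<N. \<forall>z z'. rng z = rng z' \<longrightarrow>
          cmod (cinner (F j z') (F i z) - (\<Sum>s\<in>S. \<Sum>t\<in>T. \<Sum>t'\<in>T.
             cinner (\<beta> s t' j) (\<beta> s t i :: 'h) * (cnj (g s t z) * g s t' z'))) \<le> e * (\<kappa> z * \<kappa> z')))"

text \<open>Only pairs over a common unit \<open>u = rng z = rng z'\<close> matter, so the inner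
  products of the approximating sections are continuous functions of \<open>u\<close> alone and can
  be replaced by averages, with weights \<open>q s u\<close>, of their values at finitely many units
  \<open>s\<close>.\<close>

lemma gram_approx:
  fixes F :: "nat \<Rightarrow> 'g \<Rightarrow> 'h"
  assumes F: "\<And>i. i < N \<Longrightarrow> field_Cc (F i)"
  obtains \<kappa> :: "'g \<Rightarrow> real" where "\<forall>z. 0 \<le> \<kappa> z" "(\<lambda>z. complex_of_real (\<kappa> z)) \<in> Cc"
    "\<forall>e>0. kernel_approx \<kappa> N F e"
proof -
  obtain W where W: "open W" "compact (closure W)" and FW: "\<forall>i<N. \<forall>z. z \<notin> W \<longrightarrow> F i z = 0"
    and ap: "\<forall>e>0. section_approx W N F e"
    by (rule field_approx[of N F]) (rule F)
  obtain \<kappa> :: "'g \<Rightarrow> real"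
    where \<kappa>: "\<And>x. 0 \<le> \<kappa> x" "\<And>x. x \<in> closure W \<Longrightarrow> \<kappa> x = 1" "(\<lambda>x. complex_of_real (\<kappa> x)) \<in> Cc"
    by (rule Cc_bump[OF lc W(2) open_UNIV subset_UNIV]) blast
  obtain Q :: "('g \<Rightarrow> real) set" where Q: "bump_family Q" using countable_bump_family[OF lc] by blast
  have "\<exists>M. i < N \<longrightarrow> (\<forall>z. norm (F i z) \<le> M)" for i
  proof (cases "i < N")
    case True
    have "continuous_on UNIV (\<lambda>z. norm (F i z - 0))"
      using F[OF True, unfolded field_Cc_def, THEN conjunct2, THEN conjunct2, THEN bspec, OF bounded_section_zero] .
    then have "continuous_on (closure W) (\<lambda>z. norm (F i z))"
      by (simp add: continuous_on_subset[OF _ subset_UNIV])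
    then have "compact ((\<lambda>z. norm (F i z)) ` closure W)"
      by (rule compact_continuous_image[OF _ W(2)])
    then obtain M where M: "\<forall>y\<in>(\<lambda>z. norm (F i z)) ` closure W. norm y \<le> M"
      using compact_imp_bounded[of "(\<lambda>z. norm (F i z)) ` closure W"] unfolding bounded_iff by blast
    have "norm (F i z) \<le> max 0 M" for z
    proof (cases "z \<in> W")
      case True
      then have "z \<in> closure W" using closure_subset by blast
      then have "norm (norm (F i z)) \<le> M" using M by blast
      then show ?thesis by simp
    qed (use FW \<open>i < N\<close> in auto)
    then show ?thesis by blast
  qed simp
  then have "\<exists>M. \<forall>i. i < N \<longrightarrow> (\<forall>z. norm (F i z) \<le> M i)" by (intro choice allI)
  then obtain Mi where Mi: "\<forall>i. i < N \<longrightarrow> (\<forall>z. norm (F i z) \<le> Mi i)" ..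
  define M where "M = (\<Sum>i<N. \<bar>Mi i\<bar>)"
  have M: "norm (F i z) \<le> M" if "i < N" for i z
  proof -
    have "norm (F i z) \<le> \<bar>Mi i\<bar>" using Mi that by (simp add: order_trans[OF _ abs_ge_self])
    also have "\<dots> \<le> M" unfolding M_def using that by (intro member_le_sum) auto
    finally show ?thesis .
  qed
  have M0: "0 \<le> M" by (simp add: M_def sum_nonneg)
  have "kernel_approx \<kappa> N F e"
    if e: "0 < e" for e
  proof -
    \<comment> \<open>With \<open>M\<close> bounding the fields, replacing them by \<open>F'\<close>
      costs \<open>\<delta> * M + (M + 1) * \<delta>\<close>, because \<open>F'\<close> has norm at
      most \<open>M + 1\<close> for \<open>\<delta> \<le> 1\<close>. The other half of
      \<open>e\<close> is left for freezing the Gram matrix.\<close>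
    define \<delta> where "\<delta> = min 1 (e / (2 * (2 * M + 1)))"
    have \<delta>: "0 < \<delta>" "\<delta> \<le> 1" using e M0 by (simp_all add: \<delta>_def)
    have "\<delta> * (2 * M + 1) \<le> e / (2 * (2 * M + 1)) * (2 * M + 1)"
      using M0 by (intro mult_right_mono) (auto simp: \<delta>_def)
    also have "\<dots> = e / 2" using M0 by (simp add: field_simps)
    finally have \<delta>e: "\<delta> * (2 * M + 1) \<le> e / 2" .
    from ap[rule_format, OF \<delta>(1), unfolded section_approx_def] obtain T :: "'g set" and p b where T: "finite T"
      and p: "\<forall>t\<in>T. continuous_on UNIV (p t) \<and> (\<forall>z. 0 \<le> p t z) \<and> (\<forall>z. z \<notin> W \<longrightarrow> p t z = 0)"
        "\<forall>z. (\<Sum>t\<in>T. p t z) \<le> 1" and b: "\<forall>t. \<forall>i<N. b t i \<in> \<Gamma>b"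
      and pb: "\<forall>i<N. \<forall>z. norm (F i z - (\<Sum>t\<in>T. p t z *\<^sub>R b t i (rng z))) \<le> \<delta>" by (elim exE conjE)
    define F' where "F' i z = (\<Sum>t\<in>T. p t z *\<^sub>R b t i (rng z))" for i z
    have FF': "norm (F i z - F' i z) \<le> \<delta>" if "i < N" for i z
      using pb that by (simp add: F'_def)
    define I where "I = T \<times> {..<N}"
    define B where "B k l u = cinner (b (fst l) (snd l) u) (b (fst k) (snd k) u)" for k l u
    have Bcont: "continuous_on UNIV (\<lambda>z. B k l (rng z))" if "k \<in> I" "l \<in> I" for k l
      unfolding B_def
      by (rule continuous_on_units_comp(1), rule section_cinner_continuous)
        (use b that in \<open>auto simp: I_def intro: bounded_sectionD\<close>)
    define C where "C = rng ` closure W"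
    have C: "compact C" unfolding C_def
      by (intro compact_continuous_image continuous_on_rng continuous_on_id W(2))
    have Cu: "rng u = u" if "u \<in> C" for u using that by (auto simp: C_def)
    define N' where "N' u = (\<Inter>k\<in>I. \<Inter>l\<in>I. {z. cmod (B k l (rng z) - B k l (rng u)) < e / 2})" for u
    have "open (N' u)" for u
      unfolding N'_def
    proof (intro open_INT ballI)
      show "finite I" "finite I" using T by (simp_all add: I_def)
      show "open {z. cmod (B k l (rng z) - B k l (rng u)) < e / 2}" if "k \<in> I" "l \<in> I" for k l
        by (intro open_Collect_less continuous_on_norm continuous_on_diff Bcont that continuous_on_const)
    qed
    moreover have "u \<in> N' u" for u using e by (simp add: N'_def)
    ultimately obtain S q' q where S: "finite S" "S \<subseteq> C" "\<forall>s\<in>S. q' s \<in> Q"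
      and q: "\<forall>s z. q s z = q' s z / max (1/2) (\<Sum>s\<in>S. q' s z)"
        "\<forall>s\<in>S. continuous_on UNIV (q s)" "\<forall>s\<in>S. \<forall>z. 0 \<le> q s z"
        "\<forall>s\<in>S. \<forall>z. z \<notin> N' s \<longrightarrow> q s z = 0"
        "\<forall>z. (\<Sum>s\<in>S. q s z) \<le> 1" "\<forall>z\<in>C. (\<Sum>s\<in>S. q s z) = 1"
      by (rule partition_of_unity_bumps[OF Q C])
    have Bq: "cmod (B k l u - (\<Sum>s\<in>S. q s u *\<^sub>R B k l s)) \<le> e / 2" if "k \<in> I" "l \<in> I" "u \<in> C" for k l u
    proof (rule norm_convex_approx[OF S(1)])
      show "B k l u = 0 \<or> (\<Sum>s\<in>S. q s u) = 1" using q(6) that by blast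
      show "norm (B k l u - B k l s) \<le> e / 2" if s: "s \<in> S" "q s u \<noteq> 0" for s
      proof -
        have "u \<in> N' s" using q(4) s by blast
        then have "cmod (B k l (rng u) - B k l (rng s)) < e / 2"
          using \<open>k \<in> I\<close> \<open>l \<in> I\<close> by (auto simp: N'_def)
        then show ?thesis using Cu[OF \<open>u \<in> C\<close>] Cu[of s] S(2) s(1) by auto
      qed
    qed (use q(3,5) e in auto)
    \<comment> \<open>The weight is split into two roots, one for each variable: over a common unit
      they multiply to \<open>q s u\<close>, while each factor depends on one variable only.\<close>
    define g where "g s t z = complex_of_real (sqrt (q s (rng z)) * p t z)" for s t z
    have gCc: "g s t \<in> Cc" if "s \<in> S" "t \<in> T" for s t
    proof (rule CcI[OF _ W(2)])
      have "continuous_on UNIV (\<lambda>z. q s (rng z))"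
        using q(2) that by (intro continuous_on_compose2[OF _ continuous_on_rng[OF continuous_on_id]]) auto
      then show "continuous_on UNIV (g s t)"
        unfolding g_def using p(1) that
        by (intro continuous_on_of_real continuous_on_mult continuous_on_real_sqrt) auto
      show "g s t z = 0" if z: "z \<notin> closure W" for z
      proof -
        have "z \<notin> W" using z closure_subset by blast
        then show ?thesis using p(1) \<open>t \<in> T\<close> by (simp add: g_def)
      qed
    qed
    define \<beta> where "\<beta> s t i = b t i s" for s t i
    have main: "cmod (cinner (F j z') (F i z) - (\<Sum>s\<in>S. \<Sum>t\<in>T. \<Sum>t'\<in>T.
             cinner (\<beta> s t' j) (\<beta> s t i) * (cnj (g s t z) * g s t' z'))) \<le> e * (\<kappa> z * \<kappa> z')"
      if ij: "i < N" "j < N" and zz: "rng z = rng z'" for i j z z'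
    proof (cases "z \<in> W \<and> z' \<in> W")
      case False
      then have "cinner (F j z') (F i z) = 0" using FW ij by auto
      moreover have "cnj (g s t z) * g s t' z' = 0" if "t \<in> T" "t' \<in> T" for s t t'
        using False p(1) that by (auto simp: g_def)
      then have "(\<Sum>s\<in>S. \<Sum>t\<in>T. \<Sum>t'\<in>T. cinner (\<beta> s t' j) (\<beta> s t i) * (cnj (g s t z) * g s t' z')) = 0"
        by (intro sum.neutral ballI) simp
      ultimately show ?thesis using e \<kappa>(1) by simp
    next
      case True
      define u where "u = rng z"
      have z: "z \<in> closure W" "z' \<in> closure W" using True closure_subset by auto
      then have uC: "u \<in> C" by (simp add: C_def u_def)
      have nF': "norm (F' i z) \<le> M + 1" if "i < N" for i z
        using FF'[OF that, of z] M[OF that, of z] \<delta>(2) norm_triangle_ineq2[of "F' i z" "F i z"]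
        by (simp add: norm_minus_commute)
      have "cinner (F j z') (F i z) - cinner (F' j z') (F' i z)
          = cinner (F j z' - F' j z') (F i z) + cinner (F' j z') (F i z - F' i z)"
        by (simp add: cinner_diff_left cinner_diff_right)
      also have "cmod \<dots> \<le> norm (F j z' - F' j z') * norm (F i z) + norm (F' j z') * norm (F i z - F' i z)"
        by (intro norm_triangle_le add_mono cmod_cinner_le)
      also have "\<dots> \<le> \<delta> * M + (M + 1) * \<delta>"
        using \<delta>(1) M0 by (intro add_mono mult_mono FF' M nF' ij) auto
      also have "\<dots> \<le> e / 2" using \<delta>e by (simp add: algebra_simps)
      finally have e1: "cmod (cinner (F j z') (F i z) - cinner (F' j z') (F' i z)) \<le> e / 2" .
      define D where "D t t' = B (t, i) (t', j) u - (\<Sum>s\<in>S. q s u *\<^sub>R B (t, i) (t', j) s)" for t t'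
      have D: "cmod (D t t') \<le> e / 2" if "t \<in> T" "t' \<in> T" for t t'
        unfolding D_def using that ij uC by (intro Bq) (auto simp: I_def)
      have "cinner (F' j z') (F' i z) = (\<Sum>t\<in>T. \<Sum>t'\<in>T. complex_of_real (p t z * p t' z') * B (t, i) (t', j) u)"
        unfolding F'_def u_def[symmetric] zz[symmetric]
        by (simp only: cinner_sum_right scaleC_of_real[symmetric] cinner_scaleC_right)
          (simp add: cinner_sum_left cinner_scaleC_left sum_distrib_left B_def mult_ac)
      moreover have "(\<Sum>s\<in>S. \<Sum>t\<in>T. \<Sum>t'\<in>T. cinner (\<beta> s t' j) (\<beta> s t i) * (cnj (g s t z) * g s t' z'))
          = (\<Sum>t\<in>T. \<Sum>t'\<in>T. complex_of_real (p t z * p t' z') * (\<Sum>s\<in>S. q s u *\<^sub>R B (t, i) (t', j) s))"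
      proof -
        have "cinner (\<beta> s t' j) (\<beta> s t i) * (cnj (g s t z) * g s t' z')
            = complex_of_real (p t z * p t' z') * (q s u *\<^sub>R B (t, i) (t', j) s)" if "s \<in> S" for s t t'
        proof -
          have "sqrt (q s u) * sqrt (q s u) = q s u" using q(3) that by simp
          then have "complex_of_real (sqrt (q s u)) * complex_of_real (sqrt (q s u)) = complex_of_real (q s u)"
            by (metis of_real_mult)
          then show ?thesis
            by (simp add: \<beta>_def g_def B_def u_def[symmetric] zz[symmetric] scaleR_conv_of_real mult_ac)
        qed
        then have "(\<Sum>s\<in>S. \<Sum>t\<in>T. \<Sum>t'\<in>T. cinner (\<beta> s t' j) (\<beta> s t i) * (cnj (g s t z) * g s t' z'))
          = (\<Sum>s\<in>S. \<Sum>t\<in>T. \<Sum>t'\<in>T. complex_of_real (p t z * p t' z') * (q s u *\<^sub>R B (t, i) (t', j) s))"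
          by (intro sum.cong) auto
        also have "\<dots> = (\<Sum>t\<in>T. \<Sum>s\<in>S. \<Sum>t'\<in>T. complex_of_real (p t z * p t' z') * (q s u *\<^sub>R B (t, i) (t', j) s))"
          by (rule sum.swap)
        also have "\<dots> = (\<Sum>t\<in>T. \<Sum>t'\<in>T. \<Sum>s\<in>S. complex_of_real (p t z * p t' z') * (q s u *\<^sub>R B (t, i) (t', j) s))"
          by (intro sum.cong refl sum.swap)
        finally show ?thesis by (simp only: sum_distrib_left)
      qed
      ultimately have "cinner (F' j z') (F' i z) - (\<Sum>s\<in>S. \<Sum>t\<in>T. \<Sum>t'\<in>T. cinner (\<beta> s t' j) (\<beta> s t i) * (cnj (g s t z) * g s t' z'))
          = (\<Sum>t\<in>T. \<Sum>t'\<in>T. complex_of_real (p t z * p t' z') * D t t')"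
        by (simp add: D_def right_diff_distrib sum_subtractf)
      also have "cmod \<dots> \<le> (\<Sum>t\<in>T. \<Sum>t'\<in>T. p t z * p t' z' * (e / 2))"
      proof (intro order_trans[OF norm_sum] sum_mono)
        fix t t' assume t: "t \<in> T" "t' \<in> T"
        then have "0 \<le> p t z * p t' z'" using p(1) by simp
        then show "cmod (complex_of_real (p t z * p t' z') * D t t') \<le> p t z * p t' z' * (e / 2)"
          unfolding norm_mult norm_of_real using D[OF t] by (intro mult_mono) auto
      qed
      also have "\<dots> = (\<Sum>t\<in>T. p t z) * (\<Sum>t'\<in>T. p t' z') * (e / 2)"
        unfolding sum_product by (simp add: sum_distrib_right)
      also have "\<dots> \<le> 1 * 1 * (e / 2)"
        using p e by (intro mult_right_mono mult_mono) (auto intro: sum_nonneg)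
      finally show ?thesis
        using e1 \<kappa>(2)[OF z(1)] \<kappa>(2)[OF z(2)]
          norm_triangle_ineq[of "cinner (F j z') (F i z) - cinner (F' j z') (F' i z)"
            "cinner (F' j z') (F' i z) - (\<Sum>s\<in>S. \<Sum>t\<in>T. \<Sum>t'\<in>T. cinner (\<beta> s t' j) (\<beta> s t i) * (cnj (g s t z) * g s t' z'))"]
        by simp
    qed
    show ?thesis
      unfolding kernel_approx_def
      by (intro exI[of _ S] exI[of _ T] exI[of _ g] exI[of _ \<beta>]) (simp add: S(1) T gCc main)
  qed
  then show ?thesis using \<kappa> by (intro that[of \<kappa>] allI impI)
qed

text \<open>For scalar fields this is \<open>cv (st f) f'\<close>, where \<open>f\<close> and
  \<open>f'\<close> are the conjugates of \<open>F\<close> and \<open>F'\<close>. It plays the role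
  of an inner product with values in the convolution algebra.\<close>

definition gram :: "('g \<Rightarrow> 'h) \<Rightarrow> ('g \<Rightarrow> 'h) \<Rightarrow> 'g \<Rightarrow> complex" where
  "gram F F' x = fint (rng x) (\<lambda>y. cinner (F' (iv y \<cdot> x)) (F (iv y)))"

text \<open>Were the approximation of the Gram functions exact, \<open>\<sigma>\<close> would turn
  each \<open>cv (st (g s t)) (g s t')\<close> into inner products of vectors
  \<open>\<sigma> (g s t) (w i)\<close>, and Schur's product theorem would give positivity for each
  \<open>s\<close> separately. The error tends to zero in the I-norm, with respect to which
  \<open>\<sigma>\<close> is bounded.\<close>

theorem gram_positive:
  fixes F :: "nat \<Rightarrow> 'g \<Rightarrow> 'h" and w :: "nat \<Rightarrow> ell2"
  assumes \<sigma>: "\<sigma> \<in> reps G lam" and F: "\<And>i. i < N \<Longrightarrow> field_Cc (F i)"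
    and gram: "\<And>i j. i < N \<Longrightarrow> j < N \<Longrightarrow> gram (F i) (F j) \<in> Cc"
    and int: "\<And>i j x. i < N \<Longrightarrow> j < N \<Longrightarrow> fibre_Cc (rng x) (\<lambda>y. cinner (F j (iv y \<cdot> x)) (F i (iv y)))"
  shows "0 \<le> Re (\<Sum>i<N. \<Sum>j<N. cinner (w i) (\<sigma> (gram (F i) (F j)) (w j)))"
proof -
  obtain \<kappa> :: "'g \<Rightarrow> real" where \<kappa>: "\<forall>z. 0 \<le> \<kappa> z" "(\<lambda>z. complex_of_real (\<kappa> z)) \<in> Cc"
    and ap: "\<forall>e>0. kernel_approx \<kappa> N F e"
    by (rule gram_approx[of N F]) (rule F)
  define k where "k z = complex_of_real (\<kappa> z)" for z
  have k: "k \<in> Cc" unfolding k_def by (rule \<kappa>(2))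
  \<comment> \<open>Each Gram function is off by at most \<open>e\<close> times the absolute value
    of \<open>cv (st k) k\<close>, so \<open>e * c\<close> bounds the total error of the quadratic
    form.\<close>
  define c where "c = nrm (cv (st k) k) * (\<Sum>i<N. \<Sum>j<N. norm (w i) * norm (w j))"
  have "- (e * c) \<le> Re (\<Sum>i<N. \<Sum>j<N. cinner (w i) (\<sigma> (gram (F i) (F j)) (w j)))" if e: "0 < e" for e
  proof -
    from ap[rule_format, OF e, unfolded kernel_approx_def] obtain S T :: "'g set" and g and \<beta> :: "'g \<Rightarrow> 'g \<Rightarrow> nat \<Rightarrow> 'h" where ST: "finite S" "finite T"
      and g: "\<forall>s\<in>S. \<forall>t\<in>T. g s t \<in> Cc"
      and gb: "\<forall>i<N. \<forall>j<N. \<forall>z z'. rng z = rng z' \<longrightarrow>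
          cmod (cinner (F j z') (F i z) - (\<Sum>s\<in>S. \<Sum>t\<in>T. \<Sum>t'\<in>T.
             cinner (\<beta> s t' j) (\<beta> s t i) * (cnj (g s t z) * g s t' z'))) \<le> e * (\<kappa> z * \<kappa> z')" by (elim exE conjE)
    define h where "h i j = (\<lambda>x. \<Sum>s\<in>S. \<Sum>t\<in>T. \<Sum>t'\<in>T. cinner (\<beta> s t' j) (\<beta> s t i) * cv (st (g s t)) (g s t') x)" for i j
    have hCc: "h i j \<in> Cc" for i j
      unfolding h_def using g by (intro Cc_sum Cc_scale cv_Cc st_Cc) auto
    have close: "cmod (gram (F i) (F j) x - h i j x) \<le> e * cmod (cv (st k) k x)" if ij: "i < N" "j < N" for i j x
    proof -
      define q where "q y = (\<Sum>s\<in>S. \<Sum>t\<in>T. \<Sum>t'\<in>T. cinner (\<beta> s t' j) (\<beta> s t i) * (st (g s t) y * g s t' (iv y \<cdot> x)))" for y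
      have f1: "fibre_Cc (rng x) (\<lambda>y. cinner (\<beta> s t' j) (\<beta> s t i) * (st (g s t) y * g s t' (iv y \<cdot> x)))"
        if "s \<in> S" "t \<in> T" "t' \<in> T" for s t t'
        using g that by (intro fibre_Cc_mult fibre_Cc_cv st_Cc continuous_on_const) auto
      have f3: "fibre_Cc u (\<lambda>y. \<Sum>a\<in>A. f a y)" and s3: "fint u (\<lambda>y. \<Sum>a\<in>A. f a y) = (\<Sum>a\<in>A. fint u (f a))"
        if "\<And>a. a \<in> A \<Longrightarrow> fibre_Cc u (f a)" "u \<in> units G" for u and A :: "'g set" and f
      proof -
        have "fibre_Cc u (\<lambda>y. \<Sum>a\<in>A. f a y) \<and> fint u (\<lambda>y. \<Sum>a\<in>A. f a y) = (\<Sum>a\<in>A. fint u (f a))"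
          using that(1)
        proof (induction A rule: infinite_finite_induct)
          case (insert a A)
          have 1: "fibre_Cc u (\<lambda>y. \<Sum>a\<in>A. f a y)" "fint u (\<lambda>y. \<Sum>a\<in>A. f a y) = (\<Sum>a\<in>A. fint u (f a))"
            using insert.IH insert.prems by auto
          have 2: "fibre_Cc u (f a)" by (rule insert.prems) simp
          have "fibre_Cc u (\<lambda>y. f a y - (\<lambda>y. (-1) * (\<Sum>a\<in>A. f a y)) y)"
            by (intro fibre_Cc_diff 2 fibre_Cc_mult 1 continuous_on_const)
          then show ?case using insert.hyps fint_add[OF 2 1(1) that(2)] 1 by simp
        qed (auto intro: fibre_Cc_of_Cc Cc_zero)
        then show "fibre_Cc u (\<lambda>y. \<Sum>a\<in>A. f a y)" "fint u (\<lambda>y. \<Sum>a\<in>A. f a y) = (\<Sum>a\<in>A. fint u (f a))" by auto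
      qed
      have fq: "fibre_Cc (rng x) q"
        unfolding q_def by (intro f3 f1 rng_units)
      have "h i j x = fint (rng x) q"
        unfolding h_def q_def cv_fint
        by (simp only: fint_mult[symmetric] s3 f3 f1 rng_units cong: sum.cong)
      then have "gram (F i) (F j) x - h i j x = fint (rng x) (\<lambda>y. cinner (F j (iv y \<cdot> x)) (F i (iv y)) - q y)"
        unfolding gram_def using fint_diff[OF int[OF ij] fq rng_units] by simp
      also have "cmod \<dots> \<le> Re (fint (rng x) (\<lambda>y. complex_of_real (e * (\<kappa> (iv y) * \<kappa> (iv y \<cdot> x)))))"
      proof (rule cmod_fint_le[OF fibre_Cc_diff[OF int[OF ij] fq] _ rng_units])
        have "fibre_Cc (rng x) (\<lambda>y. complex_of_real e * (st k y * k (iv y \<cdot> x)))"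
          by (intro fibre_Cc_mult fibre_Cc_cv st_Cc k continuous_on_const refl)
        then show "fibre_Cc (rng x) (\<lambda>y. complex_of_real (e * (\<kappa> (iv y) * \<kappa> (iv y \<cdot> x))))"
          by (simp add: k_def star_def)
        fix y assume y: "rng y = rng x"
        have "rng (iv y) = rng (iv y \<cdot> x)" using y by simp
        then show "cmod (cinner (F j (iv y \<cdot> x)) (F i (iv y)) - q y) \<le> e * (\<kappa> (iv y) * \<kappa> (iv y \<cdot> x))"
          using gb ij unfolding q_def star_def by blast
      qed
      also have "\<dots> = e * Re (cv (st k) k x)"
        by (simp add: cv_fint fint_mult k_def star_def)
      also have "\<dots> \<le> e * cmod (cv (st k) k x)"
        using e by (intro mult_left_mono complex_Re_le_cmod) auto
      finally show ?thesis .
    qed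
    have err: "cmod (cinner (w i) (\<sigma> (gram (F i) (F j)) (w j)) - cinner (w i) (\<sigma> (h i j) (w j)))
        \<le> e * nrm (cv (st k) k) * (norm (w i) * norm (w j))" if ij: "i < N" "j < N" for i j
    proof -
      have d: "(\<lambda>x. gram (F i) (F j) x - h i j x) \<in> Cc" by (intro Cc_diff gram hCc ij)
      have "cinner (w i) (\<sigma> (gram (F i) (F j)) (w j)) - cinner (w i) (\<sigma> (h i j) (w j))
          = cinner (w i) (\<sigma> (\<lambda>x. gram (F i) (F j) x - h i j x) (w j))"
        by (simp add: rep_diff[OF \<sigma> gram[OF ij] hCc] cinner_diff_right)
      also have "cmod \<dots> \<le> norm (w i) * norm (\<sigma> (\<lambda>x. gram (F i) (F j) x - h i j x) (w j))"
        by (rule cmod_cinner_le)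
      also have "\<dots> \<le> norm (w i) * (nrm (\<lambda>x. gram (F i) (F j) x - h i j x) * norm (w j))"
        by (intro mult_left_mono rep_norm_le \<sigma> d) simp
      also have "\<dots> \<le> norm (w i) * (e * nrm (cv (st k) k) * norm (w j))"
        using e by (intro mult_left_mono mult_right_mono nrm_le d cv_Cc st_Cc k close ij) auto
      finally show ?thesis by (simp add: mult_ac)
    qed
    have hpos: "0 \<le> Re (\<Sum>i<N. \<Sum>j<N. cinner (w i) (\<sigma> (h i j) (w j)))"
    proof -
      have "cinner (w i) (\<sigma> (h i j) (w j)) = (\<Sum>s\<in>S. \<Sum>t\<in>T. \<Sum>t'\<in>T.
          cinner (\<beta> s t' j) (\<beta> s t i) * cinner (\<sigma> (g s t) (w i)) (\<sigma> (g s t') (w j)))" for i j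
      proof -
        have "\<sigma> (h i j) (w j) = (\<Sum>s\<in>S. \<Sum>t\<in>T. \<Sum>t'\<in>T. cinner (\<beta> s t' j) (\<beta> s t i) *\<^sub>C \<sigma> (cv (st (g s t)) (g s t')) (w j))"
          unfolding h_def using g
          by (simp add: rep_sum[OF \<sigma>] rep_scale[OF \<sigma>] Cc_sum Cc_scale cv_Cc st_Cc cong: sum.cong)
        then show ?thesis using g
          by (simp add: cinner_sum_right cinner_scaleC_right rep_cv[OF \<sigma>] rep_st'[OF \<sigma>] st_Cc cong: sum.cong)
      qed
      then have "(\<Sum>i<N. \<Sum>j<N. cinner (w i) (\<sigma> (h i j) (w j))) = (\<Sum>i<N. \<Sum>j<N. \<Sum>s\<in>S. \<Sum>t\<in>T. \<Sum>t'\<in>T.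
          cinner (\<beta> s t' j) (\<beta> s t i) * cinner (\<sigma> (g s t) (w i)) (\<sigma> (g s t') (w j)))"
        by simp
      \<comment> \<open>The sum over \<open>s\<close> is moved outside and the pairs of
        \<open>i\<close> and \<open>t\<close> become one index: positivity holds for the Gram matrix
        of each single \<open>s\<close>.\<close>
      also have "\<dots> = (\<Sum>s\<in>S. \<Sum>i<N. \<Sum>j<N. \<Sum>t\<in>T. \<Sum>t'\<in>T.
          cinner (\<beta> s t' j) (\<beta> s t i) * cinner (\<sigma> (g s t) (w i)) (\<sigma> (g s t') (w j)))"
        by (subst sum.swap[of _ S], rule sum.swap[THEN trans], rule sum.cong[OF refl], rule refl)
      also have "\<dots> = (\<Sum>s\<in>S. \<Sum>a\<in>{..<N} \<times> T. \<Sum>a'\<in>{..<N} \<times> T.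
          cinner (\<beta> s (snd a') (fst a')) (\<beta> s (snd a) (fst a)) * cinner (\<sigma> (g s (snd a)) (w (fst a))) (\<sigma> (g s (snd a')) (w (fst a'))))"
      proof (rule sum.cong[OF refl])
        fix s
        have "(\<Sum>i<N. \<Sum>j<N. \<Sum>t\<in>T. \<Sum>t'\<in>T. f i j t t') = (\<Sum>a\<in>{..<N} \<times> T. \<Sum>a'\<in>{..<N} \<times> T. f (fst a) (fst a') (snd a) (snd a'))"
          for f :: "nat \<Rightarrow> nat \<Rightarrow> 'g \<Rightarrow> 'g \<Rightarrow> complex"
        proof -
          have "(\<Sum>i<N. \<Sum>j<N. \<Sum>t\<in>T. \<Sum>t'\<in>T. f i j t t') = (\<Sum>i<N. \<Sum>t\<in>T. \<Sum>j<N. \<Sum>t'\<in>T. f i j t t')"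
            by (intro sum.cong refl sum.swap)
          moreover have cp: "(\<Sum>a\<in>{..<N} \<times> T. h a) = (\<Sum>i<N. \<Sum>t\<in>T. h (i, t))" for h :: "nat \<times> 'g \<Rightarrow> complex"
            by (simp add: sum.cartesian_product)
          ultimately show ?thesis unfolding cp by simp
        qed
        then show "(\<Sum>i<N. \<Sum>j<N. \<Sum>t\<in>T. \<Sum>t'\<in>T.
            cinner (\<beta> s t' j) (\<beta> s t i) * cinner (\<sigma> (g s t) (w i)) (\<sigma> (g s t') (w j)))
          = (\<Sum>a\<in>{..<N} \<times> T. \<Sum>a'\<in>{..<N} \<times> T.
          cinner (\<beta> s (snd a') (fst a')) (\<beta> s (snd a) (fst a)) * cinner (\<sigma> (g s (snd a)) (w (fst a))) (\<sigma> (g s (snd a')) (w (fst a'))))" .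
      qed
      finally have eq: "(\<Sum>i<N. \<Sum>j<N. cinner (w i) (\<sigma> (h i j) (w j)))
        = (\<Sum>s\<in>S. \<Sum>a\<in>{..<N} \<times> T. \<Sum>a'\<in>{..<N} \<times> T.
          cinner (\<beta> s (snd a') (fst a')) (\<beta> s (snd a) (fst a)) * cinner (\<sigma> (g s (snd a)) (w (fst a))) (\<sigma> (g s (snd a')) (w (fst a'))))" .
      have "finite ({..<N} \<times> T)" using ST(2) by simp
      from sum_cinner_cinner_nonneg_finite[OF this] show ?thesis
        unfolding eq by (subst Re_sum) (rule sum_nonneg)
    qed
    have "cmod ((\<Sum>i<N. \<Sum>j<N. cinner (w i) (\<sigma> (gram (F i) (F j)) (w j))) - (\<Sum>i<N. \<Sum>j<N. cinner (w i) (\<sigma> (h i j) (w j))))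
        \<le> (\<Sum>i<N. \<Sum>j<N. e * nrm (cv (st k) k) * (norm (w i) * norm (w j)))"
      unfolding sum_subtractf[symmetric]
      by (intro order_trans[OF norm_sum] sum_mono err) auto
    also have "\<dots> = e * c" by (simp add: c_def sum_distrib_left mult.assoc)
    finally have "cmod ((\<Sum>i<N. \<Sum>j<N. cinner (w i) (\<sigma> (gram (F i) (F j)) (w j))) - (\<Sum>i<N. \<Sum>j<N. cinner (w i) (\<sigma> (h i j) (w j)))) \<le> e * c" .
    then show ?thesis using hpos abs_Re_le_cmod order_trans
      by (smt (verit, best) minus_complex.simps(1))
  qed
  note lower = this
  show ?thesis
  proof (rule field_le_epsilon)
    fix d :: real assume d: "0 < d"
    have c0: "0 \<le> c" unfolding c_def by (intro mult_nonneg_nonneg nrm_nonneg cv_Cc st_Cc k sum_nonneg) auto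
    have "d / (c + 1) * c \<le> d" using c0 d by (simp add: field_simps)
    with lower[of "d / (c + 1)"] c0 d
    show "0 \<le> Re (\<Sum>i<N. \<Sum>j<N. cinner (w i) (\<sigma> (gram (F i) (F j)) (w j))) + d" by simp
  qed
qed

end

section \<open>Representations from actions on vectors\<close>

text \<open>Iterating the quadratic inequality gives \<open>(a 0 / x) ^ (2 ^ n) \<le> a n / x \<le>
  (C / x) * r ^ (2 ^ n)\<close>. So the powers of \<open>a 0 / (x * r)\<close> with exponents
  \<open>2 ^ n\<close> stay bounded, which forces this quotient to be at most 1; the constant
  \<open>C\<close> drops out.\<close>

lemma power_iteration_bound:
  fixes a :: "nat \<Rightarrow> real"
  assumes a: "\<And>n. 0 \<le> a n" "\<And>n. (a n)\<^sup>2 \<le> x * a (Suc n)" "\<And>n. a n \<le> C * r ^ (2 ^ n)"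
    and "0 \<le> x" "0 \<le> r"
  shows "a 0 \<le> x * r"
proof (cases "x = 0 \<or> r = 0")
  case True
  then show ?thesis using a(2)[of 0] a(3)[of 0] by auto
next
  case False
  then have x: "0 < x" and r: "0 < r" using assms by auto
  have pow: "(a 0 / x) ^ (2 ^ n) \<le> a n / x" for n
  proof (induction n)
    case (Suc n)
    have "(a 0 / x) ^ (2 ^ Suc n) = ((a 0 / x) ^ (2 ^ n))\<^sup>2" by (simp add: power_mult[symmetric] mult.commute)
    also have "\<dots> \<le> (a n / x)\<^sup>2" using Suc a(1) x by (intro power_mono) auto
    also have "\<dots> \<le> (x * a (Suc n)) / x\<^sup>2" unfolding power_divide by (intro divide_right_mono a(2)) simp
    also have "\<dots> = a (Suc n) / x" using x by (simp add: power2_eq_square)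
    finally show ?case .
  qed simp
  define q where "q = a 0 / x / r"
  have qb: "q ^ (2 ^ n) \<le> C / x" for n
  proof -
    have "(a 0 / x) ^ (2 ^ n) \<le> C * r ^ (2 ^ n) / x"
      by (rule order_trans[OF pow]) (intro divide_right_mono a(3) less_imp_le x)
    then have "(a 0 / x) ^ (2 ^ n) / r ^ (2 ^ n) \<le> C * r ^ (2 ^ n) / x / r ^ (2 ^ n)"
      using r by (intro divide_right_mono) auto
    also have "\<dots> = C / x" using r by simp
    finally show ?thesis unfolding q_def by (simp only: power_divide)
  qed
  have "q \<le> 1"
  proof (rule ccontr)
    assume "\<not> q \<le> 1"
    then have q: "1 < q" by simp
    obtain n where "C / x < q ^ n" using real_arch_pow[OF q] by blast
    also have "q ^ n \<le> q ^ (2 ^ n)" using q by (intro power_increasing) (auto intro: less_imp_le less_exp)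
    finally show False using qb[of n] by simp
  qed
  then show ?thesis using x r by (simp add: q_def field_simps)
qed

text \<open>The indices carry no linear structure, so linearity and multiplicativity are demanded of
  the vectors \<open>\<Psi>\<close> and not of \<open>act\<close> itself. The constant in
  \<open>act_bound\<close> may depend on the index; that the I-norm bounds the operators is derived
  from this.\<close>

locale action = haar_groupoid G lam
  for G :: "'g::{second_countable_topology, t2_space} groupoid" and lam +
  fixes I :: "'i set" and \<Psi> :: "'i \<Rightarrow> ell2" and act :: "('g \<Rightarrow> complex) \<Rightarrow> 'i \<Rightarrow> 'i"
  assumes act_in: "f \<in> Cc \<Longrightarrow> i \<in> I \<Longrightarrow> act f i \<in> I"
    and act_add: "f \<in> Cc \<Longrightarrow> g \<in> Cc \<Longrightarrow> i \<in> I \<Longrightarrow> \<Psi> (act (\<lambda>x. f x + g x) i) = \<Psi> (act f i) + \<Psi> (act g i)"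
    and act_scale: "f \<in> Cc \<Longrightarrow> i \<in> I \<Longrightarrow> \<Psi> (act (\<lambda>x. c * f x) i) = c *\<^sub>C \<Psi> (act f i)"
    and act_cv: "f \<in> Cc \<Longrightarrow> g \<in> Cc \<Longrightarrow> i \<in> I \<Longrightarrow> \<Psi> (act (conv G lam f g) i) = \<Psi> (act f (act g i))"
    and act_st: "f \<in> Cc \<Longrightarrow> i \<in> I \<Longrightarrow> j \<in> I \<Longrightarrow> cinner (\<Psi> (act (star G f) i)) (\<Psi> j) = cinner (\<Psi> i) (\<Psi> (act f j))"
    and act_bound: "i \<in> I \<Longrightarrow> \<exists>C. \<forall>f\<in>Cc. norm (\<Psi> (act f i)) \<le> C * I_norm G lam f"
begin

section \<open>Formal combinations and their images\<close>

definition comb :: "(complex \<times> 'i) list \<Rightarrow> ell2" where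
  "comb l = (\<Sum>(c, i)\<leftarrow>l. c *\<^sub>C \<Psi> i)"

text \<open>The image is defined on formal combinations because it is not yet known to depend only
  on the vector \<open>comb l\<close>; this will follow from \<open>norm_acomb_le\<close>.\<close>

definition acomb :: "('g \<Rightarrow> complex) \<Rightarrow> (complex \<times> 'i) list \<Rightarrow> ell2" where
  "acomb f l = (\<Sum>(c, i)\<leftarrow>l. c *\<^sub>C \<Psi> (act f i))"

abbreviation combs :: "(complex \<times> 'i) list set" where "combs \<equiv> lists (UNIV \<times> I)"

lemma comb_simps [simp]: "comb [] = 0" "comb ((c, i) # l) = c *\<^sub>C \<Psi> i + comb l" "comb (l @ l') = comb l + comb l'"
  and acomb_simps [simp]: "acomb f [] = 0" "acomb f ((c, i) # l) = c *\<^sub>C \<Psi> (act f i) + acomb f l"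
    "acomb f (l @ l') = acomb f l + acomb f l'"
  by (simp_all add: comb_def acomb_def)

lemma comb_map: "comb (map (\<lambda>(c, i). (d * c, i)) l) = d *\<^sub>C comb l"
  and acomb_map: "acomb f (map (\<lambda>(c, i). (d * c, i)) l) = d *\<^sub>C acomb f l"
  by (induction l) (auto simp: scaleC_add_right scaleC_scaleC)

lemma combs_map: "l \<in> combs \<Longrightarrow> map (\<lambda>(c, i). (d * c, i)) l \<in> combs"
  by (induction l) auto

lemma cinner_acomb:
  assumes f: "f \<in> Cc" and g: "g \<in> Cc" and "l \<in> combs" "l' \<in> combs"
  shows "cinner (acomb f l) (acomb g l') = cinner (comb l) (acomb (cv (st f) g) l')"
proof -
  have 1: "cinner (\<Psi> (act f i)) (acomb g l') = cinner (\<Psi> i) (acomb (cv (st f) g) l')" if "i \<in> I" for i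
    using assms(4)
  proof (induction l')
    case (Cons p l')
    obtain c j where p: "p = (c, j)" by fastforce
    then have j: "j \<in> I" using Cons by auto
    have "cinner (\<Psi> (act f i)) (\<Psi> (act g j)) = cinner (\<Psi> i) (\<Psi> (act (st f) (act g j)))"
      using act_st[OF st_Cc[OF f] that act_in[OF g j]] by simp
    then show ?case
      using Cons j by (simp add: p cinner_add_right cinner_scaleC_right act_cv st_Cc f g)
  qed simp
  show ?thesis
    using assms(3)
  proof (induction l)
    case (Cons p l)
    obtain c j where p: "p = (c, j)" by fastforce
    then show ?case using Cons 1[of j] by (simp add: cinner_add_left cinner_scaleC_left)
  qed simp
qed

lemma cinner_Psi_acomb:
  assumes f: "f \<in> Cc" and l: "l \<in> combs" and j: "j \<in> I"
  shows "cinner (\<Psi> j) (acomb f l) = cinner (\<Psi> (act (st f) j)) (comb l)"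
  using l
proof (induction l)
  case (Cons p l)
  obtain c i where p: "p = (c, i)" by fastforce
  then show ?case using Cons act_st[OF f j, of i]
    by (simp add: cinner_add_right cinner_scaleC_right)
qed simp

lemma acomb_bound:
  assumes "l \<in> combs"
  shows "\<exists>C. \<forall>f\<in>Cc. norm (acomb f l) \<le> C * nrm f"
  using assms
proof (induction l)
  case (Cons p l)
  obtain c i where p: "p = (c, i)" by fastforce
  then have "i \<in> I" using Cons by auto
  from act_bound[OF this] obtain C where C: "\<forall>f\<in>Cc. norm (\<Psi> (act f i)) \<le> C * nrm f" ..
  obtain D where D: "\<forall>f\<in>Cc. norm (acomb f l) \<le> D * nrm f" using Cons by auto
  have "norm (acomb f (p # l)) \<le> (cmod c * C + D) * nrm f" if "f \<in> Cc" for f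
  proof -
    have "norm (acomb f (p # l)) \<le> cmod c * norm (\<Psi> (act f i)) + norm (acomb f l)"
      unfolding p by (simp add: norm_triangle_le)
    also have "\<dots> \<le> cmod c * (C * nrm f) + D * nrm f"
      using C D that by (intro add_mono mult_left_mono) auto
    finally show ?thesis by (simp add: algebra_simps)
  qed
  then show ?case by blast
qed (auto intro: exI[of _ 0])

text \<open>The spectral radius in the Banach algebra completion bounds the norm in any bounded
  *-representation; this is the elementary form of that argument.\<close>

lemma norm_acomb_le:
  assumes f: "f \<in> Cc" and l: "l \<in> combs"
  shows "norm (acomb f l) \<le> nrm f * norm (comb l)"
proof -
  \<comment> \<open>\<open>h n\<close> is the convolution power of \<open>cv (st f) f\<close> with
    exponent \<open>2 ^ n\<close>. It is self-adjoint, so the squared norm of its action is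
    controlled by the next member.\<close>
  define h where "h = rec_nat (cv (st f) f) (\<lambda>_ g. cv g g)"
  have h: "h 0 = cv (st f) f" "h (Suc n) = cv (h n) (h n)" for n by (simp_all add: h_def)
  have hCc: "h n \<in> Cc" for n by (induction n) (auto simp: h intro!: cv_Cc st_Cc f)
  have hst: "st (h n) = h n" for n
  proof (induction n)
    case 0
    then show ?case unfolding h(1) st_cv[OF st_Cc[OF f] f] by simp
  next
    case (Suc n)
    then show ?case unfolding h(2) st_cv[OF hCc hCc] by simp
  qed
  have hn: "nrm (h n) \<le> ((nrm f)\<^sup>2) ^ (2 ^ n)" for n
  proof (induction n)
    case 0
    then show ?case using nrm_cv[OF st_Cc[OF f] f] by (simp add: h nrm_st power2_eq_square)
  next
    case (Suc n)
    have "nrm (h (Suc n)) \<le> nrm (h n) * nrm (h n)" unfolding h(2) by (rule nrm_cv[OF hCc hCc])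
    also have "\<dots> \<le> ((nrm f)\<^sup>2) ^ (2 ^ n) * ((nrm f)\<^sup>2) ^ (2 ^ n)"
      by (intro mult_mono Suc nrm_nonneg hCc) auto
    finally show ?case by (simp add: power_add[symmetric] mult_2)
  qed
  obtain C0 where C0: "\<forall>f\<in>Cc. norm (acomb f l) \<le> C0 * nrm f" using acomb_bound[OF l] ..
  define C where "C = max 0 C0"
  have C: "norm (acomb g l) \<le> C * nrm g" if "g \<in> Cc" for g
    using C0 that mult_right_mono[OF _ nrm_nonneg[OF that], of C0 C] by (force simp: C_def)
  define a where "a n = norm (acomb (h n) l)" for n
  have sq: "(norm (acomb g l))\<^sup>2 \<le> norm (comb l) * norm (acomb (cv (st g) g) l)" if "g \<in> Cc" for g
  proof -
    have "complex_of_real ((norm (acomb g l))\<^sup>2) = cinner (comb l) (acomb (cv (st g) g) l)"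
      by (simp only: cinner_self[symmetric] cinner_acomb[OF that that l l])
    then have "(norm (acomb g l))\<^sup>2 = cmod (cinner (comb l) (acomb (cv (st g) g) l))"
      by (metis norm_of_real abs_power2 abs_norm_cancel power2_abs abs_of_nonneg zero_le_power2)
    also have "\<dots> \<le> norm (comb l) * norm (acomb (cv (st g) g) l)" by (rule cmod_cinner_le)
    finally show ?thesis .
  qed
  have "a 0 \<le> norm (comb l) * (nrm f)\<^sup>2"
  proof (rule power_iteration_bound)
    show "(a n)\<^sup>2 \<le> norm (comb l) * a (Suc n)" for n
      using sq[OF hCc[of n]] by (simp add: a_def hst h)
    show "a n \<le> C * ((nrm f)\<^sup>2) ^ (2 ^ n)" for n
      unfolding a_def by (rule order_trans[OF C[OF hCc]]) (intro mult_left_mono hn, simp add: C_def)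
  qed (auto simp: a_def)
  then have "(norm (acomb f l))\<^sup>2 \<le> norm (comb l) * (norm (comb l) * (nrm f)\<^sup>2)"
    using order_trans[OF sq[OF f] mult_left_mono[OF _ norm_ge_zero]] by (simp add: a_def h)
  then have "(norm (acomb f l))\<^sup>2 \<le> (nrm f * norm (comb l))\<^sup>2"
    by (simp add: power2_eq_square mult_ac)
  then show ?thesis by (rule power2_le_imp_le) (simp add: nrm_nonneg f)
qed

section \<open>The operators on the closed span and their extension by zero\<close>

definition M :: "ell2 set" where "M = closure (comb ` combs)"

lemma csubspace_combs: "csubspace (comb ` combs)"
  unfolding csubspace_def
proof (intro conjI ballI allI)
  show "0 \<in> comb ` combs" by (rule image_eqI[of _ _ "[]"]) auto
  show "x + y \<in> comb ` combs" if xy: "x \<in> comb ` combs" "y \<in> comb ` combs" for x y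
  proof -
    obtain l l' where l: "l \<in> combs" "x = comb l" "l' \<in> combs" "y = comb l'" using xy by blast
    then have "l @ l' \<in> combs" "x + y = comb (l @ l')" by (simp_all only: append_in_lists_conv comb_simps simp_thms)
    then show ?thesis by blast
  qed
  show "c *\<^sub>C x \<in> comb ` combs" if x: "x \<in> comb ` combs" for c x
  proof -
    obtain l where l: "l \<in> combs" "x = comb l" using x by blast
    from imageI[OF combs_map[OF l(1), of c], of comb] show ?thesis unfolding comb_map l(2) .
  qed
qed

lemma M_csubspace: "csubspace M" unfolding M_def by (rule csubspace_closure[OF csubspace_combs])
lemma M_closed: "closed M" by (simp add: M_def)
lemmas M_closed_under = csubspace_closed_under[OF M_csubspace]

lemma comb_in_M: "l \<in> combs \<Longrightarrow> comb l \<in> M"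
  unfolding M_def by (rule closure_subset[THEN subsetD], rule imageI)

lemma Psi_in_M: "i \<in> I \<Longrightarrow> \<Psi> i \<in> M"
  using comb_in_M[of "[(1, i)]"] by simp

lemma acomb_in_M: "f \<in> Cc \<Longrightarrow> l \<in> combs \<Longrightarrow> acomb f l \<in> M"
proof (induction l)
  case (Cons p l)
  obtain c i where p: "p = (c, i)" by fastforce
  then have "i \<in> I" "acomb f l \<in> M" using Cons by auto
  then show ?case unfolding p acomb_simps
    by (intro M_closed_under(1,2) Psi_in_M act_in Cons.prems(1))
qed (simp add: M_closed_under(4))

lemma orthogonal_zero:
  assumes "w \<in> M" "\<And>j. j \<in> I \<Longrightarrow> cinner (\<Psi> j) w = 0"
  shows "w = 0"
proof -
  have v: "cinner (comb l) w = 0" if "l \<in> combs" for l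
    using that
  proof (induction l)
    case (Cons p l)
    then show ?case using assms(2) by (cases p) (auto simp: cinner_add_left cinner_scaleC_left)
  qed simp
  obtain s where s: "\<And>n. s n \<in> comb ` combs" "s \<longlonglongrightarrow> w"
    using assms(1) unfolding M_def closure_sequential by blast
  have "(\<lambda>n. cinner (s n) w) \<longlonglongrightarrow> cinner w w" by (intro tendsto_cinner s(2) tendsto_const)
  moreover have "cinner (s n) w = 0" for n using s(1)[of n] by (elim imageE) (simp only: v)
  ultimately have "cinner w w = 0" by (simp add: LIMSEQ_const_iff)
  then show ?thesis by (simp add: cinner_self)
qed

text \<open>The operator is described by its inner products with the spanning vectors, as the
  adjoint rule prescribes them. At most one \<open>w\<close> in \<open>M\<close> satisfies these
  conditions, so every algebraic law of the operators can be verified by checking this relation, and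
  that for all \<open>v\<close> in \<open>ell2\<close> at once.\<close>

definition opr :: "('g \<Rightarrow> complex) \<Rightarrow> ell2 \<Rightarrow> ell2 \<Rightarrow> bool" where
  "opr f v w \<longleftrightarrow> w \<in> M \<and> (\<forall>j\<in>I. cinner (\<Psi> j) w = cinner (\<Psi> (act (st f) j)) v)"

lemma opr_unique: "opr f v w \<Longrightarrow> opr f v w' \<Longrightarrow> w = w'"
  using orthogonal_zero[of "w - w'"] M_closed_under(3)[of w w'] by (simp add: opr_def cinner_diff_right)

lemma opr_comb: "f \<in> Cc \<Longrightarrow> l \<in> combs \<Longrightarrow> opr f (comb l) (acomb f l)"
  by (simp add: opr_def acomb_in_M cinner_Psi_acomb)

text \<open>Vectors of \<open>M\<close> are limits of combinations; by \<open>norm_acomb_le\<close>,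
  applied to differences, the images converge and keep the bound.\<close>

lemma opr_M:
  assumes f: "f \<in> Cc" and v: "v \<in> M"
  obtains w where "opr f v w" "norm w \<le> nrm f * norm v"
proof -
  obtain s where s: "\<And>n. s n \<in> comb ` combs" "s \<longlonglongrightarrow> v"
    using v unfolding M_def closure_sequential by blast
  then have "\<forall>n. \<exists>l. l \<in> combs \<and> s n = comb l" by blast
  from choice[OF this] obtain l where l: "\<And>n. l n \<in> combs" "\<And>n. s n = comb (l n)" by blast
  define w where "w n = acomb f (l n)" for n
  have diff: "norm (w m - w n) \<le> nrm f * norm (s m - s n)" for m n
  proof -
    \<comment> \<open>The list stands for the difference of the two combinations.\<close>
    define l' where "l' = l m @ map (\<lambda>(c, i). (- 1 * c, i)) (l n)"
    have "l' \<in> combs" unfolding l'_def using l(1) combs_map by (simp only: append_in_lists_conv)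
    from norm_acomb_le[OF f this] show ?thesis
      by (simp only: l'_def comb_simps acomb_simps comb_map acomb_map scaleC_minus_one w_def l(2)) simp
  qed
  have "Cauchy w"
  proof (rule metric_CauchyI)
    fix e :: real assume e: "0 < e"
    have "0 < e / (nrm f + 1)" using e nrm_nonneg[OF f] by simp
    then obtain k where k: "\<And>m n. m \<ge> k \<Longrightarrow> n \<ge> k \<Longrightarrow> dist (s m) (s n) < e / (nrm f + 1)"
      using metric_CauchyD[OF LIMSEQ_imp_Cauchy[OF s(2)]] by blast
    have "dist (w m) (w n) < e" if "m \<ge> k" "n \<ge> k" for m n
    proof -
      have "dist (w m) (w n) \<le> nrm f * dist (s m) (s n)" using diff by (simp add: dist_norm)
      also have "\<dots> \<le> nrm f * (e / (nrm f + 1))"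
        using k[OF that] nrm_nonneg[OF f] by (intro mult_left_mono) auto
      also have "\<dots> < e" using e nrm_nonneg[OF f] by (simp add: field_simps)
      finally show ?thesis .
    qed
    then show "\<exists>k. \<forall>m\<ge>k. \<forall>n\<ge>k. dist (w m) (w n) < e" by blast
  qed
  then obtain y where y: "w \<longlonglongrightarrow> y" using Cauchy_convergent convergent_def by blast
  have wl: "opr f (s n) (w n)" for n unfolding w_def l(2) by (rule opr_comb[OF f l(1)])
  have "y \<in> M" using y wl M_closed unfolding opr_def by (metis closed_sequentially)
  moreover have "cinner (\<Psi> j) y = cinner (\<Psi> (act (st f) j)) v" if "j \<in> I" for j
  proof -
    have "(\<lambda>n. cinner (\<Psi> j) (w n)) \<longlonglongrightarrow> cinner (\<Psi> j) y" by (intro tendsto_cinner y tendsto_const)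
    moreover have "(\<lambda>n. cinner (\<Psi> (act (st f) j)) (s n)) \<longlonglongrightarrow> cinner (\<Psi> (act (st f) j)) v"
      by (intro tendsto_cinner s(2) tendsto_const)
    moreover have "cinner (\<Psi> j) (w n) = cinner (\<Psi> (act (st f) j)) (s n)" for n
      using wl[of n] that by (simp add: opr_def)
    ultimately show ?thesis by (simp add: LIMSEQ_unique)
  qed
  moreover have "norm y \<le> nrm f * norm v"
  proof (rule LIMSEQ_le)
    show "(\<lambda>n. norm (w n)) \<longlonglongrightarrow> norm y" by (intro tendsto_norm y)
    show "(\<lambda>n. nrm f * norm (s n)) \<longlonglongrightarrow> nrm f * norm v" by (intro tendsto_intros s(2))
    show "\<exists>N. \<forall>n\<ge>N. norm (w n) \<le> nrm f * norm (s n)"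
      using norm_acomb_le[OF f l(1)] by (simp add: w_def l(2))
  qed
  ultimately show ?thesis by (intro that[of y]) (simp_all add: opr_def)
qed

lemma opr_orthogonal:
  assumes "f \<in> Cc" "\<And>m. m \<in> M \<Longrightarrow> cinner m q = 0"
  shows "opr f q 0"
  using assms by (simp add: opr_def M_closed_under(4) Psi_in_M act_in st_Cc)

lemma opr_add: "opr f v w \<Longrightarrow> opr f v' w' \<Longrightarrow> opr f (v + v') (w + w')"
  by (simp add: opr_def M_closed_under(1) cinner_add_right)

lemma opr_scale: "opr f v w \<Longrightarrow> opr f (c *\<^sub>C v) (c *\<^sub>C w)"
  by (simp add: opr_def M_closed_under(2) cinner_scaleC_right)

text \<open>A vector is split into its projection to \<open>M\<close> and an orthogonal part, which
  is sent to zero. This is how a representation on a subspace becomes a possibly degenerate one on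
  all of \<open>ell2\<close>.\<close>

lemma opr_ex:
  assumes f: "f \<in> Cc"
  shows "\<exists>w. opr f v w \<and> norm w \<le> nrm f * norm v"
proof -
  obtain p where p: "p \<in> M" "\<And>m. m \<in> M \<Longrightarrow> cinner m (v - p) = 0"
    using closed_csubspace_projection[OF M_csubspace M_closed] by blast
  obtain w where w: "opr f p w" "norm w \<le> nrm f * norm p" using opr_M[OF f p(1)] .
  have "opr f (p + (v - p)) (w + 0)" by (intro opr_add w(1) opr_orthogonal[OF f p(2)])
  then have "opr f v w" by simp
  have "complex_of_real ((norm p)\<^sup>2) = cinner p v"
    using p(2)[OF p(1)] unfolding cinner_self[symmetric] by (simp add: cinner_diff_right)
  then have "(norm p)\<^sup>2 = cmod (cinner p v)" by (metis norm_of_real abs_of_nonneg zero_le_power2)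
  also have "\<dots> \<le> norm p * norm v" by (rule cmod_cinner_le)
  finally have "norm p \<le> norm v"
    by (cases "norm p = 0") (simp_all add: power2_eq_square)
  then have "nrm f * norm p \<le> nrm f * norm v" by (intro mult_left_mono nrm_nonneg f)
  then show ?thesis using \<open>opr f v w\<close> w(2) order_trans by blast
qed

definition rep :: "('g \<Rightarrow> complex) \<Rightarrow> ell2 \<Rightarrow> ell2" where
  "rep f v = (SOME w. opr f v w \<and> norm w \<le> nrm f * norm v)"

lemma rep_opr: "f \<in> Cc \<Longrightarrow> opr f v (rep f v)" and rep_norm: "f \<in> Cc \<Longrightarrow> norm (rep f v) \<le> nrm f * norm v"
  using someI_ex[OF opr_ex[of f v]] unfolding rep_def by auto

lemma rep_eqI: "f \<in> Cc \<Longrightarrow> opr f v w \<Longrightarrow> rep f v = w"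
  using opr_unique rep_opr by blast

lemma rep_Psi:
  assumes "f \<in> Cc" "i \<in> I"
  shows "rep f (\<Psi> i) = \<Psi> (act f i)"
  using rep_eqI[OF assms(1) opr_comb[OF assms(1), of "[(1, i)]"]] assms(2) by simp

text \<open>The relation \<open>opr\<close> gives the identity for combinations, and continuity
  extends it to \<open>M\<close>. It extends to all vectors because the operators vanish on the
  complement of \<open>M\<close> and have their range in \<open>M\<close>.\<close>

lemma rep_adjoint:
  assumes f: "f \<in> Cc"
  shows "cinner (rep (st f) v) w = cinner v (rep f w)"
proof -
  have comb: "cinner (rep (st f) m) w = cinner m (rep f w)" if m: "m \<in> comb ` combs" for m
  proof -
    obtain l where l: "l \<in> combs" "m = comb l" using m by blast
    have "rep (st f) m = acomb (st f) l" unfolding l(2) by (intro rep_eqI opr_comb st_Cc f l)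
    moreover have "cinner (acomb (st f) l) w = cinner (comb l) (rep f w)"
      using l(1)
    proof (induction l)
      case (Cons p l)
      obtain c i where p: "p = (c, i)" by fastforce
      have "cinner (\<Psi> i) (rep f w) = cinner (\<Psi> (act (st f) i)) w"
        using rep_opr[OF f, of w] Cons p by (simp add: opr_def)
      then show ?case using Cons by (simp add: p cinner_add_left cinner_scaleC_left)
    qed simp
    ultimately show ?thesis using l(2) by simp
  qed
  have inM: "cinner (rep (st f) m) w = cinner m (rep f w)" if m: "m \<in> M" for m
  proof -
    obtain s where s: "\<And>n. s n \<in> comb ` combs" "s \<longlonglongrightarrow> m"
      using m unfolding M_def closure_sequential by blast
    have "(\<lambda>n. rep (st f) (s n)) \<longlonglongrightarrow> rep (st f) m"
    proof (rule LIM_zero_cancel, rule tendsto_norm_zero_cancel, rule tendsto_sandwich[where f = "\<lambda>_. 0"])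
      show "\<forall>\<^sub>F n in sequentially. norm (rep (st f) (s n) - rep (st f) m) \<le> nrm f * norm (s n - m)"
      proof (intro always_eventually allI)
        fix n
        have "opr (st f) (s n + (- 1) *\<^sub>C m) (rep (st f) (s n) + (- 1) *\<^sub>C rep (st f) m)"
          by (intro opr_add opr_scale rep_opr st_Cc f)
        then have "rep (st f) (s n - m) = rep (st f) (s n) - rep (st f) m"
          by (intro rep_eqI st_Cc f) (simp add: scaleC_minus_one)
        then show "norm (rep (st f) (s n) - rep (st f) m) \<le> nrm f * norm (s n - m)"
          using rep_norm[OF st_Cc[OF f], of "s n - m"] by (simp add: nrm_st)
      qed
      have "(\<lambda>n. nrm f * norm (s n - m)) \<longlonglongrightarrow> nrm f * norm (m - m)"
        by (intro tendsto_intros s(2))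
      then show "(\<lambda>n. nrm f * norm (s n - m)) \<longlonglongrightarrow> 0" by simp
    qed auto
    then have "(\<lambda>n. cinner (rep (st f) (s n)) w) \<longlonglongrightarrow> cinner (rep (st f) m) w"
      by (intro tendsto_cinner tendsto_const)
    moreover have "(\<lambda>n. cinner (s n) (rep f w)) \<longlonglongrightarrow> cinner m (rep f w)"
      by (intro tendsto_cinner tendsto_const s(2))
    ultimately show ?thesis using comb[OF s(1)] by (simp add: LIMSEQ_unique)
  qed
  obtain p where p: "p \<in> M" "\<And>m. m \<in> M \<Longrightarrow> cinner m (v - p) = 0"
    using closed_csubspace_projection[OF M_csubspace M_closed] by blast
  have "opr (st f) (p + (v - p)) (rep (st f) p + 0)"
    by (intro opr_add rep_opr opr_orthogonal st_Cc f p(2))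
  then have "rep (st f) v = rep (st f) p" by (intro rep_eqI st_Cc f) simp
  moreover have "cinner (v - p) (rep f w) = 0"
    using p(2)[of "rep f w"] rep_opr[OF f, of w] cinner_commute[of "v - p" "rep f w"] by (simp add: opr_def)
  ultimately show ?thesis using inM[OF p(1)] by (simp add: cinner_diff_left)
qed

lemma rep_in_reps: "rep \<in> reps G lam"
proof -
  have add: "rep f (v + w) = rep f v + rep f w" and scale: "rep f (c *\<^sub>C v) = c *\<^sub>C rep f v"
    if "f \<in> Cc" for f v w c
    by (intro rep_eqI opr_add opr_scale rep_opr that)+
  have bl: "bounded_linear (rep f)" if "f \<in> Cc" for f
  proof (rule bounded_linear_intro[where K = "nrm f"])
    show "rep f (r *\<^sub>R v) = r *\<^sub>R rep f v" for r v
      using scale[OF that, of "complex_of_real r" v] by (simp add: scaleC_of_real)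
  qed (use add that rep_norm in \<open>auto simp: mult.commute\<close>)
  show ?thesis
    unfolding reps_def
  proof (intro CollectI conjI ballI allI)
    fix f :: "'g \<Rightarrow> complex" assume f: "f \<in> Cc"
    show "bounded_clinear (rep f)" unfolding bounded_clinear_def using bl scale f by blast
    show "onorm (rep f) \<le> nrm f" by (rule onorm_bound[OF nrm_nonneg[OF f] rep_norm[OF f]])
    show "cinner (rep (st f) v) w = cinner v (rep f w)" for v w by (rule rep_adjoint[OF f])
    show "rep (\<lambda>x. c * f x) = (\<lambda>v. c *\<^sub>C rep f v)" for c
    proof (rule ext, rule rep_eqI[OF Cc_scale[OF f]])
      fix v
      have "st (\<lambda>x. c * f x) = (\<lambda>x. cnj c * st f x)" by (simp add: star_def fun_eq_iff)
      then show "opr (\<lambda>x. c * f x) v (c *\<^sub>C rep f v)"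
        using rep_opr[OF f, of v]
        by (simp add: opr_def M_closed_under(2) cinner_scaleC_right cinner_scaleC_left act_scale st_Cc f)
    qed
    fix g :: "'g \<Rightarrow> complex" assume g: "g \<in> Cc"
    show "rep (\<lambda>x. f x + g x) = (\<lambda>v. rep f v + rep g v)"
    proof (rule ext, rule rep_eqI[OF Cc_add[OF f g]])
      fix v
      have "st (\<lambda>x. f x + g x) = (\<lambda>x. st f x + st g x)" by (simp add: star_def fun_eq_iff)
      then show "opr (\<lambda>x. f x + g x) v (rep f v + rep g v)"
        using rep_opr[OF f, of v] rep_opr[OF g, of v]
        by (simp add: opr_def M_closed_under(1) cinner_add_right cinner_add_left act_add st_Cc f g)
    qed
    show "rep (cv f g) = rep f \<circ> rep g"
    proof (rule ext, rule rep_eqI[OF cv_Cc[OF f g]])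
      fix v
      show "opr (cv f g) v ((rep f \<circ> rep g) v)"
        using rep_opr[OF f, of "rep g v"] rep_opr[OF g, of v]
        by (simp add: opr_def st_cv[OF f g] act_cv st_Cc f g act_in)
    qed
  qed
qed

end

section \<open>The tensor product of a bundle and a representation\<close>

text \<open>\<open>Pure g a w\<close> stands for \<open>a \<otimes> \<sigma>(g) w\<close> and \<open>Act f a u\<close> for the image of \<open>a \<otimes> u\<close> under
  the tensor product representation of \<open>f\<close>. Since the coefficient \<open>(\<xi>, \<eta>)\<close> is conjugate linear
  in \<open>\<xi>\<close>, it is the conjugate bundle that is used; hence the conjugates in \<open>field\<close>.\<close>

datatype ('g, 'h) idx = Act "'g \<Rightarrow> complex" "'g \<Rightarrow> 'h" ell2 | Pure "'g \<Rightarrow> complex" "'g \<Rightarrow> 'h" ell2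

primrec ivec :: "('g, 'h) idx \<Rightarrow> ell2" where
  "ivec (Act f a u) = u"
| "ivec (Pure g a w) = w"

definition idxs :: "('g::topological_space \<Rightarrow> 'h) set \<Rightarrow> ('g, 'h) idx set" where
  "idxs A = {Act f a u | f a u. f \<in> Cc \<and> a \<in> A} \<union> {Pure g a w | g a w. g \<in> Cc \<and> a \<in> A}"

lemma idxs_simps [simp]: "Act f a u \<in> idxs A \<longleftrightarrow> f \<in> Cc \<and> a \<in> A" "Pure f a u \<in> idxs A \<longleftrightarrow> f \<in> Cc \<and> a \<in> A"
  by (auto simp: idxs_def)

lemma (in haar_groupoid) rep_tendsto:
  assumes \<sigma>: "\<sigma> \<in> reps G lam" and s: "\<And>n. s n \<in> Cc" "f \<in> Cc" "(\<lambda>n. nrm (\<lambda>x. s n x - f x)) \<longlonglongrightarrow> 0"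
    and u: "u \<longlonglongrightarrow> u0" and v: "v \<longlonglongrightarrow> v0"
  shows "(\<lambda>n. cinner (u n) (\<sigma> (s n) (v n))) \<longlonglongrightarrow> cinner u0 (\<sigma> f v0)"
proof (rule tendsto_cinner[OF u])
  have "(\<lambda>n. \<sigma> (s n) (v n) - \<sigma> f v0) \<longlonglongrightarrow> 0"
  proof (rule tendsto_norm_zero_cancel, rule tendsto_sandwich[where f = "\<lambda>_. 0"])
    show "\<forall>\<^sub>F n in sequentially. norm (\<sigma> (s n) (v n) - \<sigma> f v0)
        \<le> nrm (\<lambda>x. s n x - f x) * norm (v n) + nrm f * norm (v n - v0)"
    proof (intro always_eventually allI)
      fix n
      have "\<sigma> (s n) (v n) - \<sigma> f v0 = \<sigma> (\<lambda>x. s n x - f x) (v n) + \<sigma> f (v n - v0)"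
        by (simp add: rep_diff[OF \<sigma> s(1,2)] rep_vdiff[OF \<sigma> s(2)])
      also have "norm \<dots> \<le> nrm (\<lambda>x. s n x - f x) * norm (v n) + nrm f * norm (v n - v0)"
        by (intro norm_triangle_le add_mono rep_norm_le[OF \<sigma>] Cc_diff s)
      finally show "norm (\<sigma> (s n) (v n) - \<sigma> f v0)
        \<le> nrm (\<lambda>x. s n x - f x) * norm (v n) + nrm f * norm (v n - v0)" .
    qed
    have "(\<lambda>n. nrm (\<lambda>x. s n x - f x) * norm (v n) + nrm f * norm (v n - v0)) \<longlonglongrightarrow> 0 * norm v0 + nrm f * norm (v0 - v0)"
      by (intro tendsto_intros s(3) v)
    then show "(\<lambda>n. nrm (\<lambda>x. s n x - f x) * norm (v n) + nrm f * norm (v n - v0)) \<longlonglongrightarrow> 0" by simp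
  qed auto
  then show "(\<lambda>n. \<sigma> (s n) (v n)) \<longlonglongrightarrow> \<sigma> f v0" by (rule LIM_zero_cancel)
qed

context haar_groupoid
begin

section \<open>Convergence in the I-norm and a countable dense set\<close>

definition Clim :: "(nat \<Rightarrow> 'g \<Rightarrow> complex) \<Rightarrow> ('g \<Rightarrow> complex) \<Rightarrow> bool" where
  "Clim s f \<longleftrightarrow> (\<forall>n. s n \<in> Cc) \<and> f \<in> Cc \<and> (\<lambda>n. nrm (\<lambda>x. s n x - f x)) \<longlonglongrightarrow> 0"

lemma ClimI:
  assumes "\<And>n. s n \<in> Cc" "f \<in> Cc" "\<And>n. nrm (\<lambda>x. s n x - f x) \<le> b n" "b \<longlonglongrightarrow> 0"
  shows "Clim s f"
  unfolding Clim_def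
proof (intro conjI allI assms(1,2))
  show "(\<lambda>n. nrm (\<lambda>x. s n x - f x)) \<longlonglongrightarrow> 0"
    by (rule tendsto_sandwich[OF _ _ tendsto_const assms(4)])
      (intro always_eventually allI nrm_nonneg Cc_diff assms)+
qed

lemma ClimD: "Clim s f \<Longrightarrow> s n \<in> Cc" "Clim s f \<Longrightarrow> f \<in> Cc" "Clim s f \<Longrightarrow> (\<lambda>n. nrm (\<lambda>x. s n x - f x)) \<longlonglongrightarrow> 0"
  by (auto simp: Clim_def)

lemma nrm_zero [simp]: "nrm (\<lambda>_. 0) = 0"
  using nrm_le[OF Cc_zero Cc_zero, of 0] nrm_nonneg[OF Cc_zero] by simp

lemma Clim_const: "f \<in> Cc \<Longrightarrow> Clim (\<lambda>_. f) f"
  by (rule ClimI[where b = "\<lambda>_. 0"]) auto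

lemma Clim_st:
  assumes "Clim s f"
  shows "Clim (\<lambda>n. st (s n)) (st f)"
proof -
  have "(\<lambda>x. st (s n) x - st f x) = st (\<lambda>x. s n x - f x)" for n by (simp add: star_def fun_eq_iff)
  then show ?thesis using ClimD[OF assms] by (simp add: Clim_def st_Cc nrm_st)
qed

lemma Clim_mult:
  assumes "Clim s f" "continuous_on UNIV m" "\<And>x. cmod (m x) \<le> B"
  shows "Clim (\<lambda>n x. m x * s n x) (\<lambda>x. m x * f x)"
proof (rule ClimI)
  note C = ClimD[OF assms(1)]
  have B: "0 \<le> B" using assms(3) norm_ge_zero order_trans by blast
  show "(\<lambda>x. m x * s n x) \<in> Cc" "(\<lambda>x. m x * f x) \<in> Cc" for n by (intro Cc_mult C assms(2))+
  show "nrm (\<lambda>x. m x * s n x - m x * f x) \<le> B * nrm (\<lambda>x. s n x - f x)" for n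
    unfolding right_diff_distrib[symmetric]
    by (intro nrm_le Cc_mult Cc_diff C assms(2) B) (simp add: norm_mult mult_right_mono assms(3))
  show "(\<lambda>n. B * nrm (\<lambda>x. s n x - f x)) \<longlonglongrightarrow> 0"
    using tendsto_mult_right_zero[OF C(3), of B] by simp
qed

lemma Clim_cv:
  assumes "Clim s f" "Clim t g"
  shows "Clim (\<lambda>n. cv (s n) (t n)) (cv f g)"
proof (rule ClimI)
  note C = ClimD[OF assms(1)] and D = ClimD[OF assms(2)]
  show "cv (s n) (t n) \<in> Cc" "cv f g \<in> Cc" for n by (intro cv_Cc C D)+
  let ?d = "\<lambda>n x. s n x - f x" and ?e = "\<lambda>n x. t n x - g x"
  show "nrm (\<lambda>x. cv (s n) (t n) x - cv f g x)
      \<le> nrm (?d n) * nrm (?e n) + nrm (?d n) * nrm g + nrm f * nrm (?e n)" for n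
  proof -
    have d: "?d n \<in> Cc" "?e n \<in> Cc" by (intro Cc_diff C D)+
    have 1: "cv (?d n) (?e n) = (\<lambda>x. cv (?d n) (t n) x - cv (?d n) g x)"
      by (rule cv_diff_right[OF D(1,2) d(1)])
    have 2: "cv (?d n) (t n) = (\<lambda>x. cv (s n) (t n) x - cv f (t n) x)"
      by (rule cv_diff_left[OF C(1,2) D(1)])
    have 3: "cv f (?e n) = (\<lambda>x. cv f (t n) x - cv f g x)"
      by (rule cv_diff_right[OF D(1,2) C(2)])
    have eq: "(\<lambda>x. cv (s n) (t n) x - cv f g x) = (\<lambda>x. (cv (?d n) (?e n) x + cv (?d n) g x) + cv f (?e n) x)"
      by (rule ext) (simp only: fun_cong[OF 1] fun_cong[OF 2] fun_cong[OF 3], simp)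
    have "nrm (\<lambda>x. (cv (?d n) (?e n) x + cv (?d n) g x) + cv f (?e n) x)
        \<le> nrm (\<lambda>x. cv (?d n) (?e n) x + cv (?d n) g x) + nrm (cv f (?e n))"
      by (rule nrm_triangle) (intro Cc_add cv_Cc d C(2) D(2))+
    moreover have "nrm (\<lambda>x. cv (?d n) (?e n) x + cv (?d n) g x) \<le> nrm (cv (?d n) (?e n)) + nrm (cv (?d n) g)"
      by (rule nrm_triangle) (intro cv_Cc d D(2))+
    moreover have "nrm (cv (?d n) (?e n)) \<le> nrm (?d n) * nrm (?e n)" by (rule nrm_cv[OF d])
    moreover have "nrm (cv (?d n) g) \<le> nrm (?d n) * nrm g" by (rule nrm_cv[OF d(1) D(2)])
    moreover have "nrm (cv f (?e n)) \<le> nrm f * nrm (?e n)" by (rule nrm_cv[OF C(2) d(2)])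
    ultimately show ?thesis unfolding eq by linarith
  qed
  have "(\<lambda>n. nrm (?d n) * nrm (?e n) + nrm (?d n) * nrm g + nrm f * nrm (?e n)) \<longlonglongrightarrow> 0 * 0 + 0 * nrm g + nrm f * 0"
    by (intro tendsto_intros C(3) D(3))
  then show "(\<lambda>n. nrm (?d n) * nrm (?e n) + nrm (?d n) * nrm g + nrm f * nrm (?e n)) \<longlonglongrightarrow> 0" by simp
qed

text \<open>Uniform convergence with a common compact set \<open>K\<close> implies convergence in
  the I-norm, since the difference is dominated by \<open>1 / Suc n\<close> times a fixed function
  in \<open>Cc\<close> that is 1 on \<open>K\<close>.\<close>

lemma Clim_separable:
  obtains D where "countable D" "D \<subseteq> Cc" "\<forall>f\<in>Cc. \<exists>s. (\<forall>n. s n \<in> D) \<and> Clim s f"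
proof -
  obtain D :: "('g \<Rightarrow> complex) set" where D: "countable D" "D \<subseteq> Cc"
    "\<forall>f\<in>Cc. \<exists>K. compact K \<and> (\<forall>e>0. \<exists>d\<in>D. (\<forall>x. cmod (f x - d x) \<le> e) \<and> (\<forall>x. x \<notin> K \<longrightarrow> f x = d x))"
    by (rule Cc_separable[OF lc])
  have "\<forall>f\<in>Cc. \<exists>s. (\<forall>n. s n \<in> D) \<and> Clim s f"
  proof (rule ballI)
    fix f :: "'g \<Rightarrow> complex" assume f: "f \<in> Cc"
    obtain K where K: "compact K"
      "\<forall>e>0. \<exists>d\<in>D. (\<forall>x. cmod (f x - d x) \<le> e) \<and> (\<forall>x. x \<notin> K \<longrightarrow> f x = d x)" using D(3)[THEN bspec, OF f] by (elim exE conjE)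
    obtain \<kappa> :: "'g \<Rightarrow> real" where \<kappa>: "\<And>x. 0 \<le> \<kappa> x" "\<And>x. x \<in> K \<Longrightarrow> \<kappa> x = 1"
      "(\<lambda>x. complex_of_real (\<kappa> x)) \<in> Cc"
      by (rule Cc_bump[OF lc K(1) open_UNIV subset_UNIV]) blast
    have "\<forall>n. \<exists>d. d \<in> D \<and> (\<forall>x. cmod (f x - d x) \<le> 1 / Suc n) \<and> (\<forall>x. x \<notin> K \<longrightarrow> f x = d x)"
    proof
      fix n
      have "0 < 1 / real (Suc n)" by simp
      from K(2)[rule_format, OF this]
      show "\<exists>d. d \<in> D \<and> (\<forall>x. cmod (f x - d x) \<le> 1 / Suc n) \<and> (\<forall>x. x \<notin> K \<longrightarrow> f x = d x)" by blast
    qed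
    from choice[OF this] obtain s where "\<forall>n. s n \<in> D \<and> (\<forall>x. cmod (f x - s n x) \<le> 1 / Suc n) \<and> (\<forall>x. x \<notin> K \<longrightarrow> f x = s n x)" ..
    then have s: "s n \<in> D" "cmod (f x - s n x) \<le> 1 / Suc n" "x \<notin> K \<Longrightarrow> f x = s n x" for n x by auto
    have sC: "s n \<in> Cc" for n using s(1) D(2) by blast
    have "Clim s f"
    proof (rule ClimI[OF sC f, where b = "\<lambda>n. 1 / Suc n * nrm (\<lambda>x. complex_of_real (\<kappa> x))"])
      show "nrm (\<lambda>x. s n x - f x) \<le> 1 / Suc n * nrm (\<lambda>x. complex_of_real (\<kappa> x))" for n
      proof (rule nrm_le[OF Cc_diff[OF sC f] \<kappa>(3)])
        fix x
        show "cmod (s n x - f x) \<le> 1 / Suc n * cmod (complex_of_real (\<kappa> x))"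
        proof (cases "x \<in> K")
          case True
          then show ?thesis using s(2)[of x n] \<kappa>(2)[OF True] by (simp add: norm_minus_commute)
        next
          case False
          then show ?thesis using s(3)[of x n] by simp
        qed
      qed simp
      have "(\<lambda>n. 1 / Suc n * nrm (\<lambda>x. complex_of_real (\<kappa> x))) \<longlonglongrightarrow> 0 * nrm (\<lambda>x. complex_of_real (\<kappa> x))"
        by (intro tendsto_mult tendsto_const LIMSEQ_inverse_real_of_nat[unfolded inverse_eq_divide])
      then show "(\<lambda>n. 1 / Suc n * nrm (\<lambda>x. complex_of_real (\<kappa> x))) \<longlonglongrightarrow> 0" by simp
    qed
    then show "\<exists>s. (\<forall>n. s n \<in> D) \<and> Clim s f" using s(1) by (intro exI[of _ s] conjI allI)
  qed
  then show ?thesis by (rule that[OF D(1,2)])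
qed

end

context coefficient_bundle
begin

text \<open>The coefficient of the pair \<open>b\<close>, \<open>a\<close>. The exchange puts the
  section of the first kernel index first, as in the inner product of the conjugate bundle.\<close>

definition cf :: "('g \<Rightarrow> 'h) \<Rightarrow> ('g \<Rightarrow> 'h) \<Rightarrow> 'g \<Rightarrow> complex" where
  "cf a b x = cinner (L x (b (src x))) (a (rng x))"

definition ip :: "('g \<Rightarrow> 'h) \<Rightarrow> ('g \<Rightarrow> 'h) \<Rightarrow> 'g \<Rightarrow> complex" where
  "ip a b z = cinner (b (rng z)) (a (rng z))"

primrec field :: "('g, 'h) idx \<Rightarrow> 'g \<Rightarrow> 'h" where
  "field (Act f a u) = (\<lambda>z. cnj (f z) *\<^sub>C L z (a (src z)))"
| "field (Pure g a w) = (\<lambda>z. cnj (g z) *\<^sub>C a (rng z))"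

lemma bsection_in: "a \<in> \<Gamma>b \<Longrightarrow> u \<in> units G \<Longrightarrow> a u \<in> H u"
  by (rule section_in[OF bounded_sectionD])

lemma cf_coefficient: "cf a b = coefficient G L b a"
  by (rule ext) (simp only: cf_def coefficient_def)

lemma cf_continuous: "a \<in> \<Gamma>b \<Longrightarrow> b \<in> \<Gamma>b \<Longrightarrow> continuous_on UNIV (cf a b)"
  unfolding cf_coefficient by (rule L_continuous)

lemma cf_bound:
  assumes "a \<in> \<Gamma>b" "b \<in> \<Gamma>b"
  shows "cmod (cf a b x) \<le> section_norm (units G) a * section_norm (units G) b"
proof -
  have "cmod (cf a b x) \<le> norm (L x (b (src x))) * norm (a (rng x))"
    unfolding cf_def by (rule cmod_cinner_le)
  also have "norm (L x (b (src x))) = norm (b (src x))"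
    by (rule L_norm) (simp add: bsection_in assms)
  also have "norm (b (src x)) * norm (a (rng x)) \<le> section_norm (units G) b * section_norm (units G) a"
    by (intro mult_mono section_norm_bound section_norm_nonneg assms) auto
  finally show ?thesis by (simp add: mult.commute)
qed

lemma ip_continuous: "a \<in> \<Gamma>b \<Longrightarrow> b \<in> \<Gamma>b \<Longrightarrow> continuous_on UNIV (ip a b)"
  unfolding ip_def[abs_def]
  by (rule continuous_on_units_comp(1)[OF section_cinner_continuous[OF bounded_sectionD bounded_sectionD]])

lemma ip_bound:
  assumes "a \<in> \<Gamma>b" "b \<in> \<Gamma>b"
  shows "cmod (ip a b x) \<le> section_norm (units G) a * section_norm (units G) b"
proof -
  have "cmod (ip a b x) \<le> norm (b (rng x)) * norm (a (rng x))"
    unfolding ip_def by (rule cmod_cinner_le)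
  also have "\<dots> \<le> section_norm (units G) b * section_norm (units G) a"
    by (intro mult_mono section_norm_bound section_norm_nonneg assms) auto
  finally show ?thesis by (simp add: mult.commute)
qed

text \<open>The norm of a difference is recovered from the norms of both terms and their inner
  product. For \<open>Act\<close> the norm is continuous because \<open>L z\<close> is isometric,
  and the inner product is, up to a scalar function, a coefficient.\<close>

lemma field_CcI:
  assumes i: "i \<in> idxs \<Gamma>b"
  shows "field_Cc (field i)"
proof -
  have sq: "(norm (x - y))\<^sup>2 = (norm x)\<^sup>2 - 2 * Re (cinner x y) + (norm y)\<^sup>2" for x y :: 'h
    by (simp add: Re_cinner power2_norm_eq_inner inner_diff_left inner_diff_right inner_commute)
  have cont: "continuous_on UNIV (\<lambda>z. norm (F z - b (rng z)))"
    if "continuous_on UNIV (\<lambda>z. norm (F z))" "continuous_on UNIV (\<lambda>z. cinner (F z) (b (rng z)))" "b \<in> \<Gamma>b"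
    for F :: "'g \<Rightarrow> 'h" and b
  proof -
    have "continuous_on UNIV (\<lambda>z. norm (b (rng z)))"
      by (rule continuous_on_units_comp(1)[OF section_norm_continuous[OF bounded_sectionD[OF that(3)]]])
    then have "continuous_on UNIV (\<lambda>z. sqrt ((norm (F z))\<^sup>2 - 2 * Re (cinner (F z) (b (rng z))) + (norm (b (rng z)))\<^sup>2))"
      by (intro continuous_on_real_sqrt continuous_on_add continuous_on_diff continuous_on_mult
          continuous_on_power continuous_on_Re continuous_on_const that)
    moreover have "sqrt ((norm (F z))\<^sup>2 - 2 * Re (cinner (F z) (b (rng z))) + (norm (b (rng z)))\<^sup>2) = norm (F z - b (rng z))" for z
      by (simp add: sq[symmetric])
    ultimately show ?thesis by simp
  qed
  show ?thesis
  proof (cases i)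
    case (Act f a u)
    then have f: "f \<in> Cc" and a: "a \<in> \<Gamma>b" using i by simp_all
    obtain K where K: "compact K" "\<And>x. x \<notin> K \<Longrightarrow> f x = 0" using f by (rule CcE) blast
    have La: "L z (a (src z)) \<in> H (rng z)" for z by (intro L_in bsection_in a src_units)
    have "norm (field i z) = cmod (f z) * norm (a (src z))" for z
      using L_norm[OF bsection_in[OF a src_units], of z] by (simp add: Act)
    moreover have "continuous_on UNIV (\<lambda>z. cmod (f z) * norm (a (src z)))"
      by (intro continuous_on_mult continuous_on_norm Cc_continuous f
          continuous_on_units_comp(2)[OF section_norm_continuous[OF bounded_sectionD[OF a]]])
    ultimately have 1: "continuous_on UNIV (\<lambda>z. norm (field i z))" by simp
    have 2: "continuous_on UNIV (\<lambda>z. cinner (field i z) (b (rng z)))" if "b \<in> \<Gamma>b" for b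
      using continuous_on_mult[OF Cc_continuous[OF f] cf_continuous[OF that a]]
      by (simp add: Act cinner_scaleC_left cf_def)
    show ?thesis
      unfolding field_Cc_def
    proof (intro conjI allI ballI exI[of _ K])
      show "field i z \<in> H (rng z)" for z
        using La by (simp add: Act H_closed)
      show "continuous_on UNIV (\<lambda>z. norm (field i z - b (rng z)))" if "b \<in> \<Gamma>b" for b
        by (rule cont[OF 1 2[OF that] that])
    qed (use K in \<open>auto simp: Act\<close>)
  next
    case (Pure g a w)
    then have g: "g \<in> Cc" and a: "a \<in> \<Gamma>b" using i by simp_all
    obtain K where K: "compact K" "\<And>x. x \<notin> K \<Longrightarrow> g x = 0" using g by (rule CcE) blast
    have "norm (field i z) = cmod (g z) * norm (a (rng z))" for z
      by (simp add: Pure)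
    moreover have "continuous_on UNIV (\<lambda>z. cmod (g z) * norm (a (rng z)))"
      by (intro continuous_on_mult continuous_on_norm Cc_continuous g
          continuous_on_units_comp(1)[OF section_norm_continuous[OF bounded_sectionD[OF a]]])
    ultimately have 1: "continuous_on UNIV (\<lambda>z. norm (field i z))" by simp
    have 2: "continuous_on UNIV (\<lambda>z. cinner (field i z) (b (rng z)))" if "b \<in> \<Gamma>b" for b
      using continuous_on_mult[OF Cc_continuous[OF g] ip_continuous[OF that a]]
      by (simp add: Pure cinner_scaleC_left ip_def)
    show ?thesis
      unfolding field_Cc_def
    proof (intro conjI allI ballI exI[of _ K])
      show "field i z \<in> H (rng z)" for z
        using bsection_in[OF a rng_units] by (simp add: Pure H_closed)
      show "continuous_on UNIV (\<lambda>z. norm (field i z - b (rng z)))" if "b \<in> \<Gamma>b" for b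
        by (rule cont[OF 1 2[OF that] that])
    qed (use K in \<open>auto simp: Pure\<close>)
  qed
qed

text \<open>In the first identity both sections are translated and \<open>L (iv y)\<close> cancels
  by isometry, so the coefficient depends on \<open>x\<close> only and can leave the integral over
  \<open>y\<close>. In the last one \<open>L y\<close> is applied to both entries to bring the
  translation onto \<open>b\<close>.\<close>

lemma field_cinner:
  assumes a: "a \<in> \<Gamma>b" and b: "b \<in> \<Gamma>b" and y: "rng y = rng x"
  shows "cinner (field (Act f' b u') (iv y \<cdot> x)) (field (Act f a u) (iv y)) = cf a b x * (st f y * f' (iv y \<cdot> x))"
    "cinner (field (Pure g' b w') (iv y \<cdot> x)) (field (Pure g a w) (iv y)) = st g y * (ip a b (iv y \<cdot> x) * g' (iv y \<cdot> x))"
    "cinner (field (Act f' b u') (iv y \<cdot> x)) (field (Pure g a w) (iv y)) = st g y * (cf a b (iv y \<cdot> x) * f' (iv y \<cdot> x))"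
    "cinner (field (Pure g' b w') (iv y \<cdot> x)) (field (Act f a u) (iv y)) = (cf a b y * st f y) * g' (iv y \<cdot> x)"
proof -
  have ax: "a (rng x) \<in> H (rng x)" "b (src x) \<in> H (src x)" "b (src y) \<in> H (src y)" "L x (b (src x)) \<in> H (rng x)"
    by (intro bsection_in a b src_units rng_units L_in)+
  have "L (iv y \<cdot> x) (b (src x)) = L (iv y) (L x (b (src x)))"
    using y ax(2) by (intro L_mul) simp_all
  then have "cinner (L (iv y \<cdot> x) (b (src x))) (L (iv y) (a (rng x))) = cf a b x"
    using L_cinner[of "L x (b (src x))" "iv y" "a (rng x)"] ax y by (simp add: cf_def)
  then show "cinner (field (Act f' b u') (iv y \<cdot> x)) (field (Act f a u) (iv y)) = cf a b x * (st f y * f' (iv y \<cdot> x))"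
    using y by (simp add: cinner_scaleC_left cinner_scaleC_right star_def mult_ac)
  show "cinner (field (Pure g' b w') (iv y \<cdot> x)) (field (Pure g a w) (iv y)) = st g y * (ip a b (iv y \<cdot> x) * g' (iv y \<cdot> x))"
    using y by (simp add: cinner_scaleC_left cinner_scaleC_right star_def ip_def mult_ac)
  show "cinner (field (Act f' b u') (iv y \<cdot> x)) (field (Pure g a w) (iv y)) = st g y * (cf a b (iv y \<cdot> x) * f' (iv y \<cdot> x))"
    using y by (simp add: cinner_scaleC_left cinner_scaleC_right star_def cf_def mult_ac)
  have "L (iv y) (a (rng y)) \<in> H (src y)"
    using L_in[of "a (rng y)" "iv y"] bsection_in[OF a rng_units] by simp
  then have "cinner (b (src y)) (L (iv y) (a (rng y))) = cinner (L y (b (src y))) (L y (L (iv y) (a (rng y))))"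
    using L_cinner[of "b (src y)" y] ax(3) by simp
  also have "L y (L (iv y) (a (rng y))) = a (rng y)"
    using L_iv[of "a (rng y)" "iv y"] bsection_in[OF a rng_units] by simp
  finally show "cinner (field (Pure g' b w') (iv y \<cdot> x)) (field (Act f a u) (iv y)) = (cf a b y * st f y) * g' (iv y \<cdot> x)"
    using y by (simp add: cinner_scaleC_left cinner_scaleC_right star_def cf_def mult_ac)
qed

text \<open>The third identity is the source of the multiplier: between \<open>Pure\<close> and
  \<open>Act\<close> the function \<open>f'\<close> enters multiplied by the coefficient.\<close>

lemma gram_field:
  assumes "a \<in> \<Gamma>b" "b \<in> \<Gamma>b"
  shows "gram (field (Act f a u)) (field (Act f' b u')) = (\<lambda>x. cf a b x * cv (st f) f' x)"
    "gram (field (Pure g a w)) (field (Pure g' b w')) = cv (st g) (\<lambda>x. ip a b x * g' x)"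
    "gram (field (Pure g a w)) (field (Act f' b u')) = cv (st g) (\<lambda>x. cf a b x * f' x)"
    "gram (field (Act f a u)) (field (Pure g' b w')) = cv (\<lambda>x. cf a b x * st f x) g'"
  by (simp_all add: fun_eq_iff gram_def cv_fint fint_mult[symmetric] field_cinner[OF assms] del: field.simps cong: fint_cong)

lemma
  assumes i: "i \<in> idxs \<Gamma>b" and j: "j \<in> idxs \<Gamma>b"
  shows gram_Cc: "gram (field i) (field j) \<in> Cc"
    and gram_integrand: "fibre_Cc (rng x) (\<lambda>y. cinner (field j (iv y \<cdot> x)) (field i (iv y)))"
proof -
  have "gram (field i) (field j) \<in> Cc \<and> fibre_Cc (rng x) (\<lambda>y. cinner (field j (iv y \<cdot> x)) (field i (iv y)))"
  proof (cases i; cases j)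
    fix f a u f' b u' assume ij: "i = Act f a u" "j = Act f' b u'"
    then have *: "f \<in> Cc" "a \<in> \<Gamma>b" "f' \<in> Cc" "b \<in> \<Gamma>b" using i j by simp_all
    have "fibre_Cc (rng x) (\<lambda>y. cf a b x * (st f y * f' (iv y \<cdot> x)))"
      by (intro fibre_Cc_mult fibre_Cc_cv st_Cc * refl continuous_on_const)
    then have "fibre_Cc (rng x) (\<lambda>y. cinner (field j (iv y \<cdot> x)) (field i (iv y)))"
      unfolding ij by (rule fibre_Cc_cong) (rule field_cinner[OF *(2,4)])
    then show ?thesis unfolding ij gram_field[OF *(2,4)]
      by (intro conjI Cc_mult cv_Cc st_Cc cf_continuous *)
  next
    fix g a w f' b u' assume ij: "i = Pure g a w" "j = Act f' b u'"
    then have *: "g \<in> Cc" "a \<in> \<Gamma>b" "f' \<in> Cc" "b \<in> \<Gamma>b" using i j by simp_all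
    have c: "(\<lambda>x. cf a b x * f' x) \<in> Cc" by (intro Cc_mult cf_continuous *)
    have "fibre_Cc (rng x) (\<lambda>y. st g y * (cf a b (iv y \<cdot> x) * f' (iv y \<cdot> x)))"
      using fibre_Cc_cv[OF st_Cc[OF *(1)] c refl] .
    then have "fibre_Cc (rng x) (\<lambda>y. cinner (field j (iv y \<cdot> x)) (field i (iv y)))"
      unfolding ij by (rule fibre_Cc_cong) (rule field_cinner[OF *(2,4)])
    then show ?thesis unfolding ij gram_field[OF *(2,4)]
      by (intro conjI c cv_Cc st_Cc *)
  next
    fix f a u g' b w' assume ij: "i = Act f a u" "j = Pure g' b w'"
    then have *: "f \<in> Cc" "a \<in> \<Gamma>b" "g' \<in> Cc" "b \<in> \<Gamma>b" using i j by simp_all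
    have c: "(\<lambda>x. cf a b x * st f x) \<in> Cc" by (intro Cc_mult cf_continuous st_Cc *)
    have "fibre_Cc (rng x) (\<lambda>y. (cf a b y * st f y) * g' (iv y \<cdot> x))"
      using fibre_Cc_cv[OF c *(3) refl] .
    then have "fibre_Cc (rng x) (\<lambda>y. cinner (field j (iv y \<cdot> x)) (field i (iv y)))"
      unfolding ij by (rule fibre_Cc_cong) (rule field_cinner[OF *(2,4)])
    then show ?thesis unfolding ij gram_field[OF *(2,4)]
      by (intro conjI c cv_Cc *)
  next
    fix g a w g' b w' assume ij: "i = Pure g a w" "j = Pure g' b w'"
    then have *: "g \<in> Cc" "a \<in> \<Gamma>b" "g' \<in> Cc" "b \<in> \<Gamma>b" using i j by simp_all
    have c: "(\<lambda>x. ip a b x * g' x) \<in> Cc" by (intro Cc_mult ip_continuous *)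
    have "fibre_Cc (rng x) (\<lambda>y. st g y * (ip a b (iv y \<cdot> x) * g' (iv y \<cdot> x)))"
      using fibre_Cc_cv[OF st_Cc[OF *(1)] c refl] .
    then have "fibre_Cc (rng x) (\<lambda>y. cinner (field j (iv y \<cdot> x)) (field i (iv y)))"
      unfolding ij by (rule fibre_Cc_cong) (rule field_cinner[OF *(2,4)])
    then show ?thesis unfolding ij gram_field[OF *(2,4)]
      by (intro conjI c cv_Cc st_Cc *)
  qed
  then show "gram (field i) (field j) \<in> Cc" "fibre_Cc (rng x) (\<lambda>y. cinner (field j (iv y \<cdot> x)) (field i (iv y)))"
    by auto
qed

lemma st_gram:
  assumes i: "i \<in> idxs \<Gamma>b" and j: "j \<in> idxs \<Gamma>b"
  shows "st (gram (field i) (field j)) = gram (field j) (field i)"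
proof
  fix x
  have "gram (field j) (field i) x = fint (src x) (\<lambda>y. cinner (field i (iv (x \<cdot> y) \<cdot> x)) (field j (iv (x \<cdot> y))))"
    unfolding gram_def by (rule fint_left_mult[OF gram_integrand[OF j i], symmetric])
  also have "\<dots> = fint (src x) (\<lambda>y. cnj (cinner (field j (iv y \<cdot> iv x)) (field i (iv y))))"
  proof (rule fint_cong)
    fix y assume y: "rng y = src x"
    then have "iv (x \<cdot> y) \<cdot> x = iv y" using mul_assoc[of "iv y" "iv x" x] mul_units(2)[of "iv y"] by (simp add: iv_mul)
    then show "cinner (field i (iv (x \<cdot> y) \<cdot> x)) (field j (iv (x \<cdot> y))) = cnj (cinner (field j (iv y \<cdot> iv x)) (field i (iv y)))"
      using y by (simp add: iv_mul cinner_commute[symmetric])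
  qed
  also have "\<dots> = st (gram (field i) (field j)) x" by (simp only: star_def gram_def fint_cnj src_rng)
  finally show "st (gram (field i) (field j)) x = gram (field j) (field i) x" ..
qed

text \<open>The inner product of an interior tensor product,
  \<open><F \<otimes> u, F' \<otimes> u'> = <u, \<sigma>(<F, F'>) u'>\<close>, where
  \<open>gram\<close> is the inner product with values in the algebra.\<close>

definition kern :: "'g rep \<Rightarrow> ('g, 'h) idx \<Rightarrow> ('g, 'h) idx \<Rightarrow> complex" where
  "kern \<sigma> i j = cinner (ivec i) (\<sigma> (gram (field i) (field j)) (ivec j))"

text \<open>The scalars are absorbed into the vectors \<open>ivec\<close>, which turns the quadratic
  form into the one of \<open>gram_positive\<close>.\<close>

lemma pos_kernel_kern:
  assumes \<sigma>: "\<sigma> \<in> reps G lam"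
  shows "pos_kernel (idxs \<Gamma>b) (kern \<sigma>)"
  unfolding pos_kernel_def
proof (intro conjI allI impI ballI)
  fix i j assume ij: "i \<in> idxs \<Gamma>b" "j \<in> idxs \<Gamma>b"
  show "kern \<sigma> j i = cnj (kern \<sigma> i j)"
    unfolding kern_def st_gram[OF ij, symmetric] rep_st'[OF \<sigma> gram_Cc[OF ij]] by (rule cinner_commute)
next
  fix N :: nat and x :: "nat \<Rightarrow> ('g, 'h) idx" and c :: "nat \<Rightarrow> complex"
  assume x: "\<forall>m<N. x m \<in> idxs \<Gamma>b"
  have "0 \<le> Re (\<Sum>m<N. \<Sum>n<N. cinner (c m *\<^sub>C ivec (x m)) (\<sigma> (gram (field (x m)) (field (x n))) (c n *\<^sub>C ivec (x n))))"
    by (rule gram_positive[OF \<sigma>]) (use x in \<open>auto intro: field_CcI gram_Cc gram_integrand\<close>)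
  also have "(\<Sum>m<N. \<Sum>n<N. cinner (c m *\<^sub>C ivec (x m)) (\<sigma> (gram (field (x m)) (field (x n))) (c n *\<^sub>C ivec (x n))))
      = (\<Sum>m<N. \<Sum>n<N. cnj (c m) * c n * kern \<sigma> (x m) (x n))"
    using x by (intro sum.cong refl)
      (simp add: rep_vscale[OF \<sigma> gram_Cc] cinner_scaleC_left cinner_scaleC_right kern_def mult.assoc)
  finally show "0 \<le> Re (\<Sum>m<N. \<Sum>n<N. cnj (c m) * c n * kern \<sigma> (x m) (x n))" .
qed

lemma kern_simps:
  assumes "a \<in> \<Gamma>b" "b \<in> \<Gamma>b"
  shows "kern \<sigma> (Act f a u) (Act f' b u') = cinner u (\<sigma> (\<lambda>x. cf a b x * cv (st f) f' x) u')"
    "kern \<sigma> (Pure g a w) (Pure g' b w') = cinner w (\<sigma> (cv (st g) (\<lambda>x. ip a b x * g' x)) w')"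
    "kern \<sigma> (Pure g a w) (Act f' b u') = cinner w (\<sigma> (cv (st g) (\<lambda>x. cf a b x * f' x)) u')"
    "kern \<sigma> (Act f a u) (Pure g' b w') = cinner u (\<sigma> (cv (\<lambda>x. cf a b x * st f x) g') w')"
  unfolding kern_def by (simp_all only: gram_field[OF assms] ivec.simps)

lemma kern_tendsto:
  assumes \<sigma>: "\<sigma> \<in> reps G lam" and a: "a \<in> \<Gamma>b"
    and s: "Clim s f" "Clim s' f" and v: "v \<longlonglongrightarrow> u" "v' \<longlonglongrightarrow> u"
  shows "(\<lambda>n. kern \<sigma> (Act (s n) a (v n)) (Act (s' n) a (v' n))) \<longlonglongrightarrow> kern \<sigma> (Act f a u) (Act f a u)"
    "(\<lambda>n. kern \<sigma> (Pure (s n) a (v n)) (Pure (s' n) a (v' n))) \<longlonglongrightarrow> kern \<sigma> (Pure f a u) (Pure f a u)"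
proof -
  have 1: "Clim (\<lambda>n x. cf a a x * cv (st (s n)) (s' n) x) (\<lambda>x. cf a a x * cv (st f) f x)"
    by (rule Clim_mult[OF Clim_cv[OF Clim_st[OF s(1)] s(2)] cf_continuous[OF a a] cf_bound[OF a a]])
  have 2: "Clim (\<lambda>n. cv (st (s n)) (\<lambda>x. ip a a x * s' n x)) (cv (st f) (\<lambda>x. ip a a x * f x))"
    by (rule Clim_cv[OF Clim_st[OF s(1)] Clim_mult[OF s(2) ip_continuous[OF a a] ip_bound[OF a a]]])
  show "(\<lambda>n. kern \<sigma> (Act (s n) a (v n)) (Act (s' n) a (v' n))) \<longlonglongrightarrow> kern \<sigma> (Act f a u) (Act f a u)"
    unfolding kern_simps[OF a a] by (rule rep_tendsto[OF \<sigma> ClimD[OF 1] v])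
  show "(\<lambda>n. kern \<sigma> (Pure (s n) a (v n)) (Pure (s' n) a (v' n))) \<longlonglongrightarrow> kern \<sigma> (Pure f a u) (Pure f a u)"
    unfolding kern_simps[OF a a] by (rule rep_tendsto[OF \<sigma> ClimD[OF 2] v])
qed

lemma kdist_tendsto_zero:
  assumes "(\<lambda>n. k i (j n)) \<longlonglongrightarrow> k i i" "(\<lambda>n. k (j n) i) \<longlonglongrightarrow> k i i" "(\<lambda>n. k (j n) (j n)) \<longlonglongrightarrow> k i i"
  shows "(\<lambda>n. kdist k i (j n)) \<longlonglongrightarrow> 0"
proof -
  have "(\<lambda>n. Re (k i i - k i (j n) - k (j n) i + k (j n) (j n))) \<longlonglongrightarrow> Re (k i i - k i i - k i i + k i i)"
    by (intro tendsto_Re tendsto_add tendsto_diff tendsto_const assms)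
  then show ?thesis by (simp add: kdist_def)
qed

text \<open>Dense indices arise by varying the function over a countable set dense for the I-norm
  and the vector over a countable dense set. The section itself is kept, which is why
  \<open>A\<close> has to be countable.\<close>

lemma kern_decomposition:
  assumes \<sigma>: "\<sigma> \<in> reps G lam" and A: "countable A" "A \<subseteq> \<Gamma>b"
  obtains \<Psi> :: "('g, 'h) idx \<Rightarrow> ell2"
  where "\<forall>i\<in>idxs A. \<forall>j\<in>idxs A. cinner (\<Psi> i) (\<Psi> j) = kern \<sigma> i j"
proof -
  have sub: "idxs A \<subseteq> idxs \<Gamma>b" using A(2) by (auto simp: idxs_def)
  obtain D0 where D0: "countable D0" "D0 \<subseteq> Cc" "\<forall>f\<in>Cc. \<exists>s. (\<forall>n. s n \<in> D0) \<and> Clim s f"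
    by (rule Clim_separable)
  obtain D1 :: "ell2 set" where D1: "countable D1" "\<forall>v. \<forall>e>0. \<exists>d\<in>D1. norm (v - d) < e"
    by (rule ell2_separable)
  have seq: "\<exists>s. (\<forall>n. s n \<in> D1) \<and> s \<longlonglongrightarrow> v" for v
  proof -
    have "v \<in> closure D1"
      unfolding closure_approachable using D1(2) by (simp add: dist_norm norm_minus_commute[of _ v])
    then show ?thesis unfolding closure_sequential .
  qed
  define D where "D = (\<lambda>(f, a, u). Act f a u) ` (D0 \<times> A \<times> D1) \<union> (\<lambda>(f, a, u). Pure f a u) ` (D0 \<times> A \<times> D1)"
  have "countable D"
    unfolding D_def by (intro countable_Un countable_image countable_SIGMA D0(1) A(1) D1(1))
  moreover have "D \<subseteq> idxs A" using D0(2) by (auto simp: D_def)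
  moreover have "\<exists>d\<in>D. kdist (kern \<sigma>) i d < e" if i: "i \<in> idxs A" and e: "0 < e" for i e
  proof -
    have "\<exists>j. (\<forall>n. j n \<in> D) \<and> (\<lambda>n. kdist (kern \<sigma>) i (j n)) \<longlonglongrightarrow> 0"
    proof (cases i)
      case (Act f a u)
      then have f: "f \<in> Cc" and a: "a \<in> A" using i by simp_all
      obtain s where s: "\<forall>n. s n \<in> D0" "Clim s f" using D0(3)[THEN bspec, OF f] by blast
      obtain w where w: "\<forall>n. w n \<in> D1" "w \<longlonglongrightarrow> u" using seq by blast
      have ab: "a \<in> \<Gamma>b" using a A(2) by blast
      have "(\<lambda>n. kdist (kern \<sigma>) i (Act (s n) a (w n))) \<longlonglongrightarrow> 0"
        unfolding Act
        by (rule kdist_tendsto_zero; rule kern_tendsto(1)[OF \<sigma> ab]; (rule s(2) w(2) Clim_const[OF f] tendsto_const))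
      then show ?thesis using s(1) w(1) a by (intro exI[of _ "\<lambda>n. Act (s n) a (w n)"]) (simp add: D_def image_iff)
    next
      case (Pure f a u)
      then have f: "f \<in> Cc" and a: "a \<in> A" using i by simp_all
      obtain s where s: "\<forall>n. s n \<in> D0" "Clim s f" using D0(3)[THEN bspec, OF f] by blast
      obtain w where w: "\<forall>n. w n \<in> D1" "w \<longlonglongrightarrow> u" using seq by blast
      have ab: "a \<in> \<Gamma>b" using a A(2) by blast
      have "(\<lambda>n. kdist (kern \<sigma>) i (Pure (s n) a (w n))) \<longlonglongrightarrow> 0"
        unfolding Pure
        by (rule kdist_tendsto_zero; rule kern_tendsto(2)[OF \<sigma> ab]; (rule s(2) w(2) Clim_const[OF f] tendsto_const))
      then show ?thesis using s(1) w(1) a by (intro exI[of _ "\<lambda>n. Pure (s n) a (w n)"]) (simp add: D_def image_iff)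
    qed
    then obtain j where j: "\<forall>n. j n \<in> D" "(\<lambda>n. kdist (kern \<sigma>) i (j n)) \<longlonglongrightarrow> 0" by blast
    have "\<forall>\<^sub>F n in sequentially. kdist (kern \<sigma>) i (j n) < e" using j(2) e by (rule order_tendstoD)
    then obtain n where "kdist (kern \<sigma>) i (j n) < e" by (auto simp: eventually_sequentially)
    then show ?thesis using j(1) by blast
  qed
  ultimately obtain \<Psi> :: "('g, 'h) idx \<Rightarrow> ell2"
    where "\<forall>i\<in>idxs A. \<forall>j\<in>idxs A. cinner (\<Psi> i) (\<Psi> j) = kern \<sigma> i j"
    by (rule kolmogorov_separable[OF pos_kernel_subset[OF pos_kernel_kern[OF \<sigma>] sub]])
  then show ?thesis by (rule that)
qed

text \<open>\<open>Pure g a w\<close> is \<open>a \<otimes> \<sigma> g w\<close>, so its image under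
  \<open>f\<close> is an \<open>Act\<close>; a second application composes by convolution. The
  section never changes, so indices over \<open>A\<close> stay over \<open>A\<close>.\<close>

primrec act :: "'g rep \<Rightarrow> ('g \<Rightarrow> complex) \<Rightarrow> ('g, 'h) idx \<Rightarrow> ('g, 'h) idx" where
  "act \<sigma> f (Act h a u) = Act (cv f h) a u"
| "act \<sigma> f (Pure g a w) = Act f a (\<sigma> g w)"

text \<open>Since \<open>l\<close> is arbitrary, linearity in the function can be lifted from the
  kernel to the vectors that represent it.\<close>

lemma kern_Act_linear:
  assumes \<sigma>: "\<sigma> \<in> reps G lam" and l: "l \<in> idxs \<Gamma>b" and h: "h \<in> Cc" "h' \<in> Cc" and a: "a \<in> \<Gamma>b"
  shows "kern \<sigma> l (Act (\<lambda>x. c * h x + d * h' x) a u) = c * kern \<sigma> l (Act h a u) + d * kern \<sigma> l (Act h' a u)"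
proof -
  have I: "Act h a u \<in> idxs \<Gamma>b" "Act h' a u \<in> idxs \<Gamma>b" using h a by simp_all
  define g where "g = gram (field l) (field (Act h a u))"
  define g' where "g' = gram (field l) (field (Act h' a u))"
  have gC: "g \<in> Cc" "g' \<in> Cc" unfolding g_def g'_def by (intro gram_Cc l I)+
  have "gram (field l) (field (Act (\<lambda>x. c * h x + d * h' x) a u)) = (\<lambda>x. c * g x + d * g' x)"
  proof
    fix x
    let ?k = "\<lambda>y. cinner (field (Act h a u) (iv y \<cdot> x)) (field l (iv y))"
    let ?k' = "\<lambda>y. cinner (field (Act h' a u) (iv y \<cdot> x)) (field l (iv y))"
    have "gram (field l) (field (Act (\<lambda>x. c * h x + d * h' x) a u)) x = fint (rng x) (\<lambda>y. c * ?k y + d * ?k' y)"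
      unfolding gram_def by (rule fint_cong) (simp add: cinner_scaleC_left algebra_simps)
    also have "\<dots> = fint (rng x) (\<lambda>y. c * ?k y) + fint (rng x) (\<lambda>y. d * ?k' y)"
      by (rule fint_add) (intro fibre_Cc_mult gram_integrand l I continuous_on_const rng_units)+
    also have "\<dots> = c * g x + d * g' x" unfolding g_def g'_def gram_def fint_mult ..
    finally show "gram (field l) (field (Act (\<lambda>x. c * h x + d * h' x) a u)) x = c * g x + d * g' x" .
  qed
  then have "kern \<sigma> l (Act (\<lambda>x. c * h x + d * h' x) a u) = cinner (ivec l) (\<sigma> (\<lambda>x. c * g x + d * g' x) u)"
    by (simp only: kern_def ivec.simps)
  also have "\<sigma> (\<lambda>x. c * g x + d * g' x) u = c *\<^sub>C \<sigma> g u + d *\<^sub>C \<sigma> g' u"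
    by (simp only: rep_add[OF \<sigma> Cc_scale[OF gC(1)] Cc_scale[OF gC(2)]] rep_scale[OF \<sigma> gC(1)] rep_scale[OF \<sigma> gC(2)])
  finally show ?thesis
    by (simp only: kern_def ivec.simps g_def g'_def cinner_add_right cinner_scaleC_right)
qed

text \<open>In all four cases the identity reduces to associativity and involution of the
  convolution and to the corresponding rules for \<open>\<sigma>\<close>.\<close>

lemma kern_act_adjoint:
  assumes \<sigma>: "\<sigma> \<in> reps G lam" and i: "i \<in> idxs \<Gamma>b" and j: "j \<in> idxs \<Gamma>b" and f: "f \<in> Cc"
  shows "kern \<sigma> (act \<sigma> (st f) i) j = kern \<sigma> i (act \<sigma> f j)"
proof (cases i; cases j)
  fix h a u h' b u' assume ij: "i = Act h a u" "j = Act h' b u'"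
  then have *: "h \<in> Cc" "a \<in> \<Gamma>b" "h' \<in> Cc" "b \<in> \<Gamma>b" using i j by simp_all
  have "cv (st (cv (st f) h)) h' = cv (st h) (cv f h')"
    using * f by (simp add: st_cv st_Cc cv_assoc)
  then show ?thesis unfolding ij act.simps kern_simps[OF *(2,4)] by simp
next
  fix h a u g b w assume ij: "i = Act h a u" "j = Pure g b w"
  then have *: "h \<in> Cc" "a \<in> \<Gamma>b" "g \<in> Cc" "b \<in> \<Gamma>b" using i j by simp_all
  have e: "st (cv (st f) h) = cv (st h) f" using * f by (simp add: st_cv st_Cc)
  have c: "(\<lambda>x. cf a b x * cv (st h) f x) \<in> Cc" by (intro Cc_mult cv_Cc st_Cc cf_continuous * f)
  show ?thesis unfolding ij act.simps kern_simps[OF *(2,4)] e rep_cv[OF \<sigma> c *(3)] ..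
next
  fix g a w h b u assume ij: "i = Pure g a w" "j = Act h b u"
  then have *: "g \<in> Cc" "a \<in> \<Gamma>b" "h \<in> Cc" "b \<in> \<Gamma>b" using i j by simp_all
  have c: "(\<lambda>x. cf a b x * cv f h x) \<in> Cc" by (intro Cc_mult cv_Cc cf_continuous * f)
  show ?thesis
    unfolding ij act.simps kern_simps[OF *(2,4)] rep_cv[OF \<sigma> st_Cc[OF *(1)] c] rep_st'[OF \<sigma> *(1)] st_st ..
next
  fix g a w g' b w' assume ij: "i = Pure g a w" "j = Pure g' b w'"
  then have *: "g \<in> Cc" "a \<in> \<Gamma>b" "g' \<in> Cc" "b \<in> \<Gamma>b" using i j by simp_all
  have c: "(\<lambda>x. cf a b x * f x) \<in> Cc" by (intro Cc_mult cf_continuous * f)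
  show ?thesis
    unfolding ij act.simps kern_simps[OF *(2,4)] rep_cv[OF \<sigma> st_Cc[OF *(1)] c] rep_cv[OF \<sigma> c *(3)]
      rep_st'[OF \<sigma> *(1)] st_st ..
qed

text \<open>The kernel determines all linear relations between the vectors \<open>\<Psi>\<close>, so
  the axioms of \<open>action\<close> follow from identities and estimates for kernel
  entries.\<close>

theorem dilation:
  assumes \<sigma>: "\<sigma> \<in> reps G lam" and A: "countable A" "A \<subseteq> \<Gamma>b"
  obtains \<Psi> :: "('g, 'h) idx \<Rightarrow> ell2" and \<tau>
  where "\<tau> \<in> reps G lam" "\<forall>i\<in>idxs A. \<forall>j\<in>idxs A. cinner (\<Psi> i) (\<Psi> j) = kern \<sigma> i j"
    "\<forall>f\<in>Cc. \<forall>i\<in>idxs A. \<tau> f (\<Psi> i) = \<Psi> (act \<sigma> f i)"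
proof -
  obtain \<Psi> :: "('g, 'h) idx \<Rightarrow> ell2"
    where \<Psi>: "\<forall>i\<in>idxs A. \<forall>j\<in>idxs A. cinner (\<Psi> i) (\<Psi> j) = kern \<sigma> i j"
    by (rule kern_decomposition[OF \<sigma> A])
  have sub: "i \<in> idxs \<Gamma>b" if "i \<in> idxs A" for i using that A(2) by (auto simp: idxs_def)
  have act_in: "act \<sigma> f i \<in> idxs A" if "f \<in> Cc" "i \<in> idxs A" for f i
    using that by (cases i) (simp_all add: cv_Cc)
  \<comment> \<open>The difference of the two sides lies in the span of the vectors
    \<open>\<Psi>\<close> and is orthogonal to all of them, hence to itself.\<close>
  have lin: "\<Psi> i = c *\<^sub>C \<Psi> j + d *\<^sub>C \<Psi> k"
    if I: "i \<in> idxs A" "j \<in> idxs A" "k \<in> idxs A"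
      and k: "\<And>l. l \<in> idxs A \<Longrightarrow> kern \<sigma> l i = c * kern \<sigma> l j + d * kern \<sigma> l k" for i j k c d
  proof -
    define x where "x = \<Psi> i - (c *\<^sub>C \<Psi> j + d *\<^sub>C \<Psi> k)"
    have o: "cinner (\<Psi> l) x = 0" if "l \<in> idxs A" for l
      using \<Psi> that I k[OF that] by (simp add: x_def cinner_diff_right cinner_add_right cinner_scaleC_right)
    have "cinner x x = cinner (\<Psi> i) x - (cnj c * cinner (\<Psi> j) x + cnj d * cinner (\<Psi> k) x)"
      by (subst (1) x_def) (simp only: cinner_diff_left cinner_add_left cinner_scaleC_left)
    also have "\<dots> = 0" using o I by simp
    finally show ?thesis by (simp add: cinner_self x_def)
  qed
  \<comment> \<open>This supplies \<open>act_bound\<close>. The resulting constant depends on the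
    section and the vector, and for an index of the form \<open>Act\<close> also on its
    function.\<close>
  have nPsi: "norm (\<Psi> (Act h a u)) \<le> norm u * section_norm (units G) a * nrm h"
    if h: "h \<in> Cc" and a: "a \<in> A" for h a u
  proof -
    have ab: "a \<in> \<Gamma>b" using a A(2) by blast
    let ?S = "section_norm (units G) a"
    have S: "0 \<le> ?S" by (rule section_norm_nonneg[OF ab])
    have c: "(\<lambda>x. cf a a x * cv (st h) h x) \<in> Cc" by (intro Cc_mult cv_Cc st_Cc cf_continuous ab h)
    have "complex_of_real ((norm (\<Psi> (Act h a u)))\<^sup>2) = kern \<sigma> (Act h a u) (Act h a u)"
      unfolding cinner_self[symmetric] using \<Psi> h a by simp
    then have "(norm (\<Psi> (Act h a u)))\<^sup>2 = cmod (kern \<sigma> (Act h a u) (Act h a u))"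
      by (metis norm_of_real abs_of_nonneg zero_le_power2)
    also have "\<dots> \<le> norm u * norm (\<sigma> (\<lambda>x. cf a a x * cv (st h) h x) u)"
      unfolding kern_simps[OF ab ab] by (rule cmod_cinner_le)
    also have "\<dots> \<le> norm u * (nrm (\<lambda>x. cf a a x * cv (st h) h x) * norm u)"
      by (intro mult_left_mono rep_norm_le[OF \<sigma> c]) simp
    also have "\<dots> \<le> norm u * ((?S * ?S * (nrm h * nrm h)) * norm u)"
    proof (intro mult_left_mono mult_right_mono)
      have "nrm (\<lambda>x. cf a a x * cv (st h) h x) \<le> ?S * ?S * nrm (cv (st h) h)"
        by (intro nrm_le c cv_Cc st_Cc h mult_nonneg_nonneg S)
          (simp add: norm_mult mult_right_mono cf_bound[OF ab ab])
      also have "\<dots> \<le> ?S * ?S * (nrm h * nrm h)"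
        using nrm_cv[OF st_Cc[OF h] h] by (intro mult_left_mono) (simp_all add: nrm_st S)
      finally show "nrm (\<lambda>x. cf a a x * cv (st h) h x) \<le> ?S * ?S * (nrm h * nrm h)" .
    qed simp_all
    also have "\<dots> = (norm u * ?S * nrm h)\<^sup>2" by (simp add: power2_eq_square mult_ac)
    finally show ?thesis by (rule power2_le_imp_le) (intro mult_nonneg_nonneg S nrm_nonneg h norm_ge_zero)
  qed
  interpret action G lam "idxs A" \<Psi> "act \<sigma>"
  proof
    fix f g :: "'g \<Rightarrow> complex" and i j c
    assume f: "f \<in> Cc" and i: "i \<in> idxs A"
    show "act \<sigma> f i \<in> idxs A" by (rule act_in[OF f i])
    show "\<Psi> (act \<sigma> (\<lambda>x. c * f x) i) = c *\<^sub>C \<Psi> (act \<sigma> f i)"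
    proof -
      have "\<Psi> (act \<sigma> (\<lambda>x. c * f x) i) = c *\<^sub>C \<Psi> (act \<sigma> f i) + 0 *\<^sub>C \<Psi> (act \<sigma> f i)"
      proof (rule lin)
        fix l assume l: "l \<in> idxs A"
        show "kern \<sigma> l (act \<sigma> (\<lambda>x. c * f x) i) = c * kern \<sigma> l (act \<sigma> f i) + 0 * kern \<sigma> l (act \<sigma> f i)"
        proof (cases i)
          case (Act h a u)
          then have *: "h \<in> Cc" "a \<in> \<Gamma>b" using i sub[OF i] by simp_all
          show ?thesis
            using kern_Act_linear[OF \<sigma> sub[OF l] cv_Cc[OF f *(1)] cv_Cc[OF f *(1)] *(2), of c 0 u]
            by (simp add: Act cv_scale_left)
        next
          case (Pure g a w)
          then have *: "a \<in> \<Gamma>b" using sub[OF i] by simp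
          show ?thesis
            using kern_Act_linear[OF \<sigma> sub[OF l] f f *, of c 0 "\<sigma> g w"] by (simp add: Pure)
        qed
      qed (intro act_in Cc_scale f i)+
      then show ?thesis by simp
    qed
    assume g: "g \<in> Cc"
    show "\<Psi> (act \<sigma> (\<lambda>x. f x + g x) i) = \<Psi> (act \<sigma> f i) + \<Psi> (act \<sigma> g i)"
    proof -
      have "\<Psi> (act \<sigma> (\<lambda>x. f x + g x) i) = 1 *\<^sub>C \<Psi> (act \<sigma> f i) + 1 *\<^sub>C \<Psi> (act \<sigma> g i)"
      proof (rule lin)
        fix l assume l: "l \<in> idxs A"
        show "kern \<sigma> l (act \<sigma> (\<lambda>x. f x + g x) i) = 1 * kern \<sigma> l (act \<sigma> f i) + 1 * kern \<sigma> l (act \<sigma> g i)"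
        proof (cases i)
          case (Act h a u)
          then have *: "h \<in> Cc" "a \<in> \<Gamma>b" using i sub[OF i] by simp_all
          show ?thesis
            using kern_Act_linear[OF \<sigma> sub[OF l] cv_Cc[OF f *(1)] cv_Cc[OF g *(1)] *(2), of 1 1 u]
            by (simp add: Act cv_add_left[OF f g *(1)])
        next
          case (Pure k a w)
          then have *: "a \<in> \<Gamma>b" using sub[OF i] by simp
          show ?thesis
            using kern_Act_linear[OF \<sigma> sub[OF l] f g *, of 1 1 "\<sigma> k w"] by (simp add: Pure)
        qed
      qed (intro act_in Cc_add f g i)+
      then show ?thesis by simp
    qed
    show "\<Psi> (act \<sigma> (cv f g) i) = \<Psi> (act \<sigma> f (act \<sigma> g i))"
      using i by (cases i) (simp_all add: cv_assoc f g)
  next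
    fix i assume i: "i \<in> idxs A"
    show "\<exists>C. \<forall>f\<in>Cc. norm (\<Psi> (act \<sigma> f i)) \<le> C * nrm f"
    proof (cases i)
      case (Act h a u)
      then have *: "h \<in> Cc" "a \<in> A" "a \<in> \<Gamma>b" using i sub[OF i] by simp_all
      have "norm (\<Psi> (act \<sigma> f i)) \<le> norm u * section_norm (units G) a * nrm h * nrm f" if f: "f \<in> Cc" for f
      proof -
        have "norm (\<Psi> (act \<sigma> f i)) \<le> norm u * section_norm (units G) a * nrm (cv f h)"
          unfolding Act act.simps by (rule nPsi[OF cv_Cc[OF f *(1)] *(2)])
        also have "\<dots> \<le> norm u * section_norm (units G) a * (nrm f * nrm h)"
          by (intro mult_left_mono nrm_cv f * mult_nonneg_nonneg section_norm_nonneg norm_ge_zero)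
        finally show ?thesis by (simp add: mult_ac)
      qed
      then show ?thesis by blast
    next
      case (Pure g a w)
      then have "a \<in> A" using i by simp
      then show ?thesis unfolding Pure act.simps using nPsi by blast
    qed
  next
    fix f :: "'g \<Rightarrow> complex" and i j assume "f \<in> Cc" "i \<in> idxs A" "j \<in> idxs A"
    then show "cinner (\<Psi> (act \<sigma> (st f) i)) (\<Psi> j) = cinner (\<Psi> i) (\<Psi> (act \<sigma> f j))"
      using \<Psi> kern_act_adjoint[OF \<sigma> sub sub] act_in st_Cc by simp
  qed
  show ?thesis
    by (rule that[OF rep_in_reps \<Psi>]) (simp add: rep_Psi)
qed

text \<open>The map \<open>\<sigma>(g) w \<mapsto> a \<otimes> \<sigma>(g) w\<close> is bounded by the norm of the section \<open>a\<close>, because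
  \<open>\<parallel>a\<parallel>\<^sup>2 - |a|\<^sup>2\<close> is the square of a continuous function.\<close>

lemma norm_pure_le:
  fixes g :: "nat \<Rightarrow> 'g \<Rightarrow> complex"
  assumes \<sigma>: "\<sigma> \<in> reps G lam" and a: "a \<in> A" "A \<subseteq> \<Gamma>b"
    and \<Psi>: "\<forall>i\<in>idxs A. \<forall>j\<in>idxs A. cinner (\<Psi> i) (\<Psi> j) = kern \<sigma> i j"
    and g: "\<And>k. k < n \<Longrightarrow> g k \<in> Cc"
  shows "norm (\<Sum>k<n. \<Psi> (Pure (g k) a (w k))) \<le> section_norm (units G) a * norm (\<Sum>k<n. \<sigma> (g k) (w k))"
proof -
  have ab: "a \<in> \<Gamma>b" using a by blast
  define S where "S = section_norm (units G) a"
  have S: "0 \<le> S" unfolding S_def by (rule section_norm_nonneg[OF ab])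
  define m where "m z = complex_of_real (sqrt (S\<^sup>2 - (norm (a (rng z)))\<^sup>2))" for z
  have le: "(norm (a (rng z)))\<^sup>2 \<le> S\<^sup>2" for z
    unfolding S_def by (intro power_mono section_norm_bound ab rng_units) simp
  have mcont: "continuous_on UNIV m"
    unfolding m_def
    by (intro continuous_on_of_real continuous_on_real_sqrt continuous_on_diff continuous_on_const continuous_on_power
        continuous_on_units_comp(1)[OF section_norm_continuous[OF bounded_sectionD[OF ab]]])
  have ipm: "ip a a z = complex_of_real (S\<^sup>2) - m z * m z" for z
  proof -
    have "m z * m z = complex_of_real (sqrt (S\<^sup>2 - (norm (a (rng z)))\<^sup>2) * sqrt (S\<^sup>2 - (norm (a (rng z)))\<^sup>2))"
      by (simp only: m_def of_real_mult)
    also have "\<dots> = complex_of_real (S\<^sup>2 - (norm (a (rng z)))\<^sup>2)" using le[of z] by simp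
    finally show ?thesis by (simp add: ip_def cinner_self)
  qed
  \<comment> \<open>The kernel is \<open>S^2\<close> times a Gram matrix minus another Gram matrix;
    discarding the latter will give the bound.\<close>
  have k: "kern \<sigma> (Pure (g k) a (w k)) (Pure (g l) a (w l))
      = complex_of_real (S\<^sup>2) * cinner (\<sigma> (g k) (w k)) (\<sigma> (g l) (w l))
        - cinner (\<sigma> (\<lambda>x. m x * g k x) (w k)) (\<sigma> (\<lambda>x. m x * g l x) (w l))" if kl: "k < n" "l < n" for k l
  proof -
    note gk = g[OF kl(1)] and gl = g[OF kl(2)]
    have mg: "(\<lambda>x. m x * g k x) \<in> Cc" "(\<lambda>x. m x * g l x) \<in> Cc" "(\<lambda>x. m x * (m x * g l x)) \<in> Cc"
      by (intro Cc_mult gk gl mcont)+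
    \<comment> \<open>\<open>m\<close> is real and depends on the range only, and
      \<open>iv y\<close> and \<open>iv y \<cdot> x\<close> have the same range, so one factor
      \<open>m\<close> can be moved to the left.\<close>
    have e1: "cv (st (g k)) (\<lambda>x. m x * (m x * g l x)) = cv (st (\<lambda>x. m x * g k x)) (\<lambda>x. m x * g l x)"
      unfolding cv_fint by (rule ext, rule fint_cong) (simp add: star_def m_def mult_ac)
    have e2: "(\<lambda>x. ip a a x * g l x) = (\<lambda>x. complex_of_real (S\<^sup>2) * g l x - m x * (m x * g l x))"
      by (simp add: ipm left_diff_distrib mult.assoc)
    have "kern \<sigma> (Pure (g k) a (w k)) (Pure (g l) a (w l))
        = cinner (w k) (\<sigma> (cv (st (g k)) (\<lambda>x. complex_of_real (S\<^sup>2) * g l x)) (w l)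
            - \<sigma> (cv (st (g k)) (\<lambda>x. m x * (m x * g l x))) (w l))"
      unfolding kern_simps[OF ab ab] e2 cv_diff_right[OF Cc_scale[OF gl] mg(3) st_Cc[OF gk]]
        rep_diff[OF \<sigma> cv_Cc[OF st_Cc[OF gk] Cc_scale[OF gl]] cv_Cc[OF st_Cc[OF gk] mg(3)]] ..
    also have "\<dots> = cinner (\<sigma> (g k) (w k)) (complex_of_real (S\<^sup>2) *\<^sub>C \<sigma> (g l) (w l))
        - cinner (\<sigma> (\<lambda>x. m x * g k x) (w k)) (\<sigma> (\<lambda>x. m x * g l x) (w l))"
      unfolding cinner_diff_right e1 rep_cv[OF \<sigma> st_Cc[OF gk] Cc_scale[OF gl]] rep_cv[OF \<sigma> st_Cc[OF mg(1)] mg(2)]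
        rep_st'[OF \<sigma> gk] rep_st'[OF \<sigma> mg(1)] rep_scale[OF \<sigma> gl] ..
    finally show ?thesis by (simp only: cinner_scaleC_right)
  qed
  define y where "y = (\<Sum>k<n. \<sigma> (g k) (w k))"
  define y' where "y' = (\<Sum>k<n. \<sigma> (\<lambda>x. m x * g k x) (w k))"
  have "complex_of_real ((norm (\<Sum>k<n. \<Psi> (Pure (g k) a (w k))))\<^sup>2)
      = (\<Sum>k<n. \<Sum>l<n. cinner (\<Psi> (Pure (g k) a (w k))) (\<Psi> (Pure (g l) a (w l))))"
    unfolding cinner_self[symmetric] by (simp only: cinner_sum_left) (simp only: cinner_sum_right)
  also have "\<dots> = (\<Sum>k<n. \<Sum>l<n. complex_of_real (S\<^sup>2) * cinner (\<sigma> (g k) (w k)) (\<sigma> (g l) (w l))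
        - cinner (\<sigma> (\<lambda>x. m x * g k x) (w k)) (\<sigma> (\<lambda>x. m x * g l x) (w l)))"
    using \<Psi> a(1) g by (intro sum.cong refl) (simp add: k)
  also have "\<dots> = complex_of_real (S\<^sup>2) * cinner y y - cinner y' y'"
    unfolding y_def y'_def cinner_sum_left
    by (simp only: cinner_sum_right sum_subtractf sum_distrib_left)
  also have "\<dots> = complex_of_real (S\<^sup>2 * (norm y)\<^sup>2 - (norm y')\<^sup>2)"
    by (simp only: cinner_self of_real_mult of_real_diff)
  finally have "(norm (\<Sum>k<n. \<Psi> (Pure (g k) a (w k))))\<^sup>2 = S\<^sup>2 * (norm y)\<^sup>2 - (norm y')\<^sup>2"
    by (simp only: of_real_eq_iff)
  also have "\<dots> \<le> (S * norm y)\<^sup>2" by (simp add: power_mult_distrib)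
  finally show ?thesis unfolding S_def y_def
    by (rule power2_le_imp_le) (intro mult_nonneg_nonneg section_norm_nonneg[OF ab] norm_ge_zero)
qed

end

section \<open>Matrix norms and the extension to the C*-algebra\<close>

text \<open>A bound that involves no supremum; \<open>opmat_norm\<close> is a supremum of reals and
  becomes informative only once such a bound is known.\<close>

definition matbd :: "nat \<Rightarrow> (nat \<Rightarrow> nat \<Rightarrow> ell2 \<Rightarrow> ell2) \<Rightarrow> real \<Rightarrow> bool" where
  "matbd n B C \<longleftrightarrow> (\<forall>v. L2_set (\<lambda>i. norm (\<Sum>j<n. B i j (v j))) {..<n} \<le> C * L2_set (\<lambda>j. norm (v j)) {..<n})"

text \<open>The crude factor \<open>n * n\<close> is harmless: either \<open>e\<close> will tend to
  zero for fixed \<open>n\<close>, or any finite bound will do.\<close>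

lemma matbd_perturb:
  assumes B: "matbd n B C" and e: "0 \<le> e"
    and d: "\<And>i j v. i < n \<Longrightarrow> j < n \<Longrightarrow> norm (B' i j v - B i j v) \<le> e * norm v"
  shows "matbd n B' (C + real n * real n * e)"
  unfolding matbd_def
proof
  fix v :: "nat \<Rightarrow> ell2"
  let ?N = "L2_set (\<lambda>j. norm (v j)) {..<n}"
  have "L2_set (\<lambda>i. norm (\<Sum>j<n. B' i j (v j))) {..<n}
      \<le> L2_set (\<lambda>i. norm (\<Sum>j<n. B i j (v j)) + norm (\<Sum>j<n. B' i j (v j) - B i j (v j))) {..<n}"
  proof (rule L2_set_mono)
    fix i
    have "(\<Sum>j<n. B' i j (v j)) = (\<Sum>j<n. B i j (v j)) + (\<Sum>j<n. B' i j (v j) - B i j (v j))"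
      by (simp add: sum_subtractf)
    then show "norm (\<Sum>j<n. B' i j (v j)) \<le> norm (\<Sum>j<n. B i j (v j)) + norm (\<Sum>j<n. B' i j (v j) - B i j (v j))"
      by (metis norm_triangle_ineq)
  qed simp
  also have "\<dots> \<le> L2_set (\<lambda>i. norm (\<Sum>j<n. B i j (v j))) {..<n}
      + L2_set (\<lambda>i. norm (\<Sum>j<n. B' i j (v j) - B i j (v j))) {..<n}"
    by (rule L2_set_triangle_ineq)
  also have "\<dots> \<le> C * ?N + real n * real n * e * ?N"
  proof (rule add_mono)
    show "L2_set (\<lambda>i. norm (\<Sum>j<n. B i j (v j))) {..<n} \<le> C * ?N"
      using B by (simp add: matbd_def)
    have "L2_set (\<lambda>i. norm (\<Sum>j<n. B' i j (v j) - B i j (v j))) {..<n}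
        \<le> (\<Sum>i<n. norm (\<Sum>j<n. B' i j (v j) - B i j (v j)))"
      by (rule L2_set_le_sum) simp
    also have "\<dots> \<le> (\<Sum>i<n. \<Sum>j<n. e * ?N)"
    proof (rule sum_mono, rule order_trans[OF norm_sum], rule sum_mono)
      fix i j assume ij: "i \<in> {..<n}" "j \<in> {..<n}"
      have "norm (B' i j (v j) - B i j (v j)) \<le> e * norm (v j)" using d ij by simp
      also have "\<dots> \<le> e * ?N" using ij by (intro mult_left_mono member_le_L2_set e) auto
      finally show "norm (B' i j (v j) - B i j (v j)) \<le> e * ?N" .
    qed
    also have "\<dots> = real n * real n * e * ?N" by simp
    finally show "L2_set (\<lambda>i. norm (\<Sum>j<n. B' i j (v j) - B i j (v j))) {..<n} \<le> real n * real n * e * ?N" .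
  qed
  finally show "L2_set (\<lambda>i. norm (\<Sum>j<n. B' i j (v j))) {..<n} \<le> (C + real n * real n * e) * ?N"
    by (simp add: distrib_right)
qed

lemma opmat_norm_L2:
  "opmat_norm n B = (SUP v \<in> {v. L2_set (\<lambda>j. norm (v j)) {..<n} \<le> 1}. L2_set (\<lambda>i. norm (\<Sum>j<n. B i j (v j))) {..<n})"
  unfolding opmat_norm_def L2_set_def by simp

lemma not_emptyI: "x \<in> S \<Longrightarrow> S \<noteq> {}"
  by auto

lemma opmat_norm_le:
  assumes "matbd n B C" "0 \<le> C"
  shows "opmat_norm n B \<le> C"
  unfolding opmat_norm_L2
proof (rule cSUP_least)
  have "(\<lambda>_. 0) \<in> {v. L2_set (\<lambda>j. norm (v j :: ell2)) {..<n} \<le> 1}"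
    unfolding mem_Collect_eq norm_zero by (simp add: L2_set_constant)
  then show "{v. L2_set (\<lambda>j. norm (v j :: ell2)) {..<n} \<le> 1} \<noteq> {}" by (rule not_emptyI)
  fix v :: "nat \<Rightarrow> ell2" assume "v \<in> {v. L2_set (\<lambda>j. norm (v j)) {..<n} \<le> 1}"
  then have "C * L2_set (\<lambda>j. norm (v j)) {..<n} \<le> C * 1" using assms(2) by (intro mult_left_mono) auto
  then show "L2_set (\<lambda>i. norm (\<Sum>j<n. B i j (v j))) {..<n} \<le> C"
    using assms(1)[unfolded matbd_def, rule_format, of v] by linarith
qed

text \<open>The preliminary bound \<open>C'\<close> makes \<open>opmat_norm\<close> the supremum of
  a bounded set; the constant \<open>C\<close> then follows by scaling vectors to norm 1.\<close>

lemma matbd_opmat_norm: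
  assumes lin: "\<And>i j. i < n \<Longrightarrow> j < n \<Longrightarrow> bounded_linear (B i j)" and bd: "matbd n B C'" "0 \<le> C'"
    and C: "opmat_norm n B \<le> C"
  shows "matbd n B C"
  unfolding matbd_def
proof
  fix v :: "nat \<Rightarrow> ell2"
  define r where "r = L2_set (\<lambda>j. norm (v j)) {..<n}"
  have unit: "L2_set (\<lambda>i. norm (\<Sum>j<n. B i j (w j))) {..<n} \<le> C"
    if w: "L2_set (\<lambda>j. norm (w j)) {..<n} \<le> 1" for w
  proof -
    have "L2_set (\<lambda>i. norm (\<Sum>j<n. B i j (w j))) {..<n} \<le> opmat_norm n B"
      unfolding opmat_norm_L2
    proof (rule cSUP_upper)
      show "bdd_above ((\<lambda>v. L2_set (\<lambda>i. norm (\<Sum>j<n. B i j (v j))) {..<n}) ` {v. L2_set (\<lambda>j. norm (v j)) {..<n} \<le> 1})"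
      proof (rule bdd_aboveI2)
        fix v assume "v \<in> {v. L2_set (\<lambda>j. norm (v j :: ell2)) {..<n} \<le> 1}"
        then have "C' * L2_set (\<lambda>j. norm (v j)) {..<n} \<le> C' * 1" using bd(2) by (intro mult_left_mono) auto
        then show "L2_set (\<lambda>i. norm (\<Sum>j<n. B i j (v j))) {..<n} \<le> C'"
          using bd(1)[unfolded matbd_def, rule_format, of v] by linarith
      qed
    qed (use w in simp)
    then show ?thesis using C by simp
  qed
  show "L2_set (\<lambda>i. norm (\<Sum>j<n. B i j (v j))) {..<n} \<le> C * L2_set (\<lambda>j. norm (v j)) {..<n}"
  proof (cases "r = 0")
    case True
    then have "v j = 0" if "j < n" for j
      using that unfolding r_def by (simp add: L2_set_eq_0_iff)
    then have "(\<Sum>j<n. B i j (v j)) = 0" if "i < n" for i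
      using that lin by (intro sum.neutral ballI) (simp add: linear_simps)
    then have "L2_set (\<lambda>i. norm (\<Sum>j<n. B i j (v j))) {..<n} = 0" by (simp add: L2_set_eq_0_iff)
    then show ?thesis using True by (simp add: r_def)
  next
    case False
    then have r: "0 < r" using L2_set_nonneg[of "\<lambda>j. norm (v j)" "{..<n}"] by (simp add: r_def less_le)
    define w where "w j = inverse r *\<^sub>R v j" for j
    have ir: "0 \<le> inverse r" using r by simp
    have "L2_set (\<lambda>j. norm (w j)) {..<n} = L2_set (\<lambda>j. inverse r * norm (v j)) {..<n}"
      using r by (simp add: w_def)
    also have "\<dots> = inverse r * r"
      unfolding L2_set_right_distrib[OF ir, symmetric] r_def[symmetric] ..
    finally have "L2_set (\<lambda>j. norm (w j)) {..<n} = inverse r * r" .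
    then have "L2_set (\<lambda>i. norm (\<Sum>j<n. B i j (w j))) {..<n} \<le> C" using r by (intro unit) simp
    moreover have "L2_set (\<lambda>i. norm (\<Sum>j<n. B i j (w j))) {..<n}
        = inverse r * L2_set (\<lambda>i. norm (\<Sum>j<n. B i j (v j))) {..<n}"
    proof -
      have "norm (\<Sum>j<n. B i j (w j)) = inverse r * norm (\<Sum>j<n. B i j (v j))" if "i < n" for i
      proof -
        have "(\<Sum>j<n. B i j (w j)) = (\<Sum>j<n. inverse r *\<^sub>R B i j (v j))"
          using that lin by (intro sum.cong refl) (simp add: w_def linear_simps)
        then have "(\<Sum>j<n. B i j (w j)) = inverse r *\<^sub>R (\<Sum>j<n. B i j (v j))"
          by (simp only: scaleR_sum_right)
        then show ?thesis using r by simp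
      qed
      then show ?thesis unfolding L2_set_right_distrib[OF ir] by (intro L2_set_cong refl) simp
    qed
    ultimately have "inverse r * L2_set (\<lambda>i. norm (\<Sum>j<n. B i j (v j))) {..<n} \<le> C" by linarith
    moreover have "x \<le> C * r" if "inverse r * x \<le> C" for x
      using that r by (simp add: inverse_eq_divide pos_divide_le_eq mult.commute)
    ultimately show ?thesis unfolding r_def[symmetric] by blast
  qed
qed

context coefficient_bundle
begin

text \<open>The entries on the left are compressions of \<open>\<tau> (f i j)\<close> for one
  representation \<open>\<tau>\<close>, by maps bounded by the norms of the two sections. These maps
  are given only on sums of vectors \<open>\<sigma> g w\<close>, so the estimate \<open>E\<close> is
  restricted to such sums.\<close>

theorem matrix_estimate:
  fixes f :: "nat \<Rightarrow> nat \<Rightarrow> 'g \<Rightarrow> complex"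
  assumes \<xi>: "\<xi> \<in> \<Gamma>b" and \<eta>: "\<eta> \<in> \<Gamma>b" and \<sigma>: "\<sigma> \<in> reps G lam"
    and f: "\<And>i j. i < n \<Longrightarrow> j < n \<Longrightarrow> f i j \<in> Cc" and C: "0 \<le> C"
    and bd: "\<And>\<tau>. \<tau> \<in> reps G lam \<Longrightarrow> matbd n (\<lambda>i j. \<tau> (f i j)) C"
  shows "matbd n (\<lambda>i j. \<sigma> (\<lambda>x. cf \<eta> \<xi> x * f i j x)) (section_norm (units G) \<xi> * section_norm (units G) \<eta> * C)"
proof -
  define A where "A = {\<xi>, \<eta>}"
  have A: "countable A" "A \<subseteq> \<Gamma>b" "\<xi> \<in> A" "\<eta> \<in> A" using \<xi> \<eta> by (auto simp: A_def)
  obtain \<Psi> :: "('g, 'h) idx \<Rightarrow> ell2" and \<tau> where \<tau>: "\<tau> \<in> reps G lam"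
    and \<Psi>: "\<forall>i\<in>idxs A. \<forall>j\<in>idxs A. cinner (\<Psi> i) (\<Psi> j) = kern \<sigma> i j"
    and act: "\<forall>f\<in>Cc. \<forall>i\<in>idxs A. \<tau> f (\<Psi> i) = \<Psi> (act \<sigma> f i)"
    by (rule dilation[OF \<sigma> A(1,2)])
  define F where "F i j = (\<lambda>x. cf \<eta> \<xi> x * f i j x)" for i j
  have F: "F i j \<in> Cc" if "i < n" "j < n" for i j
    unfolding F_def by (intro Cc_mult f that cf_continuous \<xi> \<eta>)
  let ?N = "\<lambda>v :: nat \<Rightarrow> ell2. L2_set (\<lambda>i. norm (v i)) {..<n}"
  define s where "s = section_norm (units G) \<xi>"
  define t where "t = section_norm (units G) \<eta>"
  have st0: "0 \<le> s" "0 \<le> t" unfolding s_def t_def by (intro section_norm_nonneg \<xi> \<eta>)+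
  define R where "R = s * t * C"
  have R: "0 \<le> R" unfolding R_def by (intro mult_nonneg_nonneg st0 C)
  have CS: "cmod (\<Sum>i<n. cinner (x i) (y i)) \<le> ?N x * ?N y" for x y
  proof -
    have "cmod (\<Sum>i<n. cinner (x i) (y i)) \<le> (\<Sum>i<n. \<bar>norm (x i)\<bar> * \<bar>norm (y i)\<bar>)"
      by (rule order_trans[OF norm_sum]) (intro sum_mono, simp add: cmod_cinner_le)
    also have "\<dots> \<le> ?N x * ?N y" by (rule L2_set_mult_ineq)
    finally show ?thesis .
  qed
  have E: "cmod (\<Sum>i<n. cinner (\<Sum>k<n. \<sigma> (h i k) (w' k)) (\<Sum>j<n. \<sigma> (F i j) (\<Sum>k<n. \<sigma> (g j k) (w k))))
      \<le> R * ?N (\<lambda>i. \<Sum>k<n. \<sigma> (h i k) (w' k)) * ?N (\<lambda>j. \<Sum>k<n. \<sigma> (g j k) (w k))"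
    if g: "\<And>j k. j < n \<Longrightarrow> k < n \<Longrightarrow> g j k \<in> Cc" and h: "\<And>i k. i < n \<Longrightarrow> k < n \<Longrightarrow> h i k \<in> Cc"
    for g h :: "nat \<Rightarrow> nat \<Rightarrow> 'g \<Rightarrow> complex" and w w'
  proof -
    define p where "p j = (\<Sum>k<n. \<sigma> (g j k) (w k))" for j
    define q where "q i = (\<Sum>k<n. \<sigma> (h i k) (w' k))" for i
    define P where "P j = (\<Sum>k<n. \<Psi> (Pure (g j k) \<xi> (w k)))" for j
    define Q where "Q i = (\<Sum>k<n. \<Psi> (Pure (h i k) \<eta> (w' k)))" for i
    have NP: "?N P \<le> s * ?N p"
    proof -
      have "?N P \<le> L2_set (\<lambda>j. s * norm (p j)) {..<n}"
        unfolding P_def p_def s_def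
        by (intro L2_set_mono norm_pure_le[OF \<sigma> A(3,2) \<Psi>] g) auto
      then show ?thesis by (simp add: L2_set_right_distrib st0)
    qed
    have NQ: "?N Q \<le> t * ?N q"
    proof -
      have "?N Q \<le> L2_set (\<lambda>j. t * norm (q j)) {..<n}"
        unfolding Q_def q_def t_def
        by (intro L2_set_mono norm_pure_le[OF \<sigma> A(4,2) \<Psi>] h) auto
      then show ?thesis by (simp add: L2_set_right_distrib st0)
    qed
    \<comment> \<open>Since \<open>\<tau>\<close> sends \<open>Pure\<close> to \<open>Act\<close>,
      the pairing is the mixed kernel entry, which contains the coefficient.\<close>
    have key: "cinner (Q i) (\<tau> (f i j) (P j)) = cinner (q i) (\<sigma> (F i j) (p j))" if ij: "i < n" "j < n" for i j
    proof -
      have "cinner (\<Psi> (Pure (h i k) \<eta> (w' k))) (\<tau> (f i j) (\<Psi> (Pure (g j l) \<xi> (w l))))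
          = cinner (\<sigma> (h i k) (w' k)) (\<sigma> (F i j) (\<sigma> (g j l) (w l)))" if kl: "k < n" "l < n" for k l
      proof -
        note fij = f[OF ij] and gl = g[OF ij(2) kl(2)] and hk = h[OF ij(1) kl(1)]
        have I: "Pure (h i k) \<eta> (w' k) \<in> idxs A" "Pure (g j l) \<xi> (w l) \<in> idxs A"
          "Act (f i j) \<xi> (\<sigma> (g j l) (w l)) \<in> idxs A"
          using A gl hk fij by simp_all
        have "\<tau> (f i j) (\<Psi> (Pure (g j l) \<xi> (w l))) = \<Psi> (Act (f i j) \<xi> (\<sigma> (g j l) (w l)))"
          using act[rule_format, OF fij I(2)] by simp
        then have "cinner (\<Psi> (Pure (h i k) \<eta> (w' k))) (\<tau> (f i j) (\<Psi> (Pure (g j l) \<xi> (w l))))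
            = kern \<sigma> (Pure (h i k) \<eta> (w' k)) (Act (f i j) \<xi> (\<sigma> (g j l) (w l)))"
          using \<Psi>[rule_format, OF I(1,3)] by simp
        also have "\<dots> = cinner (\<sigma> (h i k) (w' k)) (\<sigma> (F i j) (\<sigma> (g j l) (w l)))"
          unfolding kern_simps[OF \<eta> \<xi>] F_def[symmetric] rep_cv[OF \<sigma> st_Cc[OF hk] F[OF ij]] rep_st'[OF \<sigma> hk] ..
        finally show ?thesis .
      qed
      then show ?thesis
        unfolding Q_def P_def q_def p_def rep_vsum[OF \<tau> f[OF ij]] rep_vsum[OF \<sigma> F[OF ij]]
          cinner_sum_left by (simp only: cinner_sum_right) (intro sum.cong refl, simp)
    qed
    have "(\<Sum>i<n. cinner (q i) (\<Sum>j<n. \<sigma> (F i j) (p j))) = (\<Sum>i<n. cinner (Q i) (\<Sum>j<n. \<tau> (f i j) (P j)))"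
      unfolding cinner_sum_right by (intro sum.cong refl) (simp add: key)
    also have "cmod \<dots> \<le> ?N Q * ?N (\<lambda>i. \<Sum>j<n. \<tau> (f i j) (P j))" by (rule CS)
    also have "\<dots> \<le> (t * ?N q) * (C * (s * ?N p))"
    proof (rule mult_mono[OF NQ])
      have "?N (\<lambda>i. \<Sum>j<n. \<tau> (f i j) (P j)) \<le> C * ?N P"
        using bd[OF \<tau>] by (simp add: matbd_def)
      also have "\<dots> \<le> C * (s * ?N p)" by (intro mult_left_mono NP C)
      finally show "?N (\<lambda>i. \<Sum>j<n. \<tau> (f i j) (P j)) \<le> C * (s * ?N p)" .
    qed (simp_all add: st0)
    also have "\<dots> = R * ?N q * ?N p" by (simp add: R_def mult_ac)
    finally show ?thesis by (simp only: p_def q_def)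
  qed
  have cancel: "a \<le> r" if "a * a \<le> r * a" "0 \<le> a" "0 \<le> r" for a r :: real
    using that mult_right_le_imp_le[of a a r] by (cases "a = 0") auto
  show ?thesis
    unfolding matbd_def s_def[symmetric] t_def[symmetric] R_def[symmetric] F_def[symmetric]
  proof
    fix v :: "nat \<Rightarrow> ell2"
    \<comment> \<open>\<open>y\<close> is the image of \<open>v\<close> under the matrix and
      \<open>p\<close> the image of \<open>y\<close> under its adjoint; both have the form required
      by \<open>E\<close>.\<close>
    define y where "y i = (\<Sum>j<n. \<sigma> (F i j) (v j))" for i
    define p where "p j = (\<Sum>i<n. \<sigma> (st (F i j)) (y i))" for j
    have adj: "(\<Sum>j<n. cinner (p j) (z j)) = (\<Sum>i<n. cinner (y i) (\<Sum>j<n. \<sigma> (F i j) (z j)))" for z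
    proof -
      have "(\<Sum>j<n. cinner (p j) (z j)) = (\<Sum>j<n. \<Sum>i<n. cinner (y i) (\<sigma> (F i j) (z j)))"
        unfolding p_def cinner_sum_left by (intro sum.cong refl) (simp add: rep_st[OF \<sigma> F])
      also have "\<dots> = (\<Sum>i<n. \<Sum>j<n. cinner (y i) (\<sigma> (F i j) (z j)))" by (rule sum.swap)
      finally show ?thesis by (simp only: cinner_sum_right)
    qed
    have sq: "complex_of_real ((?N z)\<^sup>2) = (\<Sum>i<n. cinner (z i) (z i))" for z
      by (simp add: L2_set_def sum_nonneg cinner_self)
    have sqn: "(?N z)\<^sup>2 = cmod (\<Sum>i<n. cinner (z i) (z i))" for z
      unfolding sq[symmetric] norm_of_real by simp
    have "cmod (\<Sum>i<n. cinner (y i) (\<Sum>j<n. \<sigma> (F i j) (p j))) \<le> R * ?N y * ?N p"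
      using E[of "\<lambda>j i. st (F i j)" F v y] unfolding y_def[symmetric] p_def[symmetric]
      by (simp add: F st_Cc)
    then have "(?N p)\<^sup>2 \<le> R * ?N y * ?N p" unfolding sqn adj .
    then have Np: "?N p \<le> R * ?N y"
      unfolding power2_eq_square by (rule cancel[OF _ L2_set_nonneg]) (intro mult_nonneg_nonneg R L2_set_nonneg)
    have "(?N y)\<^sup>2 = cmod (\<Sum>j<n. cinner (p j) (v j))"
      unfolding sqn adj by (simp only: y_def)
    also have "\<dots> \<le> ?N p * ?N v" by (rule CS)
    also have "\<dots> \<le> (R * ?N y) * ?N v" by (intro mult_right_mono Np) simp
    finally have "?N y * ?N y \<le> (R * ?N v) * ?N y" by (simp add: power2_eq_square mult_ac)
    then have "?N y \<le> R * ?N v"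
      by (rule cancel[OF _ L2_set_nonneg]) (intro mult_nonneg_nonneg R L2_set_nonneg)
    then show "?N (\<lambda>i. \<Sum>j<n. \<sigma> (F i j) (v j)) \<le> R * ?N v" by (simp only: y_def)
  qed
qed

end

context haar_groupoid
begin

text \<open>This keeps suprema over \<open>reps\<close> from being taken over the empty set.\<close>

lemma zero_rep: "(\<lambda>_ _. 0) \<in> reps G lam"
  unfolding reps_def
  by (auto simp: bounded_clinear_def onorm_zero nrm_nonneg fun_eq_iff)

section \<open>The C*-algebra as the set of uniform limits of images of \<open>Cc\<close>\<close>

abbreviation calg :: "'g blocks set" where "calg \<equiv> cstar_alg G lam"
abbreviation emb :: "('g \<Rightarrow> complex) \<Rightarrow> 'g blocks" where "emb \<equiv> cstar_emb G lam"

text \<open>Closeness is uniform over all representations and is stated for each vector, so that it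
  can be used without the supremum in \<open>onorm\<close>.\<close>

definition near :: "'g blocks \<Rightarrow> ('g \<Rightarrow> complex) \<Rightarrow> real \<Rightarrow> bool" where
  "near a f e \<longleftrightarrow> (\<forall>\<sigma>\<in>reps G lam. \<forall>v. norm (a \<sigma> v - \<sigma> f v) \<le> e * norm v)"

lemma rep_bounded_linear: "\<sigma> \<in> reps G lam \<Longrightarrow> f \<in> Cc \<Longrightarrow> bounded_linear (\<sigma> f)"
  using rep_bounded_clinear by (simp add: bounded_clinear_def)

lemma calg_bounded_linear: "a \<in> calg \<Longrightarrow> \<sigma> \<in> reps G lam \<Longrightarrow> bounded_linear (a \<sigma>)"
  and calg_scale: "a \<in> calg \<Longrightarrow> \<sigma> \<in> reps G lam \<Longrightarrow> a \<sigma> (c *\<^sub>C v) = c *\<^sub>C a \<sigma> v"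
  and calg_off: "a \<in> calg \<Longrightarrow> \<sigma> \<notin> reps G lam \<Longrightarrow> a \<sigma> = (\<lambda>_. 0)"
  by (auto simp: cstar_alg_def bounded_clinear_def)

lemma calg_near:
  assumes "a \<in> calg" "0 < e"
  shows "\<exists>f. f \<in> Cc \<and> near a f e"
proof -
  obtain f where f: "f \<in> Cc" "\<forall>\<sigma>\<in>reps G lam. onorm (\<lambda>v. a \<sigma> v - emb f \<sigma> v) \<le> e"
    using assms unfolding cstar_alg_def by blast
  have "norm (a \<sigma> v - \<sigma> f v) \<le> e * norm v" if s: "\<sigma> \<in> reps G lam" for \<sigma> v
  proof -
    have "norm (a \<sigma> v - \<sigma> f v) \<le> onorm (\<lambda>v. a \<sigma> v - \<sigma> f v) * norm v"
      by (rule onorm[OF bounded_linear_sub[OF calg_bounded_linear[OF assms(1) s] rep_bounded_linear[OF s f(1)]]])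
    also have "\<dots> \<le> e * norm v"
      using f(2)[THEN bspec, OF s] s by (intro mult_right_mono) (simp_all add: cstar_emb_def)
    finally show ?thesis .
  qed
  then show ?thesis using f(1) unfolding near_def by blast
qed

text \<open>Boundedness of every block comes from a single approximating function at distance
  1.\<close>

lemma calgI:
  assumes "\<And>\<sigma>. \<sigma> \<notin> reps G lam \<Longrightarrow> a \<sigma> = (\<lambda>_. 0)"
    and lin: "\<And>\<sigma> v w. \<sigma> \<in> reps G lam \<Longrightarrow> a \<sigma> (v + w) = a \<sigma> v + a \<sigma> w"
      "\<And>\<sigma> c v. \<sigma> \<in> reps G lam \<Longrightarrow> a \<sigma> (c *\<^sub>C v) = c *\<^sub>C a \<sigma> v"
    and ap: "\<And>e. 0 < e \<Longrightarrow> \<exists>f. f \<in> Cc \<and> near a f e"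
  shows "a \<in> calg"
proof -
  obtain f1 where f1: "f1 \<in> Cc" "near a f1 1" using ap[of 1] by auto
  have bl: "bounded_linear (a \<sigma>)" if s: "\<sigma> \<in> reps G lam" for \<sigma>
  proof (rule bounded_linear_intro[where K = "1 + nrm f1"])
    show "a \<sigma> (v + w) = a \<sigma> v + a \<sigma> w" for v w by (rule lin(1)[OF s])
    show "a \<sigma> (r *\<^sub>R v) = r *\<^sub>R a \<sigma> v" for r v
      using lin(2)[OF s, of "complex_of_real r" v] by (simp add: scaleC_of_real)
    show "norm (a \<sigma> v) \<le> norm v * (1 + nrm f1)" for v
    proof -
      have "norm (a \<sigma> v) \<le> norm (a \<sigma> v - \<sigma> f1 v) + norm (\<sigma> f1 v)"
        using norm_triangle_ineq[of "a \<sigma> v - \<sigma> f1 v" "\<sigma> f1 v"] by simp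
      also have "\<dots> \<le> 1 * norm v + nrm f1 * norm v"
        using f1(2) s unfolding near_def by (intro add_mono rep_norm_le[OF s f1(1)]) blast
      finally show ?thesis by (simp add: algebra_simps)
    qed
  qed
  have "\<exists>f\<in>Cc. \<forall>\<sigma>\<in>reps G lam. onorm (\<lambda>v. a \<sigma> v - emb f \<sigma> v) \<le> e" if e: "0 < e" for e
  proof -
    obtain f where f: "f \<in> Cc" "near a f e" using ap[OF e] by blast
    have "onorm (\<lambda>v. a \<sigma> v - emb f \<sigma> v) \<le> e" if s: "\<sigma> \<in> reps G lam" for \<sigma>
      using f(2) s e unfolding near_def by (intro onorm_bound) (simp_all add: cstar_emb_def)
    then show ?thesis using f(1) by blast
  qed
  then show ?thesis
    unfolding cstar_alg_def bounded_clinear_def using assms(1) bl lin(2) by simp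
qed

lemma emb_near: "near (emb f) f 0"
  by (simp add: near_def cstar_emb_def)

lemma emb_calg: "f \<in> Cc \<Longrightarrow> emb f \<in> calg"
  by (rule calgI) (auto simp: cstar_emb_def near_def rep_vadd rep_vscale intro!: exI[of _ f])

lemma near_add:
  assumes "near a f e" "near b g d" "f \<in> Cc" "g \<in> Cc"
  shows "near (\<lambda>\<sigma> v. a \<sigma> v + b \<sigma> v) (\<lambda>x. f x + g x) (e + d)"
  unfolding near_def
proof (intro ballI allI)
  fix \<sigma> v assume s: "\<sigma> \<in> reps G lam"
  have "a \<sigma> v + b \<sigma> v - \<sigma> (\<lambda>x. f x + g x) v = (a \<sigma> v - \<sigma> f v) + (b \<sigma> v - \<sigma> g v)"
    by (simp add: rep_add[OF s assms(3,4)])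
  also have "norm \<dots> \<le> e * norm v + d * norm v"
    using assms(1,2) s unfolding near_def by (intro norm_triangle_le add_mono) blast+
  finally show "norm (a \<sigma> v + b \<sigma> v - \<sigma> (\<lambda>x. f x + g x) v) \<le> (e + d) * norm v"
    by (simp add: distrib_right)
qed

lemma near_scale:
  assumes "near a f e" "f \<in> Cc"
  shows "near (\<lambda>\<sigma> v. c *\<^sub>C a \<sigma> v) (\<lambda>x. c * f x) (cmod c * e)"
  unfolding near_def
proof (intro ballI allI)
  fix \<sigma> v assume s: "\<sigma> \<in> reps G lam"
  have "c *\<^sub>C a \<sigma> v - \<sigma> (\<lambda>x. c * f x) v = c *\<^sub>C (a \<sigma> v - \<sigma> f v)"
    by (simp add: rep_scale[OF s assms(2)] scaleC_diff_right)
  also have "norm \<dots> \<le> cmod c * (e * norm v)"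
    using assms(1) s unfolding near_def norm_scaleC by (intro mult_left_mono norm_ge_zero) blast
  finally show "norm (c *\<^sub>C a \<sigma> v - \<sigma> (\<lambda>x. c * f x) v) \<le> cmod c * e * norm v"
    by (simp only: mult.assoc)
qed

lemma calg_add:
  assumes a: "a \<in> calg" and b: "b \<in> calg"
  shows "(\<lambda>\<sigma> v. a \<sigma> v + b \<sigma> v) \<in> calg"
proof (rule calgI)
  fix e :: real assume "0 < e"
  then have e: "0 < e / 2" by simp
  obtain f where f: "f \<in> Cc" "near a f (e / 2)" using calg_near[OF a e] by blast
  obtain g where g: "g \<in> Cc" "near b g (e / 2)" using calg_near[OF b e] by blast
  have "near (\<lambda>\<sigma> v. a \<sigma> v + b \<sigma> v) (\<lambda>x. f x + g x) e"
    using near_add[OF f(2) g(2) f(1) g(1)] by simp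
  then show "\<exists>f. f \<in> Cc \<and> near (\<lambda>\<sigma> v. a \<sigma> v + b \<sigma> v) f e" using Cc_add[OF f(1) g(1)] by blast
qed (simp_all add: calg_off a b calg_scale scaleC_add_right linear_simps(1)[OF calg_bounded_linear[OF a]]
  linear_simps(1)[OF calg_bounded_linear[OF b]])

lemma calg_scaleC:
  assumes a: "a \<in> calg"
  shows "(\<lambda>\<sigma> v. c *\<^sub>C a \<sigma> v) \<in> calg"
proof (rule calgI)
  fix e :: real assume e: "0 < e"
  have c: "0 < cmod c + 1" using norm_ge_zero[of c] by linarith
  then have "0 < e / (cmod c + 1)" using e by simp
  then obtain f where f: "f \<in> Cc" "near a f (e / (cmod c + 1))" using calg_near[OF a] by blast
  have le: "cmod c * (e / (cmod c + 1)) \<le> e" using e c by (simp add: field_simps)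
  have "near (\<lambda>\<sigma> v. c *\<^sub>C a \<sigma> v) (\<lambda>x. c * f x) e"
    using near_scale[OF f(2,1), of c] le unfolding near_def
    by (meson mult_right_mono norm_ge_zero order_trans)
  then show "\<exists>f. f \<in> Cc \<and> near (\<lambda>\<sigma> v. c *\<^sub>C a \<sigma> v) f e" using Cc_scale[OF f(1)] by blast
qed (simp_all add: calg_off a calg_scale scaleC_add_right scaleC_scaleC mult.commute linear_simps(1)[OF calg_bounded_linear[OF a]])

text \<open>Each entry is within distance 1 of some \<open>f\<close> in \<open>Cc\<close>, whose
  I-norm bounds it in every representation. The resulting uniform constant is crude; its purpose is
  to make the suprema over \<open>reps\<close> finite.\<close>

lemma matbd_calg:
  assumes a: "\<And>i j. i < n \<Longrightarrow> j < n \<Longrightarrow> a i j \<in> calg"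
  obtains C where "0 \<le> C" "\<forall>\<sigma>\<in>reps G lam. matbd n (\<lambda>i j. a i j \<sigma>) C"
proof -
  have "\<exists>K. i < n \<longrightarrow> j < n \<longrightarrow> (\<forall>\<sigma>\<in>reps G lam. \<forall>v. norm (a i j \<sigma> v) \<le> K * norm v)" for i j
  proof (cases "i < n \<and> j < n")
    case True
    then obtain f where f: "f \<in> Cc" "near (a i j) f 1" using calg_near[OF a, of i j 1] by auto
    have "norm (a i j \<sigma> v) \<le> (1 + nrm f) * norm v" if s: "\<sigma> \<in> reps G lam" for \<sigma> v
    proof -
      have "norm (a i j \<sigma> v) \<le> norm (a i j \<sigma> v - \<sigma> f v) + norm (\<sigma> f v)"
        using norm_triangle_ineq[of "a i j \<sigma> v - \<sigma> f v" "\<sigma> f v"] by simp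
      also have "\<dots> \<le> 1 * norm v + nrm f * norm v"
        using f(2) s unfolding near_def by (intro add_mono rep_norm_le[OF s f(1)]) blast
      finally show ?thesis by (simp add: algebra_simps)
    qed
    then show ?thesis by blast
  qed auto
  then have "\<exists>K. \<forall>i j. i < n \<longrightarrow> j < n \<longrightarrow> (\<forall>\<sigma>\<in>reps G lam. \<forall>v. norm (a i j \<sigma> v) \<le> K i j * norm v)"
    by (intro choice allI)
  then obtain K where K: "\<forall>i j. i < n \<longrightarrow> j < n \<longrightarrow> (\<forall>\<sigma>\<in>reps G lam. \<forall>v. norm (a i j \<sigma> v) \<le> K i j * norm v)" ..
  define k where "k = (\<Sum>i<n. \<Sum>j<n. \<bar>K i j\<bar>)"
  have k0: "0 \<le> k" unfolding k_def by (intro sum_nonneg) auto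
  have kK: "K i j \<le> k" if "i < n" "j < n" for i j
  proof -
    have "K i j \<le> \<bar>K i j\<bar>" by simp
    also have "\<dots> \<le> (\<Sum>j<n. \<bar>K i j\<bar>)" using that by (intro member_le_sum) auto
    also have "\<dots> \<le> k" unfolding k_def
      using that by (intro member_le_sum[where f = "\<lambda>i. \<Sum>j<n. \<bar>K i j\<bar>"]) (auto intro: sum_nonneg)
    finally show ?thesis .
  qed
  have "matbd n (\<lambda>i j. a i j \<sigma>) (0 + real n * real n * k)" if s: "\<sigma> \<in> reps G lam" for \<sigma>
  proof (rule matbd_perturb[OF _ k0])
    show "matbd n (\<lambda>i j v. 0) 0" by (simp add: matbd_def L2_set_def)
    fix i j v assume ij: "i < n" "j < n"
    have "norm (a i j \<sigma> v) \<le> K i j * norm v" using K ij s by blast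
    also have "\<dots> \<le> k * norm v" by (intro mult_right_mono kK ij) simp
    finally show "norm (a i j \<sigma> v - 0) \<le> k * norm v" by simp
  qed
  then show ?thesis using k0 by (intro that[of "0 + real n * real n * k"]) auto
qed

lemma cstar_matnorm_matbd:
  assumes a: "\<And>i j. i < n \<Longrightarrow> j < n \<Longrightarrow> a i j \<in> calg" and C: "cstar_matnorm G lam n a \<le> C"
    and s: "\<sigma> \<in> reps G lam"
  shows "matbd n (\<lambda>i j. a i j \<sigma>) C"
proof -
  obtain K where K: "0 \<le> K" "\<forall>\<sigma>\<in>reps G lam. matbd n (\<lambda>i j. a i j \<sigma>) K"
    using a by (rule matbd_calg)
  have "opmat_norm n (\<lambda>i j. a i j \<sigma>) \<le> cstar_matnorm G lam n a"
    unfolding cstar_matnorm_def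
  proof (rule cSUP_upper[OF s])
    show "bdd_above ((\<lambda>\<sigma>. opmat_norm n (\<lambda>i j. a i j \<sigma>)) ` reps G lam)"
      by (rule bdd_aboveI2[where M = K]) (intro opmat_norm_le K(2)[THEN bspec] K(1))
  qed
  then have le: "opmat_norm n (\<lambda>i j. a i j \<sigma>) \<le> C" using C by simp
  show ?thesis
    by (rule matbd_opmat_norm[OF _ K(2)[THEN bspec, OF s] K(1) le]) (rule calg_bounded_linear[OF a s])
qed

text \<open>The case \<open>n = 1\<close> of the estimate makes the multiplication Lipschitz for the
  norm of the algebra and so provides the extension; the general case passes to matrices over the
  algebra by approximating all entries at once.\<close>

theorem multiplier_extension:
  assumes \<phi>: "continuous_on UNIV \<phi>" and R: "0 \<le> R"
    and est: "\<And>n f C \<sigma>. \<sigma> \<in> reps G lam \<Longrightarrow> (\<And>i j. i < n \<Longrightarrow> j < n \<Longrightarrow> f i j \<in> Cc) \<Longrightarrow> 0 \<le> C \<Longrightarrow>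
       (\<And>\<tau>. \<tau> \<in> reps G lam \<Longrightarrow> matbd n (\<lambda>i j. \<tau> (f i j)) C) \<Longrightarrow>
       matbd n (\<lambda>i j. \<sigma> (\<lambda>x. \<phi> x * f i j x)) (R * C)"
  shows "\<exists>T. (\<forall>f\<in>Cc. T (emb f) = emb (\<lambda>x. \<phi> x * f x)) \<and>
     completely_bounded G lam T \<and> cb_norm G lam T \<le> ereal R"
proof -
  define m where "m f = (\<lambda>x. \<phi> x * f x)" for f
  have mCc: "m f \<in> Cc" if "f \<in> Cc" for f unfolding m_def by (rule Cc_mult[OF that \<phi>])
  \<comment> \<open>The estimate for 1 by 1 matrices, applied to the difference of \<open>f\<close>
    and \<open>g\<close>.\<close>
  have m_diff: "norm (\<sigma> (m f) v - \<sigma> (m g) v) \<le> R * C * norm v"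
    if f: "f \<in> Cc" and g: "g \<in> Cc" and C: "0 \<le> C" and s: "\<sigma> \<in> reps G lam"
      and d: "\<And>\<tau> v. \<tau> \<in> reps G lam \<Longrightarrow> norm (\<tau> f v - \<tau> g v) \<le> C * norm v" for f g C \<sigma> v
  proof -
    define h where "h = (\<lambda>x. f x - g x)"
    have h: "h \<in> Cc" unfolding h_def by (rule Cc_diff[OF f g])
    have L1: "L2_set k {..<Suc 0} = \<bar>k 0\<bar>" for k by (simp add: L2_set_def)
    have "matbd 1 (\<lambda>i j. \<sigma> (\<lambda>x. \<phi> x * h x)) (R * C)"
    proof (rule est[OF s h C])
      fix \<tau> assume "\<tau> \<in> reps G lam"
      then show "matbd 1 (\<lambda>i j. \<tau> h) C"
        unfolding matbd_def using d by (simp add: L1 h_def rep_diff[OF _ f g])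
    qed
    from this[unfolded matbd_def, rule_format, of "\<lambda>_. v"]
    have "norm (\<sigma> (m h) v) \<le> R * C * norm v" by (simp add: L1 m_def)
    moreover have "m h = (\<lambda>x. m f x - m g x)" by (simp add: m_def h_def right_diff_distrib)
    ultimately show ?thesis by (simp add: rep_diff[OF s mCc[OF f] mCc[OF g]])
  qed
  define ap where "ap a k = (SOME f. f \<in> Cc \<and> near a f (1 / Suc k))" for a and k :: nat
  have ap: "ap a k \<in> Cc" "near a (ap a k) (1 / Suc k)" if "a \<in> calg" for a k
    using someI_ex[OF calg_near[OF that, of "1 / Suc k"]] unfolding ap_def by simp_all
  \<comment> \<open>The limit is taken in each block and at each vector separately. The approximants
    are chosen arbitrarily, and \<open>Tnear\<close> below shows that the result does not depend on
    the choice.\<close>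
  define T where "T a = (\<lambda>\<sigma> v. if \<sigma> \<in> reps G lam then lim (\<lambda>k. \<sigma> (m (ap a k)) v) else 0)" for a
  have diff: "norm (\<sigma> (m (ap a k)) v - \<sigma> (m f) v) \<le> R * (1 / Suc k + e) * norm v"
    if a: "a \<in> calg" and f: "f \<in> Cc" "near a f e" "0 \<le> e" and s: "\<sigma> \<in> reps G lam" for a f e \<sigma> v k
  proof (rule m_diff[OF ap(1)[OF a] f(1) _ s])
    fix \<tau> v assume t: "\<tau> \<in> reps G lam"
    have "norm (\<tau> (ap a k) v - \<tau> f v) \<le> norm (a \<tau> v - \<tau> (ap a k) v) + norm (a \<tau> v - \<tau> f v)"
      using norm_triangle_ineq4[of "a \<tau> v - \<tau> f v" "a \<tau> v - \<tau> (ap a k) v"] by simp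
    also have "\<dots> \<le> 1 / Suc k * norm v + e * norm v"
      using ap(2)[OF a, of k] f(2) t unfolding near_def by (intro add_mono) blast+
    finally show "norm (\<tau> (ap a k) v - \<tau> f v) \<le> (1 / Suc k + e) * norm v"
      by (simp only: distrib_right)
  qed (use f in simp)
  have Tlim: "(\<lambda>k. \<sigma> (m (ap a k)) v) \<longlonglongrightarrow> T a \<sigma> v" if a: "a \<in> calg" and s: "\<sigma> \<in> reps G lam" for a \<sigma> v
  proof -
    have "Cauchy (\<lambda>k. \<sigma> (m (ap a k)) v)"
    proof (rule metric_CauchyI)
      fix e :: real assume e: "0 < e"
      have "(\<lambda>k. R * (1 / Suc k + 1 / Suc k) * norm v) \<longlonglongrightarrow> R * (0 + 0) * norm v"
        by (intro tendsto_intros LIMSEQ_inverse_real_of_nat[unfolded inverse_eq_divide])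
      then have "\<forall>\<^sub>F k in sequentially. R * (1 / Suc k + 1 / Suc k) * norm v < e"
        using e by (intro order_tendstoD(2)[of _ "R * (0 + 0) * norm v"]) auto
      then obtain N where N: "R * (1 / Suc N + 1 / Suc N) * norm v < e" by (auto simp: eventually_sequentially)
      have "dist (\<sigma> (m (ap a k)) v) (\<sigma> (m (ap a l)) v) < e" if "k \<ge> N" "l \<ge> N" for k l
      proof -
        have kl: "1 / real (Suc k) \<le> 1 / real (Suc N)" "1 / real (Suc l) \<le> 1 / real (Suc N)"
          using that by (auto intro!: divide_left_mono)
        have "norm (\<sigma> (m (ap a k)) v - \<sigma> (m (ap a l)) v) \<le> R * (1 / Suc k + 1 / Suc l) * norm v"
          by (rule diff[OF a ap[OF a] _ s]) simp
        also have "\<dots> \<le> R * (1 / Suc N + 1 / Suc N) * norm v"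
          by (intro mult_right_mono mult_left_mono add_mono kl R norm_ge_zero)
        finally show ?thesis using N by (simp add: dist_norm)
      qed
      then show "\<exists>N. \<forall>k\<ge>N. \<forall>l\<ge>N. dist (\<sigma> (m (ap a k)) v) (\<sigma> (m (ap a l)) v) < e" by blast
    qed
    then show ?thesis using s by (simp add: T_def Cauchy_convergent convergent_LIMSEQ_iff[symmetric])
  qed
  \<comment> \<open>Additivity and homogeneity of \<open>T\<close>, its values on \<open>Cc\<close>
    and the matrix bound all rest on this comparison with an arbitrary approximant.\<close>
  have Tnear: "near (T a) (m f) (R * e)" if a: "a \<in> calg" and f: "f \<in> Cc" "near a f e" "0 \<le> e" for a f e
    unfolding near_def
  proof (intro ballI allI)
    fix \<sigma> v assume s: "\<sigma> \<in> reps G lam"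
    have 1: "(\<lambda>k. norm (\<sigma> (m (ap a k)) v - \<sigma> (m f) v)) \<longlonglongrightarrow> norm (T a \<sigma> v - \<sigma> (m f) v)"
      by (intro tendsto_norm tendsto_diff Tlim[OF a s] tendsto_const)
    have "(\<lambda>k. R * (1 / Suc k + e) * norm v) \<longlonglongrightarrow> R * (0 + e) * norm v"
      by (intro tendsto_intros LIMSEQ_inverse_real_of_nat[unfolded inverse_eq_divide])
    then have 2: "(\<lambda>k. R * (1 / Suc k + e) * norm v) \<longlonglongrightarrow> R * e * norm v" by simp
    show "norm (T a \<sigma> v - \<sigma> (m f) v) \<le> R * e * norm v"
      by (rule LIMSEQ_le[OF 1 2]) (intro exI[of _ 0] allI impI diff[OF a f s])
  qed
  have Toff: "T a \<sigma> = (\<lambda>_. 0)" if "\<sigma> \<notin> reps G lam" for a \<sigma> using that by (simp add: T_def)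
  have close: "x = y" if "\<And>e. 0 < e \<Longrightarrow> norm (x - y) \<le> K * e" for x y :: ell2 and K
  proof (rule ccontr)
    assume "x \<noteq> y"
    then have n: "0 < norm (x - y)" by simp
    define d where "d = norm (x - y) / (2 * (\<bar>K\<bar> + 1))"
    have "0 < d" using n by (simp add: d_def)
    then have "norm (x - y) \<le> K * d" by (rule that)
    also have "\<dots> \<le> (\<bar>K\<bar> + 1) * d" using \<open>0 < d\<close> by (intro mult_right_mono) auto
    also have "\<dots> = norm (x - y) / 2"
    proof -
      have "k * (z / (2 * k)) = z / 2" if "k \<noteq> 0" for k z :: real using that by simp
      moreover have "\<bar>K\<bar> + 1 \<noteq> 0" by linarith
      ultimately show ?thesis unfolding d_def by blast
    qed
    finally show False using n by simp
  qed
  have Tcalg: "T a \<in> calg" if a: "a \<in> calg" for a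
  proof (rule calgI)
    show "T a \<sigma> (v + w) = T a \<sigma> v + T a \<sigma> w" if s: "\<sigma> \<in> reps G lam" for \<sigma> v w
    proof (rule LIMSEQ_unique[OF Tlim[OF a s]])
      show "(\<lambda>k. \<sigma> (m (ap a k)) (v + w)) \<longlonglongrightarrow> T a \<sigma> v + T a \<sigma> w"
        unfolding rep_vadd[OF s mCc[OF ap(1)[OF a]]] by (intro tendsto_add Tlim[OF a s])
    qed
    show "T a \<sigma> (c *\<^sub>C v) = c *\<^sub>C T a \<sigma> v" if s: "\<sigma> \<in> reps G lam" for \<sigma> c v
    proof (rule LIMSEQ_unique[OF Tlim[OF a s]])
      show "(\<lambda>k. \<sigma> (m (ap a k)) (c *\<^sub>C v)) \<longlonglongrightarrow> c *\<^sub>C T a \<sigma> v"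
        unfolding rep_vscale[OF s mCc[OF ap(1)[OF a]]] by (intro tendsto_scaleC Tlim[OF a s])
    qed
    fix e :: real assume e: "0 < e"
    then have e': "0 < e / (R + 1)" using R by simp
    then obtain f where f: "f \<in> Cc" "near a f (e / (R + 1))" using calg_near[OF a] by blast
    have "R * (e / (R + 1)) \<le> e" using R e by (simp add: field_simps)
    then have "near (T a) (m f) e"
      using Tnear[OF a f less_imp_le[OF e']] unfolding near_def
      by (meson mult_right_mono norm_ge_zero order_trans)
    then show "\<exists>f. f \<in> Cc \<and> near (T a) f e" using mCc[OF f(1)] by blast
  qed (rule Toff)
  have Temb: "T (emb f) = emb (m f)" if f: "f \<in> Cc" for f
  proof (rule ext, rule ext)
    fix \<sigma> v
    show "T (emb f) \<sigma> v = emb (m f) \<sigma> v"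
      using Tnear[OF emb_calg[OF f] f emb_near] Toff
      by (cases "\<sigma> \<in> reps G lam") (auto simp: near_def cstar_emb_def)
  qed
  have Tadd: "T (\<lambda>\<sigma> v. a \<sigma> v + b \<sigma> v) = (\<lambda>\<sigma> v. T a \<sigma> v + T b \<sigma> v)" if a: "a \<in> calg" and b: "b \<in> calg" for a b
  proof (rule ext, rule ext)
    fix \<sigma> v
    show "T (\<lambda>\<sigma> v. a \<sigma> v + b \<sigma> v) \<sigma> v = T a \<sigma> v + T b \<sigma> v"
    proof (cases "\<sigma> \<in> reps G lam")
      case s: True
      show ?thesis
      proof (rule close)
        fix e :: real assume e: "0 < e"
        obtain f where f: "f \<in> Cc" "near a f e" using calg_near[OF a e] by blast
        obtain g where g: "g \<in> Cc" "near b g e" using calg_near[OF b e] by blast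
        have e0: "0 \<le> e" "0 \<le> e + e" using e by simp_all
        let ?h = "m (\<lambda>x. f x + g x)"
        have "?h = (\<lambda>x. m f x + m g x)" by (simp add: m_def distrib_left)
        then have h: "\<sigma> ?h v = \<sigma> (m f) v + \<sigma> (m g) v" by (simp add: rep_add[OF s mCc[OF f(1)] mCc[OF g(1)]])
        have 1: "norm (T (\<lambda>\<sigma> v. a \<sigma> v + b \<sigma> v) \<sigma> v - \<sigma> ?h v) \<le> R * (e + e) * norm v"
          using Tnear[OF calg_add[OF a b] Cc_add[OF f(1) g(1)] near_add[OF f(2) g(2) f(1) g(1)] e0(2)] s
          unfolding near_def by blast
        have 2: "norm (T a \<sigma> v - \<sigma> (m f) v) \<le> R * e * norm v" "norm (T b \<sigma> v - \<sigma> (m g) v) \<le> R * e * norm v"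
          using Tnear[OF a f e0(1)] Tnear[OF b g e0(1)] s unfolding near_def by blast+
        have "T (\<lambda>\<sigma> v. a \<sigma> v + b \<sigma> v) \<sigma> v - (T a \<sigma> v + T b \<sigma> v)
           = (T (\<lambda>\<sigma> v. a \<sigma> v + b \<sigma> v) \<sigma> v - \<sigma> ?h v) - ((T a \<sigma> v - \<sigma> (m f) v) + (T b \<sigma> v - \<sigma> (m g) v))"
          by (simp add: h)
        also have "norm \<dots> \<le> R * (e + e) * norm v + (R * e * norm v + R * e * norm v)"
          by (intro order_trans[OF norm_triangle_ineq4] add_mono 1 order_trans[OF norm_triangle_ineq] 2)
        also have "\<dots> = (4 * R * norm v) * e" by (simp add: algebra_simps)
        finally show "norm (T (\<lambda>\<sigma> v. a \<sigma> v + b \<sigma> v) \<sigma> v - (T a \<sigma> v + T b \<sigma> v)) \<le> (4 * R * norm v) * e" .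
      qed
    qed (simp add: Toff)
  qed
  have Tscale: "T (\<lambda>\<sigma> v. c *\<^sub>C a \<sigma> v) = (\<lambda>\<sigma> v. c *\<^sub>C T a \<sigma> v)" if a: "a \<in> calg" for a c
  proof (rule ext, rule ext)
    fix \<sigma> v
    show "T (\<lambda>\<sigma> v. c *\<^sub>C a \<sigma> v) \<sigma> v = c *\<^sub>C T a \<sigma> v"
    proof (cases "\<sigma> \<in> reps G lam")
      case s: True
      show ?thesis
      proof (rule close)
        fix e :: real assume e: "0 < e"
        obtain f where f: "f \<in> Cc" "near a f e" using calg_near[OF a e] by blast
        have e0: "0 \<le> e" "0 \<le> cmod c * e" using e by simp_all
        let ?h = "m (\<lambda>x. c * f x)"
        have "?h = (\<lambda>x. c * m f x)" by (simp add: m_def mult_ac)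
        then have h: "\<sigma> ?h v = c *\<^sub>C \<sigma> (m f) v" by (simp add: rep_scale[OF s mCc[OF f(1)]])
        have 1: "norm (T (\<lambda>\<sigma> v. c *\<^sub>C a \<sigma> v) \<sigma> v - \<sigma> ?h v) \<le> R * (cmod c * e) * norm v"
          using Tnear[OF calg_scaleC[OF a] Cc_scale[OF f(1)] near_scale[OF f(2,1)] e0(2)] s
          unfolding near_def by blast
        have 2: "norm (T a \<sigma> v - \<sigma> (m f) v) \<le> R * e * norm v"
          using Tnear[OF a f e0(1)] s unfolding near_def by blast
        have "T (\<lambda>\<sigma> v. c *\<^sub>C a \<sigma> v) \<sigma> v - c *\<^sub>C T a \<sigma> v
           = (T (\<lambda>\<sigma> v. c *\<^sub>C a \<sigma> v) \<sigma> v - \<sigma> ?h v) - c *\<^sub>C (T a \<sigma> v - \<sigma> (m f) v)"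
          by (simp add: h scaleC_diff_right)
        also have "norm \<dots> \<le> norm (T (\<lambda>\<sigma> v. c *\<^sub>C a \<sigma> v) \<sigma> v - \<sigma> ?h v) + norm (c *\<^sub>C (T a \<sigma> v - \<sigma> (m f) v))"
          by (rule norm_triangle_ineq4)
        also have "\<dots> \<le> R * (cmod c * e) * norm v + cmod c * (R * e * norm v)"
          unfolding norm_scaleC by (intro add_mono 1 mult_left_mono 2) simp
        also have "\<dots> = (2 * R * cmod c * norm v) * e" by (simp add: algebra_simps)
        finally show "norm (T (\<lambda>\<sigma> v. c *\<^sub>C a \<sigma> v) \<sigma> v - c *\<^sub>C T a \<sigma> v) \<le> (2 * R * cmod c * norm v) * e" .
      qed
    qed (simp add: Toff)
  qed
  have amp: "cstar_matnorm G lam n (\<lambda>i j. T (a i j)) \<le> R"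
    if a: "\<And>i j. i < n \<Longrightarrow> j < n \<Longrightarrow> a i j \<in> calg" and n1: "cstar_matnorm G lam n a \<le> 1" for n a
  proof -
    have a1: "matbd n (\<lambda>i j. a i j \<sigma>) 1" if "\<sigma> \<in> reps G lam" for \<sigma>
      using a n1 that by (rule cstar_matnorm_matbd)
    \<comment> \<open>The error arises twice: replacing \<open>a\<close> by \<open>f\<close> adds
      \<open>n * n * e\<close> to the bound 1 before the multiplier acts, and replacing
      \<open>m f\<close> by \<open>T a\<close> adds \<open>n * n * R * e\<close> afterwards.\<close>
    have step: "matbd n (\<lambda>i j. T (a i j) \<sigma>) (R + (2 * real n * real n * R) * e)"
      if s: "\<sigma> \<in> reps G lam" and e: "0 < e" for \<sigma> e
    proof -
      have "\<exists>f. i < n \<longrightarrow> j < n \<longrightarrow> f \<in> Cc \<and> near (a i j) f e" for i j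
        using calg_near[OF a e, of i j] by (cases "i < n \<and> j < n") auto
      then have "\<exists>f. \<forall>i j. i < n \<longrightarrow> j < n \<longrightarrow> f i j \<in> Cc \<and> near (a i j) (f i j) e" by (intro choice allI)
      then obtain f where "\<forall>i j. i < n \<longrightarrow> j < n \<longrightarrow> f i j \<in> Cc \<and> near (a i j) (f i j) e" ..
      then have f: "f i j \<in> Cc" "near (a i j) (f i j) e" if "i < n" "j < n" for i j using that by simp_all
      have e0: "0 \<le> e" using e by simp
      have "matbd n (\<lambda>i j. \<tau> (f i j)) (1 + real n * real n * e)" if t: "\<tau> \<in> reps G lam" for \<tau>
      proof (rule matbd_perturb[OF a1[OF t] e0])
        fix i j v assume ij: "i < n" "j < n"
        show "norm (\<tau> (f i j) v - a i j \<tau> v) \<le> e * norm v"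
          using f(2)[OF ij] t unfolding near_def by (simp add: norm_minus_commute[of "\<tau> (f i j) v"])
      qed
      then have "matbd n (\<lambda>i j. \<sigma> (m (f i j))) (R * (1 + real n * real n * e))"
        unfolding m_def using e0 by (intro est s f(1)) auto
      then have "matbd n (\<lambda>i j. T (a i j) \<sigma>) (R * (1 + real n * real n * e) + real n * real n * (R * e))"
      proof (rule matbd_perturb)
        show "0 \<le> R * e" using R e0 by simp
        show "norm (T (a i j) \<sigma> v - \<sigma> (m (f i j)) v) \<le> R * e * norm v" if ij: "i < n" "j < n" for i j v
          using Tnear[OF a[OF ij] f[OF ij] e0] s unfolding near_def by blast
      qed
      moreover have "R * (1 + real n * real n * e) + real n * real n * (R * e) = R + (2 * real n * real n * R) * e"
        by (simp add: algebra_simps)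
      ultimately show ?thesis by simp
    qed
    have TR: "matbd n (\<lambda>i j. T (a i j) \<sigma>) R" if s: "\<sigma> \<in> reps G lam" for \<sigma>
      unfolding matbd_def
    proof
      fix v :: "nat \<Rightarrow> ell2"
      let ?N = "L2_set (\<lambda>j. norm (v j)) {..<n}"
      define K where "K = 2 * real n * real n * R * ?N"
      have K: "0 \<le> K" unfolding K_def using R by simp
      show "L2_set (\<lambda>i. norm (\<Sum>j<n. T (a i j) \<sigma> (v j))) {..<n} \<le> R * ?N"
      proof (rule field_le_epsilon)
        fix d :: real assume d: "0 < d"
        then have "0 < d / (K + 1)" using K by simp
        from step[OF s this, unfolded matbd_def, rule_format, of v]
        have "L2_set (\<lambda>i. norm (\<Sum>j<n. T (a i j) \<sigma> (v j))) {..<n}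
            \<le> (R + 2 * real n * real n * R * (d / (K + 1))) * ?N" .
        also have "(R + 2 * real n * real n * R * z) * ?N = R * ?N + K * z" for z
          by (simp add: K_def algebra_simps)
        also have "K * (d / (K + 1)) \<le> d" using K d by (simp add: field_simps)
        finally show "L2_set (\<lambda>i. norm (\<Sum>j<n. T (a i j) \<sigma> (v j))) {..<n} \<le> R * ?N + d" by simp
      qed
    qed
    show ?thesis
      unfolding cstar_matnorm_def
      by (rule cSUP_least[OF not_emptyI[OF zero_rep]]) (rule opmat_norm_le[OF TR R])
  qed
  have "amp_norm G lam n T \<le> ereal R" for n
    unfolding amp_norm_def
  proof (rule SUP_least)
    fix a assume "a \<in> {a. (\<forall>i<n. \<forall>j<n. a i j \<in> calg) \<and> cstar_matnorm G lam n a \<le> 1}"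
    then have "\<And>i j. i < n \<Longrightarrow> j < n \<Longrightarrow> a i j \<in> calg" "cstar_matnorm G lam n a \<le> 1" by auto
    then show "ereal (cstar_matnorm G lam n (\<lambda>i j. T (a i j))) \<le> ereal R"
      using amp by (simp only: ereal_less_eq)
  qed
  then have cb: "cb_norm G lam T \<le> ereal R" unfolding cb_norm_def by (rule SUP_least)
  then have "cb_norm G lam T < \<infinity>" by (rule le_less_trans) simp
  then have "completely_bounded G lam T"
    unfolding completely_bounded_def cstar_linear_def using Tcalg Tadd Tscale by simp
  then show ?thesis using cb Temb unfolding m_def by (intro exI[of _ T] conjI ballI)
qed

end

theorem theorem3:
  fixes G :: "'g::{second_countable_topology, t2_space} groupoid"
    and lam :: "'g \<Rightarrow> 'g measure"
    and H :: "'g \<Rightarrow> 'h::chilbert_space set"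
    and \<Gamma> :: "('g \<Rightarrow> 'h) set"
    and L :: "'g \<Rightarrow> 'h \<Rightarrow> 'h"
    and \<xi> \<eta> :: "'g \<Rightarrow> 'h"
    and \<phi> :: "'g \<Rightarrow> complex"
  assumes "lch_groupoid G"
    and "left_haar_system G lam"
    and "G_hilbert_bundle G H \<Gamma> L"
    and "\<xi> \<in> bounded_sections (units G) \<Gamma>"
    and "\<eta> \<in> bounded_sections (units G) \<Gamma>"
    and "\<phi> = coefficient G L \<xi> \<eta>"
  shows "\<exists>T. (\<forall>f\<in>Cc. T (cstar_emb G lam f) = cstar_emb G lam (\<lambda>x. \<phi> x * f x)) \<and>
             completely_bounded G lam T \<and>
             cb_norm G lam T \<le> ereal (section_norm (units G) \<xi> * section_norm (units G) \<eta>)"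
proof -
  interpret coefficient_bundle G lam H \<Gamma> L
    by unfold_locales (fact assms)+
  have \<phi>: "\<phi> = cf \<eta> \<xi>" using assms(6) by (simp add: cf_coefficient)
  show ?thesis
  proof (rule multiplier_extension)
    show "continuous_on UNIV \<phi>" unfolding \<phi> by (rule cf_continuous[OF assms(5,4)])
    show "0 \<le> section_norm (units G) \<xi> * section_norm (units G) \<eta>"
      by (intro mult_nonneg_nonneg section_norm_nonneg assms)
  next
    fix n :: nat and f :: "nat \<Rightarrow> nat \<Rightarrow> 'g \<Rightarrow> complex" and C :: real and \<sigma> :: "'g rep"
    assume "\<sigma> \<in> reps G lam" "\<And>i j. i < n \<Longrightarrow> j < n \<Longrightarrow> f i j \<in> Cc" "0 \<le> C"
      "\<And>\<tau>. \<tau> \<in> reps G lam \<Longrightarrow> matbd n (\<lambda>i j. \<tau> (f i j)) C"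
    then show "matbd n (\<lambda>i j. \<sigma> (\<lambda>x. \<phi> x * f i j x)) (section_norm (units G) \<xi> * section_norm (units G) \<eta> * C)"
      unfolding \<phi> by (rule matrix_estimate[OF assms(4,5)])
  qed
qed

end
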